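(* Let $A$ be approximately unital and an ideal in an operator algebra $B$, and let $\mathcal{D}$ be the $C^*$-subalgebra of $C^*_{\rm max}(B)$ generated by $A$. Then $\mathcal{D}$ (resp. $C^*_{\rm max}(B)/\mathcal{D}$) is a maximal $C^*$-cover of $A$ (resp. of $B/A$). That is, $C^*_{\rm max}(A) = \mathcal{D}$ and $C^*_{\rm max}(B/A) = C^*_{\rm max}(B)/\mathcal{D}$ (via the canonical maps $A \hookrightarrow \mathcal{D}$ and $B/A \to C^*_{\rm max}(B)/\mathcal{D}$).
   Context: An operator algebra is a norm-closed, not necessarily selfadjoint, subalgebra of a $C^*$-algebra, with the inherited matrix norms. Approximately unital means having a contractive two-sided approximate identity. Ideals are closed and two-sided. $B/A$ is an operator algebra with the quotient matrix norms. A $C^*$-cover of $B$ is a pair $(\mathcal{E},j)$ of a $C^*$-algebra $\mathcal{E}$ and a completely isometric homomorphism $j : B\to\mathcal{E}$ whose range generates $\mathcal{E}$ as a $C^*$-algebra. The maximal $C^*$-cover $C^*_{\rm max}(B)$ is the $C^*$-cover characterized by the universal property: every completely contractive homomorphism $\pi : B \to \mathcal{G}$ into a $C^*$-algebra $\mathcal{G}$ extends to a $*$-homomorphism $C^*_{\rm max}(B) \to \mathcal{G}$. (For nonunital $B$ it is the $C^*$-algebra generated by $B$ inside $C^*_{\rm max}(B^1)$, $B^1$ being the unitization.) *)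

theory Defs
  imports "HOL-Analysis.Analysis" "HOL-Algebra.QuotRing" "HOL-Algebra.Algebraic_Closure_Type"
begin

section \<open>Complex algebras with involution and matrix norms\<close>

text \<open>
  Structures are HOL-Algebra records over the scalar ring
  \<^term>\<open>ring_of_type_algebra :: complex ring\<close>. Algebras need not be unital: the inherited field
  \<open>one\<close> is never referred to in an axiom. The field \<open>adj\<close> is meaningful only for \<open>*\<close>-algebras, and
  \<open>mnorm U n\<close> is the norm of $M_n(U)$. An operator algebra inside a \<open>C\<^sup>*\<close>-algebra \<open>C\<close> is the
  structure \<open>C\<lparr>carrier := B\<rparr>\<close>, which carries the inherited matrix norms.
\<close>

record 'a star_alg = "(complex, 'a) module" +
  adj :: "'a \<Rightarrow> 'a"

record 'a matrix_normed_alg = "'a star_alg" +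
  mnorm :: "nat \<Rightarrow> (nat \<times> nat \<Rightarrow> 'a) \<Rightarrow> real"

locale complex_algebra = Module.module "ring_of_type_algebra :: complex ring" U for U (structure) +
  assumes mult_closed: "\<lbrakk>x \<in> carrier U; y \<in> carrier U\<rbrakk> \<Longrightarrow> x \<otimes> y \<in> carrier U"
    and mult_assoc: "\<lbrakk>x \<in> carrier U; y \<in> carrier U; z \<in> carrier U\<rbrakk> \<Longrightarrow>
      (x \<otimes> y) \<otimes> z = x \<otimes> (y \<otimes> z)"
    and distr_left: "\<lbrakk>x \<in> carrier U; y \<in> carrier U; z \<in> carrier U\<rbrakk> \<Longrightarrow>
      (x \<oplus> y) \<otimes> z = x \<otimes> z \<oplus> y \<otimes> z"
    and distr_right: "\<lbrakk>x \<in> carrier U; y \<in> carrier U; z \<in> carrier U\<rbrakk> \<Longrightarrow>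
      z \<otimes> (x \<oplus> y) = z \<otimes> x \<oplus> z \<otimes> y"
    and smult_mult_left: "\<lbrakk>x \<in> carrier U; y \<in> carrier U\<rbrakk> \<Longrightarrow> (c \<odot> x) \<otimes> y = c \<odot> (x \<otimes> y)"
    and smult_mult_right: "\<lbrakk>x \<in> carrier U; y \<in> carrier U\<rbrakk> \<Longrightarrow> x \<otimes> (c \<odot> y) = c \<odot> (x \<otimes> y)"

locale star_algebra = complex_algebra U for U :: "('a, 'm) star_alg_scheme" (structure) +
  assumes adj_closed: "x \<in> carrier U \<Longrightarrow> adj U x \<in> carrier U"
    and adj_adj: "x \<in> carrier U \<Longrightarrow> adj U (adj U x) = x"
    and adj_add: "\<lbrakk>x \<in> carrier U; y \<in> carrier U\<rbrakk> \<Longrightarrow> adj U (x \<oplus> y) = adj U x \<oplus> adj U y"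
    and adj_smult: "x \<in> carrier U \<Longrightarrow> adj U (c \<odot> x) = cnj c \<odot> adj U x"
    and adj_mult: "\<lbrakk>x \<in> carrier U; y \<in> carrier U\<rbrakk> \<Longrightarrow> adj U (x \<otimes> y) = adj U y \<otimes> adj U x"

text \<open>The distance is cut off outside the carrier, as the locale \<^locale>\<open>Metric_space\<close> asks for
  symmetry and nonnegativity on the whole type.\<close>

definition norm_dist :: "('a, 'm) ring_scheme \<Rightarrow> ('a \<Rightarrow> real) \<Rightarrow> 'a \<Rightarrow> 'a \<Rightarrow> real" where
  "norm_dist U \<nu> x y = (if x \<in> carrier U \<and> y \<in> carrier U then \<nu> (x \<ominus>\<^bsub>U\<^esub> y) else 0)"

locale complete_cstar_norm = star_algebra U for U :: "('a, 'm) star_alg_scheme" (structure) +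
  fixes \<nu> :: "'a \<Rightarrow> real"
  assumes norm_nonneg: "x \<in> carrier U \<Longrightarrow> 0 \<le> \<nu> x"
    and norm_eq_zero: "x \<in> carrier U \<Longrightarrow> \<nu> x = 0 \<longleftrightarrow> x = \<zero>"
    and norm_triangle: "\<lbrakk>x \<in> carrier U; y \<in> carrier U\<rbrakk> \<Longrightarrow> \<nu> (x \<oplus> y) \<le> \<nu> x + \<nu> y"
    and norm_smult: "x \<in> carrier U \<Longrightarrow> \<nu> (c \<odot> x) = cmod c * \<nu> x"
    and norm_mult: "\<lbrakk>x \<in> carrier U; y \<in> carrier U\<rbrakk> \<Longrightarrow> \<nu> (x \<otimes> y) \<le> \<nu> x * \<nu> y"
    and cstar_identity: "x \<in> carrier U \<Longrightarrow> \<nu> (adj U x \<otimes> x) = (\<nu> x)\<^sup>2"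
    and complete: "Metric_space.mcomplete (carrier U) (norm_dist U \<nu>)"

abbreviation matrix_index :: "nat \<Rightarrow> (nat \<times> nat) set" where
  "matrix_index n \<equiv> {..<n} \<times> {..<n}"

abbreviation matrices :: "nat \<Rightarrow> ('a, 'm) partial_object_scheme \<Rightarrow> (nat \<times> nat \<Rightarrow> 'a) set" where
  "matrices n U \<equiv> matrix_index n \<rightarrow>\<^sub>E carrier U"

definition matrix_algebra :: "nat \<Rightarrow> ('a, 'm) star_alg_scheme \<Rightarrow> (nat \<times> nat \<Rightarrow> 'a) star_alg" where
  "matrix_algebra n U =
    \<lparr>carrier = matrices n U,
     mult = (\<lambda>M N. \<lambda>(i, k)\<in>matrix_index n. \<Oplus>\<^bsub>U\<^esub>j\<in>{..<n}. M (i, j) \<otimes>\<^bsub>U\<^esub> N (j, k)),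
     one = (\<lambda>(i, j)\<in>matrix_index n. if i = j then \<one>\<^bsub>U\<^esub> else \<zero>\<^bsub>U\<^esub>),
     zero = (\<lambda>p\<in>matrix_index n. \<zero>\<^bsub>U\<^esub>),
     add = (\<lambda>M N. \<lambda>p\<in>matrix_index n. M p \<oplus>\<^bsub>U\<^esub> N p),
     smult = (\<lambda>c M. \<lambda>p\<in>matrix_index n. c \<odot>\<^bsub>U\<^esub> M p),
     adj = (\<lambda>M. \<lambda>(i, j)\<in>matrix_index n. adj U (M (j, i)))\<rparr>"

text \<open>
  A \<open>C\<^sup>*\<close>-algebra together with its canonical matrix norms. The \<open>*\<close>-algebra $M_n(U)$ over a
  \<open>C\<^sup>*\<close>-algebra \<open>U\<close> has exactly one complete \<open>C\<^sup>*\<close>-norm, so the field \<open>mnorm\<close> is determined by the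
  underlying \<open>*\<close>-algebra (the case $n = 1$ being the norm of \<open>U\<close> itself) and is no extra structure.
\<close>

definition cstar_algebra :: "('a, 'm) matrix_normed_alg_scheme \<Rightarrow> bool" where
  "cstar_algebra U \<longleftrightarrow>
    star_algebra U \<and> (\<forall>n\<ge>1. complete_cstar_norm (matrix_algebra n U) (mnorm U n))"

definition elt_norm :: "('a, 'm) matrix_normed_alg_scheme \<Rightarrow> 'a \<Rightarrow> real" where
  "elt_norm U x = mnorm U 1 (\<lambda>p\<in>matrix_index 1. x)"

definition norm_topology :: "('a, 'm) matrix_normed_alg_scheme \<Rightarrow> 'a topology" where
  "norm_topology U = Metric_space.mtopology (carrier U) (norm_dist U (elt_norm U))"

section \<open>Subalgebras, ideals and quotients\<close>

definition closed_subspace :: "'a set \<Rightarrow> ('a, 'm) matrix_normed_alg_scheme \<Rightarrow> bool" where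
  "closed_subspace S U \<longleftrightarrow>
    submodule S (ring_of_type_algebra :: complex ring) U \<and> closedin (norm_topology U) S"

definition closed_subalgebra :: "'a set \<Rightarrow> ('a, 'm) matrix_normed_alg_scheme \<Rightarrow> bool" where
  "closed_subalgebra S U \<longleftrightarrow>
    closed_subspace S U \<and> (\<forall>x\<in>S. \<forall>y\<in>S. x \<otimes>\<^bsub>U\<^esub> y \<in> S)"

definition cstar_subalgebra :: "'a set \<Rightarrow> ('a, 'm) matrix_normed_alg_scheme \<Rightarrow> bool" where
  "cstar_subalgebra S U \<longleftrightarrow> closed_subalgebra S U \<and> (\<forall>x\<in>S. adj U x \<in> S)"

definition generated_cstar_subalgebra ::
    "('a, 'm) matrix_normed_alg_scheme \<Rightarrow> 'a set \<Rightarrow> 'a set" where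
  "generated_cstar_subalgebra U S = \<Inter>{T. cstar_subalgebra T U \<and> S \<subseteq> T}"

definition closed_ideal :: "'a set \<Rightarrow> ('a, 'm) matrix_normed_alg_scheme \<Rightarrow> bool" where
  "closed_ideal I U \<longleftrightarrow> closed_subspace I U \<and>
    (\<forall>a\<in>I. \<forall>x\<in>carrier U. a \<otimes>\<^bsub>U\<^esub> x \<in> I \<and> x \<otimes>\<^bsub>U\<^esub> a \<in> I)"

text \<open>The approximate identity is given as a proper filter on the algebra: a net yields the filter
  of its tails, and every proper filter arises from a net.\<close>

definition approximately_unital :: "('a, 'm) matrix_normed_alg_scheme \<Rightarrow> bool" where
  "approximately_unital U \<longleftrightarrow> (\<exists>F. F \<noteq> bot \<and>
    (\<forall>\<^sub>F e in F. e \<in> carrier U \<and> elt_norm U e \<le> 1) \<and>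
    (\<forall>x\<in>carrier U. limitin (norm_topology U) (\<lambda>e. e \<otimes>\<^bsub>U\<^esub> x) x F \<and>
                   limitin (norm_topology U) (\<lambda>e. x \<otimes>\<^bsub>U\<^esub> e) x F))"

text \<open>The quotient $U/I$ with the matrix norms of $M_n(U/I) = M_n(U)/M_n(I)$. The ring operations are
  those of \<^const>\<open>FactRing\<close>; \<open>adj\<close> is the induced involution if \<open>I\<close> is selfadjoint.\<close>

definition quotient_algebra ::
    "('a, 'm) matrix_normed_alg_scheme \<Rightarrow> 'a set \<Rightarrow> 'a set matrix_normed_alg" where
  "quotient_algebra U I =
    \<lparr>carrier = a_rcosets\<^bsub>U\<^esub> I,
     mult = rcoset_mult U I,
     one = I +>\<^bsub>U\<^esub> \<one>\<^bsub>U\<^esub>,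
     zero = I,
     add = set_add U,
     smult = (\<lambda>c S. \<Union>x\<in>S. I +>\<^bsub>U\<^esub> (c \<odot>\<^bsub>U\<^esub> x)),
     adj = (\<lambda>S. \<Union>x\<in>S. I +>\<^bsub>U\<^esub> adj U x),
     mnorm = (\<lambda>n Q. Inf (mnorm U n ` {M \<in> matrices n U. \<forall>p\<in>matrix_index n. M p \<in> Q p}))\<rparr>"

text \<open>For a homomorphism \<open>j : U \<rightarrow> Y\<close> mapping \<open>I\<close> into \<open>J\<close>, this is the map
  \<open>U/I \<rightarrow> Y/J\<close>, \<open>I + x \<mapsto> J + j(x)\<close>.\<close>

definition induced_map ::
    "('b, 'm) matrix_normed_alg_scheme \<Rightarrow> 'b set \<Rightarrow> ('a \<Rightarrow> 'b) \<Rightarrow> 'a set \<Rightarrow> 'b set" where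
  "induced_map Y J j S = (\<Union>x\<in>S. J +>\<^bsub>Y\<^esub> j x)"

section \<open>Homomorphisms and maximal \<open>C\<^sup>*\<close>-covers\<close>

definition algebra_hom ::
    "('a, 'm) matrix_normed_alg_scheme \<Rightarrow> ('b, 'n) matrix_normed_alg_scheme \<Rightarrow> ('a \<Rightarrow> 'b) set" where
  "algebra_hom U Y = {f. f \<in> hom U Y \<and> f \<in> hom (add_monoid U) (add_monoid Y) \<and>
    (\<forall>c. \<forall>x\<in>carrier U. f (c \<odot>\<^bsub>U\<^esub> x) = c \<odot>\<^bsub>Y\<^esub> f x)}"

definition star_hom ::
    "('a, 'm) matrix_normed_alg_scheme \<Rightarrow> ('b, 'n) matrix_normed_alg_scheme \<Rightarrow> ('a \<Rightarrow> 'b) set" where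
  "star_hom U Y = {f \<in> algebra_hom U Y. \<forall>x\<in>carrier U. f (adj U x) = adj Y (f x)}"

definition completely_contractive ::
    "('a, 'm) matrix_normed_alg_scheme \<Rightarrow> ('b, 'n) matrix_normed_alg_scheme \<Rightarrow> ('a \<Rightarrow> 'b) \<Rightarrow> bool" where
  "completely_contractive U Y f \<longleftrightarrow>
    (\<forall>n\<ge>1. \<forall>M\<in>matrices n U. mnorm Y n (compose (matrix_index n) f M) \<le> mnorm U n M)"

definition completely_isometric ::
    "('a, 'm) matrix_normed_alg_scheme \<Rightarrow> ('b, 'n) matrix_normed_alg_scheme \<Rightarrow> ('a \<Rightarrow> 'b) \<Rightarrow> bool" where
  "completely_isometric U Y f \<longleftrightarrow>
    (\<forall>n\<ge>1. \<forall>M\<in>matrices n U. mnorm Y n (compose (matrix_index n) f M) = mnorm U n M)"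

definition cstar_cover ::
    "('a, 'm) matrix_normed_alg_scheme \<Rightarrow> ('e, 'n) matrix_normed_alg_scheme \<Rightarrow> ('a \<Rightarrow> 'e) \<Rightarrow> bool" where
  "cstar_cover U E j \<longleftrightarrow> cstar_algebra E \<and> j \<in> algebra_hom U E \<and> completely_isometric U E j \<and>
    generated_cstar_subalgebra E (j ` carrier U) = carrier E"

text \<open>
  The maximal \<open>C\<^sup>*\<close>-cover is the \<open>C\<^sup>*\<close>-cover with the universal property for completely contractive
  homomorphisms into all \<open>C\<^sup>*\<close>-algebras \<open>G\<close>. As HOL cannot quantify over types inside a formula, the
  type \<open>'g\<close> of the elements of \<open>G\<close> is a parameter; the carrier of \<open>G\<close> is an arbitrary subset of it.
  The full notion is \<open>max_cstar_cover TYPE('g) U E j\<close> for all types \<open>'g\<close>: a conclusion with a free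
  \<open>'g\<close> asserts it in full, and a hypothesis at one particular type asks for less than it.
  For \<open>U\<close> with elements of type \<open>'a\<close>, the type \<open>nat \<Rightarrow> 'a\<close> has room for a copy of every
  \<open>C\<^sup>*\<close>-algebra generated by a homomorphic image of \<open>U\<close>, so the instance at \<open>nat \<Rightarrow> 'a\<close>
  is equivalent to the full notion.
\<close>

definition max_cstar_cover :: "'g itself \<Rightarrow>
    ('a, 'm) matrix_normed_alg_scheme \<Rightarrow> ('e, 'n) matrix_normed_alg_scheme \<Rightarrow> ('a \<Rightarrow> 'e) \<Rightarrow> bool" where
  "max_cstar_cover T U E j \<longleftrightarrow> cstar_cover U E j \<and>
    (\<forall>(G :: 'g matrix_normed_alg) \<pi>.
       cstar_algebra G \<and> \<pi> \<in> algebra_hom U G \<and> completely_contractive U G \<pi> \<longrightarrow>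
       (\<exists>\<theta>\<in>star_hom E G. \<forall>x\<in>carrier U. \<theta> (j x) = \<pi> x))"

end

theory Submission
  imports Defs
begin

text \<open>
  Let \<open>D\<close> be generated by \<open>A\<close> in the maximal cover \<open>E\<close> of \<open>B\<close>. The approximate identity
  \<open>(e\<^sub>t)\<close> of \<open>A\<close> is one for \<open>D\<close>, and so is \<open>(e\<^sub>t\<^sup>*)\<close>; as \<open>A\<close> is an ideal of \<open>B\<close>, both \<open>j(B)\<close> and
  \<open>j(B)\<^sup>*\<close> multiply \<open>D\<close> into itself, so \<open>D\<close> is an ideal of \<open>E\<close>.

  A completely contractive homomorphism \<open>\<pi>\<close> on \<open>A\<close>, whose range may be assumed to generate the
  target \<open>H\<close>, extends to \<open>B\<close> with values in the multiplier algebra of \<open>H\<close>, by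
  \<open>\<tau>(b) \<pi>(a) y = \<pi>(ba) y\<close>. The extension of \<open>\<tau>\<close> to \<open>E\<close> maps \<open>D\<close> into \<open>H\<close>. A completely
  contractive homomorphism on \<open>B/A\<close> lifts to \<open>B\<close>, and the extension of the lift to \<open>E\<close> kills \<open>D\<close>.

  That \<open>B/A \<rightarrow> E/D\<close> is completely isometric, and that \<open>E/D\<close> satisfies the \<open>C\<^sup>*\<close>-identity, both need
  elements \<open>a\<close> of \<open>A\<close> such that \<open>1 - a\<close> has norm at most \<open>1 + \<delta>\<close> and nearly annihilates a given
  \<open>d \<in> D\<close>. The \<open>1 - e\<^sub>t\<close> need only have norm at most 2, but an average of suitable \<open>e\<^sub>t\<close> will do,
  as \<open>(1 - e\<^sub>s)\<^sup>*(1 - e\<^sub>t)\<close> is close to \<open>1 - e\<^sub>t\<close> for \<open>t\<close> far beyond \<open>s\<close>.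

  No functional calculus is needed: the positivity arguments rest on square roots in the form
  of \<open>1 - s = (1 - c)\<^sup>2\<close> with \<open>\<parallel>s\<parallel> < 1\<close>, and multipliers are adjointable maps \<open>H \<rightarrow> H\<close>.
\<close>

section \<open>Linear identities in complex algebras\<close>

text \<open>In the bidual of E the complement of the support projection of D is a central
  projection, and both facts about quotients are immediate from it. The averages used here are a
  substitute for that complement inside the algebra. They must be averages of elements of A, and not
  merely of D: for b in B the element b - ab is then again in B and in the coset of b, so that a
  nearly optimal lift in E can be compared with a lift in B. Since the norms to be compared are
  matrix norms, this happens in every M_n(E), with the net diag(e_t). The matrix norms of the
  multiplier algebra and of E/D are given by formulas, and each has to be recognised as a complete
  C*-norm. For multipliers, subalgebras and copies this is done by pulling a norm back along an
  injective *-homomorphism with closed range. A further obstacle is one of size. The universal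
  property of E is assumed for targets on a single type, while the extension to B takes values in
  multipliers of an arbitrary target, which live on another type. Passing to the generated
  subalgebra and counting its elements bridges the gap.\<close>

lemma roa_simps [simp]:
  "carrier (ring_of_type_algebra :: complex ring) = UNIV"
  "mult (ring_of_type_algebra :: complex ring) = (*)"
  "add (ring_of_type_algebra :: complex ring) = (+)"
  "one (ring_of_type_algebra :: complex ring) = 1"
  "zero (ring_of_type_algebra :: complex ring) = 0"
  by (auto simp: ring_of_type_algebra_def)

lemma module_complexI:
  fixes M (structure)
  assumes "abelian_group M"
    and "\<And>a x. x \<in> carrier M \<Longrightarrow> a \<odot> x \<in> carrier M"
    and "\<And>a b x. x \<in> carrier M \<Longrightarrow> (a + b) \<odot> x = a \<odot> x \<oplus> b \<odot> x"
    and "\<And>a x y. \<lbrakk>x \<in> carrier M; y \<in> carrier M\<rbrakk> \<Longrightarrow> a \<odot> (x \<oplus> y) = a \<odot> x \<oplus> a \<odot> y"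
    and "\<And>a b x. x \<in> carrier M \<Longrightarrow> (a * b) \<odot> x = a \<odot> (b \<odot> x)"
    and "\<And>x. x \<in> carrier M \<Longrightarrow> 1 \<odot> x = x"
  shows "Module.module (ring_of_type_algebra :: complex ring) M"
  by (rule moduleI[OF cring_from_type_algebra assms(1)]) (simp_all add: assms)

text \<open>Continuity is not asked for, and values outside the carrier are unconstrained:
  functionals serve to separate points algebraically, before any norm is introduced.\<close>

definition functional :: "(complex, 'a, 'm) module_scheme \<Rightarrow> ('a \<Rightarrow> complex) \<Rightarrow> bool" where
  "functional U f \<longleftrightarrow> (\<forall>x\<in>carrier U. \<forall>y\<in>carrier U. f (x \<oplus>\<^bsub>U\<^esub> y) = f x + f y) \<and>
     (\<forall>c. \<forall>x\<in>carrier U. f (c \<odot>\<^bsub>U\<^esub> x) = c * f x)"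

context complex_algebra
begin

declare mult_closed [simp, intro]

lemma sm_closed [simp, intro]: "x \<in> carrier U \<Longrightarrow> c \<odot> x \<in> carrier U"
  using smult_closed[of c x] by simp

lemma sm_add_left: "x \<in> carrier U \<Longrightarrow> (a + b) \<odot> x = a \<odot> x \<oplus> b \<odot> x"
  using smult_l_distr[of a b x] by simp

lemma sm_add_right: "\<lbrakk>x \<in> carrier U; y \<in> carrier U\<rbrakk> \<Longrightarrow> a \<odot> (x \<oplus> y) = a \<odot> x \<oplus> a \<odot> y"
  using smult_r_distr[of a x y] by simp

lemma sm_assoc: "x \<in> carrier U \<Longrightarrow> a \<odot> (b \<odot> x) = (a * b) \<odot> x"
  using smult_assoc1[of a b x] by simp

lemma sm_one [simp]: "x \<in> carrier U \<Longrightarrow> 1 \<odot> x = x"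
  using smult_one[of x] by simp

lemma sm_zero [simp]: "x \<in> carrier U \<Longrightarrow> 0 \<odot> x = \<zero>"
  using smult_l_null[of x] by simp

lemma sm_zero_right [simp]: "c \<odot> \<zero> = \<zero>"
  using smult_r_null[of c] by simp

lemma sm_minus_one: "x \<in> carrier U \<Longrightarrow> (- 1) \<odot> x = \<ominus> x"
  by (metis M.l_neg M.minus_equality add.left_inverse sm_add_left sm_closed sm_one sm_zero)

lemma functionalD:
  assumes "functional U f"
  shows "\<And>x y. \<lbrakk>x \<in> carrier U; y \<in> carrier U\<rbrakk> \<Longrightarrow> f (x \<oplus> y) = f x + f y"
    and "\<And>c x. x \<in> carrier U \<Longrightarrow> f (c \<odot> x) = c * f x"
    and "f \<zero> = 0"
    and "\<And>x. x \<in> carrier U \<Longrightarrow> f (\<ominus> x) = - f x"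
    and "\<And>x y. \<lbrakk>x \<in> carrier U; y \<in> carrier U\<rbrakk> \<Longrightarrow> f (x \<ominus> y) = f x - f y"
proof -
  show 1: "\<And>x y. \<lbrakk>x \<in> carrier U; y \<in> carrier U\<rbrakk> \<Longrightarrow> f (x \<oplus> y) = f x + f y"
    and 2: "\<And>c x. x \<in> carrier U \<Longrightarrow> f (c \<odot> x) = c * f x"
    using assms by (auto simp: functional_def)
  show "f \<zero> = 0" using 2[of \<zero> 0] by simp
  show 3: "f (\<ominus> x) = - f x" if "x \<in> carrier U" for x
    using 2[OF that, of "-1"] that by (simp add: sm_minus_one)
  show "f (x \<ominus> y) = f x - f y" if "x \<in> carrier U" "y \<in> carrier U" for x y
    using that by (simp add: M.minus_eq 1 3)
qed

lemma functional_finsum: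
  assumes f: "functional U f" and "finite I" "g \<in> I \<rightarrow> carrier U"
  shows "f (\<Oplus>i\<in>I. g i) = (\<Sum>i\<in>I. f (g i))"
  using assms(2,3)
proof (induction I rule: finite_induct)
  case empty
  then show ?case by (simp add: functionalD(3)[OF f])
next
  case (insert x F)
  then show ?case
    by (subst M.finsum_insert) (auto simp: functionalD(1)[OF f] M.finsum_closed Pi_iff)
qed

text \<open>A subspace that is maximal among those missing \<open>x\<close> is a complement of the
  line through \<open>x\<close>. The functional reads off the coefficient of \<open>x\<close> along
  this decomposition.\<close>

lemma separating_functional:
  assumes x: "x \<in> carrier U" "x \<noteq> \<zero>"
  obtains f where "functional U f" "f x \<noteq> 0"
proof -
  define sub where "sub S \<longleftrightarrow> S \<subseteq> carrier U \<and> \<zero> \<in> S \<and> x \<notin> S \<and>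
    (\<forall>a\<in>S. \<forall>b\<in>S. a \<oplus> b \<in> S) \<and> (\<forall>c. \<forall>a\<in>S. c \<odot> a \<in> S)" for S
  have "\<exists>M\<in>{S. sub S}. \<forall>T\<in>{S. sub S}. M \<subseteq> T \<longrightarrow> T = M"
  proof (rule subset_Zorn_nonempty)
    show "{S. sub S} \<noteq> {}"
      using x by (auto simp: sub_def intro!: exI[of _ "{\<zero>}"])
  next
    fix \<C> assume C: "\<C> \<noteq> {}" "subset.chain {S. sub S} \<C>"
    then have s: "\<And>S. S \<in> \<C> \<Longrightarrow> sub S" by (auto simp: subset.chain_def)
    have "a \<oplus> b \<in> \<Union>\<C>" if ab: "a \<in> \<Union>\<C>" "b \<in> \<Union>\<C>" for a b
    proof -
      obtain S T where "S \<in> \<C>" "T \<in> \<C>" "a \<in> S" "b \<in> T" using ab by auto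
      moreover then have "S \<subseteq> T \<or> T \<subseteq> S" using C(2) by (auto simp: subset.chain_def)
      ultimately show ?thesis using s unfolding sub_def by (meson UnionI subsetD)
    qed
    moreover have "\<Union>\<C> \<subseteq> carrier U" "\<zero> \<in> \<Union>\<C>" "x \<notin> \<Union>\<C>"
      using C(1) s unfolding sub_def by blast+
    moreover have "c \<odot> a \<in> \<Union>\<C>" if "a \<in> \<Union>\<C>" for c a
      using that s unfolding sub_def by blast
    ultimately have "sub (\<Union>\<C>)" unfolding sub_def by blast
    then show "\<Union>\<C> \<in> {S. sub S}" by simp
  qed
  then obtain M where M: "sub M" and max: "\<And>T. sub T \<Longrightarrow> M \<subseteq> T \<Longrightarrow> T = M" by auto
  have Mc: "M \<subseteq> carrier U" and M0: "\<zero> \<in> M" and Mx: "x \<notin> M"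
    and Ma: "\<And>a b. a \<in> M \<Longrightarrow> b \<in> M \<Longrightarrow> a \<oplus> b \<in> M" and Ms: "\<And>c a. a \<in> M \<Longrightarrow> c \<odot> a \<in> M"
    using M by (auto simp: sub_def)
  have ex: "\<exists>c. \<exists>m\<in>M. y = m \<oplus> c \<odot> x" if y: "y \<in> carrier U" for y
  proof (cases "y \<in> M")
    case True
    then show ?thesis using x Mc by (intro exI[of _ 0] bexI[of _ y]) auto
  next
    case False
    \<comment> \<open>Adjoining \<open>y\<close> to \<open>M\<close> must capture \<open>x\<close>,
      by maximality. The coefficient of \<open>y\<close> in the resulting representation of
      \<open>x\<close> is nonzero, so the equation can be solved for \<open>y\<close>.\<close>
    define N where "N = {m \<oplus> c \<odot> y |m c. m \<in> M}"
    have "y = \<zero> \<oplus> 1 \<odot> y" using y by simp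
    then have "y \<in> N" using M0 unfolding N_def by blast
    then have "N \<noteq> M" using False by blast
    moreover have "M \<subseteq> N"
    proof
      fix m assume "m \<in> M"
      then have "m = m \<oplus> 0 \<odot> y" using y Mc by auto
      then show "m \<in> N" using \<open>m \<in> M\<close> by (auto simp: N_def)
    qed
    ultimately have "\<not> sub N" using max by blast
    moreover have "N \<subseteq> carrier U" using Mc y by (auto simp: N_def)
    moreover have "\<zero> \<in> N" using \<open>M \<subseteq> N\<close> M0 by auto
    moreover have "a \<oplus> b \<in> N" if ab: "a \<in> N" "b \<in> N" for a b
    proof -
      obtain m c m' c' where *: "m \<in> M" "m' \<in> M" "a = m \<oplus> c \<odot> y" "b = m' \<oplus> c' \<odot> y"
        using ab unfolding N_def by blast
      then have "m \<in> carrier U" "m' \<in> carrier U" using Mc by auto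
      then have "a \<oplus> b = (m \<oplus> m') \<oplus> (c + c') \<odot> y"
        using y by (simp add: * sm_add_left M.a_ac)
      then show ?thesis using * Ma by (auto simp: N_def)
    qed
    moreover have "c \<odot> a \<in> N" if ab: "a \<in> N" for a c
    proof -
      obtain m c' where *: "m \<in> M" "a = m \<oplus> c' \<odot> y" using ab unfolding N_def by blast
      then have "c \<odot> a = c \<odot> m \<oplus> (c * c') \<odot> y" using y Mc by (auto simp: sm_add_right sm_assoc)
      then show ?thesis using * Ms by (auto simp: N_def)
    qed
    ultimately have "x \<in> N" by (auto simp: sub_def)
    then obtain m c where mc: "m \<in> M" "x = m \<oplus> c \<odot> y" by (auto simp: N_def)
    have mU: "m \<in> carrier U" using mc Mc by auto
    have c0: "c \<noteq> 0"
    proof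
      assume "c = 0" then show False using mc mU y Mx by auto
    qed
    have "(- inverse c) \<odot> m \<oplus> inverse c \<odot> x
        = ((- inverse c) \<odot> m \<oplus> inverse c \<odot> m) \<oplus> inverse c \<odot> (c \<odot> y)"
      using mU y by (subst mc(2)) (simp add: sm_add_right M.a_ac)
    also have "\<dots> = y"
      using mU y c0 by (simp add: sm_add_left[symmetric] sm_assoc)
    finally show ?thesis using Ms[OF mc(1)] by metis
  qed
  \<comment> \<open>Different coefficients would put a nonzero multiple of \<open>x\<close>, hence
    \<open>x\<close> itself, into \<open>M\<close>.\<close>
  have uniq: "c = c'" if "m \<in> M" "m' \<in> M" "m \<oplus> c \<odot> x = m' \<oplus> c' \<odot> x" for m m' c c'
  proof (rule ccontr)
    assume ne: "c \<noteq> c'"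
    have mU: "m \<in> carrier U" "m' \<in> carrier U" using that Mc by auto
    have "(c - c') \<odot> x = ((-1) \<odot> m \<oplus> m) \<oplus> c \<odot> x \<oplus> (- c') \<odot> x"
      using mU x by (simp add: sm_add_left[symmetric] sm_minus_one M.l_neg)
    also have "\<dots> = (-1) \<odot> m \<oplus> (m \<oplus> c \<odot> x) \<oplus> (- c') \<odot> x"
      using mU x by (simp add: M.a_assoc)
    also have "\<dots> = (-1) \<odot> m \<oplus> m' \<oplus> (c' \<odot> x \<oplus> (- c') \<odot> x)"
      using mU x by (simp add: that(3) M.a_assoc)
    also have "\<dots> = (-1) \<odot> m \<oplus> m'"
      using mU x by (simp add: sm_add_left[symmetric])
    finally have "inverse (c - c') \<odot> ((c - c') \<odot> x) \<in> M" using Ma Ms that by simp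
    then show False using ne x Mx by (simp add: sm_assoc)
  qed
  define f where "f y = (THE c. \<exists>m\<in>M. y = m \<oplus> c \<odot> x)" for y
  have fI: "f (m \<oplus> c \<odot> x) = c" if "m \<in> M" for m c
    unfolding f_def using uniq that by (intro the_equality) blast+
  have "functional U f"
    unfolding functional_def
  proof (intro conjI ballI allI)
    fix y z assume "y \<in> carrier U" "z \<in> carrier U"
    then obtain m c m' c' where *: "m \<in> M" "m' \<in> M" "y = m \<oplus> c \<odot> x" "z = m' \<oplus> c' \<odot> x"
      using ex by metis
    then have "m \<in> carrier U" "m' \<in> carrier U" using Mc by auto
    then have "y \<oplus> z = (m \<oplus> m') \<oplus> (c + c') \<odot> x" using x by (simp add: * sm_add_left M.a_ac)
    then show "f (y \<oplus> z) = f y + f z" using * Ma by (simp add: fI)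
  next
    fix c y assume "y \<in> carrier U"
    then obtain m c' where *: "m \<in> M" "y = m \<oplus> c' \<odot> x" using ex by metis
    then have "c \<odot> y = c \<odot> m \<oplus> (c * c') \<odot> x" using x Mc by (auto simp: sm_add_right sm_assoc)
    then show "f (c \<odot> y) = c * f y" using * Ms by (simp add: fI)
  qed
  moreover have "f x = 1" using fI[OF M0, of 1] x by simp
  ultimately show thesis using that by force
qed

text \<open>Linear functionals turn identities between elements of the algebra into identities between
  complex numbers, where ring normalisation is available.\<close>

lemma eq_by_functionals:
  assumes "x \<in> carrier U" "y \<in> carrier U" and "\<And>f. functional U f \<Longrightarrow> f x = f y"
  shows "x = y"
proof (rule ccontr)
  assume "x \<noteq> y"
  then have "x \<ominus> y \<noteq> \<zero>" using assms(1,2) by (metis M.add.inv_solve_right M.l_zero M.minus_eq M.zero_closed)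
  then obtain f where "functional U f" "f (x \<ominus> y) \<noteq> 0"
    using separating_functional[of "x \<ominus> y"] assms(1,2) by (metis M.minus_closed)
  then show False using assms functionalD(5) by force
qed

text \<open>Lets a functional be pushed through a sum that is one factor of a product.\<close>

lemma functional_mult_left: "functional U f \<Longrightarrow> z \<in> carrier U \<Longrightarrow> functional U (\<lambda>x. f (z \<otimes> x))"
  by (auto simp: functional_def distr_right smult_mult_right)

lemma functional_mult_right: "functional U f \<Longrightarrow> z \<in> carrier U \<Longrightarrow> functional U (\<lambda>x. f (x \<otimes> z))"
  by (auto simp: functional_def distr_left smult_mult_left)

lemma mult_zero [simp]: "x \<in> carrier U \<Longrightarrow> \<zero> \<otimes> x = \<zero>" "x \<in> carrier U \<Longrightarrow> x \<otimes> \<zero> = \<zero>"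
  using smult_mult_left[of \<zero> x 0] smult_mult_right[of x \<zero> 0] by simp_all

lemma minus_sm: "x \<in> carrier U \<Longrightarrow> \<ominus> x = (-1) \<odot> x"
  by (simp add: sm_minus_one)

lemma mult_minus:
  "\<lbrakk>x \<in> carrier U; y \<in> carrier U\<rbrakk> \<Longrightarrow> (\<ominus> x) \<otimes> y = \<ominus> (x \<otimes> y)"
  "\<lbrakk>x \<in> carrier U; y \<in> carrier U\<rbrakk> \<Longrightarrow> x \<otimes> (\<ominus> y) = \<ominus> (x \<otimes> y)"
  by (simp_all add: minus_sm smult_mult_left smult_mult_right)

lemma distr_minus:
  "\<lbrakk>x \<in> carrier U; y \<in> carrier U; z \<in> carrier U\<rbrakk> \<Longrightarrow> (x \<ominus> y) \<otimes> z = x \<otimes> z \<ominus> y \<otimes> z"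
  "\<lbrakk>x \<in> carrier U; y \<in> carrier U; z \<in> carrier U\<rbrakk> \<Longrightarrow> z \<otimes> (x \<ominus> y) = z \<otimes> x \<ominus> z \<otimes> y"
  by (simp_all add: M.minus_eq distr_left distr_right mult_minus)

lemma finsum_mult_left:
  assumes "finite I" "g \<in> I \<rightarrow> carrier U" "z \<in> carrier U"
  shows "z \<otimes> (\<Oplus>i\<in>I. g i) = (\<Oplus>i\<in>I. z \<otimes> g i)"
proof (rule eq_by_functionals)
  fix f assume f: "functional U f"
  show "f (z \<otimes> (\<Oplus>i\<in>I. g i)) = f (\<Oplus>i\<in>I. z \<otimes> g i)"
    using functional_finsum[OF functional_mult_left[OF f assms(3)] assms(1,2)]
      functional_finsum[OF f assms(1), of "\<lambda>i. z \<otimes> g i"] assms by (simp add: Pi_iff)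
qed (use assms in \<open>auto intro!: M.finsum_closed\<close>)

lemma finsum_mult_right:
  assumes "finite I" "g \<in> I \<rightarrow> carrier U" "z \<in> carrier U"
  shows "(\<Oplus>i\<in>I. g i) \<otimes> z = (\<Oplus>i\<in>I. g i \<otimes> z)"
proof (rule eq_by_functionals)
  fix f assume f: "functional U f"
  show "f ((\<Oplus>i\<in>I. g i) \<otimes> z) = f (\<Oplus>i\<in>I. g i \<otimes> z)"
    using functional_finsum[OF functional_mult_right[OF f assms(3)] assms(1,2)]
      functional_finsum[OF f assms(1), of "\<lambda>i. g i \<otimes> z"] assms by (simp add: Pi_iff)
qed (use assms in \<open>auto intro!: M.finsum_closed\<close>)

lemmas distr_simps = distr_left distr_right distr_minus smult_mult_left smult_mult_right
  mult_minus mult_assoc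

end

lemma complex_algebraI:
  fixes U (structure)
  assumes "abelian_group U"
    and "\<And>a x. x \<in> carrier U \<Longrightarrow> a \<odot> x \<in> carrier U"
    and "\<And>a b x. x \<in> carrier U \<Longrightarrow> (a + b) \<odot> x = a \<odot> x \<oplus> b \<odot> x"
    and "\<And>a x y. \<lbrakk>x \<in> carrier U; y \<in> carrier U\<rbrakk> \<Longrightarrow> a \<odot> (x \<oplus> y) = a \<odot> x \<oplus> a \<odot> y"
    and "\<And>a b x. x \<in> carrier U \<Longrightarrow> (a * b) \<odot> x = a \<odot> (b \<odot> x)"
    and "\<And>x. x \<in> carrier U \<Longrightarrow> 1 \<odot> x = x"
    and "complex_algebra_axioms U"
  shows "complex_algebra U"
  using assms by (intro complex_algebra.intro module_complexI)

context star_algebra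
begin

declare adj_closed [simp, intro] adj_adj [simp]

lemma adj_zero [simp]: "adj U \<zero> = \<zero>"
  using adj_smult[of \<zero> 0] by simp

lemma adj_minus: "x \<in> carrier U \<Longrightarrow> adj U (\<ominus> x) = \<ominus> adj U x"
  by (simp add: minus_sm adj_smult)

lemma adj_diff: "\<lbrakk>x \<in> carrier U; y \<in> carrier U\<rbrakk> \<Longrightarrow> adj U (x \<ominus> y) = adj U x \<ominus> adj U y"
  by (simp add: M.minus_eq adj_add adj_minus)

lemma adj_finsum:
  assumes "finite I" "g \<in> I \<rightarrow> carrier U"
  shows "adj U (\<Oplus>i\<in>I. g i) = (\<Oplus>i\<in>I. adj U (g i))"
  using assms
proof (induction I rule: finite_induct)
  case (insert x F)
  then show ?case by (simp add: adj_add Pi_iff M.finsum_closed)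
qed simp

lemmas adj_simps = adj_add adj_diff adj_minus adj_smult adj_mult

end

section \<open>Complete \<open>C\<^sup>*\<close>-norms\<close>

text \<open>An arbitrary filter is allowed, so that one notion covers sequences and approximate
  identities. Membership in the carrier is required eventually for the net, and of the
  limit.\<close>

definition conv :: "('a, 'm) ring_scheme \<Rightarrow> ('a \<Rightarrow> real) \<Rightarrow> 't filter \<Rightarrow> ('t \<Rightarrow> 'a) \<Rightarrow> 'a \<Rightarrow> bool" where
  "conv U \<nu> F f x \<longleftrightarrow> x \<in> carrier U \<and> (\<forall>\<^sub>F t in F. f t \<in> carrier U) \<and>
     ((\<lambda>t. \<nu> (f t \<ominus>\<^bsub>U\<^esub> x)) \<longlongrightarrow> 0) F"

text \<open>The counterpart of \<open>star_hom\<close> for structures without matrix norms;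
  \<open>matrix_algebra\<close> and \<open>adjointable\<close> are plain \<open>star_alg\<close>
  records.\<close>

definition star_map :: "('a, 'm) star_alg_scheme \<Rightarrow> ('b, 'n) star_alg_scheme \<Rightarrow> ('a \<Rightarrow> 'b) \<Rightarrow> bool" where
  "star_map V W \<phi> \<longleftrightarrow> (\<forall>x\<in>carrier V. \<phi> x \<in> carrier W) \<and>
     (\<forall>x\<in>carrier V. \<forall>y\<in>carrier V. \<phi> (x \<otimes>\<^bsub>V\<^esub> y) = \<phi> x \<otimes>\<^bsub>W\<^esub> \<phi> y) \<and>
     (\<forall>x\<in>carrier V. \<forall>y\<in>carrier V. \<phi> (x \<oplus>\<^bsub>V\<^esub> y) = \<phi> x \<oplus>\<^bsub>W\<^esub> \<phi> y) \<and>
     (\<forall>c. \<forall>x\<in>carrier V. \<phi> (c \<odot>\<^bsub>V\<^esub> x) = c \<odot>\<^bsub>W\<^esub> \<phi> x) \<and>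
     (\<forall>x\<in>carrier V. \<phi> (adj V x) = adj W (\<phi> x))"

lemma star_mapD:
  assumes "star_map V W \<phi>"
  shows "\<And>x. x \<in> carrier V \<Longrightarrow> \<phi> x \<in> carrier W"
    and "\<And>x y. \<lbrakk>x \<in> carrier V; y \<in> carrier V\<rbrakk> \<Longrightarrow> \<phi> (x \<otimes>\<^bsub>V\<^esub> y) = \<phi> x \<otimes>\<^bsub>W\<^esub> \<phi> y"
    and "\<And>x y. \<lbrakk>x \<in> carrier V; y \<in> carrier V\<rbrakk> \<Longrightarrow> \<phi> (x \<oplus>\<^bsub>V\<^esub> y) = \<phi> x \<oplus>\<^bsub>W\<^esub> \<phi> y"
    and "\<And>c x. x \<in> carrier V \<Longrightarrow> \<phi> (c \<odot>\<^bsub>V\<^esub> x) = c \<odot>\<^bsub>W\<^esub> \<phi> x"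
    and "\<And>x. x \<in> carrier V \<Longrightarrow> \<phi> (adj V x) = adj W (\<phi> x)"
  using assms by (auto simp: star_map_def)

text \<open>Only linearity is assumed, so that the lemma serves equally for algebra homomorphisms,
  for taking an entry of a matrix and for evaluating an operator at a point.\<close>

lemma star_map_linear:
  assumes "complex_algebra V" "complex_algebra W"
    and "\<And>x. x \<in> carrier V \<Longrightarrow> \<phi> x \<in> carrier W"
    and "\<And>x y. \<lbrakk>x \<in> carrier V; y \<in> carrier V\<rbrakk> \<Longrightarrow> \<phi> (x \<oplus>\<^bsub>V\<^esub> y) = \<phi> x \<oplus>\<^bsub>W\<^esub> \<phi> y"
    and "\<And>c x. x \<in> carrier V \<Longrightarrow> \<phi> (c \<odot>\<^bsub>V\<^esub> x) = c \<odot>\<^bsub>W\<^esub> \<phi> x"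
  shows "\<phi> \<zero>\<^bsub>V\<^esub> = \<zero>\<^bsub>W\<^esub>" "x \<in> carrier V \<Longrightarrow> \<phi> (\<ominus>\<^bsub>V\<^esub> x) = \<ominus>\<^bsub>W\<^esub> \<phi> x"
    "\<lbrakk>x \<in> carrier V; y \<in> carrier V\<rbrakk> \<Longrightarrow> \<phi> (x \<ominus>\<^bsub>V\<^esub> y) = \<phi> x \<ominus>\<^bsub>W\<^esub> \<phi> y"
    "\<lbrakk>finite I; g \<in> I \<rightarrow> carrier V\<rbrakk> \<Longrightarrow>
      \<phi> (\<Oplus>\<^bsub>V\<^esub>i\<in>I. g i) = (\<Oplus>\<^bsub>W\<^esub>i\<in>I. \<phi> (g i))"
proof -
  interpret V: complex_algebra V by fact
  interpret W: complex_algebra W by fact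
  show 1: "\<phi> \<zero>\<^bsub>V\<^esub> = \<zero>\<^bsub>W\<^esub>"
    using assms(5)[of "\<zero>\<^bsub>V\<^esub>" 0] assms(3)[of "\<zero>\<^bsub>V\<^esub>"] by simp
  show 2: "\<phi> (\<ominus>\<^bsub>V\<^esub> x) = \<ominus>\<^bsub>W\<^esub> \<phi> x" if "x \<in> carrier V" for x
    using that assms(3,5) by (simp add: V.minus_sm W.minus_sm)
  show "\<phi> (x \<ominus>\<^bsub>V\<^esub> y) = \<phi> x \<ominus>\<^bsub>W\<^esub> \<phi> y" if "x \<in> carrier V" "y \<in> carrier V"
    using that by (simp add: V.M.minus_eq W.M.minus_eq assms(4) 2)
  assume "finite I" "g \<in> I \<rightarrow> carrier V"
  then show "\<phi> (\<Oplus>\<^bsub>V\<^esub>i\<in>I. g i) = (\<Oplus>\<^bsub>W\<^esub>i\<in>I. \<phi> (g i))"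
  proof (induction I rule: finite_induct)
    case (insert x F)
    then show ?case using assms(3) by (simp add: assms(4) Pi_iff V.M.finsum_closed)
  qed (simp add: 1)
qed

context complete_cstar_norm
begin

declare norm_nonneg [simp]

lemma norm_zero [simp]: "\<nu> \<zero> = 0"
  by (simp add: norm_eq_zero)

lemma norm_minus [simp]: "x \<in> carrier U \<Longrightarrow> \<nu> (\<ominus> x) = \<nu> x"
  by (simp add: minus_sm norm_smult)

lemma diff_self [simp]: "x \<in> carrier U \<Longrightarrow> x \<ominus> x = \<zero>"
  by (simp add: M.minus_eq M.r_neg)

lemma diff_zero [simp]: "x \<in> carrier U \<Longrightarrow> x \<ominus> \<zero> = x"
  by (simp add: M.minus_eq)

lemma norm_diff_comm: "\<lbrakk>x \<in> carrier U; y \<in> carrier U\<rbrakk> \<Longrightarrow> \<nu> (x \<ominus> y) = \<nu> (y \<ominus> x)"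
  by (metis M.a_inv_closed M.minus_add M.minus_closed M.minus_eq M.minus_minus M.a_comm norm_minus)

lemma norm_diff_eq_zero: "\<lbrakk>x \<in> carrier U; y \<in> carrier U\<rbrakk> \<Longrightarrow> \<nu> (x \<ominus> y) = 0 \<longleftrightarrow> x = y"
  by (metis M.add.inv_solve_right M.l_zero M.minus_closed M.minus_eq M.zero_closed norm_eq_zero)

lemma norm_diff_le: "\<lbrakk>x \<in> carrier U; y \<in> carrier U\<rbrakk> \<Longrightarrow> \<nu> (x \<ominus> y) \<le> \<nu> x + \<nu> y"
  using norm_triangle[of x "\<ominus> y"] by (simp add: M.minus_eq)

lemma norm_diff_triangle:
  assumes "x \<in> carrier U" "y \<in> carrier U" "z \<in> carrier U"
  shows "\<nu> (x \<ominus> z) \<le> \<nu> (x \<ominus> y) + \<nu> (y \<ominus> z)"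
proof -
  have "x \<ominus> z = (x \<ominus> y) \<oplus> (y \<ominus> z)"
  proof (rule eq_by_functionals)
    fix f assume f: "functional U f"
    show "f (x \<ominus> z) = f ((x \<ominus> y) \<oplus> (y \<ominus> z))" using assms by (simp add: functionalD[OF f])
  qed (use assms in auto)
  then show ?thesis using norm_triangle[of "x \<ominus> y" "y \<ominus> z"] assms by simp
qed

lemma norm_le_diff:
  assumes "x \<in> carrier U" "y \<in> carrier U"
  shows "\<nu> x \<le> \<nu> y + \<nu> (x \<ominus> y)"
  using norm_diff_triangle[of x y \<zero>] assms by simp

lemma abs_norm_diff_le:
  assumes "x \<in> carrier U" "y \<in> carrier U"
  shows "\<bar>\<nu> x - \<nu> y\<bar> \<le> \<nu> (x \<ominus> y)"
  using norm_le_diff[of x y] norm_le_diff[of y x] assms norm_diff_comm[of x y] by linarith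

lemma norm_finsum:
  assumes "finite I" "g \<in> I \<rightarrow> carrier U"
  shows "\<nu> (\<Oplus>i\<in>I. g i) \<le> (\<Sum>i\<in>I. \<nu> (g i))"
  using assms
proof (induction I rule: finite_induct)
  case (insert x F)
  then have "\<nu> (g x \<oplus> (\<Oplus>i\<in>F. g i)) \<le> \<nu> (g x) + \<nu> (\<Oplus>i\<in>F. g i)"
    by (intro norm_triangle M.finsum_closed) auto
  with insert show ?case by (simp add: Pi_iff)
qed simp

text \<open>The C*-identity and submultiplicativity bound the norm of any element by that of its
  adjoint; this is applied to \<open>x\<close> and to \<open>adj U x\<close>.\<close>

lemma norm_adj [simp]:
  assumes "x \<in> carrier U"
  shows "\<nu> (adj U x) = \<nu> x"
proof -
  have *: "\<nu> x \<le> \<nu> (adj U x)" if x: "x \<in> carrier U" for x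
  proof (cases "\<nu> x = 0")
    case False
    have "(\<nu> x)\<^sup>2 \<le> \<nu> (adj U x) * \<nu> x"
      using cstar_identity[OF x] norm_mult[of "adj U x" x] x by simp
    then show ?thesis using False norm_nonneg[OF x] by (simp add: power2_eq_square)
  qed (use x in auto)
  show ?thesis using *[of x] *[of "adj U x"] assms by (simp add: antisym)
qed

lemma adj_mult_self_eq_zero: "x \<in> carrier U \<Longrightarrow> adj U x \<otimes> x = \<zero> \<Longrightarrow> x = \<zero>"
  using cstar_identity[of x] norm_eq_zero[of x] by simp

lemma mult_eq_zeroI:
  assumes "x \<in> carrier U" "\<And>z. z \<in> carrier U \<Longrightarrow> z \<otimes> x = \<zero>"
  shows "x = \<zero>"
  using assms adj_mult_self_eq_zero by blast

lemma metric: "Metric_space (carrier U) (norm_dist U \<nu>)"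
  by unfold_locales
    (auto simp: norm_dist_def norm_diff_comm norm_diff_eq_zero norm_diff_triangle)

lemma Cauchy_converges:
  assumes "\<And>n. \<xi> n \<in> carrier U"
    and "\<And>\<epsilon>. \<epsilon> > 0 \<Longrightarrow> \<exists>N. \<forall>m\<ge>N. \<forall>n\<ge>N. \<nu> (\<xi> m \<ominus> \<xi> n) < \<epsilon>"
  obtains x where "conv U \<nu> sequentially \<xi> x"
proof -
  interpret m: Metric_space "carrier U" "norm_dist U \<nu>" by (rule metric)
  have "m.MCauchy \<xi>"
    using assms by (force simp: m.MCauchy_def norm_dist_def)
  then obtain x where x: "limitin m.mtopology \<xi> x sequentially"
    using complete by (auto simp: m.mcomplete_def)
  then have xU: "x \<in> carrier U" by (auto simp: m.limitin_metric)
  have "(\<lambda>n. \<nu> (\<xi> n \<ominus> x)) \<longlonglongrightarrow> 0"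
  proof (rule tendstoI)
    fix \<epsilon> :: real assume "\<epsilon> > 0"
    with x have "\<forall>\<^sub>F n in sequentially. \<xi> n \<in> carrier U \<and> norm_dist U \<nu> (\<xi> n) x < \<epsilon>"
      by (auto simp: m.limitin_metric)
    then show "\<forall>\<^sub>F n in sequentially. dist (\<nu> (\<xi> n \<ominus> x)) 0 < \<epsilon>"
      using assms(1) xU by (auto simp: norm_dist_def elim: eventually_mono)
  qed
  then show thesis using that assms(1) xU by (auto simp: conv_def)
qed

lemma geometric_converges:
  assumes \<xi>: "\<And>n. \<xi> n \<in> carrier U" and r: "0 \<le> r" "r < 1"
    and step: "\<And>n. \<nu> (\<xi> (Suc n) \<ominus> \<xi> n) \<le> K * r ^ n"
  obtains x where "conv U \<nu> sequentially \<xi> x"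
proof (rule Cauchy_converges[of \<xi>])
  have dist: "\<nu> (\<xi> (m + k) \<ominus> \<xi> m) \<le> (\<Sum>i<k. K * r ^ (m + i))" for m k
  proof (induction k)
    case (Suc k)
    have "\<nu> (\<xi> (m + Suc k) \<ominus> \<xi> m) \<le> \<nu> (\<xi> (Suc (m + k)) \<ominus> \<xi> (m + k)) + \<nu> (\<xi> (m + k) \<ominus> \<xi> m)"
      using norm_diff_triangle \<xi> by simp
    then show ?case using Suc step[of "m + k"] by simp
  qed (use \<xi> in simp)
  have K: "K \<ge> 0" using order_trans[OF norm_nonneg step[of 0]] \<xi> by simp
  have le: "\<nu> (\<xi> (m + k) \<ominus> \<xi> m) \<le> K / (1 - r) * r ^ m" for m k
  proof -
    have "(\<Sum>i<k. K * r ^ (m + i)) = K * r ^ m * (\<Sum>i<k. r ^ i)"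
      by (simp add: sum_distrib_left power_add mult.assoc)
    also have "(\<Sum>i<k. r ^ i) = (1 - r ^ k) / (1 - r)" using r by (simp add: sum_gp_strict)
    also have "\<dots> \<le> 1 / (1 - r)" using r by (intro divide_right_mono) auto
    finally show ?thesis using dist[of m k] K r
      by (smt (verit) mult.commute mult.left_commute mult_left_mono times_divide_eq_right mult_nonneg_nonneg zero_le_power mult_cancel_right1)
  qed
  fix \<epsilon> :: real assume e: "\<epsilon> > 0"
  have "(\<lambda>m. K / (1 - r) * r ^ m) \<longlonglongrightarrow> K / (1 - r) * 0"
    using r by (intro tendsto_intros LIMSEQ_realpow_zero)
  then have "\<forall>\<^sub>F m in sequentially. K / (1 - r) * r ^ m < \<epsilon> / 2"
    using e by (intro order_tendstoD) auto
  then obtain N where N: "K / (1 - r) * r ^ N < \<epsilon> / 2" by (auto simp: eventually_sequentially)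
  have "\<nu> (\<xi> m \<ominus> \<xi> n) < \<epsilon>" if "m \<ge> N" "n \<ge> N" for m n
  proof -
    have "\<nu> (\<xi> m \<ominus> \<xi> n) \<le> \<nu> (\<xi> m \<ominus> \<xi> N) + \<nu> (\<xi> n \<ominus> \<xi> N)"
      using norm_diff_triangle[of "\<xi> m" "\<xi> N" "\<xi> n"] \<xi> norm_diff_comm by simp
    moreover have "\<nu> (\<xi> m \<ominus> \<xi> N) \<le> K / (1 - r) * r ^ N" "\<nu> (\<xi> n \<ominus> \<xi> N) \<le> K / (1 - r) * r ^ N"
      using le[of N "m - N"] le[of N "n - N"] that by simp_all
    ultimately show ?thesis using N by linarith
  qed
  then show "\<exists>N. \<forall>m\<ge>N. \<forall>n\<ge>N. \<nu> (\<xi> m \<ominus> \<xi> n) < \<epsilon>" by blast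
qed (use \<xi> that in auto)

lemma convD:
  assumes "conv U \<nu> F f x"
  shows "x \<in> carrier U" "\<forall>\<^sub>F t in F. f t \<in> carrier U" "((\<lambda>t. \<nu> (f t \<ominus> x)) \<longlongrightarrow> 0) F"
  using assms by (auto simp: conv_def)

lemma convI_bound:
  assumes x: "x \<in> carrier U" and "\<forall>\<^sub>F t in F. f t \<in> carrier U \<and> \<nu> (f t \<ominus> x) \<le> g t" "(g \<longlongrightarrow> 0) F"
  shows "conv U \<nu> F f x"
proof -
  have ev: "\<forall>\<^sub>F t in F. f t \<in> carrier U" using assms(2) by (rule eventually_mono) auto
  have "((\<lambda>t. \<nu> (f t \<ominus> x)) \<longlongrightarrow> 0) F"
  proof (rule tendsto_sandwich[OF _ _ tendsto_const assms(3)])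
    show "\<forall>\<^sub>F t in F. 0 \<le> \<nu> (f t \<ominus> x)" using ev by (rule eventually_mono) (use x in auto)
    show "\<forall>\<^sub>F t in F. \<nu> (f t \<ominus> x) \<le> g t" using assms(2) by (rule eventually_mono) auto
  qed
  then show ?thesis using x ev by (simp add: conv_def)
qed

lemma conv_const: "x \<in> carrier U \<Longrightarrow> conv U \<nu> F (\<lambda>_. x) x"
  by (simp add: conv_def)

lemma conv_cong:
  assumes "conv U \<nu> F f x" "\<forall>\<^sub>F t in F. f t = g t"
  shows "conv U \<nu> F g x"
proof -
  have "\<forall>\<^sub>F t in F. g t \<in> carrier U"
    using assms(2) convD(2)[OF assms(1)] by eventually_elim simp
  moreover have "\<forall>\<^sub>F t in F. \<nu> (f t \<ominus> x) = \<nu> (g t \<ominus> x)"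
    using assms(2) by eventually_elim simp
  ultimately show ?thesis
    using assms(1) Lim_transform_eventually by (auto simp: conv_def)
qed

lemma conv_add:
  assumes "conv U \<nu> F f x" "conv U \<nu> F g y"
  shows "conv U \<nu> F (\<lambda>t. f t \<oplus> g t) (x \<oplus> y)"
proof (rule convI_bound)
  note f = convD[OF assms(1)] and g = convD[OF assms(2)]
  show "((\<lambda>t. \<nu> (f t \<ominus> x) + \<nu> (g t \<ominus> y)) \<longlongrightarrow> 0) F"
    using tendsto_add[OF f(3) g(3)] by simp
  show "\<forall>\<^sub>F t in F. f t \<oplus> g t \<in> carrier U \<and>
      \<nu> ((f t \<oplus> g t) \<ominus> (x \<oplus> y)) \<le> \<nu> (f t \<ominus> x) + \<nu> (g t \<ominus> y)"
    using f(2) g(2)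
  proof eventually_elim
    case (elim t)
    have "(f t \<oplus> g t) \<ominus> (x \<oplus> y) = (f t \<ominus> x) \<oplus> (g t \<ominus> y)"
    proof (rule eq_by_functionals)
      fix h assume h: "functional U h"
      show "h ((f t \<oplus> g t) \<ominus> (x \<oplus> y)) = h ((f t \<ominus> x) \<oplus> (g t \<ominus> y))"
        using elim f g by (simp add: functionalD[OF h])
    qed (use elim f g in auto)
    then show ?case using norm_triangle elim f g by simp
  qed
qed (use assms in \<open>simp add: conv_def\<close>)

text \<open>The left factor need not converge: boundedness of \<open>g\<close>, together with
  convergence against the limit of the right factor, suffices.\<close>

lemma conv_mult_bounded:
  assumes f: "conv U \<nu> F f x" and g: "\<forall>\<^sub>F t in F. g t \<in> carrier U" "conv U \<nu> F (\<lambda>t. g t \<otimes> x) y"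
    and bd: "\<forall>\<^sub>F t in F. \<nu> (g t) \<le> K"
  shows "conv U \<nu> F (\<lambda>t. g t \<otimes> f t) y"
proof (rule convI_bound)
  note f = convD[OF f]
  show y: "y \<in> carrier U" by (rule convD[OF g(2)])
  show "((\<lambda>t. K * \<nu> (f t \<ominus> x) + \<nu> (g t \<otimes> x \<ominus> y)) \<longlongrightarrow> 0) F"
    using tendsto_add[OF tendsto_mult_left[OF f(3), of K] convD(3)[OF g(2)]] by simp
  show "\<forall>\<^sub>F t in F. g t \<otimes> f t \<in> carrier U \<and> \<nu> (g t \<otimes> f t \<ominus> y) \<le> K * \<nu> (f t \<ominus> x) + \<nu> (g t \<otimes> x \<ominus> y)"
    using f(2) g(1) bd
  proof eventually_elim
    case (elim t)
    have "\<nu> (g t \<otimes> f t \<ominus> y) \<le> \<nu> (g t \<otimes> f t \<ominus> g t \<otimes> x) + \<nu> (g t \<otimes> x \<ominus> y)"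
      using elim f y by (intro norm_diff_triangle) auto
    moreover have "\<nu> (g t \<otimes> f t \<ominus> g t \<otimes> x) \<le> \<nu> (g t) * \<nu> (f t \<ominus> x)"
      using elim f norm_mult[of "g t" "f t \<ominus> x"] by (simp add: distr_minus)
    moreover have "\<nu> (g t) * \<nu> (f t \<ominus> x) \<le> K * \<nu> (f t \<ominus> x)"
      using elim f by (intro mult_right_mono) auto
    ultimately show ?case using elim by auto
  qed
qed

lemma conv_mult_left:
  assumes f: "conv U \<nu> F f x" and z: "z \<in> carrier U"
  shows "conv U \<nu> F (\<lambda>t. z \<otimes> f t) (z \<otimes> x)"
  by (rule conv_mult_bounded[OF f, where K = "\<nu> z"]) (use z convD(1)[OF f] in \<open>auto intro: conv_const\<close>)

lemma conv_adj:
  assumes "conv U \<nu> F f x"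
  shows "conv U \<nu> F (\<lambda>t. adj U (f t)) (adj U x)"
proof (rule convI_bound)
  note f = convD[OF assms]
  show "adj U x \<in> carrier U" using f by simp
  show "((\<lambda>t. \<nu> (f t \<ominus> x)) \<longlongrightarrow> 0) F" by (rule f)
  show "\<forall>\<^sub>F t in F. adj U (f t) \<in> carrier U \<and> \<nu> (adj U (f t) \<ominus> adj U x) \<le> \<nu> (f t \<ominus> x)"
    using f(2) by eventually_elim (use f in \<open>simp add: adj_diff[symmetric]\<close>)
qed

lemma conv_mult_right:
  assumes f: "conv U \<nu> F f x" and z: "z \<in> carrier U"
  shows "conv U \<nu> F (\<lambda>t. f t \<otimes> z) (x \<otimes> z)"
proof (rule convI_bound)
  note f = convD[OF f]
  show "x \<otimes> z \<in> carrier U" using f z by simp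
  show "((\<lambda>t. \<nu> (f t \<ominus> x) * \<nu> z) \<longlongrightarrow> 0) F"
    using tendsto_mult_right[OF f(3)] by simp
  show "\<forall>\<^sub>F t in F. f t \<otimes> z \<in> carrier U \<and> \<nu> (f t \<otimes> z \<ominus> x \<otimes> z) \<le> \<nu> (f t \<ominus> x) * \<nu> z"
    using f(2) by eventually_elim
      (use f z norm_mult in \<open>simp add: distr_minus(1)[symmetric]\<close>)
qed

lemma conv_smult:
  assumes f: "conv U \<nu> F f x"
  shows "conv U \<nu> F (\<lambda>t. c \<odot> f t) (c \<odot> x)"
proof (rule convI_bound)
  note f = convD[OF f]
  show "c \<odot> x \<in> carrier U" using f by simp
  show "((\<lambda>t. cmod c * \<nu> (f t \<ominus> x)) \<longlongrightarrow> 0) F"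
    using tendsto_mult_left[OF f(3)] by simp
  show "\<forall>\<^sub>F t in F. c \<odot> f t \<in> carrier U \<and> \<nu> (c \<odot> f t \<ominus> c \<odot> x) \<le> cmod c * \<nu> (f t \<ominus> x)"
    using f(2)
  proof eventually_elim
    case (elim t)
    have "c \<odot> f t \<ominus> c \<odot> x = c \<odot> (f t \<ominus> x)"
    proof (rule eq_by_functionals)
      fix h assume h: "functional U h"
      show "h (c \<odot> f t \<ominus> c \<odot> x) = h (c \<odot> (f t \<ominus> x))"
        using elim f by (simp add: functionalD[OF h] algebra_simps)
    qed (use elim f in auto)
    then show ?case using elim f by (simp add: norm_smult)
  qed
qed

lemma conv_diff:
  assumes "conv U \<nu> F f x" "conv U \<nu> F g y"
  shows "conv U \<nu> F (\<lambda>t. f t \<ominus> g t) (x \<ominus> y)"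
proof -
  have "conv U \<nu> F (\<lambda>t. f t \<oplus> (-1) \<odot> g t) (x \<oplus> (-1) \<odot> y)"
    using assms by (intro conv_add conv_smult)
  then show ?thesis
    using conv_cong[of F "\<lambda>t. f t \<oplus> (-1) \<odot> g t" _ "\<lambda>t. f t \<ominus> g t"] convD(1)[OF assms(2)] convD(2)[OF assms(2)]
    by (simp add: M.minus_eq minus_sm eventually_mono)
qed

lemma conv_norm:
  assumes f: "conv U \<nu> F f x"
  shows "((\<lambda>t. \<nu> (f t)) \<longlongrightarrow> \<nu> x) F"
proof (rule LIM_zero_cancel, rule Lim_null_comparison)
  note f = convD[OF f]
  show "\<forall>\<^sub>F t in F. norm (\<nu> (f t) - \<nu> x) \<le> \<nu> (f t \<ominus> x)"
    using f(2) by eventually_elim (use f abs_norm_diff_le in simp)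
qed (rule convD[OF f])

lemma conv_norm_le:
  assumes "conv U \<nu> F f x" "\<forall>\<^sub>F t in F. \<nu> (f t) \<le> K" "F \<noteq> bot"
  shows "\<nu> x \<le> K"
  using tendsto_upperbound[OF conv_norm[OF assms(1)] assms(2,3)] .

lemma conv_unique:
  assumes "conv U \<nu> F f x" "conv U \<nu> F f y" "F \<noteq> bot"
  shows "x = y"
proof -
  have "conv U \<nu> F (\<lambda>t. f t \<ominus> f t) (x \<ominus> y)" using conv_diff assms by blast
  then have "((\<lambda>t. \<nu> (f t \<ominus> f t)) \<longlongrightarrow> \<nu> (x \<ominus> y)) F" by (rule conv_norm)
  moreover have "((\<lambda>t. \<nu> (f t \<ominus> f t)) \<longlongrightarrow> 0) F"
    by (rule Lim_transform_eventually[OF tendsto_const])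
      (use convD(2)[OF assms(1)] in \<open>auto elim: eventually_mono\<close>)
  ultimately have "\<nu> (x \<ominus> y) = 0" using assms(3) tendsto_unique by blast
  then show ?thesis using norm_diff_eq_zero convD(1) assms by blast
qed

lemma conv_finsum:
  assumes "finite I" "\<And>i. i \<in> I \<Longrightarrow> conv U \<nu> F (\<lambda>t. f t i) (x i)"
    and "\<And>i t. i \<in> I \<Longrightarrow> f t i \<in> carrier U"
  shows "conv U \<nu> F (\<lambda>t. \<Oplus>i\<in>I. f t i) (\<Oplus>i\<in>I. x i)"
  using assms
proof (induction I rule: finite_induct)
  case (insert i I)
  have "x k \<in> carrier U" if "k \<in> insert i I" for k
    using insert.prems(1)[OF that] by (rule convD(1))
  then show ?case using insert conv_add[of F "\<lambda>t. f t i" "x i"] by (simp add: Pi_iff)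
qed (simp add: conv_const)

end

section \<open>Square roots near 1 and automatic contractivity of *-homomorphisms\<close>

context complete_cstar_norm
begin

text \<open>The element \<open>c\<close> is \<open>1 - (1 - s)\<^sup>1\<^sup>/\<^sup>2\<close>, found as the fixed point of \<open>c \<mapsto> (s + c\<^sup>2) / 2\<close>.\<close>

lemma one_minus_sqrt:
  assumes s: "s \<in> carrier U" "adj U s = s" "\<nu> s < 1"
  obtains c where "c \<in> carrier U" "adj U c = c" "c \<oplus> c \<ominus> c \<otimes> c = s"
    "\<And>z. z \<in> carrier U \<Longrightarrow> z \<otimes> s = s \<otimes> z \<Longrightarrow> z \<otimes> c = c \<otimes> z"
proof -
  \<comment> \<open>The smaller root of \<open>r\<^sup>2 - 2 r + \<nu> s = 0\<close>. The iteration
    maps the ball of radius \<open>r\<close> into itself, and \<open>r < 1\<close> is also its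
    contraction rate there.\<close>
  define r where "r = 1 - sqrt (1 - \<nu> s)"
  have q: "0 \<le> \<nu> s" using s by simp
  have r: "0 \<le> r" "r < 1" "(\<nu> s + r\<^sup>2) / 2 = r"
    using q s(3) by (auto simp: r_def power2_eq_square field_simps real_sqrt_le_1_iff)
  define t where "t = rec_nat \<zero> (\<lambda>_ c. (1/2) \<odot> (s \<oplus> c \<otimes> c))"
  have t0: "t 0 = \<zero>" and tS: "\<And>n. t (Suc n) = (1/2) \<odot> (s \<oplus> t n \<otimes> t n)"
    by (simp_all add: t_def)
  have tU [simp]: "t n \<in> carrier U" for n by (induction n) (auto simp: t0 tS s)
  have t_adj: "adj U (t n) = t n" for n by (induction n) (auto simp: t0 tS s adj_simps)
  have t_comm: "z \<otimes> t n = t n \<otimes> z" if "z \<in> carrier U" "z \<otimes> s = s \<otimes> z" for z n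
  proof (induction n)
    case (Suc n)
    have "z \<otimes> (t n \<otimes> t n) = t n \<otimes> t n \<otimes> z"
      by (metis Suc that(1) tU mult_assoc)
    then show ?case using that s by (simp add: tS smult_mult_left smult_mult_right distr_left distr_right)
  qed (use that in \<open>simp add: t0\<close>)
  have t_norm: "\<nu> (t n) \<le> r" for n
  proof (induction n)
    case (Suc n)
    have "\<nu> (t (Suc n)) \<le> (\<nu> s + \<nu> (t n) * \<nu> (t n)) / 2"
      using norm_triangle[of s "t n \<otimes> t n"] norm_mult[of "t n" "t n"] s
      by (simp add: tS norm_smult)
    also have "\<dots> \<le> (\<nu> s + r\<^sup>2) / 2"
      using mult_mono[OF Suc Suc] r by (simp add: power2_eq_square)
    finally show ?case using r by simp
  qed (use r in \<open>simp add: t0\<close>)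
  have "\<nu> (t (Suc n) \<ominus> t n) \<le> \<nu> (t 1) * r ^ n" for n
  proof (induction n)
    case (Suc n)
    let ?d = "t (Suc n) \<ominus> t n"
    \<comment> \<open>Here \<open>s\<close> cancels, and the difference of squares is split as
      \<open>x (x - y) + (x - y) y\<close>, which does not require \<open>x\<close> and
      \<open>y\<close> to commute.\<close>
    have "t (Suc (Suc n)) \<ominus> t (Suc n) = (1/2) \<odot> (t (Suc n) \<otimes> ?d \<oplus> ?d \<otimes> t n)"
    proof (rule eq_by_functionals)
      fix f assume f: "functional U f"
      have *: "t (Suc (Suc n)) \<ominus> t (Suc n) = (1/2) \<odot> (s \<oplus> t (Suc n) \<otimes> t (Suc n)) \<ominus> (1/2) \<odot> (s \<oplus> t n \<otimes> t n)"
        by (simp only: tS)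
      show "f (t (Suc (Suc n)) \<ominus> t (Suc n)) = f ((1/2) \<odot> (t (Suc n) \<otimes> ?d \<oplus> ?d \<otimes> t n))"
        unfolding * using s by (simp add: functionalD[OF f] distr_minus algebra_simps add_divide_distrib diff_divide_distrib)
    qed (use s in auto)
    then have "\<nu> (t (Suc (Suc n)) \<ominus> t (Suc n)) \<le> (\<nu> (t (Suc n) \<otimes> ?d) + \<nu> (?d \<otimes> t n)) / 2"
      using norm_triangle[of "t (Suc n) \<otimes> ?d" "?d \<otimes> t n"] by (simp add: norm_smult)
    also have "\<dots> \<le> (\<nu> (t (Suc n)) * \<nu> ?d + \<nu> ?d * \<nu> (t n)) / 2"
      using norm_mult[of "t (Suc n)" ?d] norm_mult[of ?d "t n"] by (intro divide_right_mono) auto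
    also have "\<dots> \<le> (r * \<nu> ?d + \<nu> ?d * r) / 2"
      using t_norm by (intro divide_right_mono add_mono mult_mono) (auto simp: r)
    also have "\<dots> \<le> r * (\<nu> (t 1) * r ^ n)" using Suc r by (simp add: mult_left_mono)
    finally show ?case by (simp add: mult.left_commute)
  qed (use t0 in simp)
  then obtain c where c: "conv U \<nu> sequentially t c"
    using geometric_converges[of t r "\<nu> (t 1)"] r by auto
  note cU [simp] = convD(1)[OF c]
  have "conv U \<nu> sequentially (\<lambda>n. t n \<otimes> t n) (c \<otimes> c)"
    using t_norm by (intro conv_mult_bounded[OF c, of _ _ r] conv_mult_right[OF c]) auto
  then have "conv U \<nu> sequentially (\<lambda>n. t (Suc n)) ((1/2) \<odot> (s \<oplus> c \<otimes> c))"
    unfolding tS using s by (intro conv_smult conv_add conv_const)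
  moreover have "conv U \<nu> sequentially (\<lambda>n. t (Suc n)) c"
    using c LIMSEQ_Suc[of "\<lambda>n. \<nu> (t n \<ominus> c)" 0] by (simp add: conv_def)
  ultimately have fp: "c = (1/2) \<odot> (s \<oplus> c \<otimes> c)"
    using conv_unique[of sequentially "\<lambda>n. t (Suc n)"] by simp
  have "c \<oplus> c \<ominus> c \<otimes> c = s"
  proof (rule eq_by_functionals)
    fix f assume f: "functional U f"
    have "f c = f ((1/2) \<odot> (s \<oplus> c \<otimes> c))" using fp by simp
    then show "f (c \<oplus> c \<ominus> c \<otimes> c) = f s"
      using s by (simp add: functionalD[OF f] algebra_simps)
  qed (use s in auto)
  moreover have "adj U c = c"
    using conv_unique[OF conv_adj[OF c]] c by (simp add: t_adj)
  moreover have "z \<otimes> c = c \<otimes> z" if z: "z \<in> carrier U" "z \<otimes> s = s \<otimes> z" for z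
    using conv_unique[OF conv_mult_left[OF c z(1)]] conv_mult_right[OF c z(1)]
    by (simp add: t_comm[OF z])
  ultimately show thesis using that cU by blast
qed

text \<open>If \<open>h = h\<^sup>*\<close> and \<open>c = c\<^sup>*\<close> commute and \<open>h\<^sup>2 + (1 - c)\<^sup>2 = 1\<close>, then \<open>h + i(1 - c)\<close> and its adjoint
  are unitary multipliers, and \<open>h\<close> is their mean.\<close>

lemma norm_mult_le_by_unitary:
  assumes h: "h \<in> carrier U" "adj U h = h" and c: "c \<in> carrier U" "adj U c = c"
    and comm: "h \<otimes> c = c \<otimes> h" and eq: "c \<oplus> c \<ominus> c \<otimes> c = h \<otimes> h" and x: "x \<in> carrier U"
  shows "\<nu> (h \<otimes> x) \<le> \<nu> x"
proof -
  have hhx: "h \<otimes> (h \<otimes> z) = c \<otimes> z \<oplus> c \<otimes> z \<ominus> c \<otimes> (c \<otimes> z)" if "z \<in> carrier U" for z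
    using that h c by (simp add: mult_assoc[symmetric] eq[symmetric] distr_minus distr_left)
  have hcx: "h \<otimes> (c \<otimes> z) = c \<otimes> (h \<otimes> z)" if "z \<in> carrier U" for z
    using that h c comm by (simp add: mult_assoc[symmetric])
  \<comment> \<open>\<open>u e\<close> stands for \<open>(h + e (1 - c)) x\<close>. As there is no
    unit, the would-be unitary appears only applied to \<open>x\<close>. The two conditions on
    \<open>e\<close> below are satisfied by \<open>\<i>\<close> and \<open>- \<i>\<close>.\<close>
  define u where "u e = h \<otimes> x \<oplus> e \<odot> (x \<ominus> c \<otimes> x)" for e
  have uU [simp]: "u e \<in> carrier U" for e using h c x by (simp add: u_def)
  have u: "\<nu> (u e) = \<nu> x" if e: "cnj e = - e" "e * e = -1" for e
  proof -
    have "adj U (u e) \<otimes> u e = adj U x \<otimes> x"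
    proof (rule eq_by_functionals)
      fix f assume f: "functional U f"
      have e2: "e * (e * z) = - z" for z using e(2) by (simp add: mult.assoc[symmetric])
      show "f (adj U (u e) \<otimes> u e) = f (adj U x \<otimes> x)"
        using h c x by (simp add: u_def adj_simps distr_simps functionalD[OF f] hhx hcx e algebra_simps e2)
    qed (use x in auto)
    then have "(\<nu> (u e))\<^sup>2 = (\<nu> x)\<^sup>2" using cstar_identity x uU by metis
    then show ?thesis using x by (simp add: power2_eq_iff_nonneg)
  qed
  have "h \<otimes> x = (1/2) \<odot> (u \<i> \<oplus> u (- \<i>))"
  proof (rule eq_by_functionals)
    fix f assume f: "functional U f"
    show "f (h \<otimes> x) = f ((1/2) \<odot> (u \<i> \<oplus> u (- \<i>)))"
      using h c x by (simp add: u_def functionalD[OF f])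
  qed (use h x in auto)
  then have "\<nu> (h \<otimes> x) \<le> (\<nu> (u \<i>) + \<nu> (u (- \<i>))) / 2"
    using norm_triangle[of "u \<i>" "u (- \<i>)"] by (simp add: norm_smult)
  then show ?thesis by (simp add: u)
qed

end

text \<open>For selfadjoint \<open>h\<close> of norm below 1, write
  \<open>1 - h\<^sup>2 = (1 - c)\<^sup>2\<close>. This relation passes to \<open>W\<close>, where
  the unitary argument, applied to the element \<open>\<phi> h\<close>, gives
  \<open>(\<mu> (\<phi> h))\<^sup>2 \<le> \<mu> (\<phi> h)\<close>. Scaling covers all selfadjoint
  elements, and the C*-identity the remaining ones. No spectral radius enters.\<close>

lemma star_map_contractive:
  assumes V: "complete_cstar_norm V \<nu>" and W: "complete_cstar_norm W \<mu>"
    and \<phi>: "star_map V W \<phi>" and x: "x \<in> carrier V"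
  shows "\<mu> (\<phi> x) \<le> \<nu> x"
proof -
  interpret V: complete_cstar_norm V \<nu> by fact
  interpret W: complete_cstar_norm W \<mu> by fact
  note \<phi> = star_mapD[OF \<phi>]
  have diff: "\<phi> (a \<ominus>\<^bsub>V\<^esub> b) = \<phi> a \<ominus>\<^bsub>W\<^esub> \<phi> b" if "a \<in> carrier V" "b \<in> carrier V" for a b
    using star_map_linear(3)[OF V.complex_algebra_axioms W.complex_algebra_axioms \<phi>(1,3,4)] that by simp
  have ball: "\<mu> (\<phi> h) \<le> 1" if h: "h \<in> carrier V" "adj V h = h" "\<nu> h < 1" for h
  proof -
    have hh: "\<nu> (h \<otimes>\<^bsub>V\<^esub> h) < 1"
      using V.cstar_identity[of h] h by (simp add: power_less_one_iff)
    obtain c where c: "c \<in> carrier V" "adj V c = c" "c \<oplus>\<^bsub>V\<^esub> c \<ominus>\<^bsub>V\<^esub> c \<otimes>\<^bsub>V\<^esub> c = h \<otimes>\<^bsub>V\<^esub> h"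
      and comm: "\<And>z. z \<in> carrier V \<Longrightarrow> z \<otimes>\<^bsub>V\<^esub> (h \<otimes>\<^bsub>V\<^esub> h) = h \<otimes>\<^bsub>V\<^esub> h \<otimes>\<^bsub>V\<^esub> z \<Longrightarrow> z \<otimes>\<^bsub>V\<^esub> c = c \<otimes>\<^bsub>V\<^esub> z"
      using V.one_minus_sqrt[of "h \<otimes>\<^bsub>V\<^esub> h"] h hh V.adj_mult by (metis V.mult_closed)
    have hc: "h \<otimes>\<^bsub>V\<^esub> c = c \<otimes>\<^bsub>V\<^esub> h" using comm[of h] h by (simp add: V.mult_assoc)
    have "\<mu> (\<phi> h \<otimes>\<^bsub>W\<^esub> \<phi> h) \<le> \<mu> (\<phi> h)"
    proof (rule W.norm_mult_le_by_unitary)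
      show "\<phi> c \<oplus>\<^bsub>W\<^esub> \<phi> c \<ominus>\<^bsub>W\<^esub> \<phi> c \<otimes>\<^bsub>W\<^esub> \<phi> c = \<phi> h \<otimes>\<^bsub>W\<^esub> \<phi> h"
        using c h by (simp add: \<phi>(2,3)[symmetric] diff[symmetric])
      show "\<phi> h \<otimes>\<^bsub>W\<^esub> \<phi> c = \<phi> c \<otimes>\<^bsub>W\<^esub> \<phi> h"
        using c h hc by (simp add: \<phi>(2)[symmetric])
    qed (use h c \<phi>(1) \<phi>(5)[symmetric] in auto)
    moreover have "\<mu> (\<phi> h \<otimes>\<^bsub>W\<^esub> \<phi> h) = (\<mu> (\<phi> h))\<^sup>2"
      using W.cstar_identity[of "\<phi> h"] h \<phi>(1) \<phi>(5)[symmetric] by simp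
    ultimately have "\<mu> (\<phi> h) * \<mu> (\<phi> h) \<le> \<mu> (\<phi> h)" by (simp add: power2_eq_square)
    then show ?thesis
      using mult_strict_right_mono[of 1 "\<mu> (\<phi> h)" "\<mu> (\<phi> h)"] by linarith
  qed
  have sa: "\<mu> (\<phi> h) \<le> \<nu> h" if h: "h \<in> carrier V" "adj V h = h" for h
  proof (rule field_le_epsilon)
    fix e :: real assume e: "e > 0"
    \<comment> \<open>Division by \<open>\<nu> h + e\<close> rather than by \<open>\<nu> h\<close>:
      the norm becomes strictly smaller than 1, and the case \<open>\<nu> h = 0\<close> is
      harmless.\<close>
    let ?r = "\<nu> h + e"
    have r: "?r > 0" using e V.norm_nonneg[OF h(1)] by linarith
    let ?k = "complex_of_real (1 / ?r) \<odot>\<^bsub>V\<^esub> h"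
    have "\<nu> ?k = \<bar>1 / ?r\<bar> * \<nu> h" using h by (simp only: V.norm_smult norm_of_real)
    then have "\<nu> ?k < 1" using r e by simp
    then have "\<mu> (\<phi> ?k) \<le> 1" using ball[of ?k] h by (simp add: V.adj_smult)
    moreover have "\<mu> (\<phi> ?k) = \<bar>1 / ?r\<bar> * \<mu> (\<phi> h)"
      using h \<phi>(1) by (simp only: \<phi>(4) W.norm_smult norm_of_real)
    ultimately have "\<bar>1 / ?r\<bar> * \<mu> (\<phi> h) \<le> 1" by simp
    then show "\<mu> (\<phi> h) \<le> ?r" using r by (simp add: field_simps)
  qed
  have "(\<mu> (\<phi> x))\<^sup>2 = \<mu> (\<phi> (adj V x \<otimes>\<^bsub>V\<^esub> x))"
    using W.cstar_identity[OF \<phi>(1)[OF x]] x by (simp add: \<phi>)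
  also have "\<dots> \<le> \<nu> (adj V x \<otimes>\<^bsub>V\<^esub> x)" using x by (intro sa) (auto simp: V.adj_mult)
  also have "\<dots> = (\<nu> x)\<^sup>2" using x by (rule V.cstar_identity)
  finally show ?thesis using V.norm_nonneg[OF x] power2_le_imp_le by blast
qed

section \<open>Pullback of complete C*-norms and their uniqueness\<close>

definition seq_closed :: "('a, 'm) ring_scheme \<Rightarrow> ('a \<Rightarrow> real) \<Rightarrow> 'a set \<Rightarrow> bool" where
  "seq_closed U \<nu> S \<longleftrightarrow> (\<forall>\<xi> x. (\<forall>n. \<xi> n \<in> S) \<and> conv U \<nu> sequentially \<xi> x \<longrightarrow> x \<in> S)"

lemma seq_closedD:
  assumes "seq_closed U \<nu> S" "\<And>n. \<xi> n \<in> S" "conv U \<nu> sequentially \<xi> x"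
  shows "x \<in> S"
  using assms unfolding seq_closed_def by blast

text \<open>Completeness comes from the closed range, everything else from \<open>L\<close> being an
  injective *-homomorphism. Subalgebras, transported copies and the multiplier algebra acquire their
  C*-norms in this way.\<close>

lemma complete_cstar_norm_pullback:
  assumes W: "star_algebra W" and V: "complete_cstar_norm V \<nu>" and L: "star_map W V L"
    and inj: "inj_on L (carrier W)" and closed: "seq_closed V \<nu> (L ` carrier W)"
  shows "complete_cstar_norm W (\<lambda>x. \<nu> (L x))"
proof -
  interpret W: star_algebra W by fact
  interpret V: complete_cstar_norm V \<nu> by fact
  note Lm = star_mapD[OF L]
  note lin = star_map_linear[OF W.complex_algebra_axioms V.complex_algebra_axioms Lm(1,3,4), simplified]
  let ?\<mu> = "\<lambda>x. \<nu> (L x)"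
  have L0: "L x = \<zero>\<^bsub>V\<^esub> \<longleftrightarrow> x = \<zero>\<^bsub>W\<^esub>" if "x \<in> carrier W" for x
    using that inj lin(1) by (metis W.M.zero_closed inj_onD)
  have diff: "L (x \<ominus>\<^bsub>W\<^esub> y) = L x \<ominus>\<^bsub>V\<^esub> L y" if "x \<in> carrier W" "y \<in> carrier W" for x y
    using that by (rule lin(3))
  have m: "Metric_space (carrier W) (norm_dist W ?\<mu>)"
  proof
    fix x y z
    show "0 \<le> norm_dist W ?\<mu> x y" by (simp add: norm_dist_def Lm)
    show "norm_dist W ?\<mu> x y = norm_dist W ?\<mu> y x"
      by (simp add: norm_dist_def Lm diff V.norm_diff_comm)
    assume "x \<in> carrier W" "y \<in> carrier W"
    then show "norm_dist W ?\<mu> x y = 0 \<longleftrightarrow> x = y"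
      using inj by (auto simp: norm_dist_def Lm diff V.norm_diff_eq_zero inj_on_def)
    assume "z \<in> carrier W"
    then show "norm_dist W ?\<mu> x z \<le> norm_dist W ?\<mu> x y + norm_dist W ?\<mu> y z"
      using \<open>x \<in> carrier W\<close> \<open>y \<in> carrier W\<close>
      by (simp add: norm_dist_def Lm diff V.norm_diff_triangle)
  qed
  interpret m: Metric_space "carrier W" "norm_dist W ?\<mu>" by (rule m)
  have "m.mcomplete"
    unfolding m.mcomplete_def
  proof (intro allI impI)
    fix \<xi> assume C: "m.MCauchy \<xi>"
    then have \<xi>: "\<And>n. \<xi> n \<in> carrier W" by (auto simp: m.MCauchy_def)
    have "\<exists>N. \<forall>k\<ge>N. \<forall>n\<ge>N. \<nu> (L (\<xi> k) \<ominus>\<^bsub>V\<^esub> L (\<xi> n)) < \<epsilon>" if "\<epsilon> > 0" for \<epsilon>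
      using C that \<xi> unfolding m.MCauchy_def by (force simp: norm_dist_def diff)
    then obtain y where y: "conv V \<nu> sequentially (\<lambda>n. L (\<xi> n)) y"
      using V.Cauchy_converges[of "\<lambda>n. L (\<xi> n)"] \<xi> Lm(1) by metis
    have "y \<in> L ` carrier W"
      by (rule seq_closedD[OF closed _ y]) (use \<xi> in auto)
    then obtain x where x: "x \<in> carrier W" "y = L x" by auto
    have "limitin m.mtopology \<xi> x sequentially"
      unfolding m.limitin_metric
    proof (intro conjI allI impI)
      fix \<epsilon> :: real assume "\<epsilon> > 0"
      then have "\<forall>\<^sub>F n in sequentially. \<nu> (L (\<xi> n) \<ominus>\<^bsub>V\<^esub> y) < \<epsilon>"
        using order_tendstoD(2)[OF V.convD(3)[OF y]] by auto
      then show "\<forall>\<^sub>F n in sequentially. \<xi> n \<in> carrier W \<and> norm_dist W ?\<mu> (\<xi> n) x < \<epsilon>"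
        by eventually_elim (use x \<xi> in \<open>simp add: norm_dist_def diff\<close>)
    qed (use x in auto)
    then show "\<exists>x. limitin m.mtopology \<xi> x sequentially" by blast
  qed
  then show ?thesis
    using W
    by (auto simp: complete_cstar_norm_def complete_cstar_norm_axioms_def Lm L0 V.norm_eq_zero
        V.norm_triangle V.norm_smult V.norm_mult V.cstar_identity)
qed

lemma complete_cstar_norm_cong:
  assumes "complete_cstar_norm V \<nu>" "\<And>x. x \<in> carrier V \<Longrightarrow> \<mu> x = \<nu> x"
  shows "complete_cstar_norm V \<mu>"
proof -
  interpret V: complete_cstar_norm V \<nu> by fact
  have "norm_dist V \<mu> = norm_dist V \<nu>" by (intro ext) (simp add: norm_dist_def assms(2))
  then show ?thesis
    using assms(1) V.complete
    by (auto simp: complete_cstar_norm_def complete_cstar_norm_axioms_def assms(2) V.norm_eq_zero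
        V.norm_triangle V.norm_smult V.norm_mult V.cstar_identity)
qed

text \<open>The norm pulled back along \<open>\<phi>\<close> is a second complete C*-norm on
  \<open>V\<close>. Since *-homomorphisms are contractive, the identity map bounds either norm by
  the other.\<close>

lemma isometric_of_closed_range:
  assumes V: "complete_cstar_norm V \<nu>" and W: "complete_cstar_norm W \<mu>" and \<phi>: "star_map V W \<phi>"
    and inj: "inj_on \<phi> (carrier V)" and closed: "seq_closed W \<mu> (\<phi> ` carrier V)"
    and x: "x \<in> carrier V"
  shows "\<mu> (\<phi> x) = \<nu> x"
proof (rule antisym)
  show "\<mu> (\<phi> x) \<le> \<nu> x" by (rule star_map_contractive[OF V W \<phi> x])
  interpret V: complete_cstar_norm V \<nu> by fact
  have "complete_cstar_norm V (\<lambda>x. \<mu> (\<phi> x))"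
    by (rule complete_cstar_norm_pullback[OF V.star_algebra_axioms W \<phi> inj closed])
  from star_map_contractive[OF this V, of id x] x show "\<nu> x \<le> \<mu> (\<phi> x)"
    by (simp add: star_map_def)
qed

section \<open>Matrix algebras\<close>

lemma matrix_sel [simp]:
  "carrier (matrix_algebra n U) = matrices n U"
  "mult (matrix_algebra n U) M N = (\<lambda>(i, k)\<in>matrix_index n. \<Oplus>\<^bsub>U\<^esub>j\<in>{..<n}. M (i, j) \<otimes>\<^bsub>U\<^esub> N (j, k))"
  "zero (matrix_algebra n U) = (\<lambda>p\<in>matrix_index n. \<zero>\<^bsub>U\<^esub>)"
  "add (matrix_algebra n U) M N = (\<lambda>p\<in>matrix_index n. M p \<oplus>\<^bsub>U\<^esub> N p)"
  "smult (matrix_algebra n U) c M = (\<lambda>p\<in>matrix_index n. c \<odot>\<^bsub>U\<^esub> M p)"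
  "adj (matrix_algebra n U) M = (\<lambda>(i, j)\<in>matrix_index n. adj U (M (j, i)))"
  by (simp_all add: matrix_algebra_def)

lemma matrices_iff [simp]:
  "M \<in> matrices n U \<longleftrightarrow> (\<forall>i<n. \<forall>j<n. M (i, j) \<in> carrier U) \<and> M \<in> extensional (matrix_index n)"
  by (auto simp: PiE_iff)

lemma matrix_eqI:
  assumes "M \<in> matrices n U" "N \<in> matrices n U" "\<And>i j. i < n \<Longrightarrow> j < n \<Longrightarrow> M (i, j) = N (i, j)"
  shows "M = N"
  using assms by (intro PiE_ext[of M _ "\<lambda>_. carrier U" N]) blast+

lemma (in complex_algebra) finsum_sm:
  "finite I \<Longrightarrow> g \<in> I \<rightarrow> carrier U \<Longrightarrow> c \<odot> (\<Oplus>i\<in>I. g i) = (\<Oplus>i\<in>I. c \<odot> g i)"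
  using finsum_smult_ldistr[of I c g] by simp

lemma (in star_algebra) matrix_star_algebra: "star_algebra (matrix_algebra n U)"
proof -
  let ?M = "matrix_algebra n U"
  have cl: "(\<lambda>(i, k)\<in>matrix_index n. \<Oplus>j\<in>{..<n}. M (i, j) \<otimes> N (j, k)) \<in> matrices n U"
    if "M \<in> matrices n U" "N \<in> matrices n U" for M N
    using that by (auto intro!: M.finsum_closed)
  have mc: "M \<otimes>\<^bsub>?M\<^esub> N \<in> carrier ?M" if "M \<in> carrier ?M" "N \<in> carrier ?M" for M N
    using cl that by simp
  have ab: "abelian_group ?M"
  proof (rule abelian_groupI)
    fix M assume M: "M \<in> carrier ?M"
    show "\<exists>N\<in>carrier ?M. N \<oplus>\<^bsub>?M\<^esub> M = \<zero>\<^bsub>?M\<^esub>"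
    proof (rule bexI)
      show N: "(\<lambda>p\<in>matrix_index n. \<ominus> M p) \<in> carrier ?M" using M by auto
      show "(\<lambda>p\<in>matrix_index n. \<ominus> M p) \<oplus>\<^bsub>?M\<^esub> M = \<zero>\<^bsub>?M\<^esub>"
        using M by (intro matrix_eqI[of _ n U]) (auto simp: M.l_neg)
    qed
    show "\<zero>\<^bsub>?M\<^esub> \<oplus>\<^bsub>?M\<^esub> M = M"
      using M by (intro matrix_eqI[of _ n U]) auto
  next
    fix M N assume MN: "M \<in> carrier ?M" "N \<in> carrier ?M"
    show "M \<oplus>\<^bsub>?M\<^esub> N = N \<oplus>\<^bsub>?M\<^esub> M"
      using MN by (intro matrix_eqI[of _ n U]) (auto simp: M.a_comm)
    fix K assume K: "K \<in> carrier ?M"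
    show "M \<oplus>\<^bsub>?M\<^esub> N \<oplus>\<^bsub>?M\<^esub> K = M \<oplus>\<^bsub>?M\<^esub> (N \<oplus>\<^bsub>?M\<^esub> K)"
      using MN K by (intro matrix_eqI[of _ n U]) (auto simp: M.a_assoc)
  qed auto
  have "complex_algebra ?M"
  proof (rule complex_algebraI[OF ab])
    show "complex_algebra_axioms ?M"
    proof
      fix M N assume MN: "M \<in> carrier ?M" "N \<in> carrier ?M"
      show "M \<otimes>\<^bsub>?M\<^esub> N \<in> carrier ?M" using mc[OF MN] .
      show "c \<odot>\<^bsub>?M\<^esub> M \<otimes>\<^bsub>?M\<^esub> N = c \<odot>\<^bsub>?M\<^esub> (M \<otimes>\<^bsub>?M\<^esub> N)"
        "M \<otimes>\<^bsub>?M\<^esub> (c \<odot>\<^bsub>?M\<^esub> N) = c \<odot>\<^bsub>?M\<^esub> (M \<otimes>\<^bsub>?M\<^esub> N)" for c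
        using MN by (auto intro!: restrict_ext simp: finsum_sm smult_mult_left smult_mult_right
            cong: M.finsum_cong)
      fix K assume K: "K \<in> carrier ?M"
      show "(M \<oplus>\<^bsub>?M\<^esub> N) \<otimes>\<^bsub>?M\<^esub> K = M \<otimes>\<^bsub>?M\<^esub> K \<oplus>\<^bsub>?M\<^esub> N \<otimes>\<^bsub>?M\<^esub> K"
        "K \<otimes>\<^bsub>?M\<^esub> (M \<oplus>\<^bsub>?M\<^esub> N) = K \<otimes>\<^bsub>?M\<^esub> M \<oplus>\<^bsub>?M\<^esub> K \<otimes>\<^bsub>?M\<^esub> N"
        using MN K by (auto intro!: restrict_ext simp: M.finsum_addf distr_left distr_right
            cong: M.finsum_cong)
      show "M \<otimes>\<^bsub>?M\<^esub> N \<otimes>\<^bsub>?M\<^esub> K = M \<otimes>\<^bsub>?M\<^esub> (N \<otimes>\<^bsub>?M\<^esub> K)"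
      proof (rule matrix_eqI[of _ n U])
        show "M \<otimes>\<^bsub>?M\<^esub> N \<otimes>\<^bsub>?M\<^esub> K \<in> matrices n U" using mc[OF mc[OF MN] K] by (simp only: matrix_sel(1))
        show "M \<otimes>\<^bsub>?M\<^esub> (N \<otimes>\<^bsub>?M\<^esub> K) \<in> matrices n U" using mc[OF MN(1) mc[OF MN(2) K]] by (simp only: matrix_sel(1))
        fix i k assume ik: "i < n" "k < n"
        have "(\<Oplus>l\<in>{..<n}. (\<Oplus>j\<in>{..<n}. M (i, j) \<otimes> N (j, l)) \<otimes> K (l, k))
            = (\<Oplus>l\<in>{..<n}. \<Oplus>j\<in>{..<n}. M (i, j) \<otimes> N (j, l) \<otimes> K (l, k))"
          using MN K ik by (intro M.finsum_cong' refl) (auto simp: finsum_mult_right intro!: M.finsum_closed)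
        also have "\<dots> = (\<Oplus>j\<in>{..<n}. \<Oplus>l\<in>{..<n}. M (i, j) \<otimes> (N (j, l) \<otimes> K (l, k)))"
        \<comment> \<open>Inside a functional the two finite sums become sums of complex numbers,
          which may be interchanged.\<close>
        proof (rule eq_by_functionals)
          fix f assume f: "functional U f"
          show "f (\<Oplus>l\<in>{..<n}. \<Oplus>j\<in>{..<n}. M (i, j) \<otimes> N (j, l) \<otimes> K (l, k))
              = f (\<Oplus>j\<in>{..<n}. \<Oplus>l\<in>{..<n}. M (i, j) \<otimes> (N (j, l) \<otimes> K (l, k)))"
            using MN K ik by (simp add: functional_finsum[OF f] M.finsum_closed mult_assoc) (rule sum.swap)
        qed (use MN K ik in \<open>auto intro!: M.finsum_closed\<close>)
        also have "\<dots> = (\<Oplus>j\<in>{..<n}. M (i, j) \<otimes> (\<Oplus>l\<in>{..<n}. N (j, l) \<otimes> K (l, k)))"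
          using MN K ik by (intro M.finsum_cong' refl) (auto simp: finsum_mult_left intro!: M.finsum_closed)
        finally show "(M \<otimes>\<^bsub>?M\<^esub> N \<otimes>\<^bsub>?M\<^esub> K) (i, k) = (M \<otimes>\<^bsub>?M\<^esub> (N \<otimes>\<^bsub>?M\<^esub> K)) (i, k)"
          using ik MN K by (simp add: M.finsum_closed cong: M.finsum_cong)
      qed
    qed
    show "1 \<odot>\<^bsub>?M\<^esub> M = M" if "M \<in> carrier ?M" for M
      using that by (intro matrix_eqI[of _ n U]) auto
  qed (auto simp: sm_add_left sm_add_right sm_assoc[symmetric] intro!: restrict_ext)
  then show ?thesis
  proof (rule star_algebra.intro)
    show "star_algebra_axioms ?M"
    proof
      fix M N assume MN: "M \<in> carrier ?M" "N \<in> carrier ?M"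
      show "adj ?M (M \<otimes>\<^bsub>?M\<^esub> N) = adj ?M N \<otimes>\<^bsub>?M\<^esub> adj ?M M"
      proof (rule matrix_eqI)
        fix i j assume "i < n" "j < n"
        then show "adj ?M (M \<otimes>\<^bsub>?M\<^esub> N) (i, j) = (adj ?M N \<otimes>\<^bsub>?M\<^esub> adj ?M M) (i, j)"
          using MN by (simp add: adj_finsum adj_mult cong: M.finsum_cong)
      qed (use MN cl in \<open>auto intro!: M.finsum_closed\<close>)
      show "adj ?M (adj ?M M) = M"
        using MN by (intro matrix_eqI[of _ n U]) auto
    qed (auto simp: adj_add adj_smult intro!: restrict_ext)
  qed
qed

context star_algebra
begin

lemma matrix_linear:
  assumes p: "p \<in> matrix_index n"
  shows "M \<in> matrices n U \<Longrightarrow> N \<in> matrices n U \<Longrightarrow> (M \<ominus>\<^bsub>matrix_algebra n U\<^esub> N) p = M p \<ominus> N p"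
    and "finite I \<Longrightarrow> g \<in> I \<rightarrow> matrices n U \<Longrightarrow>
      (\<Oplus>\<^bsub>matrix_algebra n U\<^esub>i\<in>I. g i) p = (\<Oplus>i\<in>I. g i p)"
proof -
  interpret m: star_algebra "matrix_algebra n U" by (rule matrix_star_algebra)
  note lin = star_map_linear[OF m.complex_algebra_axioms complex_algebra_axioms, of "\<lambda>M. M p"]
  show "M \<in> matrices n U \<Longrightarrow> N \<in> matrices n U \<Longrightarrow> (M \<ominus>\<^bsub>matrix_algebra n U\<^esub> N) p = M p \<ominus> N p"
    by (rule lin(3)) (use p in auto)
  show "finite I \<Longrightarrow> g \<in> I \<rightarrow> matrices n U \<Longrightarrow>
      (\<Oplus>\<^bsub>matrix_algebra n U\<^esub>i\<in>I. g i) p = (\<Oplus>i\<in>I. g i p)"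
    by (rule lin(4)) (use p in auto)
qed

lemma finsum_delta:
  assumes "finite I" "i \<in> I" "g i \<in> carrier U" "\<And>j. j \<in> I \<Longrightarrow> j \<noteq> i \<Longrightarrow> g j = \<zero>"
  shows "(\<Oplus>j\<in>I. g j) = g i"
proof -
  have "(\<Oplus>j\<in>I. g j) = (\<Oplus>j\<in>I. if i = j then g j else \<zero>)"
    using assms by (intro M.finsum_cong') auto
  also have "\<dots> = g i"
    using assms by (intro M.finsum_singleton) (auto simp: Pi_iff, metis M.zero_closed)
  finally show ?thesis .
qed

text \<open>The algebra has no unit in general, so a matrix unit carries an element \<open>x\<close>
  in its one distinguished place.\<close>

definition matrix_unit :: "nat \<Rightarrow> nat \<Rightarrow> nat \<Rightarrow> 'a \<Rightarrow> nat \<times> nat \<Rightarrow> 'a" where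
  "matrix_unit n i j x = (\<lambda>p\<in>matrix_index n. if p = (i, j) then x else \<zero>)"

lemma matrix_unit_closed [simp]: "x \<in> carrier U \<Longrightarrow> matrix_unit n i j x \<in> matrices n U"
  by (auto simp: matrix_unit_def)

lemma matrix_unit_mult:
  assumes "x \<in> carrier U" "M \<in> matrices n U" "i < n" "j < n"
  shows "matrix_unit n i j x \<otimes>\<^bsub>matrix_algebra n U\<^esub> M
      = (\<lambda>(k, l)\<in>matrix_index n. if k = i then x \<otimes> M (j, l) else \<zero>)"
    and "M \<otimes>\<^bsub>matrix_algebra n U\<^esub> matrix_unit n i j x
      = (\<lambda>(k, l)\<in>matrix_index n. if l = j then M (k, i) \<otimes> x else \<zero>)"
proof -
  show "matrix_unit n i j x \<otimes>\<^bsub>matrix_algebra n U\<^esub> M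
      = (\<lambda>(k, l)\<in>matrix_index n. if k = i then x \<otimes> M (j, l) else \<zero>)"
    unfolding matrix_sel
  proof (rule restrict_ext, clarify)
    fix k l assume "k < n" "l < n"
    then show "(\<Oplus>m\<in>{..<n}. matrix_unit n i j x (k, m) \<otimes> M (m, l)) = (if k = i then x \<otimes> M (j, l) else \<zero>)"
      using assms by (subst finsum_delta[where i = j]) (auto simp: matrix_unit_def)
  qed
  show "M \<otimes>\<^bsub>matrix_algebra n U\<^esub> matrix_unit n i j x
      = (\<lambda>(k, l)\<in>matrix_index n. if l = j then M (k, i) \<otimes> x else \<zero>)"
    unfolding matrix_sel
  proof (rule restrict_ext, clarify)
    fix k l assume "k < n" "l < n"
    then show "(\<Oplus>m\<in>{..<n}. M (k, m) \<otimes> matrix_unit n i j x (m, l)) = (if l = j then M (k, i) \<otimes> x else \<zero>)"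
      using assms by (subst finsum_delta[where i = i]) (auto simp: matrix_unit_def)
  qed
qed

lemma matrix_unit_adj:
  "\<lbrakk>x \<in> carrier U; i < n; j < n\<rbrakk> \<Longrightarrow>
    adj (matrix_algebra n U) (matrix_unit n i j x) = matrix_unit n j i (adj U x)"
  by (auto simp: matrix_unit_def intro!: restrict_ext)

text \<open>The ampliation of \<open>x\<close>; multiplying by it acts on every entry separately.
  Applied to an approximate unit, it provides one for matrices.\<close>

definition diag :: "nat \<Rightarrow> 'a \<Rightarrow> nat \<times> nat \<Rightarrow> 'a" where
  "diag n x = (\<lambda>(i, j)\<in>matrix_index n. if i = j then x else \<zero>)"

lemma diag_closed [simp]: "x \<in> carrier U \<Longrightarrow> diag n x \<in> matrices n U"
  by (auto simp: diag_def)

lemma diag_mult: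
  assumes "x \<in> carrier U" "M \<in> matrices n U"
  shows "diag n x \<otimes>\<^bsub>matrix_algebra n U\<^esub> M = (\<lambda>p\<in>matrix_index n. x \<otimes> M p)"
    and "M \<otimes>\<^bsub>matrix_algebra n U\<^esub> diag n x = (\<lambda>p\<in>matrix_index n. M p \<otimes> x)"
proof -
  show "diag n x \<otimes>\<^bsub>matrix_algebra n U\<^esub> M = (\<lambda>p\<in>matrix_index n. x \<otimes> M p)"
    unfolding matrix_sel
  proof (rule restrict_ext, clarify)
    fix k l assume "k < n" "l < n"
    then show "(\<Oplus>m\<in>{..<n}. diag n x (k, m) \<otimes> M (m, l)) = x \<otimes> M (k, l)"
      using assms by (subst finsum_delta[where i = k]) (auto simp: diag_def)
  qed
  show "M \<otimes>\<^bsub>matrix_algebra n U\<^esub> diag n x = (\<lambda>p\<in>matrix_index n. M p \<otimes> x)"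
    unfolding matrix_sel
  proof (rule restrict_ext, clarify)
    fix k l assume "k < n" "l < n"
    then show "(\<Oplus>m\<in>{..<n}. M (k, m) \<otimes> diag n x (m, l)) = M (k, l) \<otimes> x"
      using assms by (subst finsum_delta[where i = l]) (auto simp: diag_def)
  qed
qed

lemma star_map_diag: "star_map U (matrix_algebra n U) (diag n)"
  unfolding star_map_def
proof (intro conjI ballI allI)
  fix x y assume "x \<in> carrier U" "y \<in> carrier U"
  then show "diag n (x \<otimes> y) = diag n x \<otimes>\<^bsub>matrix_algebra n U\<^esub> diag n y"
    by (subst diag_mult) (auto simp: diag_def intro!: restrict_ext)
qed (auto simp: diag_def intro!: restrict_ext)

end

lemma star_map_matrix:
  assumes V: "star_algebra V" and W: "star_algebra W" and \<phi>: "star_map V W \<phi>"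
  shows "star_map (matrix_algebra n V) (matrix_algebra n W) (compose (matrix_index n) \<phi>)"
proof -
  interpret V: star_algebra V by fact
  interpret W: star_algebra W by fact
  note \<phi> = star_mapD[OF \<phi>]
  note lin = star_map_linear[OF V.complex_algebra_axioms W.complex_algebra_axioms \<phi>(1,3,4), simplified]
  show ?thesis
    unfolding star_map_def
  proof (intro conjI ballI allI)
    fix M N assume "M \<in> carrier (matrix_algebra n V)" "N \<in> carrier (matrix_algebra n V)"
    then show "compose (matrix_index n) \<phi> (M \<otimes>\<^bsub>matrix_algebra n V\<^esub> N)
        = compose (matrix_index n) \<phi> M \<otimes>\<^bsub>matrix_algebra n W\<^esub> compose (matrix_index n) \<phi> N"
      by (auto simp: compose_def lin(4) \<phi> intro!: restrict_ext cong: W.M.finsum_cong)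
  qed (auto simp: compose_def \<phi> PiE_mem intro!: restrict_ext)
qed

lemma (in complete_cstar_norm) norm_mult3:
  assumes "x \<in> carrier U" "y \<in> carrier U" "z \<in> carrier U"
  shows "\<nu> (x \<otimes> y \<otimes> z) \<le> \<nu> x * \<nu> y * \<nu> z"
proof -
  have "\<nu> (x \<otimes> y \<otimes> z) \<le> \<nu> (x \<otimes> y) * \<nu> z" using assms by (intro norm_mult) auto
  also have "\<dots> \<le> \<nu> x * \<nu> y * \<nu> z" using assms by (intro mult_right_mono norm_mult) auto
  finally show ?thesis .
qed

text \<open>Every 1 by 1 matrix comes from an element, so the embedding of \<open>U\<close> into
  \<open>M_1(U)\<close> has full, hence closed, range.\<close>

lemma elt_norm_complete:
  assumes "cstar_algebra U"
  shows "complete_cstar_norm U (elt_norm U)"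
proof -
  have s: "star_algebra U" and c: "complete_cstar_norm (matrix_algebra 1 U) (mnorm U 1)"
    using assms by (auto simp: cstar_algebra_def)
  interpret star_algebra U by (rule s)
  have idx: "matrix_index 1 = {(0, 0)}" by auto
  have L: "star_map U (matrix_algebra 1 U) (\<lambda>x. \<lambda>p\<in>matrix_index 1. x)"
    by (auto simp: star_map_def matrix_algebra_def M.finsum_insert lessThan_Suc intro!: restrict_ext)
  have "complete_cstar_norm U (\<lambda>x. mnorm U 1 (\<lambda>p\<in>matrix_index 1. x))"
  proof (rule complete_cstar_norm_pullback[OF s c L])
    show "inj_on (\<lambda>x. \<lambda>p\<in>matrix_index 1. x) (carrier U)"
      by (rule inj_onI) (metis idx restrict_apply' singletonI)
    have "M \<in> (\<lambda>x. \<lambda>p\<in>matrix_index 1. x) ` carrier U" if "M \<in> matrices 1 U" for M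
      using that by (intro image_eqI[of _ _ "M (0, 0)"] matrix_eqI[of _ 1 U]) auto
    then show "seq_closed (matrix_algebra 1 U) (mnorm U 1) ((\<lambda>x. \<lambda>p\<in>matrix_index 1. x) ` carrier U)"
      unfolding seq_closed_def conv_def matrix_sel by blast
  qed
  then show ?thesis by (simp add: elt_norm_def[abs_def])
qed

locale cstar_alg =
  fixes U :: "('a, 'm) matrix_normed_alg_scheme" (structure)
  assumes cstar: "cstar_algebra U"

sublocale cstar_alg \<subseteq> complete_cstar_norm U "elt_norm U"
  by (rule elt_norm_complete[OF cstar])

section \<open>Matrix norms compared with the norms of the entries\<close>

context cstar_alg
begin

lemma matrix_complete: "n \<ge> 1 \<Longrightarrow> complete_cstar_norm (matrix_algebra n U) (mnorm U n)"
  using cstar by (auto simp: cstar_algebra_def)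

text \<open>An injective *-homomorphism is isometric once its range is closed. Continuity of single
  entries is not yet known, so closedness is shown by multiplication: a matrix unit carrying
  \<open>z\<close> at another diagonal place annihilates the sequence from the left or from the
  right, hence also its limit. As \<open>z\<close> is arbitrary, the entries of the limit off
  \<open>(j, j)\<close> vanish.\<close>

lemma matrix_unit_diag_isometric:
  assumes j: "j < n" and x: "x \<in> carrier U"
  shows "mnorm U n (matrix_unit n j j x) = elt_norm U x"
proof -
  interpret m: complete_cstar_norm "matrix_algebra n U" "mnorm U n"
    using j by (intro matrix_complete) simp
  have map: "star_map U (matrix_algebra n U) (matrix_unit n j j)"
    unfolding star_map_def
  proof (intro conjI ballI allI)
    fix x y assume "x \<in> carrier U" "y \<in> carrier U"
    then show "matrix_unit n j j (x \<otimes> y) = matrix_unit n j j x \<otimes>\<^bsub>matrix_algebra n U\<^esub> matrix_unit n j j y"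
      using j by (subst matrix_unit_mult) (auto simp: matrix_unit_def intro!: restrict_ext)
  qed (auto simp: matrix_unit_def intro!: restrict_ext)
  have "seq_closed (matrix_algebra n U) (mnorm U n) (matrix_unit n j j ` carrier U)"
    unfolding seq_closed_def
  proof (intro allI impI, elim conjE)
    fix \<xi> Y assume \<xi>: "\<forall>k. \<xi> k \<in> matrix_unit n j j ` carrier U"
      and lim: "conv (matrix_algebra n U) (mnorm U n) sequentially \<xi> Y"
    have Y: "Y \<in> matrices n U" using m.convD(1)[OF lim] by simp
    have z0: "(\<lambda>p\<in>matrix_index n. \<zero>) = \<zero>\<^bsub>matrix_algebra n U\<^esub>" by simp
    have row: "z \<otimes> Y (i, l) = \<zero>" if "i < n" "l < n" "i \<noteq> j" "z \<in> carrier U" for i l z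
    proof -
      let ?E = "matrix_unit n i i z"
      have 1: "?E \<otimes>\<^bsub>matrix_algebra n U\<^esub> \<xi> k = \<zero>\<^bsub>matrix_algebra n U\<^esub>" for k
      proof -
        obtain x where "x \<in> carrier U" "\<xi> k = matrix_unit n j j x" using \<xi> by blast
        then show ?thesis using that j
          by (subst matrix_unit_mult(1)) (auto simp: matrix_unit_def intro!: restrict_ext)
      qed
      have "conv (matrix_algebra n U) (mnorm U n) sequentially (\<lambda>k. ?E \<otimes>\<^bsub>matrix_algebra n U\<^esub> \<xi> k) (?E \<otimes>\<^bsub>matrix_algebra n U\<^esub> Y)"
        by (rule m.conv_mult_left[OF lim]) (use that in \<open>simp del: matrices_iff\<close>)
      then have "?E \<otimes>\<^bsub>matrix_algebra n U\<^esub> Y = \<zero>\<^bsub>matrix_algebra n U\<^esub>"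
        unfolding 1 using m.conv_unique[OF _ m.conv_const[OF m.M.zero_closed] sequentially_bot] by blast
      then have "(?E \<otimes>\<^bsub>matrix_algebra n U\<^esub> Y) (i, l) = \<zero>" using that by simp
      then show ?thesis using that Y by (subst (asm) matrix_unit_mult(1)) auto
    qed
    have col: "Y (i, l) \<otimes> z = \<zero>" if "i < n" "l < n" "l \<noteq> j" "z \<in> carrier U" for i l z
    proof -
      let ?E = "matrix_unit n l l z"
      have 1: "\<xi> k \<otimes>\<^bsub>matrix_algebra n U\<^esub> ?E = \<zero>\<^bsub>matrix_algebra n U\<^esub>" for k
      proof -
        obtain x where "x \<in> carrier U" "\<xi> k = matrix_unit n j j x" using \<xi> by blast
        then show ?thesis using that j
          by (subst matrix_unit_mult(2)) (auto simp: matrix_unit_def intro!: restrict_ext)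
      qed
      have "conv (matrix_algebra n U) (mnorm U n) sequentially (\<lambda>k. \<xi> k \<otimes>\<^bsub>matrix_algebra n U\<^esub> ?E) (Y \<otimes>\<^bsub>matrix_algebra n U\<^esub> ?E)"
        by (rule m.conv_mult_right[OF lim]) (use that in \<open>simp del: matrices_iff\<close>)
      then have "Y \<otimes>\<^bsub>matrix_algebra n U\<^esub> ?E = \<zero>\<^bsub>matrix_algebra n U\<^esub>"
        unfolding 1 using m.conv_unique[OF _ m.conv_const[OF m.M.zero_closed] sequentially_bot] by blast
      then have "(Y \<otimes>\<^bsub>matrix_algebra n U\<^esub> ?E) (i, l) = \<zero>" using that by simp
      then show ?thesis using that Y by (subst (asm) matrix_unit_mult(2)) auto
    qed
    have "Y (i, l) = \<zero>" if "i < n" "l < n" "(i, l) \<noteq> (j, j)" for i l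
    proof (cases "i = j")
      case True
      have "adj U (Y (i, l)) = \<zero>"
      proof (rule mult_eq_zeroI)
        fix z assume "z \<in> carrier U"
        then show "z \<otimes> adj U (Y (i, l)) = \<zero>"
          using col[of i l "adj U z"] that True Y adj_mult[of "Y (i, l)" "adj U z"] by auto
      qed (use that Y in auto)
      then show ?thesis using adj_adj[of "Y (i, l)"] that Y by auto
    next
      case False
      then show ?thesis
        using that row[of i l] Y by (intro mult_eq_zeroI[of "Y (i, l)"]) auto
    qed
    then have "Y = matrix_unit n j j (Y (j, j))"
      using Y j by (intro matrix_eqI[of _ n U]) (auto simp: matrix_unit_def)
    then show "Y \<in> matrix_unit n j j ` carrier U" using Y j by (intro image_eqI) auto
  qed
  moreover have "inj_on (matrix_unit n j j) (carrier U)"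
  proof (rule inj_onI)
    fix x y assume "matrix_unit n j j x = matrix_unit n j j y"
    from fun_cong[OF this, of "(j, j)"] show "x = y" using j by (simp add: matrix_unit_def)
  qed
  ultimately show ?thesis
    by (rule isometric_of_closed_range[OF elt_norm_complete[OF cstar] m.complete_cstar_norm_axioms map _ _ x, rotated])
qed

text \<open>Multiplying this matrix from the left by its adjoint gives the diagonal matrix unit with
  entry \<open>adj(x) x\<close>, so the C*-identity reduces the claim to the diagonal case.\<close>

lemma matrix_unit_isometric:
  assumes i: "i < n" and j: "j < n" and x: "x \<in> carrier U"
  shows "mnorm U n (matrix_unit n i j x) = elt_norm U x"
proof -
  interpret m: complete_cstar_norm "matrix_algebra n U" "mnorm U n"
    using j by (intro matrix_complete) simp
  have c: "matrix_unit n i j x \<in> carrier (matrix_algebra n U)" using x by (simp del: matrices_iff)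
  have "adj (matrix_algebra n U) (matrix_unit n i j x) \<otimes>\<^bsub>matrix_algebra n U\<^esub> matrix_unit n i j x
      = matrix_unit n j j (adj U x \<otimes> x)"
    using assms matrix_unit_closed[OF x, of n i j]
    by (subst matrix_unit_adj, simp_all only: matrix_unit_mult adj_closed)
      (auto simp: matrix_unit_def intro!: restrict_ext)
  then have "(mnorm U n (matrix_unit n i j x))\<^sup>2 = (elt_norm U x)\<^sup>2"
    using m.cstar_identity[OF c] cstar_identity[OF x] x j
    by (simp add: matrix_unit_diag_isometric)
  then show ?thesis using m.norm_nonneg[OF c] norm_nonneg[OF x] by (simp add: power2_eq_iff_nonneg)
qed

text \<open>Without a unit, the entry \<open>x\<close> is cut out by multiplying on both sides with
  matrix units that carry \<open>adj x\<close>, which produces \<open>adj(x) x adj(x)\<close> at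
  \<open>(i, j)\<close>. As the norm of \<open>adj(x) x adj(x) x\<close> is the fourth power of that
  of \<open>x\<close>, the surplus factors can be divided out.\<close>

lemma norm_entry_le:
  assumes M: "M \<in> matrices n U" and ij: "i < n" "j < n"
  shows "elt_norm U (M (i, j)) \<le> mnorm U n M"
proof -
  let ?A = "matrix_algebra n U" and ?x = "M (i, j)" and ?\<nu> = "elt_norm U"
  interpret m: complete_cstar_norm ?A "mnorm U n"
    using ij by (intro matrix_complete) simp
  have x: "?x \<in> carrier U" using M ij by auto
  let ?l = "matrix_unit n i i (adj U ?x)" and ?r = "matrix_unit n j j (adj U ?x)"
  have lr: "?l \<in> matrices n U" "?r \<in> matrices n U" using x matrix_unit_closed adj_closed by blast+
  have lM: "?l \<otimes>\<^bsub>?A\<^esub> M \<in> matrices n U" using m.mult_closed[of ?l M] lr M by (simp only: matrix_sel(1))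
  have "?l \<otimes>\<^bsub>?A\<^esub> M \<otimes>\<^bsub>?A\<^esub> ?r = matrix_unit n i j (adj U ?x \<otimes> ?x \<otimes> adj U ?x)"
    using ij x M by (subst matrix_unit_mult(2)[OF _ lM], simp_all only: matrix_unit_mult adj_closed)
      (auto simp: matrix_unit_def intro!: restrict_ext)
  then have "?\<nu> (adj U ?x \<otimes> ?x \<otimes> adj U ?x) = mnorm U n (?l \<otimes>\<^bsub>?A\<^esub> M \<otimes>\<^bsub>?A\<^esub> ?r)"
    using x ij by (simp add: matrix_unit_isometric)
  also have "\<dots> \<le> mnorm U n ?l * mnorm U n M * mnorm U n ?r"
    using m.norm_mult3[of ?l M ?r] lr M by (simp only: matrix_sel(1))
  also have "\<dots> = (?\<nu> ?x)\<^sup>2 * mnorm U n M"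
    using x ij by (simp add: matrix_unit_isometric power2_eq_square)
  finally have 1: "?\<nu> (adj U ?x \<otimes> ?x \<otimes> adj U ?x) \<le> (?\<nu> ?x)\<^sup>2 * mnorm U n M" .
  have "(?\<nu> (adj U ?x \<otimes> ?x))\<^sup>2 = ?\<nu> (adj U ?x \<otimes> ?x \<otimes> adj U ?x \<otimes> ?x)"
    using cstar_identity[of "adj U ?x \<otimes> ?x"] x by (simp add: adj_mult mult_assoc)
  also have "\<dots> \<le> ?\<nu> (adj U ?x \<otimes> ?x \<otimes> adj U ?x) * ?\<nu> ?x" using x by (intro norm_mult) auto
  also have "\<dots> \<le> (?\<nu> ?x)\<^sup>2 * mnorm U n M * ?\<nu> ?x" using 1 x by (intro mult_right_mono) auto
  finally have "(?\<nu> ?x)\<^sup>2 * (?\<nu> ?x)\<^sup>2 \<le> (?\<nu> ?x)\<^sup>2 * (mnorm U n M * ?\<nu> ?x)"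
    using x by (simp add: cstar_identity power2_eq_square mult.assoc)
  moreover have "mnorm U n M \<ge> 0" using m.norm_nonneg[of M] M by (simp only: matrix_sel(1))
  moreover have "?\<nu> ?x \<ge> 0" using x by simp
  ultimately show ?thesis
    using mult_le_cancel_left_pos[of "(?\<nu> ?x)\<^sup>2"] mult_le_cancel_right_pos[of "?\<nu> ?x" "?\<nu> ?x"]
    by (cases "?\<nu> ?x = 0") (simp_all add: power2_eq_square)
qed

lemma norm_le_entries:
  assumes M: "M \<in> matrices n U" and n: "n \<ge> 1"
  shows "mnorm U n M \<le> (\<Sum>p\<in>matrix_index n. elt_norm U (M p))"
proof -
  let ?A = "matrix_algebra n U"
  interpret m: complete_cstar_norm ?A "mnorm U n" using n by (rule matrix_complete)
  let ?e = "\<lambda>p. matrix_unit n (fst p) (snd p) (M p)"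
  have cl: "?e \<in> matrix_index n \<rightarrow> matrices n U" using M by (auto simp del: matrices_iff intro!: matrix_unit_closed)
  have "M = (\<Oplus>\<^bsub>?A\<^esub>p\<in>matrix_index n. ?e p)"
  proof (rule matrix_eqI[OF M])
    show "(\<Oplus>\<^bsub>?A\<^esub>p\<in>matrix_index n. ?e p) \<in> matrices n U"
      using m.M.finsum_closed[of ?e "matrix_index n"] cl by (simp only: matrix_sel(1))
    fix i j assume ij: "i < n" "j < n"
    then have "(\<Oplus>\<^bsub>?A\<^esub>p\<in>matrix_index n. ?e p) (i, j) = (\<Oplus>p\<in>matrix_index n. ?e p (i, j))"
      using cl by (intro matrix_linear(2)) auto
    also have "\<dots> = ?e (i, j) (i, j)"
      using ij M by (intro finsum_delta) (auto simp: matrix_unit_def)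
    finally show "M (i, j) = (\<Oplus>\<^bsub>?A\<^esub>p\<in>matrix_index n. ?e p) (i, j)"
      using ij by (simp add: matrix_unit_def)
  qed
  then have "mnorm U n M = mnorm U n (\<Oplus>\<^bsub>?A\<^esub>p\<in>matrix_index n. ?e p)" by (rule arg_cong)
  also have "\<dots> \<le> (\<Sum>p\<in>matrix_index n. mnorm U n (?e p))"
    using cl by (intro m.norm_finsum) (auto simp del: matrices_iff)
  also have "\<dots> = (\<Sum>p\<in>matrix_index n. elt_norm U (M p))"
    using M by (intro sum.cong refl) (auto simp: matrix_unit_isometric)
  finally show ?thesis .
qed

text \<open>Combines the two preceding bounds. From here on, closedness of a set of matrices is
  checked entry by entry.\<close>

lemma conv_matrix_iff:
  assumes n: "n \<ge> 1"
  shows "conv (matrix_algebra n U) (mnorm U n) F f M \<longleftrightarrow> M \<in> matrices n U \<and>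
    (\<forall>\<^sub>F t in F. f t \<in> matrices n U) \<and> (\<forall>i<n. \<forall>j<n. conv U (elt_norm U) F (\<lambda>t. f t (i, j)) (M (i, j)))"
    (is "?l \<longleftrightarrow> ?r")
proof
  interpret m: complete_cstar_norm "matrix_algebra n U" "mnorm U n" using n by (rule matrix_complete)
  {
    assume l: ?l
    note D = m.convD[OF l, unfolded matrix_sel]
    have "conv U (elt_norm U) F (\<lambda>t. f t (i, j)) (M (i, j))" if ij: "i < n" "j < n" for i j
    proof (rule convI_bound[OF _ _ D(3)])
      show "\<forall>\<^sub>F t in F. f t (i, j) \<in> carrier U \<and>
          elt_norm U (f t (i, j) \<ominus> M (i, j)) \<le> mnorm U n (f t \<ominus>\<^bsub>matrix_algebra n U\<^esub> M)"
        using D(2)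
      proof eventually_elim
        case (elim t)
        have "f t \<ominus>\<^bsub>matrix_algebra n U\<^esub> M \<in> matrices n U"
          using m.M.minus_closed[of "f t" M] elim D(1) by (simp only: matrix_sel(1))
        from norm_entry_le[OF this ij] show ?case
          using matrix_linear(1)[of "(i, j)" n "f t" M] elim D(1) ij by auto
      qed
    qed (use D ij in auto)
    then show ?r using D by (auto simp del: matrices_iff)
  }
  assume r: ?r
  then have M: "M \<in> matrices n U" and f: "\<forall>\<^sub>F t in F. f t \<in> matrices n U" by blast+
  show ?l
  proof (rule m.convI_bound)
    have "((\<lambda>t. \<Sum>p\<in>matrix_index n. elt_norm U (f t p \<ominus> M p)) \<longlongrightarrow> (\<Sum>p\<in>matrix_index n. 0)) F"
      using r by (intro tendsto_sum) (auto simp: conv_def)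
    then show "((\<lambda>t. \<Sum>p\<in>matrix_index n. elt_norm U (f t p \<ominus> M p)) \<longlongrightarrow> 0) F" by simp
    show "\<forall>\<^sub>F t in F. f t \<in> carrier (matrix_algebra n U) \<and>
        mnorm U n (f t \<ominus>\<^bsub>matrix_algebra n U\<^esub> M) \<le> (\<Sum>p\<in>matrix_index n. elt_norm U (f t p \<ominus> M p))"
      using f
    proof eventually_elim
      case (elim t)
      have "f t \<ominus>\<^bsub>matrix_algebra n U\<^esub> M \<in> matrices n U"
        using m.M.minus_closed[of "f t" M] elim M by (simp only: matrix_sel(1))
      from norm_le_entries[OF this n] show ?case
        using matrix_linear(1)[OF _ elim M] elim by (simp del: matrices_iff)
    qed
  qed (use M in \<open>simp only: matrix_sel\<close>)
qed

lemma norm_diag_le: "n \<ge> 1 \<Longrightarrow> x \<in> carrier U \<Longrightarrow> mnorm U n (diag n x) \<le> elt_norm U x"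
  using star_map_contractive[OF elt_norm_complete[OF cstar] matrix_complete star_map_diag] by blast

end

subsection \<open>Domination of a column by its first entry\<close>

lemma (in complex_algebra) finsum_subset:
  assumes "finite I" "J \<subseteq> I" "g \<in> I \<rightarrow> carrier U" "\<And>i. i \<in> I - J \<Longrightarrow> g i = \<zero>"
  shows "(\<Oplus>i\<in>I. g i) = (\<Oplus>i\<in>J. g i)"
proof (rule eq_by_functionals)
  fix f assume f: "functional U f"
  have J: "finite J" "g \<in> J \<rightarrow> carrier U" using assms finite_subset by auto
  show "f (\<Oplus>i\<in>I. g i) = f (\<Oplus>i\<in>J. g i)"
    using assms J by (simp add: functional_finsum[OF f] functionalD(3)[OF f] sum.mono_neutral_right)
next
  show "(\<Oplus>i\<in>I. g i) \<in> carrier U" using assms by (auto intro!: M.finsum_closed)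
  show "(\<Oplus>i\<in>J. g i) \<in> carrier U" using assms by (auto intro!: M.finsum_closed)
qed

text \<open>Row \<open>l\<close> of a stack of \<open>r\<close> blocks of height \<open>n\<close> is
  row \<open>l mod n\<close> of block \<open>l div n\<close>; this is the corresponding change of
  index in a sum.\<close>

lemma sum_div_mod:
  fixes h :: "nat \<Rightarrow> nat \<Rightarrow> 'b::comm_monoid_add"
  shows "(\<Sum>l<r * n. h (l div n) (l mod n)) = (\<Sum>b<r. \<Sum>m<n. h b m)"
proof -
  have "(\<Sum>l<r * n. h (l div n) (l mod n)) = (\<Sum>b<r. \<Sum>l\<in>{b * n..<b * n + n}. h (l div n) (l mod n))"
    by (rule sum.nat_group[symmetric])
  also have "\<dots> = (\<Sum>b<r. \<Sum>m<n. h b m)"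
  proof (rule sum.cong[OF refl])
    fix b
    show "(\<Sum>l\<in>{b * n..<b * n + n}. h (l div n) (l mod n)) = (\<Sum>m<n. h b m)"
      by (subst sum.atLeastLessThan_shift_0) (simp add: atLeast0LessThan)
  qed
  finally show ?thesis .
qed

context star_algebra
begin

definition corner :: "nat \<Rightarrow> nat \<Rightarrow> (nat \<times> nat \<Rightarrow> 'a) \<Rightarrow> nat \<times> nat \<Rightarrow> 'a" where
  "corner n N M = (\<lambda>p\<in>matrix_index N. if p \<in> matrix_index n then M p else \<zero>)"

lemma corner_apply: "i < N \<Longrightarrow> j < N \<Longrightarrow> corner n N M (i, j) = (if i < n \<and> j < n then M (i, j) else \<zero>)"
  by (simp add: corner_def)

lemma corner_closed: "M \<in> matrices n U \<Longrightarrow> corner n N M \<in> matrices N U"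
  by (auto simp: corner_def)

lemma star_map_corner:
  assumes "n \<le> N"
  shows "star_map (matrix_algebra n U) (matrix_algebra N U) (corner n N)"
  unfolding star_map_def
proof (intro conjI ballI allI)
  interpret m: star_algebra "matrix_algebra n U" by (rule matrix_star_algebra)
  interpret m': star_algebra "matrix_algebra N U" by (rule matrix_star_algebra)
  fix M K assume MK: "M \<in> carrier (matrix_algebra n U)" "K \<in> carrier (matrix_algebra n U)"
  show "corner n N (M \<otimes>\<^bsub>matrix_algebra n U\<^esub> K)
      = corner n N M \<otimes>\<^bsub>matrix_algebra N U\<^esub> corner n N K"
  proof (rule matrix_eqI[of _ N U])
    show "corner n N (M \<otimes>\<^bsub>matrix_algebra n U\<^esub> K) \<in> matrices N U"
      using m.mult_closed[OF MK] by (intro corner_closed) (simp only: matrix_sel(1))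
    show "corner n N M \<otimes>\<^bsub>matrix_algebra N U\<^esub> corner n N K \<in> matrices N U"
      using m'.mult_closed[of "corner n N M" "corner n N K"] MK corner_closed by (simp only: matrix_sel(1))
    fix i k assume ik: "i < N" "k < N"
    have "(\<Oplus>j\<in>{..<N}. corner n N M (i, j) \<otimes> corner n N K (j, k))
        = (\<Oplus>j\<in>{..<n}. corner n N M (i, j) \<otimes> corner n N K (j, k))"
      using assms ik MK by (intro finsum_subset) (auto simp: corner_apply)
    also have "\<dots> = (if i < n \<and> k < n then \<Oplus>j\<in>{..<n}. M (i, j) \<otimes> K (j, k) else \<zero>)"
      using assms ik MK by (auto simp: corner_apply cong: M.finsum_cong)
    finally show "corner n N (M \<otimes>\<^bsub>matrix_algebra n U\<^esub> K) (i, k)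
        = (corner n N M \<otimes>\<^bsub>matrix_algebra N U\<^esub> corner n N K) (i, k)"
      using ik by (simp add: corner_apply)
  qed
qed (use assms in \<open>auto simp: corner_def intro!: restrict_ext\<close>)

end

context cstar_alg
begin

text \<open>The range consists of the matrices that vanish outside the corner, a condition on
  entries which is preserved by limits.\<close>

lemma corner_isometric:
  assumes n: "1 \<le> n" "n \<le> N" and M: "M \<in> matrices n U"
  shows "mnorm U N (corner n N M) = mnorm U n M"
proof (rule isometric_of_closed_range[OF matrix_complete matrix_complete star_map_corner])
  show "inj_on (corner n N) (carrier (matrix_algebra n U))"
  proof (rule inj_onI)
    fix M K assume "M \<in> carrier (matrix_algebra n U)" "K \<in> carrier (matrix_algebra n U)"
      and eq: "corner n N M = corner n N K"
    moreover have "M (i, j) = K (i, j)" if "i < n" "j < n" for i j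
      using fun_cong[OF eq, of "(i, j)"] that n by (simp add: corner_def)
    ultimately show "M = K" by (intro matrix_eqI[of _ n U]) auto
  qed
  show "seq_closed (matrix_algebra N U) (mnorm U N) (corner n N ` carrier (matrix_algebra n U))"
    unfolding seq_closed_def
  proof (intro allI impI, elim conjE)
    fix \<xi> Y assume \<xi>: "\<forall>k. \<xi> k \<in> corner n N ` carrier (matrix_algebra n U)"
      and lim: "conv (matrix_algebra N U) (mnorm U N) sequentially \<xi> Y"
    have Y: "Y \<in> matrices N U" and
      ent: "\<And>i j. i < N \<Longrightarrow> j < N \<Longrightarrow> conv U (elt_norm U) sequentially (\<lambda>k. \<xi> k (i, j)) (Y (i, j))"
      using lim n unfolding conv_matrix_iff[OF order_trans[OF n]] by blast+
    have "Y (i, j) = \<zero>" if ij: "i < N" "j < N" "\<not> (i < n \<and> j < n)" for i j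
    proof -
      have "\<xi> k (i, j) = \<zero>" for k
      proof -
        obtain M where "\<xi> k = corner n N M" using \<xi> by blast
        then show ?thesis using ij by (auto simp: corner_apply)
      qed
      then show ?thesis
        using ent[OF ij(1,2)] conv_unique[OF _ conv_const[OF M.zero_closed] sequentially_bot] by simp
    qed
    then have "Y = corner n N (\<lambda>p\<in>matrix_index n. Y p)"
      using Y n by (intro matrix_eqI[of _ N U]) (auto simp: corner_def)
    moreover have "(\<lambda>p\<in>matrix_index n. Y p) \<in> carrier (matrix_algebra n U)"
      using Y n by auto
    ultimately show "Y \<in> corner n N ` carrier (matrix_algebra n U)" by blast
  qed
qed (use n M in \<open>simp_all del: matrices_iff\<close>)

text \<open>Stack the \<open>S b\<close> into the first \<open>n\<close> columns of a square matrix
  \<open>Z\<close> of size \<open>r * n\<close>. Then \<open>adj(Z) Z\<close> is the sum on the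
  right, placed in a corner, so the norm of that sum is the square of the norm of \<open>Z\<close>.
  Multiplying \<open>Z\<close> by the padded adjoint of \<open>S 0\<close> returns
  \<open>adj(S 0) S 0\<close>, hence the norm of \<open>S 0\<close> is at most that of
  \<open>Z\<close>. This replaces arguments with the order on positive elements.\<close>

lemma column_norm_le:
  assumes n: "1 \<le> n" and r: "1 \<le> r" and S: "\<And>b::nat. b < r \<Longrightarrow> S b \<in> matrices n U"
  shows "(mnorm U n (S 0))\<^sup>2 \<le> mnorm U n (\<Oplus>\<^bsub>matrix_algebra n U\<^esub>b\<in>{..<r}.
    adj (matrix_algebra n U) (S b) \<otimes>\<^bsub>matrix_algebra n U\<^esub> S b)"
proof -
  let ?N = "r * n" and ?A = "matrix_algebra n U"
  let ?B = "matrix_algebra ?N U"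
  let ?T = "\<Oplus>\<^bsub>?A\<^esub>b\<in>{..<r}. adj ?A (S b) \<otimes>\<^bsub>?A\<^esub> S b"
  interpret a: complete_cstar_norm ?A "mnorm U n" using n by (rule matrix_complete)
  have nN: "n \<le> ?N" using r by simp
  interpret b: complete_cstar_norm ?B "mnorm U ?N" using n nN by (intro matrix_complete) simp
  have Sb: "S b (i, j) \<in> carrier U" if "b < r" "i < n" "j < n" for b i j using S[OF that(1)] that by auto
  define Z where "Z = (\<lambda>(i, j)\<in>matrix_index ?N. if j < n then S (i div n) (i mod n, j) else \<zero>)"
  have dm: "i div n < r" "i mod n < n" if "i < ?N" for i
    using that n by (auto simp: less_mult_imp_div_less)
  have Zap: "Z (i, j) = (if j < n then S (i div n) (i mod n, j) else \<zero>)" if "i < ?N" "j < ?N" for i j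
    using that by (simp add: Z_def)
  have Zent: "Z (i, j) \<in> carrier U" if "i < ?N" "j < ?N" for i j
    using that Sb dm by (simp add: Zap)
  then have Z: "Z \<in> carrier ?B" by (auto simp: Z_def)
  have SS: "(\<lambda>b. adj ?A (S b) \<otimes>\<^bsub>?A\<^esub> S b) \<in> {..<r} \<rightarrow> carrier ?A"
  proof
    fix b assume "b \<in> {..<r}"
    then have "S b \<in> carrier ?A" using S by (simp only: matrix_sel(1) lessThan_iff)
    then show "adj ?A (S b) \<otimes>\<^bsub>?A\<^esub> S b \<in> carrier ?A" by (intro a.mult_closed a.adj_closed)
  qed
  have T: "?T \<in> carrier ?A" using SS by (rule a.M.finsum_closed)
  have "adj ?B Z \<otimes>\<^bsub>?B\<^esub> Z = corner n ?N ?T"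
  proof (rule matrix_eqI[of _ ?N U])
    show "adj ?B Z \<otimes>\<^bsub>?B\<^esub> Z \<in> matrices ?N U" using b.mult_closed[OF b.adj_closed[OF Z] Z] by (simp only: matrix_sel(1))
    show "corner n ?N ?T \<in> matrices ?N U" using T by (intro corner_closed) (simp only: matrix_sel(1))
    fix i j assume ij: "i < ?N" "j < ?N"
    have L: "(adj ?B Z \<otimes>\<^bsub>?B\<^esub> Z) (i, j) = (\<Oplus>l\<in>{..<?N}. adj U (Z (l, i)) \<otimes> Z (l, j))"
      using ij Zent by (simp cong: M.finsum_cong)
    show "(adj ?B Z \<otimes>\<^bsub>?B\<^esub> Z) (i, j) = corner n ?N ?T (i, j)"
    proof (cases "i < n \<and> j < n")
      case True
      have Tij: "?T (i, j) = (\<Oplus>b\<in>{..<r}. \<Oplus>m\<in>{..<n}. adj U (S b (m, i)) \<otimes> S b (m, j))"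
      proof -
        have "?T (i, j) = (\<Oplus>b\<in>{..<r}. (adj ?A (S b) \<otimes>\<^bsub>?A\<^esub> S b) (i, j))"
          using SS True by (intro matrix_linear(2)) (auto simp del: matrix_sel simp: matrix_sel(1)[symmetric] intro: funcset_mem)
        also have "\<dots> = (\<Oplus>b\<in>{..<r}. \<Oplus>m\<in>{..<n}. adj U (S b (m, i)) \<otimes> S b (m, j))"
          using True Sb by (intro M.finsum_cong') (auto intro!: M.finsum_closed cong: M.finsum_cong)
        finally show ?thesis .
      qed
      have "(\<Oplus>l\<in>{..<?N}. adj U (Z (l, i)) \<otimes> Z (l, j)) = ?T (i, j)"
      proof (rule eq_by_functionals)
        fix f assume f: "functional U f"
        have "f (\<Oplus>l\<in>{..<?N}. adj U (Z (l, i)) \<otimes> Z (l, j)) = (\<Sum>l<?N. f (adj U (Z (l, i)) \<otimes> Z (l, j)))"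
          using ij Zent by (intro functional_finsum[OF f]) auto
        also have "\<dots> = (\<Sum>l<?N. f (adj U (S (l div n) (l mod n, i)) \<otimes> S (l div n) (l mod n, j)))"
          using True ij by (intro sum.cong) (auto simp: Zap)
        also have "\<dots> = (\<Sum>b<r. \<Sum>m<n. f (adj U (S b (m, i)) \<otimes> S b (m, j)))"
          by (rule sum_div_mod)
        also have "\<dots> = (\<Sum>b<r. f (\<Oplus>m\<in>{..<n}. adj U (S b (m, i)) \<otimes> S b (m, j)))"
          using True Sb by (intro sum.cong refl functional_finsum[OF f, symmetric]) auto
        also have "\<dots> = f (?T (i, j))"
          unfolding Tij using True Sb
          by (intro functional_finsum[OF f, symmetric]) (auto intro!: M.finsum_closed)
        finally show "f (\<Oplus>l\<in>{..<?N}. adj U (Z (l, i)) \<otimes> Z (l, j)) = f (?T (i, j))" .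
      next
        show "(\<Oplus>l\<in>{..<?N}. adj U (Z (l, i)) \<otimes> Z (l, j)) \<in> carrier U"
          using ij Zent by (auto intro!: M.finsum_closed)
        show "?T (i, j) \<in> carrier U" using T True by (simp only: matrix_sel(1) matrices_iff)
      qed
      then show ?thesis using L True ij by (simp only: corner_apply) simp
    next
      case False
      have "(\<Oplus>l\<in>{..<?N}. adj U (Z (l, i)) \<otimes> Z (l, j)) = (\<Oplus>l\<in>{..<?N}. \<zero>)"
        using ij False Zent by (intro M.finsum_cong') (auto simp: Zap dm Sb)
      then show ?thesis using L False ij by (simp only: corner_apply) simp
    qed
  qed
  then have "(mnorm U ?N Z)\<^sup>2 = mnorm U n ?T"
    using b.cstar_identity[OF Z] T corner_isometric[OF n nN, of ?T] by (simp only: matrix_sel(1))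
  moreover have "mnorm U n (S 0) \<le> mnorm U ?N Z"
  proof -
    have S0: "S 0 \<in> carrier ?A" using S[of 0] r by (simp del: matrices_iff)
    have S0': "adj ?A (S 0) \<in> carrier ?A" by (rule a.adj_closed[OF S0])
    have cS: "corner n ?N (adj ?A (S 0)) \<in> carrier ?B"
      using S0' corner_closed by (simp only: matrix_sel(1))
    have eq: "corner n ?N (adj ?A (S 0)) \<otimes>\<^bsub>?B\<^esub> Z = corner n ?N (adj ?A (S 0) \<otimes>\<^bsub>?A\<^esub> S 0)"
    proof (rule matrix_eqI[of _ ?N U])
      show "corner n ?N (adj ?A (S 0)) \<otimes>\<^bsub>?B\<^esub> Z \<in> matrices ?N U"
        using b.mult_closed[OF cS Z] by (simp only: matrix_sel(1))
      show "corner n ?N (adj ?A (S 0) \<otimes>\<^bsub>?A\<^esub> S 0) \<in> matrices ?N U"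
        using a.mult_closed[OF S0' S0] by (intro corner_closed) (simp only: matrix_sel(1))
      fix i k assume ik: "i < ?N" "k < ?N"
      have e: "adj ?A (S 0) (i, j) = adj U (S 0 (j, i))" if "i < n" "j < n" for i j
        using that by simp
      have "(\<Oplus>j\<in>{..<?N}. corner n ?N (adj ?A (S 0)) (i, j) \<otimes> Z (j, k))
          = (\<Oplus>j\<in>{..<n}. corner n ?N (adj ?A (S 0)) (i, j) \<otimes> Z (j, k))"
        using nN ik r Sb Zent by (intro finsum_subset) (auto simp: corner_apply e simp del: matrix_sel)
      also have "\<dots> = (if i < n \<and> k < n then \<Oplus>j\<in>{..<n}. adj U (S 0 (j, i)) \<otimes> S 0 (j, k) else \<zero>)"
      proof -
        have "corner n ?N (adj ?A (S 0)) (i, j) \<otimes> Z (j, k)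
            = (if i < n \<and> k < n then adj U (S 0 (j, i)) \<otimes> S 0 (j, k) else \<zero>)" if "j < n" for j
          using that less_le_trans[OF that nN] ik r Sb[of 0]
          by (auto simp: corner_apply e Zap simp del: matrix_sel)
        then have "(\<Oplus>j\<in>{..<n}. corner n ?N (adj ?A (S 0)) (i, j) \<otimes> Z (j, k))
            = (\<Oplus>j\<in>{..<n}. if i < n \<and> k < n then adj U (S 0 (j, i)) \<otimes> S 0 (j, k) else \<zero>)"
          using r Sb[of 0] by (intro M.finsum_cong') auto
        then show ?thesis by auto
      qed
      finally show "(corner n ?N (adj ?A (S 0)) \<otimes>\<^bsub>?B\<^esub> Z) (i, k) = corner n ?N (adj ?A (S 0) \<otimes>\<^bsub>?A\<^esub> S 0) (i, k)"
        using ik r Sb[of 0] by (simp add: corner_apply e del: matrix_sel(6) cong: M.finsum_cong)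
    qed
    have "(mnorm U n (S 0))\<^sup>2 = mnorm U ?N (corner n ?N (adj ?A (S 0) \<otimes>\<^bsub>?A\<^esub> S 0))"
      using a.cstar_identity[OF S0] a.mult_closed[OF S0' S0] corner_isometric[OF n nN]
      by (simp only: matrix_sel(1))
    also have "\<dots> \<le> mnorm U ?N (corner n ?N (adj ?A (S 0))) * mnorm U ?N Z"
      unfolding eq[symmetric] by (rule b.norm_mult[OF cS Z])
    also have "mnorm U ?N (corner n ?N (adj ?A (S 0))) = mnorm U n (S 0)"
      using corner_isometric[OF n nN] S0' a.norm_adj[OF S0] by (simp only: matrix_sel(1))
    finally have "mnorm U n (S 0) * mnorm U n (S 0) \<le> mnorm U n (S 0) * mnorm U ?N Z"
      by (simp add: power2_eq_square)
    then show ?thesis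
      using a.norm_nonneg[OF S0] b.norm_nonneg[OF Z]
      by (cases "mnorm U n (S 0) = 0") (simp_all add: mult_le_cancel_left_pos)
  qed
  ultimately show ?thesis
    using power_mono[of "mnorm U n (S 0)" "mnorm U ?N Z" 2] a.norm_nonneg[of "S 0"] S[of 0] r
    by (simp del: matrices_iff)
qed

end

text \<open>The form in which positivity enters the estimates: a sum of squares dominates its first
  term in norm. It is isolated as a locale because it is used both in \<open>U\<close> and in the
  matrix algebras over \<open>U\<close>.\<close>

locale column_cstar_norm = complete_cstar_norm +
  assumes column: "\<And>s. \<lbrakk>1 \<le> r; \<And>i. i < r \<Longrightarrow> s i \<in> carrier U\<rbrakk> \<Longrightarrow>
    (\<nu> (s 0))\<^sup>2 \<le> \<nu> (\<Oplus>i\<in>{..<r::nat}. adj U (s i) \<otimes> s i)"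

lemma (in cstar_alg) matrix_column_norm:
  assumes "n \<ge> 1"
  shows "column_cstar_norm (matrix_algebra n U) (mnorm U n)"
  using matrix_complete[OF assms] column_norm_le[OF assms]
  by (simp add: column_cstar_norm_def column_cstar_norm_axioms_def del: matrix_sel(2-) matrices_iff)

text \<open>The bound \<open>u < 1\<close> allows terms of higher order in \<open>u\<close> to be
  absorbed into \<open>K\<close>.\<close>

lemma le_of_le_add_small:
  fixes a b K :: real
  assumes "\<And>u. 0 < u \<Longrightarrow> u < 1 \<Longrightarrow> a \<le> b + u * K"
  shows "a \<le> b"
proof (rule field_le_epsilon)
  fix \<epsilon> :: real assume \<epsilon>: "0 < \<epsilon>"
  define u where "u = min (1/2) (\<epsilon> / (\<bar>K\<bar> + 1))"
  have u: "0 < u" "u < 1" using \<epsilon> by (auto simp: u_def)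
  have "u * K \<le> u * (\<bar>K\<bar> + 1)" using u by (intro mult_left_mono) auto
  also have "\<dots> \<le> \<epsilon>"
    using pos_le_divide_eq[of "\<bar>K\<bar> + 1" u \<epsilon>] by (auto simp: u_def)
  finally show "a \<le> b + \<epsilon>" using assms[OF u] by linarith
qed

context column_cstar_norm
begin

text \<open>Since \<open>1 - e\<^sub>i\<^sup>*e\<^sub>i\<close> is positive, adding multiples of \<open>x\<^sup>*(1 - e\<^sub>i\<^sup>*e\<^sub>i)x\<close> to \<open>y\<^sup>*y\<close> does not
  decrease the norm.\<close>

lemma norm_le_add_contractions:
  assumes y: "y \<in> carrier U" and x: "x \<in> carrier U"
    and e: "\<And>i. i < r \<Longrightarrow> e i \<in> carrier U" "\<And>i. i < r \<Longrightarrow> \<nu> (e i) \<le> 1"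
    and w: "\<And>i. i < r \<Longrightarrow> 0 \<le> w i"
  shows "(\<nu> y)\<^sup>2 \<le> \<nu> (adj U y \<otimes> y \<oplus> (\<Oplus>i\<in>{..<r::nat}.
    complex_of_real (w i) \<odot> (adj U x \<otimes> x \<ominus> adj U x \<otimes> (adj U (e i) \<otimes> (e i \<otimes> x)))))"
    (is "_ \<le> \<nu> (_ \<oplus> (\<Oplus>i\<in>_. ?t i))")
proof (rule le_of_le_add_small)
  fix u :: real assume u: "0 < u" "u < 1"
  \<comment> \<open>The factor \<open>1 - u\<close> pushes the norm below 1, as the square root
    requires. The error so made is of order \<open>u\<close> and disappears in the limit.\<close>
  let ?s = "\<lambda>i. complex_of_real (1 - u) \<odot> (adj U (e i) \<otimes> e i)"
  have "\<exists>c. c \<in> carrier U \<and> adj U c = c \<and> c \<oplus> c \<ominus> c \<otimes> c = ?s i" if i: "i < r" for i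
  proof -
    have "\<nu> (?s i) = (1 - u) * (\<nu> (e i))\<^sup>2"
      using e i u cstar_identity[of "e i"] norm_smult[of "adj U (e i) \<otimes> e i" "complex_of_real (1 - u)"]
      by (simp del: of_real_diff)
    also have "\<dots> \<le> (1 - u) * 1"
      using e i u by (intro mult_left_mono power_le_one) auto
    also have "\<dots> < 1" using u by simp
    finally have lt: "\<nu> (?s i) < 1" .
    have "?s i \<in> carrier U" "adj U (?s i) = ?s i" using e i by (simp_all add: adj_smult adj_mult)
    then show ?thesis by (rule one_minus_sqrt[OF _ _ lt]) (intro exI conjI)
  qed
  then have "\<forall>i. \<exists>c. i < r \<longrightarrow> c \<in> carrier U \<and> adj U c = c \<and> c \<oplus> c \<ominus> c \<otimes> c = ?s i" by blast
  then obtain c where c: "i < r \<Longrightarrow> c i \<in> carrier U" "i < r \<Longrightarrow> adj U (c i) = c i"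
    "i < r \<Longrightarrow> c i \<oplus> c i \<ominus> c i \<otimes> c i = ?s i" for i
    using choice[of "\<lambda>i c. i < r \<longrightarrow> c \<in> carrier U \<and> adj U c = c \<and> c \<oplus> c \<ominus> c \<otimes> c = ?s i"] by blast
  \<comment> \<open>A square root of the \<open>i\<close>-th summand: \<open>adj(z i) z i\<close> is
    \<open>?t i\<close> up to the error \<open>?d i\<close> caused by the factor
    \<open>1 - u\<close>.\<close>
  define z where "z i = complex_of_real (sqrt (w i)) \<odot> (x \<ominus> c i \<otimes> x)" for i
  have z: "z i \<in> carrier U" if "i < r" for i using that c x by (simp add: z_def)
  let ?d = "\<lambda>i. complex_of_real (u * w i) \<odot> (adj U x \<otimes> (adj U (e i) \<otimes> (e i \<otimes> x)))"
  have zz: "adj U (z i) \<otimes> z i = ?t i \<oplus> ?d i" if i: "i < r" for i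
  proof (rule eq_by_functionals)
    fix f assume f: "functional U f"
    have "f (adj U x \<otimes> ((c i \<oplus> c i \<ominus> c i \<otimes> c i) \<otimes> x)) = f (adj U x \<otimes> (?s i \<otimes> x))"
      using c(3)[OF i] by simp
    then have *: "2 * f (adj U x \<otimes> (c i \<otimes> x)) - f (adj U x \<otimes> (c i \<otimes> (c i \<otimes> x)))
        = complex_of_real (1 - u) * f (adj U x \<otimes> (adj U (e i) \<otimes> (e i \<otimes> x)))"
      using i c(1)[OF i] x e(1)[OF i] by (simp add: distr_simps functionalD[OF f])
    have w2: "complex_of_real (sqrt (w i)) * (complex_of_real (sqrt (w i)) * k) = complex_of_real (w i) * k" for k
      using w[OF i] by (simp add: mult.assoc[symmetric] flip: of_real_mult)
    have "f (adj U (z i) \<otimes> z i) = complex_of_real (w i) * (f (adj U x \<otimes> x)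
        - (2 * f (adj U x \<otimes> (c i \<otimes> x)) - f (adj U x \<otimes> (c i \<otimes> (c i \<otimes> x)))))"
      using c(1,2)[OF i] x by (simp add: z_def distr_simps adj_simps functionalD[OF f] w2 algebra_simps)
    then show "f (adj U (z i) \<otimes> z i) = f (?t i \<oplus> ?d i)"
      using i e x unfolding * by (simp add: functionalD[OF f] algebra_simps)
  qed (use i z e x in auto)
  let ?D = "\<Oplus>i\<in>{..<r}. ?d i" and ?T = "\<Oplus>i\<in>{..<r}. ?t i"
  have cl: "?t \<in> {..<r} \<rightarrow> carrier U" "?d \<in> {..<r} \<rightarrow> carrier U" using e x by auto
  \<comment> \<open>\<open>y\<close> takes place 0, since the column inequality singles out the
    first term.\<close>
  define v where "v i = (case i of 0 \<Rightarrow> y | Suc i \<Rightarrow> z i)" for i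
  have v: "v i \<in> carrier U" if "i < Suc r" for i using that y z by (auto simp: v_def split: nat.splits)
  have "(\<Oplus>i\<in>{..<Suc r}. adj U (v i) \<otimes> v i) = (adj U y \<otimes> y \<oplus> ?T) \<oplus> ?D"
  proof (rule eq_by_functionals)
    fix f assume f: "functional U f"
    have "f (\<Oplus>i\<in>{..<Suc r}. adj U (v i) \<otimes> v i) = (\<Sum>i<Suc r. f (adj U (v i) \<otimes> v i))"
      using v by (intro functional_finsum[OF f]) auto
    also have "\<dots> = f (adj U y \<otimes> y) + (\<Sum>i<r. f (adj U (z i) \<otimes> z i))"
      by (subst sum.lessThan_Suc_shift) (simp add: v_def)
    also have "\<dots> = f (adj U y \<otimes> y) + (\<Sum>i<r. f (?t i) + f (?d i))"
      using zz cl by (simp add: functionalD(1)[OF f] Pi_iff)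
    also have "\<dots> = f ((adj U y \<otimes> y \<oplus> ?T) \<oplus> ?D)"
      using y cl by (simp add: functionalD(1)[OF f] functional_finsum[OF f] sum.distrib M.finsum_closed)
    finally show "f (\<Oplus>i\<in>{..<Suc r}. adj U (v i) \<otimes> v i) = f ((adj U y \<otimes> y \<oplus> ?T) \<oplus> ?D)" .
  qed (use y v cl in \<open>auto intro!: M.finsum_closed\<close>)
  moreover have "(\<nu> y)\<^sup>2 \<le> \<nu> (\<Oplus>i\<in>{..<Suc r}. adj U (v i) \<otimes> v i)"
    using column[of "Suc r" v] v by (simp add: v_def)
  moreover have "\<nu> ((adj U y \<otimes> y \<oplus> ?T) \<oplus> ?D) \<le> \<nu> (adj U y \<otimes> y \<oplus> ?T) + \<nu> ?D"
    using y cl by (intro norm_triangle) (auto intro!: M.finsum_closed)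
  moreover have "\<nu> ?D \<le> u * (\<Sum>i<r. w i * (\<nu> x)\<^sup>2)"
  proof -
    have "\<nu> ?D \<le> (\<Sum>i<r. \<nu> (?d i))" using cl by (intro norm_finsum) auto
    also have "\<dots> \<le> (\<Sum>i<r. u * (w i * (\<nu> x)\<^sup>2))"
    proof (rule sum_mono)
      fix i assume "i \<in> {..<r}"
      then have i: "i < r" by simp
      have "adj U x \<otimes> (adj U (e i) \<otimes> (e i \<otimes> x)) = adj U (e i \<otimes> x) \<otimes> (e i \<otimes> x)"
        using e i x by (simp add: adj_mult mult_assoc)
      then have "\<nu> (adj U x \<otimes> (adj U (e i) \<otimes> (e i \<otimes> x))) = (\<nu> (e i \<otimes> x))\<^sup>2"
        using e i x by (simp add: cstar_identity)
      also have "\<dots> \<le> (\<nu> x)\<^sup>2"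
      proof (rule power_mono)
        have "\<nu> (e i \<otimes> x) \<le> \<nu> (e i) * \<nu> x" using e i x by (intro norm_mult) auto
        also have "\<dots> \<le> 1 * \<nu> x" using e i x by (intro mult_right_mono) auto
        finally show "\<nu> (e i \<otimes> x) \<le> \<nu> x" by simp
      qed (use e i x in auto)
      finally have "\<nu> (?d i) \<le> (u * w i) * (\<nu> x)\<^sup>2"
        using e i x u w[OF i]
        by (subst norm_smult) (auto simp: norm_mult simp del: of_real_mult intro!: mult_left_mono)
      then show "\<nu> (?d i) \<le> u * (w i * (\<nu> x)\<^sup>2)" by (simp add: mult.assoc)
    qed
    finally show ?thesis by (simp add: sum_distrib_left)
  qed
  ultimately show "(\<nu> y)\<^sup>2 \<le> \<nu> (adj U y \<otimes> y \<oplus> ?T) + u * (\<Sum>i<r. w i * (\<nu> x)\<^sup>2)" by simp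
qed

subsection \<open>Approximate units\<close>

definition left_unit :: "'t filter \<Rightarrow> ('t \<Rightarrow> 'a) \<Rightarrow> 'a \<Rightarrow> bool" where
  "left_unit F e x \<longleftrightarrow> conv U \<nu> F (\<lambda>t. e t \<otimes> x) x"

text \<open>Formally \<open>adj(1 - e) (1 - e) + (1 - adj(e) e) = 2 - e - adj(e)\<close>, and the
  second summand is positive for a contraction \<open>e\<close>. So the square of the norm of
  \<open>y - e y\<close> is at most twice the norm of \<open>adj(y) e y - adj(y) y\<close>.\<close>

lemma left_unitI:
  assumes y: "y \<in> carrier U" and e: "\<And>t. e t \<in> carrier U" "\<And>t. \<nu> (e t) \<le> 1"
    and lim: "conv U \<nu> F (\<lambda>t. adj U y \<otimes> (e t \<otimes> y)) (adj U y \<otimes> y)"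
  shows "left_unit F e y"
  unfolding left_unit_def
proof (rule convI_bound[OF y])
  let ?d = "\<lambda>t. \<nu> (adj U y \<otimes> (e t \<otimes> y) \<ominus> adj U y \<otimes> y)"
  have "((\<lambda>t. sqrt (2 * ?d t)) \<longlongrightarrow> sqrt (2 * 0)) F"
    by (intro tendsto_intros convD(3)[OF lim])
  then show "((\<lambda>t. sqrt (2 * ?d t)) \<longlongrightarrow> 0) F" by simp
  have "\<nu> (e t \<otimes> y \<ominus> y) \<le> sqrt (2 * ?d t)" for t
  proof (rule real_le_rsqrt)
    let ?g = "y \<ominus> e t \<otimes> y"
    let ?b = "adj U y \<otimes> (e t \<otimes> y) \<ominus> adj U y \<otimes> y"
    have "(\<nu> ?g)\<^sup>2 \<le> \<nu> (adj U ?g \<otimes> ?g \<oplus> (\<Oplus>i\<in>{..<1::nat}.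
      complex_of_real 1 \<odot> (adj U y \<otimes> y \<ominus> adj U y \<otimes> (adj U (e t) \<otimes> (e t \<otimes> y)))))"
      using e y by (intro norm_le_add_contractions) auto
    also have "adj U ?g \<otimes> ?g \<oplus> (\<Oplus>i\<in>{..<1::nat}.
      complex_of_real 1 \<odot> (adj U y \<otimes> y \<ominus> adj U y \<otimes> (adj U (e t) \<otimes> (e t \<otimes> y)))) = \<ominus> (?b \<oplus> adj U ?b)"
    proof (rule eq_by_functionals)
      fix f assume f: "functional U f"
      show "f (adj U ?g \<otimes> ?g \<oplus> (\<Oplus>i\<in>{..<1::nat}.
        complex_of_real 1 \<odot> (adj U y \<otimes> y \<ominus> adj U y \<otimes> (adj U (e t) \<otimes> (e t \<otimes> y))))) = f (\<ominus> (?b \<oplus> adj U ?b))"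
        using e y by (simp add: functionalD[OF f] functional_finsum[OF f] distr_simps adj_simps lessThan_Suc)
    qed (use e y in \<open>auto intro!: M.finsum_closed\<close>)
    also have "\<nu> \<dots> \<le> 2 * \<nu> ?b"
      using norm_triangle[of ?b "adj U ?b"] e y by simp
    finally show "(\<nu> (e t \<otimes> y \<ominus> y))\<^sup>2 \<le> 2 * ?d t"
      using e y norm_diff_comm[of y "e t \<otimes> y"] by simp
  qed
  then show "\<forall>\<^sub>F t in F. e t \<otimes> y \<in> carrier U \<and> \<nu> (e t \<otimes> y \<ominus> y) \<le> sqrt (2 * ?d t)"
    using e y by simp
qed

text \<open>Both the net and its adjoints are to act on \<open>x\<close> as well as on its adjoint.
  Then the set of all such \<open>x\<close> is a C*-subalgebra, and it suffices to check
  generators.\<close>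

definition approx_unit :: "'t filter \<Rightarrow> ('t \<Rightarrow> 'a) \<Rightarrow> 'a \<Rightarrow> bool" where
  "approx_unit F e x \<longleftrightarrow> left_unit F e x \<and> left_unit F (\<lambda>t. adj U (e t)) x \<and>
     left_unit F e (adj U x) \<and> left_unit F (\<lambda>t. adj U (e t)) (adj U x)"

text \<open>That the adjoint net acts on \<open>x\<close> does not follow by taking adjoints of the
  two limits, which only gives statements about \<open>adj x\<close>. But it does follow that
  \<open>adj(x) adj(e t) x\<close> tends to \<open>adj(x) x\<close>, and for contractions this weak
  convergence is enough by \<open>left_unitI\<close>.\<close>

lemma approx_unitI:
  assumes x: "x \<in> carrier U" and e: "\<And>t. e t \<in> carrier U" "\<And>t. \<nu> (e t) \<le> 1"
    and l: "conv U \<nu> F (\<lambda>t. e t \<otimes> x) x" and r: "conv U \<nu> F (\<lambda>t. x \<otimes> e t) x"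
  shows "approx_unit F e x"
  unfolding approx_unit_def
proof (intro conjI)
  show "left_unit F e x" using l by (simp add: left_unit_def)
  show "left_unit F (\<lambda>t. adj U (e t)) (adj U x)"
    unfolding left_unit_def using conv_adj[OF r] x e by (simp add: adj_mult)
  show "left_unit F (\<lambda>t. adj U (e t)) x"
  proof (rule left_unitI[OF x])
    have "conv U \<nu> F (\<lambda>t. adj U (adj U x \<otimes> (e t \<otimes> x))) (adj U (adj U x \<otimes> x))"
      using x by (intro conv_adj conv_mult_left l) auto
    then show "conv U \<nu> F (\<lambda>t. adj U x \<otimes> (adj U (e t) \<otimes> x)) (adj U x \<otimes> x)"
      using x e by (simp add: adj_mult mult_assoc)
  qed (use e in auto)
  show "left_unit F e (adj U x)"
  proof (rule left_unitI)
    have "conv U \<nu> F (\<lambda>t. x \<otimes> e t \<otimes> adj U x) (x \<otimes> adj U x)"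
      using x by (intro conv_mult_right r) auto
    then show "conv U \<nu> F (\<lambda>t. adj U (adj U x) \<otimes> (e t \<otimes> adj U x)) (adj U (adj U x) \<otimes> adj U x)"
      using x e by (simp add: mult_assoc)
  qed (use x e in auto)
qed

text \<open>Contractivity matters for the last clause, where it controls
  \<open>e t x - e t (\<xi> n)\<close> uniformly in \<open>t\<close>.\<close>

lemma left_unit_closure:
  assumes e: "\<And>t. e t \<in> carrier U" "\<And>t. \<nu> (e t) \<le> 1"
  shows "left_unit F e \<zero>"
    and "left_unit F e x \<Longrightarrow> left_unit F e y \<Longrightarrow> left_unit F e (x \<oplus> y)"
    and "left_unit F e x \<Longrightarrow> left_unit F e (c \<odot> x)"
    and "left_unit F e x \<Longrightarrow> y \<in> carrier U \<Longrightarrow> left_unit F e (x \<otimes> y)"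
    and "(\<And>n::nat. left_unit F e (\<xi> n)) \<Longrightarrow> conv U \<nu> sequentially \<xi> x \<Longrightarrow> left_unit F e x"
proof -
  have U: "left_unit F e x \<Longrightarrow> x \<in> carrier U" for x
    unfolding left_unit_def by (rule convD(1))
  show "left_unit F e \<zero>" using e by (simp add: left_unit_def conv_const)
  show "left_unit F e (x \<oplus> y)" if "left_unit F e x" "left_unit F e y"
    using conv_add[OF that[unfolded left_unit_def]] U[OF that(1)] U[OF that(2)] e
    by (simp add: left_unit_def distr_right)
  show "left_unit F e (c \<odot> x)" if "left_unit F e x"
    using conv_smult[OF that[unfolded left_unit_def], of c] U[OF that] e
    by (simp add: left_unit_def smult_mult_right)
  show "left_unit F e (x \<otimes> y)" if "left_unit F e x" "y \<in> carrier U"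
    using conv_mult_right[OF that(1)[unfolded left_unit_def] that(2)] U[OF that(1)] e that
    by (simp add: left_unit_def mult_assoc)
  assume \<xi>: "\<And>n. left_unit F e (\<xi> n)" and lim: "conv U \<nu> sequentially \<xi> x"
  note x = convD(1)[OF lim]
  have "((\<lambda>t. \<nu> (e t \<otimes> x \<ominus> x)) \<longlongrightarrow> 0) F"
  proof (rule tendstoI)
    fix \<epsilon> :: real assume \<epsilon>: "\<epsilon> > 0"
    then have "\<forall>\<^sub>F n in sequentially. \<nu> (\<xi> n \<ominus> x) < \<epsilon> / 4"
      by (intro order_tendstoD(2)[OF convD(3)[OF lim]]) simp
    then obtain n where n: "\<nu> (\<xi> n \<ominus> x) < \<epsilon> / 4" by (auto simp: eventually_sequentially)
    have "\<forall>\<^sub>F t in F. \<nu> (e t \<otimes> \<xi> n \<ominus> \<xi> n) < \<epsilon> / 4"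
      using \<epsilon> by (intro order_tendstoD(2)[OF convD(3)[OF \<xi>[of n, unfolded left_unit_def]]]) simp
    then show "\<forall>\<^sub>F t in F. dist (\<nu> (e t \<otimes> x \<ominus> x)) 0 < \<epsilon>"
    proof eventually_elim
      case (elim t)
      note y = U[OF \<xi>[of n]]
      have "\<nu> (e t \<otimes> x \<ominus> x) \<le> \<nu> (e t \<otimes> x \<ominus> e t \<otimes> \<xi> n) + \<nu> (e t \<otimes> \<xi> n \<ominus> x)"
        using x y e by (intro norm_diff_triangle) auto
      also have "\<nu> (e t \<otimes> \<xi> n \<ominus> x) \<le> \<nu> (e t \<otimes> \<xi> n \<ominus> \<xi> n) + \<nu> (\<xi> n \<ominus> x)"
        using x y e by (intro norm_diff_triangle) auto
      also have "\<nu> (e t \<otimes> x \<ominus> e t \<otimes> \<xi> n) \<le> \<nu> (e t) * \<nu> (x \<ominus> \<xi> n)"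
        using x y e norm_mult[of "e t" "x \<ominus> \<xi> n"] by (simp add: distr_minus)
      also have "\<dots> \<le> 1 * \<nu> (x \<ominus> \<xi> n)" using x y e by (intro mult_right_mono) auto
      finally show ?case using n elim x y e norm_diff_comm[of x "\<xi> n"] \<epsilon> by simp
    qed
  qed
  then show "left_unit F e x" using x e by (simp add: left_unit_def conv_def)
qed

lemma approx_unit_closure:
  assumes e: "\<And>t. e t \<in> carrier U" "\<And>t. \<nu> (e t) \<le> 1"
  shows "approx_unit F e x \<Longrightarrow> x \<in> carrier U"
    and "approx_unit F e \<zero>"
    and "approx_unit F e x \<Longrightarrow> approx_unit F e y \<Longrightarrow> approx_unit F e (x \<oplus> y)"
    and "approx_unit F e x \<Longrightarrow> approx_unit F e (c \<odot> x)"
    and "approx_unit F e x \<Longrightarrow> approx_unit F e y \<Longrightarrow> approx_unit F e (x \<otimes> y)"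
    and "approx_unit F e x \<Longrightarrow> approx_unit F e (adj U x)"
    and "(\<And>n::nat. approx_unit F e (\<xi> n)) \<Longrightarrow> conv U \<nu> sequentially \<xi> x \<Longrightarrow> approx_unit F e x"
proof -
  have e': "\<And>t. adj U (e t) \<in> carrier U" "\<And>t. \<nu> (adj U (e t)) \<le> 1" using e by auto
  note L = left_unit_closure[of e, OF e] left_unit_closure[of "\<lambda>t. adj U (e t)", OF e']
  have U: "approx_unit F e x \<Longrightarrow> x \<in> carrier U" for x
    unfolding approx_unit_def left_unit_def by (blast dest: convD(1))
  show "approx_unit F e x \<Longrightarrow> x \<in> carrier U" by (rule U)
  show "approx_unit F e \<zero>" by (simp add: approx_unit_def L)
  show "approx_unit F e (x \<oplus> y)" if "approx_unit F e x" "approx_unit F e y"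
    using that U[OF that(1)] U[OF that(2)] by (simp add: approx_unit_def adj_add L)
  show "approx_unit F e (c \<odot> x)" if "approx_unit F e x"
    using that U[OF that] by (simp add: approx_unit_def adj_smult L)
  show "approx_unit F e (x \<otimes> y)" if "approx_unit F e x" "approx_unit F e y"
    using that U[OF that(1)] U[OF that(2)] by (simp add: approx_unit_def adj_mult L)
  show "approx_unit F e (adj U x)" if "approx_unit F e x"
    using that U[OF that] by (simp add: approx_unit_def)
  show "approx_unit F e x" if "\<And>n::nat. approx_unit F e (\<xi> n)" "conv U \<nu> sequentially \<xi> x"
    using that conv_adj[OF that(2)] unfolding approx_unit_def
    by (blast intro: L(5)[of F \<xi>] L(10)[of F \<xi>] L(5)[of F "\<lambda>n. adj U (\<xi> n)"] L(10)[of F "\<lambda>n. adj U (\<xi> n)"])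
qed

lemma approx_unitD:
  assumes e: "\<And>t. e t \<in> carrier U" and x: "approx_unit F e x"
  shows "conv U \<nu> F (\<lambda>t. e t \<otimes> x) x" "conv U \<nu> F (\<lambda>t. x \<otimes> e t) x" "conv U \<nu> F (\<lambda>t. x \<otimes> adj U (e t)) x"
proof -
  have xU: "x \<in> carrier U" using x unfolding approx_unit_def left_unit_def by (blast dest: convD(1))
  show "conv U \<nu> F (\<lambda>t. e t \<otimes> x) x" using x by (simp add: approx_unit_def left_unit_def)
  show "conv U \<nu> F (\<lambda>t. x \<otimes> e t) x" "conv U \<nu> F (\<lambda>t. x \<otimes> adj U (e t)) x"
    using conv_adj[of F "\<lambda>t. adj U (e t) \<otimes> adj U x" "adj U x"] conv_adj[of F "\<lambda>t. e t \<otimes> adj U x" "adj U x"]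
      x xU e by (simp_all add: approx_unit_def left_unit_def adj_mult)
qed

end

subsection \<open>Averages of approximate units\<close>

lemma sum_square_triangle:
  fixes b :: "nat \<Rightarrow> nat \<Rightarrow> 'b::comm_monoid_add"
  shows "(\<Sum>k<n. \<Sum>m<n. b k m) = (\<Sum>m<n. b m m) + (\<Sum>m<n. \<Sum>k<m. b k m + b m k)"
  by (induction n) (simp_all add: sum.distrib ac_simps)

context column_cstar_norm
begin

definition avg_diff :: "nat \<Rightarrow> (nat \<Rightarrow> real) \<Rightarrow> (nat \<Rightarrow> 'a) \<Rightarrow> 'a \<Rightarrow> 'a" where
  "avg_diff n w e x = (\<Oplus>m\<in>{..<n}. complex_of_real (w m) \<odot> (x \<ominus> e m \<otimes> x))"

lemma avg_diff_closed:
  "x \<in> carrier U \<Longrightarrow> (\<And>m. m < n \<Longrightarrow> e m \<in> carrier U) \<Longrightarrow> avg_diff n w e x \<in> carrier U"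
  by (auto simp: avg_diff_def intro!: M.finsum_closed)

lemma avg_diff_functional:
  assumes f: "functional U f" and "x \<in> carrier U" "\<And>m. m < n \<Longrightarrow> e m \<in> carrier U"
  shows "f (avg_diff n w e x) = (\<Sum>m<n. of_real (w m) * f (x \<ominus> e m \<otimes> x))"
  using assms by (simp add: avg_diff_def functional_finsum[OF f] functionalD(2)[OF f] Pi_iff)

lemma avg_diff_scale:
  assumes "x \<in> carrier U" "\<And>m. m < n \<Longrightarrow> e m \<in> carrier U"
  shows "avg_diff n (\<lambda>m. c * w m) e x = complex_of_real c \<odot> avg_diff n w e x"
proof (rule eq_by_functionals)
  fix f assume f: "functional U f"
  show "f (avg_diff n (\<lambda>m. c * w m) e x) = f (complex_of_real c \<odot> avg_diff n w e x)"
    using assms by (simp add: avg_diff_functional[OF f] functionalD(2)[OF f] avg_diff_closed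
        sum_distrib_left mult.assoc)
qed (use assms avg_diff_closed in auto)

text \<open>The \<open>e\<^sub>m\<close> act almost as a unit on the earlier \<open>e\<^sub>k\<^sup>*\<close>, so the mixed terms
  \<open>(1 - e\<^sub>k)\<^sup>*(1 - e\<^sub>m)\<close> collapse to \<open>1 - e\<^sub>m\<close>.\<close>

lemma avg_diff_norm_square:
  assumes x: "x \<in> carrier U" and e: "\<And>m. m < n \<Longrightarrow> e m \<in> carrier U" "\<And>m. m < n \<Longrightarrow> \<nu> (e m) \<le> 1"
    and far: "\<And>k m. m < n \<Longrightarrow> k < m \<Longrightarrow> \<nu> (adj U (e k) \<ominus> adj U (e k) \<otimes> e m) \<le> \<epsilon>"
    and w: "\<And>m. m < n \<Longrightarrow> 0 \<le> w m" "(\<Sum>m<n. w m) = 1" and \<epsilon>: "\<epsilon> \<ge> 0"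
  shows "(\<nu> (avg_diff n w e x))\<^sup>2 \<le>
    2 * \<nu> x * \<nu> (avg_diff n (\<lambda>m. w m * (w m + (\<Sum>k<m. w k))) e x) + \<epsilon> * (\<nu> x)\<^sup>2"
proof -
  \<comment> \<open>Each pair \<open>k < m\<close> contributes the weight \<open>w k * w m\<close>
    to the later index \<open>m\<close>, and the diagonal contributes the square of
    \<open>w m\<close>. This is the total weight of \<open>1 - e m\<close> after the
    collapse.\<close>
  let ?w = "\<lambda>m. w m * (w m + (\<Sum>k<m. w k))"
  let ?y = "avg_diff n w e x" and ?y' = "avg_diff n ?w e x"
  note cl = avg_diff_closed[OF x e(1)]
  define g where "g m = x \<ominus> e m \<otimes> x" for m
  have g: "g m \<in> carrier U" if "m < n" for m using that x e by (simp add: g_def)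
  \<comment> \<open>The error in replacing \<open>adj(1 - e k) (1 - e m)\<close> by
    \<open>1 - e m\<close>, sandwiched between \<open>adj x\<close> and \<open>x\<close>.\<close>
  define d where "d k m = adj U x \<otimes> ((adj U (e k) \<ominus> adj U (e k) \<otimes> e m) \<otimes> x)" for k m
  have d: "d k m \<in> carrier U" if "k < n" "m < n" for k m using that x e by (simp add: d_def)
  \<comment> \<open>Added to the diagonal terms \<open>adj(1 - e m) (1 - e m)\<close>, these make
    them linear in \<open>1 - e m\<close> and its adjoint. Being positive for contractions
    \<open>e m\<close>, they may be added without decreasing the norm.\<close>
  let ?t = "\<lambda>m. complex_of_real ((w m)\<^sup>2) \<odot> (adj U x \<otimes> x \<ominus> adj U x \<otimes> (adj U (e m) \<otimes> (e m \<otimes> x)))"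
  let ?T = "\<Oplus>m\<in>{..<n}. ?t m"
  let ?dd = "\<lambda>m k. complex_of_real (w k * w m) \<odot> (d k m \<oplus> adj U (d k m))"
  let ?D = "\<Oplus>m\<in>{..<n}. \<Oplus>k\<in>{..<m}. ?dd m k"
  have dd: "?dd m k \<in> carrier U" if "m < n" "k < m" for m k using that d by simp
  have ddm: "(\<Oplus>k\<in>{..<m}. ?dd m k) \<in> carrier U" if "m < n" for m
    using that dd by (auto intro!: M.finsum_closed simp del: of_real_mult)
  have D: "?D \<in> carrier U" using ddm by (auto intro!: M.finsum_closed simp del: of_real_mult)
  have T: "?T \<in> carrier U" using x e by (auto intro!: M.finsum_closed)
  have main: "adj U ?y \<otimes> ?y \<oplus> ?T = (adj U x \<otimes> ?y' \<oplus> adj U ?y' \<otimes> x) \<ominus> ?D"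
  proof (rule eq_by_functionals)
    fix f assume f: "functional U f"
    let ?p = "\<lambda>m. f (adj U x \<otimes> g m)" and ?q = "\<lambda>m. f (adj U (g m) \<otimes> x)"
    let ?a = "\<lambda>k m. complex_of_real (w k * w m) * f (adj U (g k) \<otimes> g m)"
    have yadj: "adj U (avg_diff n w e x) = (\<Oplus>m\<in>{..<n}. complex_of_real (w m) \<odot> adj U (g m))" for w
      unfolding avg_diff_def g_def[symmetric] using g by (subst adj_finsum) (auto simp: adj_smult intro!: M.finsum_cong')
    have fy: "f (z \<otimes> avg_diff n v e x) = (\<Sum>m<n. of_real (v m) * f (z \<otimes> g m))" if z: "z \<in> carrier U" for z v
      using avg_diff_functional[OF functional_mult_left[OF f z] x e(1)] by (simp add: g_def)
    have fy': "f (adj U (avg_diff n v e x) \<otimes> z) = (\<Sum>m<n. of_real (v m) * f (adj U (g m) \<otimes> z))" if z: "z \<in> carrier U" for z v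
      unfolding yadj using g z
      by (subst functional_finsum[OF functional_mult_right[OF f z]])
        (auto simp: functionalD(2)[OF functional_mult_right[OF f z]])
    have "f (adj U ?y \<otimes> ?y) = (\<Sum>k<n. of_real (w k) * f (adj U (g k) \<otimes> ?y))"
      by (rule fy'[OF cl]) 
    also have "\<dots> = (\<Sum>k<n. \<Sum>m<n. ?a k m)"
      using g by (intro sum.cong refl) (simp add: fy sum_distrib_left mult.assoc)
    also have "\<dots> = (\<Sum>m<n. ?a m m) + (\<Sum>m<n. \<Sum>k<m. ?a k m + ?a m k)"
      by (rule sum_square_triangle)
    also have "(\<Sum>m<n. \<Sum>k<m. ?a k m + ?a m k)
        = (\<Sum>m<n. \<Sum>k<m. of_real (w k * w m) * (?p m + ?q m) - f (?dd m k))"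
    proof (intro sum.cong refl)
      fix m k assume "m \<in> {..<n}" "k \<in> {..<m}"
      then have km: "m < n" "k < m" "k < n" by auto
      have 1: "f (adj U (g k) \<otimes> g m) = ?p m - f (d k m)" "f (adj U (g m) \<otimes> g k) = ?q m - f (adj U (d k m))"
        using km e x by (simp_all add: g_def d_def distr_simps adj_simps functionalD[OF f])
      have 2: "f (?dd m k) = of_real (w k * w m) * (f (d k m) + f (adj U (d k m)))"
        using km d by (simp add: functionalD[OF f])
      show "?a k m + ?a m k = of_real (w k * w m) * (?p m + ?q m) - f (?dd m k)"
        unfolding 1 2 by (simp add: algebra_simps)
    qed
    also have "\<dots> = (\<Sum>m<n. of_real (w m * (\<Sum>k<m. w k)) * (?p m + ?q m)) - f ?D"
    proof -
      have "f ?D = (\<Sum>m<n. f (\<Oplus>k\<in>{..<m}. ?dd m k))"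
        using ddm by (intro functional_finsum[OF f]) (auto simp del: of_real_mult)
      also have "\<dots> = (\<Sum>m<n. \<Sum>k<m. f (?dd m k))"
        using dd by (intro sum.cong refl functional_finsum[OF f]) (auto simp del: of_real_mult)
      finally show ?thesis
        by (simp add: sum_subtractf sum_distrib_left sum_distrib_right mult_ac)
    qed
    finally have yy: "f (adj U ?y \<otimes> ?y) = (\<Sum>m<n. ?a m m)
        + ((\<Sum>m<n. of_real (w m * (\<Sum>k<m. w k)) * (?p m + ?q m)) - f ?D)" .
    have TT: "f ?T = (\<Sum>m<n. f (?t m))"
      using x e by (intro functional_finsum[OF f]) auto
    have diag: "?a m m + f (?t m) = of_real (w m * w m) * (?p m + ?q m)" if m: "m < n" for m
    proof -
      have "f (adj U (g m) \<otimes> g m) + f (adj U x \<otimes> x \<ominus> adj U x \<otimes> (adj U (e m) \<otimes> (e m \<otimes> x))) = ?p m + ?q m"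
        using m e x by (simp add: g_def distr_simps adj_simps functionalD[OF f])
      then show ?thesis
        using m e x by (simp add: functionalD(2)[OF f] power2_eq_square distrib_left[symmetric])
    qed
    have "f (adj U ?y \<otimes> ?y \<oplus> ?T) = f (adj U ?y \<otimes> ?y) + f ?T"
      using cl T by (simp add: functionalD(1)[OF f])
    also have "\<dots> = (\<Sum>m<n. ?a m m + f (?t m))
        + (\<Sum>m<n. of_real (w m * (\<Sum>k<m. w k)) * (?p m + ?q m)) - f ?D"
      by (simp only: yy TT sum.distrib) simp
    also have "(\<Sum>m<n. ?a m m + f (?t m)) = (\<Sum>m<n. of_real (w m * w m) * (?p m + ?q m))"
      by (intro sum.cong refl diag) simp
    also have "(\<Sum>m<n. of_real (w m * w m) * (?p m + ?q m))
        + (\<Sum>m<n. of_real (w m * (\<Sum>k<m. w k)) * (?p m + ?q m)) = (\<Sum>m<n. of_real (?w m) * (?p m + ?q m))"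
      by (simp add: sum.distrib[symmetric] algebra_simps)
    also have "(\<Sum>m<n. of_real (?w m) * (?p m + ?q m)) = f (adj U x \<otimes> ?y') + f (adj U ?y' \<otimes> x)"
      using x by (simp add: fy fy' distrib_left sum.distrib)
    finally show "f (adj U ?y \<otimes> ?y \<oplus> ?T) = f ((adj U x \<otimes> ?y' \<oplus> adj U ?y' \<otimes> x) \<ominus> ?D)"
      using x cl D by (simp add: functionalD[OF f])
  qed (use cl T D x in auto)
  have "(\<nu> ?y)\<^sup>2 \<le> \<nu> (adj U ?y \<otimes> ?y \<oplus> ?T)"
    using cl x e by (intro norm_le_add_contractions) auto
  also have "\<dots> \<le> \<nu> (adj U x \<otimes> ?y' \<oplus> adj U ?y' \<otimes> x) + \<nu> ?D"
    unfolding main using cl x D by (intro norm_diff_le) auto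
  also have "\<nu> (adj U x \<otimes> ?y' \<oplus> adj U ?y' \<otimes> x) \<le> 2 * \<nu> x * \<nu> ?y'"
    using norm_triangle[of "adj U x \<otimes> ?y'" "adj U ?y' \<otimes> x"] norm_mult[of "adj U x" ?y'] norm_mult[of "adj U ?y'" x] cl x
    by (simp add: mult.commute)
  also have "\<nu> ?D \<le> \<epsilon> * (\<nu> x)\<^sup>2"
  proof -
    have "\<nu> ?D \<le> (\<Sum>m<n. \<nu> (\<Oplus>k\<in>{..<m}. ?dd m k))"
      using ddm by (intro norm_finsum) (auto simp del: of_real_mult)
    also have "\<dots> \<le> (\<Sum>m<n. \<Sum>k<m. \<nu> (?dd m k))"
      using dd by (intro sum_mono norm_finsum) (auto simp del: of_real_mult)
    also have "\<dots> \<le> (\<Sum>m<n. \<Sum>k<m. (w k * w m + w m * w k) * (\<epsilon> * (\<nu> x)\<^sup>2))"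
    proof (intro sum_mono)
      fix m k assume "m \<in> {..<n}" "k \<in> {..<m}"
      then have km: "m < n" "k < m" "k < n" by auto
      have "\<nu> (d k m) \<le> \<nu> (adj U x) * (\<nu> (adj U (e k) \<ominus> adj U (e k) \<otimes> e m) * \<nu> x)"
        unfolding d_def using km x e
        by (intro order_trans[OF norm_mult] mult_left_mono norm_mult) auto
      also have "\<dots> \<le> \<nu> x * (\<epsilon> * \<nu> x)"
        using x far[OF km(1,2)] by (simp add: mult_left_mono mult_right_mono)
      finally have "\<nu> (d k m) \<le> \<epsilon> * (\<nu> x)\<^sup>2" by (simp add: power2_eq_square mult_ac)
      then have "\<nu> (d k m \<oplus> adj U (d k m)) \<le> 2 * (\<epsilon> * (\<nu> x)\<^sup>2)"
        using norm_triangle[of "d k m" "adj U (d k m)"] d[OF km(3,1)] by simp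
      then have "(w k * w m) * \<nu> (d k m \<oplus> adj U (d k m)) \<le> (w k * w m) * (2 * (\<epsilon> * (\<nu> x)\<^sup>2))"
        using w(1) km by (intro mult_left_mono) auto
      then show "\<nu> (?dd m k) \<le> (w k * w m + w m * w k) * (\<epsilon> * (\<nu> x)\<^sup>2)"
        using w(1) km d[OF km(3,1)] by (simp add: norm_smult mult_ac Real_Vector_Spaces.norm_mult)
    qed
    also have "\<dots> = (\<Sum>m<n. \<Sum>k<m. w k * w m + w m * w k) * (\<epsilon> * (\<nu> x)\<^sup>2)"
      by (simp add: sum_distrib_right)
    \<comment> \<open>The mixed products are part of the expansion of the squared sum of the
      weights, which is 1; the other part is nonnegative.\<close>
    also have "\<dots> \<le> 1 * (\<epsilon> * (\<nu> x)\<^sup>2)"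
    proof (rule mult_right_mono)
      have "(\<Sum>k<n. w k) * (\<Sum>m<n. w m) = (\<Sum>m<n. w m * w m) + (\<Sum>m<n. \<Sum>k<m. w k * w m + w m * w k)"
        unfolding sum_product by (rule sum_square_triangle)
      moreover have "(\<Sum>m<n. w m * w m) \<ge> 0" by (simp add: sum_nonneg)
      ultimately show "(\<Sum>m<n. \<Sum>k<m. w k * w m + w m * w k) \<le> 1" using w(2) by simp
    qed (use \<epsilon> in simp)
    finally show ?thesis by simp
  qed
  finally show ?thesis by simp
qed

text \<open>The thresholds \<open>\<mu>\<close> and \<open>\<epsilon>\<close> are uniform in the
  number of terms, the weights and \<open>x\<close>. This makes the bound self-improving, as it can
  be applied again to the same \<open>e m\<close> with other weights.\<close>

definition avg_bound :: "real \<Rightarrow> bool" where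
  "avg_bound s \<longleftrightarrow> (\<exists>\<mu>>0. \<exists>\<epsilon>>0. \<forall>n e w x. x \<in> carrier U \<longrightarrow>
     (\<forall>m<n. e m \<in> carrier U \<and> \<nu> (e m) \<le> 1 \<and> 0 \<le> w m \<and> w m \<le> \<mu>) \<longrightarrow>
     (\<forall>m<n. \<forall>k<m. \<nu> (adj U (e k) \<ominus> adj U (e k) \<otimes> e m) \<le> \<epsilon>) \<longrightarrow> (\<Sum>m<n. w m) = 1 \<longrightarrow>
     \<nu> (avg_diff n w e x) \<le> s * \<nu> x)"

lemma avg_bound_mono:
  assumes "avg_bound s" "s \<le> s'"
  shows "avg_bound s'"
proof -
  have *: "s * \<nu> x \<le> s' * \<nu> x" if "x \<in> carrier U" for x
    by (rule mult_right_mono[OF assms(2) norm_nonneg[OF that]])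
  from assms(1) obtain \<mu> \<epsilon> where "\<mu> > 0" "\<epsilon> > 0" and
    bd: "\<And>n e w x. x \<in> carrier U \<Longrightarrow>
     (\<forall>m<n. e m \<in> carrier U \<and> \<nu> (e m) \<le> 1 \<and> 0 \<le> w m \<and> w m \<le> \<mu>) \<Longrightarrow>
     (\<forall>m<n. \<forall>k<m. \<nu> (adj U (e k) \<ominus> adj U (e k) \<otimes> e m) \<le> \<epsilon>) \<Longrightarrow> (\<Sum>m<n. w m) = 1 \<Longrightarrow>
     \<nu> (avg_diff n w e x) \<le> s * \<nu> x"
    unfolding avg_bound_def by blast
  have "\<nu> (avg_diff n w e x) \<le> s' * \<nu> x"
    if "x \<in> carrier U" "\<forall>m<n. e m \<in> carrier U \<and> \<nu> (e m) \<le> 1 \<and> 0 \<le> w m \<and> w m \<le> \<mu>"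
      "\<forall>m<n. \<forall>k<m. \<nu> (adj U (e k) \<ominus> adj U (e k) \<otimes> e m) \<le> \<epsilon>" "(\<Sum>m<n. w m) = 1" for n e w x
    using bd[OF that] *[OF that(1)] by linarith
  then show ?thesis
    unfolding avg_bound_def using \<open>\<mu> > 0\<close> \<open>\<epsilon> > 0\<close> by blast
qed

lemma avg_bound_2: "avg_bound 2"
proof -
  have "\<nu> (avg_diff n w e x) \<le> 2 * \<nu> x"
    if x: "x \<in> carrier U" and e: "\<forall>m<n. e m \<in> carrier U \<and> \<nu> (e m) \<le> 1 \<and> 0 \<le> w m \<and> w m \<le> 1"
      and w: "(\<Sum>m<n. w m) = 1" for n e w x
  proof -
    have "\<nu> (avg_diff n w e x) \<le> (\<Sum>m<n. \<nu> (complex_of_real (w m) \<odot> (x \<ominus> e m \<otimes> x)))"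
      unfolding avg_diff_def using x e by (intro norm_finsum) auto
    also have "\<dots> \<le> (\<Sum>m<n. w m * (2 * \<nu> x))"
    proof (rule sum_mono)
      fix m assume "m \<in> {..<n}"
      then have m: "e m \<in> carrier U" "\<nu> (e m) \<le> 1" "0 \<le> w m" using e by auto
      have "\<nu> (x \<ominus> e m \<otimes> x) \<le> \<nu> x + \<nu> (e m) * \<nu> x"
        using norm_diff_le[of x "e m \<otimes> x"] norm_mult[of "e m" x] m x by simp
      also have "\<dots> \<le> \<nu> x + 1 * \<nu> x" using m x by (intro add_left_mono mult_right_mono) auto
      finally show "\<nu> (complex_of_real (w m) \<odot> (x \<ominus> e m \<otimes> x)) \<le> w m * (2 * \<nu> x)"
        using m x by (simp add: norm_smult mult_left_mono)
    qed
    also have "\<dots> = 2 * \<nu> x" using w by (simp add: sum_distrib_right[symmetric])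
    finally show ?thesis .
  qed
  then show ?thesis
    unfolding avg_bound_def by (intro exI[of _ "1::real"] conjI allI impI) auto
qed

text \<open>The weights produced by squaring sum to nearly 1/2, so after normalising them the bound
  \<open>s\<close> turns the square estimate into roughly \<open>s\<close> times the square of the
  norm of \<open>x\<close>. The constant thus improves from \<open>s\<close> to about its square
  root, and \<open>(s + 1) / 2\<close> lies strictly above that root.\<close>

lemma avg_bound_step:
  assumes s: "avg_bound s" "s > 1"
  shows "avg_bound ((s + 1) / 2)"
proof -
  obtain \<mu>0 \<epsilon>0 where pos: "\<mu>0 > 0" "\<epsilon>0 > 0" and
    bd: "\<And>n e w x. x \<in> carrier U \<Longrightarrow>
     (\<forall>m<n. e m \<in> carrier U \<and> \<nu> (e m) \<le> 1 \<and> 0 \<le> w m \<and> w m \<le> \<mu>0) \<Longrightarrow>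
     (\<forall>m<n. \<forall>k<m. \<nu> (adj U (e k) \<ominus> adj U (e k) \<otimes> e m) \<le> \<epsilon>0) \<Longrightarrow> (\<Sum>m<n. w m) = 1 \<Longrightarrow>
     \<nu> (avg_diff n w e x) \<le> s * \<nu> x"
    using s(1) unfolding avg_bound_def by blast
  \<comment> \<open>Chosen such that \<open>s + \<delta> * (s + 1)\<close> is the square of the
    target \<open>(s + 1) / 2\<close>. It is positive because this square exceeds \<open>s\<close>
    by the square of \<open>(s - 1) / 2\<close>.\<close>
  define \<delta> where "\<delta> = (((s + 1) / 2)\<^sup>2 - s) / (s + 1)"
  have "((s + 1) / 2)\<^sup>2 - s = ((s - 1) / 2)\<^sup>2" by (simp add: power2_eq_square field_simps)
  then have \<delta>: "\<delta> > 0" "s + \<delta> * (s + 1) = ((s + 1) / 2)\<^sup>2" using s(2) by (auto simp: \<delta>_def)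
  \<comment> \<open>The halving compensates for the normalisation by \<open>\<tau> \<ge> 1/2\<close>
    below.\<close>
  define \<mu> where "\<mu> = min (\<mu>0 / 2) \<delta>"
  define \<epsilon> where "\<epsilon> = min \<epsilon>0 \<delta>"
  have \<mu>: "\<mu> > 0" "2 * \<mu> \<le> \<mu>0" "\<mu> \<le> \<delta>" and \<epsilon>: "\<epsilon> > 0" "\<epsilon> \<le> \<epsilon>0" "\<epsilon> \<le> \<delta>"
    using pos \<delta> by (auto simp: \<mu>_def \<epsilon>_def)
  have "\<nu> (avg_diff n w e x) \<le> (s + 1) / 2 * \<nu> x"
    if x: "x \<in> carrier U" and e: "\<forall>m<n. e m \<in> carrier U \<and> \<nu> (e m) \<le> 1 \<and> 0 \<le> w m \<and> w m \<le> \<mu>"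
      and far: "\<forall>m<n. \<forall>k<m. \<nu> (adj U (e k) \<ominus> adj U (e k) \<otimes> e m) \<le> \<epsilon>"
      and w: "(\<Sum>m<n. w m) = 1" for n e w x
  proof -
    let ?W = "\<lambda>m. w m + (\<Sum>k<m. w k)"
    let ?w = "\<lambda>m. w m * ?W m"
    \<comment> \<open>Twice this total is 1 plus the sum of the squares of the weights, and the
      latter is at most \<open>\<mu>\<close>.\<close>
    define \<tau> where "\<tau> = (\<Sum>m<n. ?w m)"
    have "(\<Sum>k<n. w k) * (\<Sum>m<n. w m) = (\<Sum>m<n. w m * w m) + (\<Sum>m<n. \<Sum>k<m. w k * w m + w m * w k)"
      unfolding sum_product by (rule sum_square_triangle)
    also have "(\<Sum>m<n. \<Sum>k<m. w k * w m + w m * w k) = 2 * \<tau> - 2 * (\<Sum>m<n. w m * w m)"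
      by (simp add: \<tau>_def algebra_simps sum.distrib sum_distrib_left)
    finally have \<tau>: "2 * \<tau> = 1 + (\<Sum>m<n. w m * w m)" using w by simp
    have sq: "0 \<le> (\<Sum>m<n. w m * w m)" by (simp add: sum_nonneg)
    have "(\<Sum>m<n. w m * w m) \<le> (\<Sum>m<n. w m * \<mu>)"
      using e by (intro sum_mono mult_left_mono) auto
    then have sq': "(\<Sum>m<n. w m * w m) \<le> \<mu>" using w by (simp add: sum_distrib_right[symmetric])
    have W: "0 \<le> ?W m \<and> ?W m \<le> 1" if m: "m < n" for m
    proof -
      have "?W m = (\<Sum>k<Suc m. w k)" by simp
      moreover have "(\<Sum>k<Suc m. w k) \<le> (\<Sum>k<n. w k)"
        using m e by (intro sum_mono2) auto
      moreover have "0 \<le> (\<Sum>k<Suc m. w k)" using m e by (intro sum_nonneg) auto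
      ultimately show ?thesis using w by simp
    qed
    let ?v = "\<lambda>m. ?w m / \<tau>"
    have \<tau>0: "\<tau> \<ge> 1/2" using \<tau> sq by simp
    have v: "0 \<le> ?v m \<and> ?v m \<le> \<mu>0" if m: "m < n" for m
    proof -
      have wm: "0 \<le> w m" "w m \<le> \<mu>" using e m by auto
      have "?w m \<le> w m * 1" using W[OF m] wm by (intro mult_left_mono) auto
      also have "\<dots> \<le> \<mu>0 * (1/2)" using wm \<mu> by simp
      also have "\<dots> \<le> \<mu>0 * \<tau>" using pos \<tau>0 by (intro mult_left_mono) auto
      finally show ?thesis using W[OF m] wm \<tau>0 by (simp add: pos_divide_le_eq)
    qed
    have "\<nu> (avg_diff n ?v e x) \<le> s * \<nu> x"
    proof (rule bd[OF x])
      show "\<forall>m<n. e m \<in> carrier U \<and> \<nu> (e m) \<le> 1 \<and> 0 \<le> ?v m \<and> ?v m \<le> \<mu>0" using e v by blast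
      show "\<forall>m<n. \<forall>k<m. \<nu> (adj U (e k) \<ominus> adj U (e k) \<otimes> e m) \<le> \<epsilon>0"
        using far \<epsilon>(2) order_trans by blast
      show "(\<Sum>m<n. ?v m) = 1" using \<tau>0 by (simp add: sum_divide_distrib[symmetric] \<tau>_def)
    qed
    moreover have "avg_diff n ?w e x = complex_of_real \<tau> \<odot> avg_diff n ?v e x"
      using avg_diff_scale[of x n e \<tau> ?v] x e \<tau>0 by simp
    ultimately have y': "\<nu> (avg_diff n ?w e x) \<le> \<tau> * (s * \<nu> x)"
      using x e \<tau>0 by (simp add: norm_smult avg_diff_closed mult_left_mono)
    have "(\<nu> (avg_diff n w e x))\<^sup>2 \<le> 2 * \<nu> x * \<nu> (avg_diff n ?w e x) + \<epsilon> * (\<nu> x)\<^sup>2"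
      using x e far w \<epsilon> by (intro avg_diff_norm_square) auto
    also have "\<dots> \<le> 2 * \<nu> x * (\<tau> * (s * \<nu> x)) + \<epsilon> * (\<nu> x)\<^sup>2"
      using y' x by (intro add_right_mono mult_left_mono) auto
    also have "\<dots> = (2 * \<tau> * s + \<epsilon>) * (\<nu> x)\<^sup>2" by (simp add: power2_eq_square algebra_simps)
    also have "\<dots> \<le> (s + \<delta> * (s + 1)) * (\<nu> x)\<^sup>2"
    proof (rule mult_right_mono)
      have "2 * \<tau> * s \<le> (1 + \<delta>) * s" using \<tau> sq' \<mu> s(2) by (intro mult_right_mono) auto
      then show "2 * \<tau> * s + \<epsilon> \<le> s + \<delta> * (s + 1)" using \<epsilon>(3) by (simp add: algebra_simps)
    qed simp
    also have "\<dots> = ((s + 1) / 2 * \<nu> x)\<^sup>2" by (simp only: \<delta>(2) power_mult_distrib)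
    finally show ?thesis
      using s(2) x by (intro power2_le_imp_le[of "\<nu> (avg_diff n w e x)"]) auto
  qed
  then show ?thesis unfolding avg_bound_def using \<mu>(1) \<epsilon>(1) by blast
qed

text \<open>Starting from the trivial constant 2, each step halves its excess over 1.\<close>

lemma avg_bound_gt_1:
  assumes "s > 1"
  shows "avg_bound s"
proof -
  have *: "avg_bound (1 + (1/2) ^ k)" for k
  proof (induction k)
    case 0
    then show ?case using avg_bound_2 by simp
  next
    case (Suc k)
    have eq: "(1 + (1/2) ^ k + 1) / 2 = 1 + (1/2::real) ^ Suc k" and "1 < 1 + (1/2::real) ^ k"
      by simp_all
    from avg_bound_step[OF Suc this(2)] show ?case by (simp only: eq)
  qed
  obtain k where k: "(1/2::real) ^ k < s - 1"
    using real_arch_pow_inv[of "s - 1" "1/2"] assms by auto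
  show ?thesis
    by (rule avg_bound_mono[OF *[of k]]) (use k in simp)
qed

text \<open>The indices are picked one after the other, each so far along the filter that the new
  element nearly fixes \<open>d\<close> and is nearly a right unit for the adjoints of the earlier
  choices. Equal weights \<open>1 / n\<close> fall below the threshold once \<open>n\<close> is
  large.\<close>

theorem exists_average_unit:
  assumes F: "F \<noteq> bot" and e: "\<And>t. e t \<in> carrier U" "\<And>t. \<nu> (e t) \<le> 1"
    and ee: "\<And>t. approx_unit F e (e t)" and d: "approx_unit F e d" and \<delta>: "\<delta> > 0"
  obtains n t where "n \<ge> 1"
    "\<And>x. x \<in> carrier U \<Longrightarrow>
      \<nu> (x \<ominus> (\<Oplus>m\<in>{..<n::nat}. complex_of_real (1 / n) \<odot> e (t m)) \<otimes> x) \<le> (1 + \<delta>) * \<nu> x"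
    "\<nu> (d \<ominus> (\<Oplus>m\<in>{..<n}. complex_of_real (1 / n) \<odot> e (t m)) \<otimes> d) \<le> \<delta>"
proof -
  obtain \<mu> \<epsilon> where pos: "\<mu> > 0" "\<epsilon> > 0" and
    bd: "\<And>n e w x. x \<in> carrier U \<Longrightarrow>
     (\<forall>m<n. e m \<in> carrier U \<and> \<nu> (e m) \<le> 1 \<and> 0 \<le> w m \<and> w m \<le> \<mu>) \<Longrightarrow>
     (\<forall>m<n. \<forall>k<m. \<nu> (adj U (e k) \<ominus> adj U (e k) \<otimes> e m) \<le> \<epsilon>) \<Longrightarrow> (\<Sum>m<n. w m) = 1 \<Longrightarrow>
     \<nu> (avg_diff n w e x) \<le> (1 + \<delta>) * \<nu> x"
    using avg_bound_gt_1[of "1 + \<delta>"] \<delta> unfolding avg_bound_def by (metis less_add_same_cancel1)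
  have dU: "d \<in> carrier U" using approx_unit_closure(1)[OF e d] .
  have ex: "\<exists>t. \<forall>m<n. \<nu> (d \<ominus> e (t m) \<otimes> d) \<le> \<delta> \<and>
      (\<forall>k<m. \<nu> (adj U (e (t k)) \<ominus> adj U (e (t k)) \<otimes> e (t m)) \<le> \<epsilon>)" for n :: nat
  proof (induction n)
    case (Suc n)
    then obtain t where t: "\<forall>m<n. \<nu> (d \<ominus> e (t m) \<otimes> d) \<le> \<delta> \<and>
      (\<forall>k<m. \<nu> (adj U (e (t k)) \<ominus> adj U (e (t k)) \<otimes> e (t m)) \<le> \<epsilon>)" by blast
    have "\<forall>\<^sub>F s in F. \<nu> (adj U (e (t k)) \<ominus> adj U (e (t k)) \<otimes> e s) \<le> \<epsilon>" for k
    proof -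
      have "conv U \<nu> F (\<lambda>s. adj U (e (t k)) \<otimes> e s) (adj U (e (t k)))"
        by (rule approx_unitD(2)[OF e(1) approx_unit_closure(6)[OF e ee]])
      then have "\<forall>\<^sub>F s in F. \<nu> (adj U (e (t k)) \<otimes> e s \<ominus> adj U (e (t k))) < \<epsilon>"
        using pos by (intro order_tendstoD(2)[OF convD(3)]) auto
      then show ?thesis
        by eventually_elim (use e in \<open>simp add: norm_diff_comm\<close>)
    qed
    then have "\<forall>\<^sub>F s in F. \<forall>k\<in>{..<n}. \<nu> (adj U (e (t k)) \<ominus> adj U (e (t k)) \<otimes> e s) \<le> \<epsilon>"
      by (intro eventually_ball_finite) auto
    moreover have "\<forall>\<^sub>F s in F. \<nu> (e s \<otimes> d \<ominus> d) < \<delta>"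
      using \<delta> by (intro order_tendstoD(2)[OF convD(3)[OF approx_unitD(1)[OF e(1) d]]]) auto
    ultimately have "\<forall>\<^sub>F s in F. (\<forall>k\<in>{..<n}. \<nu> (adj U (e (t k)) \<ominus> adj U (e (t k)) \<otimes> e s) \<le> \<epsilon>)
        \<and> \<nu> (d \<ominus> e s \<otimes> d) \<le> \<delta>"
      by eventually_elim (use e dU in \<open>simp add: norm_diff_comm\<close>)
    then obtain s where s: "\<forall>k<n. \<nu> (adj U (e (t k)) \<ominus> adj U (e (t k)) \<otimes> e s) \<le> \<epsilon>"
        "\<nu> (d \<ominus> e s \<otimes> d) \<le> \<delta>"
      using eventually_happens[of _ F] F by blast
    show ?case using t s by (intro exI[of _ "t(n := s)"]) (auto simp: less_Suc_eq)
  qed simp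
  obtain n :: nat where n: "n \<ge> 1" "1 / n \<le> \<mu>"
  proof -
    obtain n where "n > 0" "inverse (real n) < \<mu>" using ex_inverse_of_nat_less[OF pos(1)] by blast
    then show thesis by (intro that[of n]) (auto simp: inverse_eq_divide)
  qed
  obtain t where t: "\<forall>m<n. \<nu> (d \<ominus> e (t m) \<otimes> d) \<le> \<delta> \<and>
      (\<forall>k<m. \<nu> (adj U (e (t k)) \<ominus> adj U (e (t k)) \<otimes> e (t m)) \<le> \<epsilon>)" using ex by blast
  let ?a = "\<Oplus>m\<in>{..<n}. complex_of_real (1 / n) \<odot> e (t m)"
  have a: "?a \<in> carrier U" using e by (auto intro!: M.finsum_closed)
  have eq: "x \<ominus> ?a \<otimes> x = avg_diff n (\<lambda>_. 1 / n) (\<lambda>m. e (t m)) x" if x: "x \<in> carrier U" for x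
  proof (rule eq_by_functionals)
    fix f assume f: "functional U f"
    have "f (?a \<otimes> x) = (\<Sum>m<n. of_real (1 / n) * f (e (t m) \<otimes> x))"
      using e x by (subst functional_finsum[OF functional_mult_right[OF f x]])
        (auto simp: functionalD(2)[OF functional_mult_right[OF f x]])
    then show "f (x \<ominus> ?a \<otimes> x) = f (avg_diff n (\<lambda>_. 1 / n) (\<lambda>m. e (t m)) x)"
      using e x a n by (simp add: functionalD[OF f] avg_diff_functional[OF f] right_diff_distrib sum_subtractf)
  qed (use e x a avg_diff_closed in auto)
  show thesis
  proof (rule that[OF n(1)])
    show "\<nu> (x \<ominus> ?a \<otimes> x) \<le> (1 + \<delta>) * \<nu> x" if x: "x \<in> carrier U" for x
      unfolding eq[OF x] using e t n by (intro bd[OF x]) auto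
    have "\<nu> (d \<ominus> ?a \<otimes> d) \<le> (\<Sum>m<n. \<nu> (complex_of_real (1 / n) \<odot> (d \<ominus> e (t m) \<otimes> d)))"
      unfolding eq[OF dU] avg_diff_def using e dU by (intro norm_finsum) auto
    also have "\<dots> \<le> (\<Sum>m<n. 1 / n * \<delta>)"
    proof (rule sum_mono)
      fix m assume "m \<in> {..<n}"
      then have "1 / n * \<nu> (d \<ominus> e (t m) \<otimes> d) \<le> 1 / n * \<delta>" using t by (intro mult_left_mono) auto
      then show "\<nu> (complex_of_real (1 / n) \<odot> (d \<ominus> e (t m) \<otimes> d)) \<le> 1 / n * \<delta>"
        using e dU by (simp add: norm_smult norm_divide)
    qed
    also have "\<dots> = \<delta>" using n by simp
    finally show "\<nu> (d \<ominus> ?a \<otimes> d) \<le> \<delta>" .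
  qed
qed

end

section \<open>Closed subalgebras\<close>

definition linear_subspace :: "(complex, 'a, 'm) module_scheme \<Rightarrow> 'a set \<Rightarrow> bool" where
  "linear_subspace U S \<longleftrightarrow> S \<subseteq> carrier U \<and> \<zero>\<^bsub>U\<^esub> \<in> S \<and>
     (\<forall>x\<in>S. \<forall>y\<in>S. x \<oplus>\<^bsub>U\<^esub> y \<in> S) \<and> (\<forall>c. \<forall>x\<in>S. c \<odot>\<^bsub>U\<^esub> x \<in> S)"

lemma linear_subspaceD:
  assumes "linear_subspace U S"
  shows "S \<subseteq> carrier U" "\<And>x. x \<in> S \<Longrightarrow> x \<in> carrier U" "\<zero>\<^bsub>U\<^esub> \<in> S"
    "\<And>x y. x \<in> S \<Longrightarrow> y \<in> S \<Longrightarrow> x \<oplus>\<^bsub>U\<^esub> y \<in> S" "\<And>c x. x \<in> S \<Longrightarrow> c \<odot>\<^bsub>U\<^esub> x \<in> S"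
  using assms by (auto simp: linear_subspace_def)

context complex_algebra
begin

lemma linear_subspace_minus:
  assumes "linear_subspace U S" "x \<in> S" "y \<in> S"
  shows "\<ominus> x \<in> S" "x \<ominus> y \<in> S"
  using linear_subspaceD[OF assms(1)] assms(2,3) by (auto simp: M.minus_eq minus_sm)

lemma linear_subspace_finsum:
  assumes S: "linear_subspace U S" and "finite I" "\<And>i. i \<in> I \<Longrightarrow> g i \<in> S"
  shows "(\<Oplus>i\<in>I. g i) \<in> S"
  using assms(2,3)
proof (induction I rule: finite_induct)
  case (insert i I)
  then show ?case using linear_subspaceD[OF S] by (simp add: Pi_iff)
qed (use linear_subspaceD[OF S] in simp)

lemma submodule_iff: "submodule S (ring_of_type_algebra :: complex ring) U \<longleftrightarrow> linear_subspace U S"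
proof
  assume s: "submodule S (ring_of_type_algebra :: complex ring) U"
  note E = submoduleE[OF s]
  obtain x where "x \<in> S" using E(2) by blast
  then have "\<zero> \<in> S" using E(1) E(4)[of 0 x] by auto
  then show "linear_subspace U S" using E by (simp add: linear_subspace_def)
next
  assume s: "linear_subspace U S"
  show "submodule S (ring_of_type_algebra :: complex ring) U"
    using linear_subspaceD[OF s] linear_subspace_minus[OF s] by (intro submoduleI) auto
qed

lemma subspace_module:
  assumes "linear_subspace U S"
  shows "Module.module (ring_of_type_algebra :: complex ring) (U\<lparr>carrier := S\<rparr>)"
  using submodule.submodule_is_module[of S "ring_of_type_algebra :: complex ring" U]
    assms module_axioms submodule_iff by blast

text \<open>Negation is defined by a description over the carrier, so shrinking the carrier might
  change it. Uniqueness of inverses in \<open>U\<close> shows that it does not.\<close>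

lemma subspace_diff:
  assumes S: "linear_subspace U S" and xy: "x \<in> S" "y \<in> S"
  shows "x \<ominus>\<^bsub>U\<lparr>carrier := S\<rparr>\<^esub> y = x \<ominus> y"
proof -
  interpret s: Module.module "ring_of_type_algebra :: complex ring" "U\<lparr>carrier := S\<rparr>"
    by (rule subspace_module[OF S])
  have "\<ominus>\<^bsub>U\<lparr>carrier := S\<rparr>\<^esub> y \<in> S" "\<ominus>\<^bsub>U\<lparr>carrier := S\<rparr>\<^esub> y \<oplus> y = \<zero>"
    using s.M.a_inv_closed[of y] s.M.l_neg[of y] xy by auto
  then have "\<ominus> y = \<ominus>\<^bsub>U\<lparr>carrier := S\<rparr>\<^esub> y"
    using linear_subspaceD(2)[OF S] xy by (intro M.minus_equality) auto
  then show ?thesis by (simp add: a_minus_def)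
qed

lemma subalgebra_complex_algebra:
  assumes S: "linear_subspace U S" and m: "\<And>x y. x \<in> S \<Longrightarrow> y \<in> S \<Longrightarrow> x \<otimes> y \<in> S"
  shows "complex_algebra (U\<lparr>carrier := S\<rparr>)"
proof (rule complex_algebra.intro[OF subspace_module[OF S]])
  show "complex_algebra_axioms (U\<lparr>carrier := S\<rparr>)"
    using m linear_subspaceD(2)[OF S]
    by unfold_locales (auto simp: mult_assoc distr_left distr_right smult_mult_left smult_mult_right)
qed

end

lemma (in star_algebra) subalgebra_star_algebra:
  assumes S: "linear_subspace U S" and m: "\<And>x y. x \<in> S \<Longrightarrow> y \<in> S \<Longrightarrow> x \<otimes> y \<in> S"
    and a: "\<And>x. x \<in> S \<Longrightarrow> adj U x \<in> S"
  shows "star_algebra (U\<lparr>carrier := S\<rparr>)"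
proof (rule star_algebra.intro[OF subalgebra_complex_algebra[OF S m]])
  show "star_algebra_axioms (U\<lparr>carrier := S\<rparr>)"
    using a linear_subspaceD(2)[OF S] by unfold_locales (auto simp: adj_simps)
qed

lemma elt_norm_carrier [simp]: "elt_norm (U\<lparr>carrier := S\<rparr>) = elt_norm U"
  by (intro ext) (simp add: elt_norm_def)

context cstar_alg
begin

abbreviation (input) cnv :: "'t filter \<Rightarrow> ('t \<Rightarrow> 'a) \<Rightarrow> 'a \<Rightarrow> bool" where
  "cnv \<equiv> conv U (elt_norm U)"

lemma subspace_metric:
  assumes S: "linear_subspace U S"
  shows "Metric_space S (norm_dist (U\<lparr>carrier := S\<rparr>) (elt_norm U))"
proof -
  have *: "norm_dist (U\<lparr>carrier := S\<rparr>) (elt_norm U) x y = norm_dist U (elt_norm U) x y"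
    if "x \<in> S" "y \<in> S" for x y
    using that linear_subspaceD(2)[OF S] by (simp add: norm_dist_def subspace_diff[OF S])
  interpret m: Metric_space "carrier U" "norm_dist U (elt_norm U)" by (rule metric)
  show ?thesis
  proof
    fix x y
    have 0: "norm_dist (U\<lparr>carrier := S\<rparr>) (elt_norm U) x y = 0" if "\<not> (x \<in> S \<and> y \<in> S)" for x y
      using that by (auto simp: norm_dist_def)
    show "0 \<le> norm_dist (U\<lparr>carrier := S\<rparr>) (elt_norm U) x y"
      using * 0 by (cases "x \<in> S \<and> y \<in> S") auto
    show "norm_dist (U\<lparr>carrier := S\<rparr>) (elt_norm U) x y = norm_dist (U\<lparr>carrier := S\<rparr>) (elt_norm U) y x"
      using * 0[of x y] 0[of y x] m.commute by (cases "x \<in> S \<and> y \<in> S") auto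
  qed (use * linear_subspaceD(2)[OF S] m.triangle in auto)
qed

text \<open>Translates the topology of the definitions, whose metric is formed in the smaller
  structure, into \<open>conv\<close> of the ambient algebra.\<close>

lemma limitin_subspace:
  assumes S: "linear_subspace U S"
  shows "limitin (norm_topology (U\<lparr>carrier := S\<rparr>)) f x F \<longleftrightarrow>
    x \<in> S \<and> (\<forall>\<^sub>F t in F. f t \<in> S) \<and> cnv F f x"
proof -
  note SU = linear_subspaceD(2)[OF S]
  interpret m: Metric_space S "norm_dist (U\<lparr>carrier := S\<rparr>) (elt_norm U)" by (rule subspace_metric[OF S])
  have t: "norm_topology (U\<lparr>carrier := S\<rparr>) = m.mtopology" by (simp add: norm_topology_def)
  show ?thesis
    unfolding t m.limitin_metric
  proof (intro iffI conjI; (elim conjE)?)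
    assume x: "x \<in> S" and lim: "\<forall>\<epsilon>>0. \<forall>\<^sub>F t in F. f t \<in> S \<and> norm_dist (U\<lparr>carrier := S\<rparr>) (elt_norm U) (f t) x < \<epsilon>"
    show f: "\<forall>\<^sub>F t in F. f t \<in> S" using lim[rule_format, of 1] by (auto elim: eventually_mono)
    have "((\<lambda>t. elt_norm U (f t \<ominus> x)) \<longlongrightarrow> 0) F"
    proof (rule tendstoI)
      fix \<epsilon> :: real assume "\<epsilon> > 0"
      then show "\<forall>\<^sub>F t in F. dist (elt_norm U (f t \<ominus> x)) 0 < \<epsilon>"
        using lim by (auto elim!: eventually_mono allE[of _ \<epsilon>] simp: norm_dist_def x SU subspace_diff[OF S])
    qed
    then show "cnv F f x" using x f SU by (auto simp: conv_def elim: eventually_mono)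
  next
    assume x: "x \<in> S" and f: "\<forall>\<^sub>F t in F. f t \<in> S" and l: "cnv F f x"
    show "\<forall>\<epsilon>>0. \<forall>\<^sub>F t in F. f t \<in> S \<and> norm_dist (U\<lparr>carrier := S\<rparr>) (elt_norm U) (f t) x < \<epsilon>"
    proof (intro allI impI)
      fix \<epsilon> :: real assume "\<epsilon> > 0"
      then have "\<forall>\<^sub>F t in F. elt_norm U (f t \<ominus> x) < \<epsilon>"
        by (intro order_tendstoD(2)[OF convD(3)[OF l]]) auto
      with f show "\<forall>\<^sub>F t in F. f t \<in> S \<and> norm_dist (U\<lparr>carrier := S\<rparr>) (elt_norm U) (f t) x < \<epsilon>"
        by eventually_elim (simp add: norm_dist_def x SU subspace_diff[OF S])
    qed
  qed auto
qed

lemma closedin_subspace: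
  assumes S: "linear_subspace U S"
  shows "closedin (norm_topology (U\<lparr>carrier := S\<rparr>)) T \<longleftrightarrow>
    T \<subseteq> S \<and> (\<forall>\<xi> x. (\<forall>n. \<xi> n \<in> T) \<and> x \<in> S \<and> cnv sequentially \<xi> x \<longrightarrow> x \<in> T)"
proof -
  interpret m: Metric_space S "norm_dist (U\<lparr>carrier := S\<rparr>) (elt_norm U)" by (rule subspace_metric[OF S])
  have t: "norm_topology (U\<lparr>carrier := S\<rparr>) = m.mtopology" by (simp add: norm_topology_def)
  have lim: "limitin m.mtopology \<xi> x sequentially \<longleftrightarrow> x \<in> S \<and> cnv sequentially \<xi> x"
    if "range \<xi> \<subseteq> T" "T \<subseteq> S" for \<xi> x
  proof -
    have "\<xi> n \<in> S" for n using that by auto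
    then show ?thesis using limitin_subspace[OF S, unfolded t, of \<xi> x sequentially] by simp
  qed
  show ?thesis
    unfolding t m.metric_closedin_iff_sequentially_closed
  proof (rule conj_cong[OF refl], intro all_cong1)
    fix \<xi> x assume TS: "T \<subseteq> S"
    show "(range \<xi> \<subseteq> T \<and> limitin m.mtopology \<xi> x sequentially \<longrightarrow> x \<in> T) \<longleftrightarrow>
        ((\<forall>n. \<xi> n \<in> T) \<and> x \<in> S \<and> cnv sequentially \<xi> x \<longrightarrow> x \<in> T)"
      using lim[of \<xi> x, OF _ TS] by (cases "range \<xi> \<subseteq> T") (auto simp: image_subset_iff)
  qed
qed

lemma carrier_subspace: "linear_subspace U (carrier U)"
  by (auto simp: linear_subspace_def)

lemma carrier_update_self: "U\<lparr>carrier := carrier U\<rparr> = U"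
  by simp

lemma closed_subspace_iff: "closed_subspace T U \<longleftrightarrow> linear_subspace U T \<and> seq_closed U (elt_norm U) T"
proof -
  have "closedin (norm_topology U) T \<longleftrightarrow> T \<subseteq> carrier U \<and> seq_closed U (elt_norm U) T"
    using closedin_subspace[OF carrier_subspace, of T] convD(1)
    unfolding carrier_update_self seq_closed_def by blast
  then show ?thesis
    using linear_subspaceD(1) by (auto simp: closed_subspace_def submodule_iff)
qed

lemma closed_subspace_sub_iff:
  assumes S: "linear_subspace U S" "seq_closed U (elt_norm U) S" and m: "\<And>x y. x \<in> S \<Longrightarrow> y \<in> S \<Longrightarrow> x \<otimes> y \<in> S"
  shows "closed_subspace T (U\<lparr>carrier := S\<rparr>) \<longleftrightarrow>
    T \<subseteq> S \<and> linear_subspace U T \<and> seq_closed U (elt_norm U) T"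
proof -
  interpret s: complex_algebra "U\<lparr>carrier := S\<rparr>" by (rule subalgebra_complex_algebra[OF S(1) m])
  have "linear_subspace (U\<lparr>carrier := S\<rparr>) T \<longleftrightarrow> T \<subseteq> S \<and> linear_subspace U T"
    using linear_subspaceD(1)[OF S(1)] by (auto simp: linear_subspace_def)
  moreover have "closedin (norm_topology (U\<lparr>carrier := S\<rparr>)) T \<longleftrightarrow> seq_closed U (elt_norm U) T" if "T \<subseteq> S"
  proof -
    have "x \<in> S" if "\<And>n. \<xi> n \<in> T" "cnv sequentially \<xi> x" for \<xi> x
      by (rule seq_closedD[OF S(2) _ that(2)]) (use that(1) \<open>T \<subseteq> S\<close> in auto)
    then show ?thesis
      unfolding closedin_subspace[OF S(1)] seq_closed_def using that by blast
  qed
  ultimately show ?thesis by (auto simp: closed_subspace_def s.submodule_iff)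
qed

lemma cstar_subalgebra_iff: "cstar_subalgebra T U \<longleftrightarrow> linear_subspace U T \<and>
    seq_closed U (elt_norm U) T \<and> (\<forall>x\<in>T. \<forall>y\<in>T. x \<otimes> y \<in> T) \<and> (\<forall>x\<in>T. adj U x \<in> T)"
  by (auto simp: cstar_subalgebra_def closed_subalgebra_def closed_subspace_iff)

lemma cstar_subalgebraD:
  assumes "cstar_subalgebra T U"
  shows "linear_subspace U T" "seq_closed U (elt_norm U) T" "T \<subseteq> carrier U"
    "\<And>x. x \<in> T \<Longrightarrow> x \<in> carrier U"
    "\<And>x y. x \<in> T \<Longrightarrow> y \<in> T \<Longrightarrow> x \<otimes> y \<in> T" "\<And>x. x \<in> T \<Longrightarrow> adj U x \<in> T"
  using assms linear_subspaceD(1,2) unfolding cstar_subalgebra_iff by blast+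

lemma cstar_subalgebra_sub_iff:
  assumes D: "cstar_subalgebra D U"
  shows "cstar_subalgebra T (U\<lparr>carrier := D\<rparr>) \<longleftrightarrow> T \<subseteq> D \<and> cstar_subalgebra T U"
  using closed_subspace_sub_iff[OF cstar_subalgebraD(1,2,5)[OF D], of T] cstar_subalgebra_iff
  by (auto simp: cstar_subalgebra_def closed_subalgebra_def)

lemma carrier_cstar_subalgebra: "cstar_subalgebra (carrier U) U"
  using carrier_subspace convD(1) by (auto simp: cstar_subalgebra_iff seq_closed_def)

lemma generated_cstar_subalgebra:
  assumes Q: "Q \<subseteq> carrier U"
  shows "cstar_subalgebra (generated_cstar_subalgebra U Q) U"
    and "Q \<subseteq> generated_cstar_subalgebra U Q"
    and "\<And>T. cstar_subalgebra T U \<Longrightarrow> Q \<subseteq> T \<Longrightarrow> generated_cstar_subalgebra U Q \<subseteq> T"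
proof -
  let ?D = "generated_cstar_subalgebra U Q"
  have in_iff: "x \<in> ?D \<longleftrightarrow> (\<forall>T. cstar_subalgebra T U \<and> Q \<subseteq> T \<longrightarrow> x \<in> T)" for x
    by (auto simp: generated_cstar_subalgebra_def)
  show "Q \<subseteq> ?D" "\<And>T. cstar_subalgebra T U \<Longrightarrow> Q \<subseteq> T \<Longrightarrow> ?D \<subseteq> T"
    by (auto simp: generated_cstar_subalgebra_def)
  show "cstar_subalgebra ?D U"
    unfolding cstar_subalgebra_iff
  proof (intro conjI ballI)
    have "?D \<subseteq> carrier U" using carrier_cstar_subalgebra Q by (auto simp: in_iff)
    then show "linear_subspace U ?D"
      unfolding linear_subspace_def Ball_def in_iff
      using cstar_subalgebraD(1)[THEN linear_subspaceD(3)] cstar_subalgebraD(1)[THEN linear_subspaceD(4)]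
        cstar_subalgebraD(1)[THEN linear_subspaceD(5)] by auto
    show "seq_closed U (elt_norm U) ?D"
      unfolding seq_closed_def in_iff using cstar_subalgebraD(2) seq_closedD by metis
    show "x \<otimes> y \<in> ?D" if "x \<in> ?D" "y \<in> ?D" for x y
      using that cstar_subalgebraD(5) unfolding in_iff by blast
    show "adj U x \<in> ?D" if "x \<in> ?D" for x
      using that cstar_subalgebraD(6) unfolding in_iff by blast
  qed
qed

end

text \<open>Generation may be tested inside the smaller structure, because its C*-subalgebras are
  exactly the C*-subalgebras of \<open>U\<close> contained in \<open>D\<close>.\<close>

lemma generated_cstar_subalgebra_self:
  assumes "cstar_algebra U" and Q: "Q \<subseteq> carrier U"
  defines "D \<equiv> generated_cstar_subalgebra U Q"
  shows "generated_cstar_subalgebra (U\<lparr>carrier := D\<rparr>) Q = D"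
proof -
  interpret cstar_alg U using assms by unfold_locales
  note g = generated_cstar_subalgebra[OF Q, folded D_def]
  have "{T. cstar_subalgebra T (U\<lparr>carrier := D\<rparr>) \<and> Q \<subseteq> T} = {D}"
    using g cstar_subalgebra_sub_iff[OF g(1)] by blast
  then show ?thesis by (simp add: generated_cstar_subalgebra_def[of "U\<lparr>carrier := D\<rparr>"])
qed

text \<open>Closedness of the range passes from \<open>g\<close> to its matrix ampliations, since
  matrices converge entry by entry. Hence the norms of all matrix levels are pulled back by one
  hypothesis.\<close>

lemma cstar_algebra_embed:
  fixes H :: "('h, 'm) matrix_normed_alg_scheme" and W :: "('w, 'n) matrix_normed_alg_scheme"
  assumes H: "cstar_algebra H" and W: "star_algebra W" and g: "star_map W H g"
    and inj: "inj_on g (carrier W)" and closed: "seq_closed H (elt_norm H) (g ` carrier W)"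
    and norm: "\<And>n M. n \<ge> 1 \<Longrightarrow> M \<in> matrices n W \<Longrightarrow> mnorm W n M = mnorm H n (compose (matrix_index n) g M)"
  shows "cstar_algebra W"
  unfolding cstar_algebra_def
proof (intro conjI allI impI W)
  interpret H: cstar_alg H using H by unfold_locales
  interpret W: star_algebra W by (rule W)
  fix n :: nat assume n: "n \<ge> 1"
  let ?g = "compose (matrix_index n) g"
  have gap: "?g M (i, j) = g (M (i, j))" if "i < n" "j < n" for M i j
    using that by (simp add: compose_def)
  have sm: "star_map (matrix_algebra n W) (matrix_algebra n H) ?g"
    by (rule star_map_matrix[OF W H.star_algebra_axioms g])
  have "complete_cstar_norm (matrix_algebra n W) (\<lambda>M. mnorm H n (?g M))"
  proof (rule complete_cstar_norm_pullback[OF W.matrix_star_algebra H.matrix_complete[OF n] sm])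
    show "inj_on ?g (carrier (matrix_algebra n W))"
    proof (rule inj_onI)
      fix M N assume MN: "M \<in> carrier (matrix_algebra n W)" "N \<in> carrier (matrix_algebra n W)" and eq: "?g M = ?g N"
      show "M = N"
      proof (rule matrix_eqI[of _ n W])
        fix i j assume "i < n" "j < n"
        then show "M (i, j) = N (i, j)"
          using fun_cong[OF eq, of "(i, j)"] MN inj by (auto simp: gap inj_on_def)
      qed (use MN in simp_all)
    qed
    show "seq_closed (matrix_algebra n H) (mnorm H n) (?g ` carrier (matrix_algebra n W))"
      unfolding seq_closed_def
    proof (intro allI impI, elim conjE)
      fix \<xi> Y assume \<xi>: "\<forall>k. \<xi> k \<in> ?g ` carrier (matrix_algebra n W)"
        and lim: "conv (matrix_algebra n H) (mnorm H n) sequentially \<xi> Y"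
      have Y: "Y \<in> matrices n H" and
        ent: "\<And>i j. i < n \<Longrightarrow> j < n \<Longrightarrow> conv H (elt_norm H) sequentially (\<lambda>k. \<xi> k (i, j)) (Y (i, j))"
        using lim unfolding H.conv_matrix_iff[OF n] by blast+
      have im: "Y (i, j) \<in> g ` carrier W" if ij: "i < n" "j < n" for i j
      proof (rule seq_closedD[OF closed _ ent[OF ij]])
        fix k
        obtain M where "M \<in> matrices n W" "\<xi> k = ?g M" using \<xi> by (auto simp del: matrices_iff)
        then show "\<xi> k (i, j) \<in> g ` carrier W" using ij by (auto simp: gap)
      qed
      define N where "N = (\<lambda>p\<in>matrix_index n. inv_into (carrier W) g (Y p))"
      have "N \<in> carrier (matrix_algebra n W)" using im by (auto simp: N_def inv_into_into)
      moreover have "Y = ?g N"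
        using Y im by (intro matrix_eqI[of _ n H]) (auto simp: gap N_def f_inv_into_f compose_def)
      ultimately show "Y \<in> ?g ` carrier (matrix_algebra n W)" by blast
    qed
  qed
  then show "complete_cstar_norm (matrix_algebra n W) (mnorm W n)"
    by (rule complete_cstar_norm_cong) (use norm n in simp)
qed

lemma cstar_subalgebra_cstar:
  assumes U: "cstar_algebra U" and S: "cstar_subalgebra S U"
  shows "cstar_algebra (U\<lparr>carrier := S\<rparr>)"
proof -
  interpret cstar_alg U using U by unfold_locales
  note S = cstar_subalgebraD[OF S]
  show ?thesis
  proof (rule cstar_algebra_embed[OF U, of _ "\<lambda>x. x"])
    show "star_algebra (U\<lparr>carrier := S\<rparr>)" using S by (intro subalgebra_star_algebra) auto
    show "star_map (U\<lparr>carrier := S\<rparr>) U (\<lambda>x. x)" using S by (auto simp: star_map_def)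
    show "mnorm (U\<lparr>carrier := S\<rparr>) n M = mnorm U n (compose (matrix_index n) (\<lambda>x. x) M)"
      if "M \<in> matrices n (U\<lparr>carrier := S\<rparr>)" for n M
    proof -
      have "compose (matrix_index n) (\<lambda>x. x) M = M"
        using that by (intro matrix_eqI[of _ n "U\<lparr>carrier := S\<rparr>"]) (auto simp: compose_def)
      then show ?thesis by simp
    qed
  qed (use S in auto)
qed

lemma star_hom_iff: "f \<in> star_hom V Y \<longleftrightarrow> star_map V Y f"
  by (auto simp: star_hom_def algebra_hom_def hom_def star_map_def)

lemma star_map_conv:
  assumes V: "complete_cstar_norm V \<nu>" and W: "complete_cstar_norm W \<mu>" and \<phi>: "star_map V W \<phi>"
    and l: "conv V \<nu> F f x"
  shows "conv W \<mu> F (\<lambda>t. \<phi> (f t)) (\<phi> x)"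
proof -
  interpret V: complete_cstar_norm V \<nu> by fact
  interpret W: complete_cstar_norm W \<mu> by fact
  note \<phi>' = star_mapD[OF \<phi>]
  note l' = V.convD[OF l]
  show ?thesis
  proof (rule W.convI_bound[OF _ _ l'(3)])
    show "\<phi> x \<in> carrier W" using \<phi>'(1) l' by simp
    show "\<forall>\<^sub>F t in F. \<phi> (f t) \<in> carrier W \<and> \<mu> (\<phi> (f t) \<ominus>\<^bsub>W\<^esub> \<phi> x) \<le> \<nu> (f t \<ominus>\<^bsub>V\<^esub> x)"
      using l'(2)
    proof eventually_elim
      case (elim t)
      have "\<phi> (f t) \<ominus>\<^bsub>W\<^esub> \<phi> x = \<phi> (f t \<ominus>\<^bsub>V\<^esub> x)"
        using star_map_linear(3)[OF V.complex_algebra_axioms W.complex_algebra_axioms \<phi>'(1,3,4)] elim l' by simp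
      then show ?case using star_map_contractive[OF V W \<phi>, of "f t \<ominus>\<^bsub>V\<^esub> x"] elim l' \<phi>'(1) by simp
    qed
  qed
qed

text \<open>The means of spreading a property from generators to the algebra they generate: express
  it as membership of the image in a C*-subalgebra.\<close>

lemma cstar_subalgebra_vimage:
  assumes V: "cstar_algebra V" and W: "cstar_algebra W" and \<phi>: "star_map V W \<phi>"
    and T: "cstar_subalgebra T W"
  shows "cstar_subalgebra {x \<in> carrier V. \<phi> x \<in> T} V"
proof -
  interpret V: cstar_alg V using V by unfold_locales
  interpret W: cstar_alg W using W by unfold_locales
  note \<phi>' = star_mapD[OF \<phi>]
  note T' = W.cstar_subalgebraD[OF T]
  note Tl = linear_subspaceD[OF T'(1)]
  have z: "\<phi> \<zero>\<^bsub>V\<^esub> = \<zero>\<^bsub>W\<^esub>"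
    by (rule star_map_linear(1)[OF V.complex_algebra_axioms W.complex_algebra_axioms \<phi>'(1,3,4)])
  have "seq_closed V (elt_norm V) {x \<in> carrier V. \<phi> x \<in> T}"
    unfolding seq_closed_def
  proof (intro allI impI, elim conjE)
    fix \<xi> x assume \<xi>: "\<forall>n. \<xi> n \<in> {x \<in> carrier V. \<phi> x \<in> T}" and l: "conv V (elt_norm V) sequentially \<xi> x"
    have "\<phi> x \<in> T"
      by (rule seq_closedD[OF T'(2) _ star_map_conv[OF V.complete_cstar_norm_axioms W.complete_cstar_norm_axioms \<phi> l]])
        (use \<xi> in auto)
    then show "x \<in> {x \<in> carrier V. \<phi> x \<in> T}" using V.convD(1)[OF l] by simp
  qed
  then show ?thesis
    using T' Tl z by (auto simp: V.cstar_subalgebra_iff linear_subspace_def \<phi>')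
qed

section \<open>The universal property for arbitrary types\<close>

text \<open>Identities pass to a surjective image whose operations are compatible with the map.
  Nothing is presupposed about the algebra structure of \<open>W\<close>, which is the situation for
  quotients and for copies on another type.\<close>

lemma star_algebra_image:
  fixes V :: "('a, 'm) star_alg_scheme" and W :: "('b, 'n) star_alg_scheme"
  assumes V: "star_algebra V" and car: "carrier W = q ` carrier V" and zero: "\<zero>\<^bsub>W\<^esub> = q \<zero>\<^bsub>V\<^esub>"
    and q: "star_map V W q"
  shows "star_algebra W"
proof -
  interpret V: star_algebra V by fact
  note q' = star_mapD(2-5)[OF q, symmetric]
  have ab: "abelian_group W"
  proof (rule abelian_groupI)
    fix x assume "x \<in> carrier W"
    then obtain a where a: "a \<in> carrier V" "x = q a" by (auto simp: car)
    show "\<exists>y\<in>carrier W. y \<oplus>\<^bsub>W\<^esub> x = \<zero>\<^bsub>W\<^esub>"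
      using a by (intro bexI[of _ "q (\<ominus>\<^bsub>V\<^esub> a)"]) (auto simp: car zero q' V.M.l_neg)
  qed (auto simp: car zero q' V.M.a_assoc intro!: image_eqI[OF refl] arg_cong[of _ _ q] intro: V.M.a_comm)
  have "complex_algebra W"
  proof (rule complex_algebraI[OF ab])
    show "complex_algebra_axioms W"
      by unfold_locales
        (auto simp: car q' V.mult_assoc V.distr_left V.distr_right V.smult_mult_left V.smult_mult_right)
  qed (auto simp: car q' V.sm_add_left V.sm_add_right V.sm_assoc[symmetric])
  then show ?thesis
    by (rule star_algebra.intro, unfold_locales) (auto simp: car q' V.adj_simps)
qed

text \<open>Transport of structure: the subalgebra \<open>K\<close> of \<open>H\<close> is copied
  along \<open>f\<close> onto a subset of another type. It moves a target algebra to the type for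
  which the universal property is assumed.\<close>

definition transported :: "('h, 'm) matrix_normed_alg_scheme \<Rightarrow> 'h set \<Rightarrow> ('h \<Rightarrow> 'k) \<Rightarrow> 'k matrix_normed_alg" where
  "transported H K f = (let g = inv_into K f in
    \<lparr>carrier = f ` K, mult = (\<lambda>x y. f (g x \<otimes>\<^bsub>H\<^esub> g y)), one = f \<one>\<^bsub>H\<^esub>, zero = f \<zero>\<^bsub>H\<^esub>,
     add = (\<lambda>x y. f (g x \<oplus>\<^bsub>H\<^esub> g y)), smult = (\<lambda>c x. f (c \<odot>\<^bsub>H\<^esub> g x)), adj = (\<lambda>x. f (adj H (g x))),
     mnorm = (\<lambda>n M. mnorm H n (compose (matrix_index n) g M))\<rparr>)"

lemma transported_sel:
  "carrier (transported H K f) = f ` K"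
  "zero (transported H K f) = f \<zero>\<^bsub>H\<^esub>"
  "mult (transported H K f) x y = f (inv_into K f x \<otimes>\<^bsub>H\<^esub> inv_into K f y)"
  "add (transported H K f) x y = f (inv_into K f x \<oplus>\<^bsub>H\<^esub> inv_into K f y)"
  "smult (transported H K f) c x = f (c \<odot>\<^bsub>H\<^esub> inv_into K f x)"
  "adj (transported H K f) x = f (adj H (inv_into K f x))"
  "mnorm (transported H K f) n M = mnorm H n (compose (matrix_index n) (inv_into K f) M)"
  by (simp_all add: transported_def Let_def)

lemma transported_cstar:
  assumes H: "cstar_algebra H" and K: "cstar_subalgebra K H" and f: "inj_on f K"
  shows "cstar_algebra (transported H K f)"
    and "star_map (H\<lparr>carrier := K\<rparr>) (transported H K f) f"
    and "star_map (transported H K f) H (inv_into K f)"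
proof -
  interpret H: cstar_alg H using H by unfold_locales
  note K' = H.cstar_subalgebraD[OF K]
  note Kl = linear_subspaceD[OF K'(1)]
  show sf: "star_map (H\<lparr>carrier := K\<rparr>) (transported H K f) f"
    using f by (auto simp: star_map_def transported_sel inv_into_f_f)
  have "star_algebra (H\<lparr>carrier := K\<rparr>)" using K' by (intro H.subalgebra_star_algebra) auto
  then have s: "star_algebra (transported H K f)"
    by (rule star_algebra_image[OF _ _ _ sf]) (simp_all add: transported_sel)
  show g: "star_map (transported H K f) H (inv_into K f)"
    using f K' Kl by (auto simp: star_map_def transported_sel inv_into_f_f)
  have gK: "inv_into K f ` carrier (transported H K f) = K"
    using f by (auto simp: transported_sel image_iff inv_into_f_f)
  show "cstar_algebra (transported H K f)"
  proof (rule cstar_algebra_embed[OF H s g])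
    show "inj_on (inv_into K f) (carrier (transported H K f))"
      by (auto simp: transported_sel inj_on_inv_into)
    show "seq_closed H (elt_norm H) (inv_into K f ` carrier (transported H K f))"
      unfolding gK by (rule K')
  qed (simp add: transported_sel)
qed

text \<open>A point of \<open>nat \<Rightarrow> 'c\<close> encodes a sequence of such points.\<close>

definition part :: "nat \<Rightarrow> (nat \<Rightarrow> 'c) \<Rightarrow> nat \<Rightarrow> 'c" where
  "part i z = (\<lambda>k. z (prod_encode (i, k)))"

lemma part_surj: "\<exists>z. \<forall>i. part i z = zs i"
  by (rule exI[of _ "\<lambda>m. case prod_decode m of (i, k) \<Rightarrow> zs i k"]) (auto simp: part_def)

lemma (in complete_cstar_norm) conv_mult:
  assumes "conv U \<nu> F f x" "conv U \<nu> F g y"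
  shows "conv U \<nu> F (\<lambda>t. f t \<otimes> g t) (x \<otimes> y)"
proof (rule conv_mult_bounded[OF assms(2) convD(2)[OF assms(1)]])
  show "conv U \<nu> F (\<lambda>t. f t \<otimes> y) (x \<otimes> y)" by (rule conv_mult_right[OF assms(1) convD(1)[OF assms(2)]])
  have "\<forall>\<^sub>F t in F. \<nu> (f t) < \<nu> x + 1" by (rule order_tendstoD(2)[OF conv_norm[OF assms(1)]]) simp
  then show "\<forall>\<^sub>F t in F. \<nu> (f t) \<le> \<nu> x + 1" by eventually_elim simp
qed

section \<open>The size of a generated C*-algebra\<close>

context cstar_alg
begin

text \<open>Limits of limits are limits: the \<open>n\<close>-th term of a convergent sequence of
  limits is approximated within \<open>1 / Suc n\<close> by an element of \<open>T\<close>. So one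
  closure step suffices, and an element of the closure is coded by a single sequence in
  \<open>T\<close>.\<close>

lemma sequential_closure_cstar_subalgebra:
  assumes lin: "linear_subspace U T" and m: "\<And>x y. x \<in> T \<Longrightarrow> y \<in> T \<Longrightarrow> x \<otimes> y \<in> T"
    and a: "\<And>x. x \<in> T \<Longrightarrow> adj U x \<in> T"
  shows "cstar_subalgebra {x. \<exists>\<xi>. (\<forall>n. \<xi> n \<in> T) \<and> cnv sequentially \<xi> x} U"
    (is "cstar_subalgebra ?C U")
proof -
  note L = linear_subspaceD[OF lin]
  have sub: "x \<in> carrier U" if "x \<in> ?C" for x using that convD(1) by blast
  have "x \<oplus> y \<in> ?C \<and> x \<otimes> y \<in> ?C" if xy: "x \<in> ?C" "y \<in> ?C" for x y
  proof -
    obtain \<xi> \<eta> where *: "\<forall>n. \<xi> n \<in> T" "cnv sequentially \<xi> x" "\<forall>n. \<eta> n \<in> T" "cnv sequentially \<eta> y"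
      using xy by auto
    have "cnv sequentially (\<lambda>n. \<xi> n \<oplus> \<eta> n) (x \<oplus> y)" "cnv sequentially (\<lambda>n. \<xi> n \<otimes> \<eta> n) (x \<otimes> y)"
      using * conv_add conv_mult by blast+
    moreover have "\<forall>n. \<xi> n \<oplus> \<eta> n \<in> T" "\<forall>n. \<xi> n \<otimes> \<eta> n \<in> T" using * L(4) m by auto
    ultimately show ?thesis
      by (intro conjI CollectI) (rule exI[of _ "\<lambda>n. \<xi> n \<oplus> \<eta> n"] exI[of _ "\<lambda>n. \<xi> n \<otimes> \<eta> n"], simp)+
  qed
  moreover have "c \<odot> x \<in> ?C \<and> adj U x \<in> ?C" if x: "x \<in> ?C" for c x
  proof -
    obtain \<xi> where *: "\<forall>n. \<xi> n \<in> T" "cnv sequentially \<xi> x" using x by auto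
    have "cnv sequentially (\<lambda>n. c \<odot> \<xi> n) (c \<odot> x)" "cnv sequentially (\<lambda>n. adj U (\<xi> n)) (adj U x)"
      using * conv_smult conv_adj by blast+
    moreover have "\<forall>n. c \<odot> \<xi> n \<in> T" "\<forall>n. adj U (\<xi> n) \<in> T" using * L(5) a by auto
    ultimately show ?thesis
      by (intro conjI CollectI) (rule exI[of _ "\<lambda>n. c \<odot> \<xi> n"] exI[of _ "\<lambda>n. adj U (\<xi> n)"], simp)+
  qed
  moreover have "\<zero> \<in> ?C" using L(3) conv_const[of \<zero> sequentially] by (intro CollectI exI[of _ "\<lambda>_. \<zero>"]) auto
  moreover have "seq_closed U (elt_norm U) ?C"
    unfolding seq_closed_def
  proof (intro allI impI, elim conjE)
    fix \<xi> x assume \<xi>: "\<forall>n. \<xi> n \<in> ?C" and l: "cnv sequentially \<xi> x"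
    have "\<exists>y\<in>T. elt_norm U (y \<ominus> \<xi> n) < 1 / Suc n" for n
    proof -
      obtain \<eta> where \<eta>: "\<forall>n. \<eta> n \<in> T" "cnv sequentially \<eta> (\<xi> n)" using \<xi> by blast
      have "\<forall>\<^sub>F k in sequentially. elt_norm U (\<eta> k \<ominus> \<xi> n) < 1 / Suc n"
        by (rule order_tendstoD(2)[OF convD(3)[OF \<eta>(2)]]) simp
      then show ?thesis using \<eta>(1) by (auto simp: eventually_sequentially)
    qed
    then obtain y where y: "\<And>n. y n \<in> T" "\<And>n. elt_norm U (y n \<ominus> \<xi> n) < 1 / Suc n" by metis
    have "cnv sequentially y x"
    proof (rule convI_bound)
      show "x \<in> carrier U" by (rule convD(1)[OF l])
      show "(\<lambda>n. 1 / Suc n + elt_norm U (\<xi> n \<ominus> x)) \<longlonglongrightarrow> 0"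
        using tendsto_add[OF LIMSEQ_inverse_real_of_nat convD(3)[OF l]] by (simp add: inverse_eq_divide)
      have "y n \<in> carrier U \<and> elt_norm U (y n \<ominus> x) \<le> 1 / Suc n + elt_norm U (\<xi> n \<ominus> x)" for n
        using norm_diff_triangle[of "y n" "\<xi> n" x] y(1)[of n] y(2)[of n] L(2) sub \<xi> convD(1)[OF l] by fastforce
      then show "\<forall>\<^sub>F n in sequentially. y n \<in> carrier U \<and> elt_norm U (y n \<ominus> x) \<le> 1 / Suc n + elt_norm U (\<xi> n \<ominus> x)"
        by simp
    qed
    then show "x \<in> ?C" using y(1) by blast
  qed
  ultimately show ?thesis
    using sub unfolding cstar_subalgebra_iff linear_subspace_def by blast
qed

text \<open>A \<open>C\<^sup>*\<close>-algebra generated by the image of a complex vector space of type \<open>'c\<close> has at most as many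
  elements as \<open>nat \<Rightarrow> 'c\<close>: it consists of limits of sequences in the union of the sets \<open>S n\<close>.\<close>

lemma generated_small:
  fixes V :: "('c, 'n) star_alg_scheme"
  assumes V: "complex_algebra V" and \<pi>: "\<And>x. x \<in> carrier V \<Longrightarrow> \<pi> x \<in> carrier U"
    and \<pi>_sm: "\<And>c x. x \<in> carrier V \<Longrightarrow> \<pi> (c \<odot>\<^bsub>V\<^esub> x) = c \<odot> \<pi> x"
  shows "\<exists>F :: (nat \<Rightarrow> 'c) \<Rightarrow> 'a. generated_cstar_subalgebra U (\<pi> ` carrier V) \<subseteq> range F"
proof -
  interpret V: complex_algebra V by fact
  \<comment> \<open>All ring operations and the adjoint are merged into the one form
    \<open>x + y + z w + adj v\<close>. As zero belongs to every stage, each single operation is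
    recovered by inserting zeros.\<close>
  define S where "S = rec_nat (\<pi> ` carrier V)
    (\<lambda>_ S. {x \<oplus> y \<oplus> z \<otimes> w \<oplus> adj U v |x y z w v. x \<in> S \<and> y \<in> S \<and> z \<in> S \<and> w \<in> S \<and> v \<in> S})"
  have S0: "S 0 = \<pi> ` carrier V" and
    SS: "S (Suc n) = {x \<oplus> y \<oplus> z \<otimes> w \<oplus> adj U v |x y z w v. x \<in> S n \<and> y \<in> S n \<and> z \<in> S n \<and> w \<in> S n \<and> v \<in> S n}" for n
    by (simp_all add: S_def)
  have SSI: "x \<oplus> y \<oplus> z \<otimes> w \<oplus> adj U v \<in> S (Suc n)" if "x \<in> S n" "y \<in> S n" "z \<in> S n" "w \<in> S n" "v \<in> S n" for n x y z w v
    unfolding SS using that by blast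
  have SU: "x \<in> carrier U" if "x \<in> S n" for n x
    using that by (induction n arbitrary: x) (auto simp: S0 SS \<pi>)
  have \<pi>0: "\<pi> \<zero>\<^bsub>V\<^esub> = \<zero>" using \<pi>_sm[of "\<zero>\<^bsub>V\<^esub>" 0] \<pi> by simp
  have S_zero: "\<zero> \<in> S n" for n
  proof (induction n)
    case 0
    then show ?case using \<pi>0 by (force simp: S0)
  next
    case (Suc n)
    from SSI[OF this this this this this] show ?case by simp
  qed
  have op: "x \<oplus> y \<in> S (Suc n)" "x \<otimes> y \<in> S (Suc n)" "adj U x \<in> S (Suc n)" "x \<in> S (Suc n)"
    if "x \<in> S n" "y \<in> S n" for n x y
  proof -
    note z = S_zero[of n]
    show "x \<oplus> y \<in> S (Suc n)" using SSI[OF that z z z] that SU by simp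
    show "x \<otimes> y \<in> S (Suc n)" using SSI[OF z z that z] that SU by simp
    show "adj U x \<in> S (Suc n)" using SSI[OF z z z z that(1)] that SU by simp
    show "x \<in> S (Suc n)" using SSI[OF that(1) z z z z] that SU by simp
  qed
  have S_mono: "S m \<subseteq> S n" if "m \<le> n" for m n
    using that by (induction rule: dec_induct) (use op(4) in blast)+
  \<comment> \<open>Scalars need no code of their own: stage 0 is the image of a vector space and
    closed under them, and this is inherited by the later stages.\<close>
  have S_sm: "c \<odot> x \<in> S n" if "x \<in> S n" for c x n
    using that
  proof (induction n arbitrary: c x)
    case 0
    then obtain a where "a \<in> carrier V" "x = \<pi> a" by (auto simp: S0)
    then show ?case unfolding S0 using \<pi>_sm[of a c] V.sm_closed[of a c] by (metis imageI)
  next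
    case (Suc n)
    then obtain a b z w v where *: "a \<in> S n" "b \<in> S n" "z \<in> S n" "w \<in> S n" "v \<in> S n"
        "x = a \<oplus> b \<oplus> z \<otimes> w \<oplus> adj U v" by (auto simp: SS)
    then have "c \<odot> x = (c \<odot> a) \<oplus> (c \<odot> b) \<oplus> (c \<odot> z) \<otimes> w \<oplus> adj U (cnj c \<odot> v)"
      using SU by (simp add: sm_add_right adj_smult smult_mult_left)
    then show ?case using SSI[OF Suc.IH[OF *(1)] Suc.IH[OF *(2)] Suc.IH[OF *(3)] *(4) Suc.IH[OF *(5)]] by metis
  qed
  let ?T = "\<Union>n. S n"
  have common: "\<exists>n. x \<in> S n \<and> y \<in> S n" if xy: "x \<in> ?T" "y \<in> ?T" for x y
  proof -
    obtain m n where "x \<in> S m" "y \<in> S n" using xy by auto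
    then show ?thesis using S_mono[of m "max m n"] S_mono[of n "max m n"] by (intro exI[of _ "max m n"]) auto
  qed
  have T_ops: "x \<oplus> y \<in> ?T \<and> x \<otimes> y \<in> ?T" if xy: "x \<in> ?T" "y \<in> ?T" for x y
  proof -
    obtain n where "x \<in> S n" "y \<in> S n" using common[OF xy] by blast
    then have "x \<oplus> y \<in> S (Suc n)" "x \<otimes> y \<in> S (Suc n)" by (rule op)+
    then show ?thesis by blast
  qed
  have T_adj: "adj U x \<in> ?T" if x: "x \<in> ?T" for x
  proof -
    obtain n where "x \<in> S n" using x by blast
    then have "adj U x \<in> S (Suc n)" by (intro op(3)[of x n x])
    then show ?thesis by blast
  qed
  have T_lin: "linear_subspace U ?T"
    unfolding linear_subspace_def
  proof (intro conjI ballI allI)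
    show "?T \<subseteq> carrier U" using SU by blast
    show "\<zero> \<in> ?T" using S_zero by blast
    show "c \<odot> x \<in> ?T" if "x \<in> ?T" for c x using that S_sm by blast
  qed (use T_ops in blast)
  let ?C = "{x. \<exists>\<xi>. (\<forall>n. \<xi> n \<in> ?T) \<and> cnv sequentially \<xi> x}"
  have "cstar_subalgebra ?C U"
    by (rule sequential_closure_cstar_subalgebra[OF T_lin]) (use T_ops T_adj in blast)+
  moreover have "\<pi> ` carrier V \<subseteq> ?C"
  proof
    fix x assume x: "x \<in> \<pi> ` carrier V"
    then have "x \<in> ?T" using S0 by blast
    moreover have "cnv sequentially (\<lambda>_. x) x" using x \<pi> by (intro conv_const) auto
    ultimately show "x \<in> ?C" by (intro CollectI exI[of _ "\<lambda>_. x"]) simp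
  qed
  moreover have "\<pi> ` carrier V \<subseteq> carrier U" using \<pi> by blast
  ultimately have gen: "generated_cstar_subalgebra U (\<pi> ` carrier V) \<subseteq> ?C"
    by (intro generated_cstar_subalgebra(3))
  \<comment> \<open>A trivial carrier is treated apart: then \<open>'c\<close> might lack two
    distinct elements with which to code a stage number, but all stages are zero.\<close>
  have "\<exists>F0 :: (nat \<Rightarrow> 'c) \<Rightarrow> 'a. ?T \<subseteq> range F0"
  proof (cases "carrier V \<subseteq> {\<zero>\<^bsub>V\<^esub>}")
    case True
    have "S n \<subseteq> {\<zero>}" for n
    proof (induction n)
      case 0
      then show ?case using True \<pi>0 by (auto simp: S0)
    next
      case (Suc n)
      then have "S n = {\<zero>}" using S_zero by blast
      then show ?case by (auto simp: SS)
    qed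
    then show ?thesis by (intro exI[of _ "\<lambda>_. \<zero>"]) auto
  next
    case False
    then obtain a b :: 'c where ab: "a \<noteq> b" by auto
    \<comment> \<open>Decodes stage \<open>n\<close>: five parts of \<open>z\<close> code the five
      arguments of the merged operation.\<close>
    define FF where "FF = rec_nat (\<lambda>z :: nat \<Rightarrow> 'c. \<pi> (z 0))
      (\<lambda>_ F z. F (part 0 z) \<oplus> F (part 1 z) \<oplus> F (part 2 z) \<otimes> F (part 3 z) \<oplus> adj U (F (part 4 z)))"
    have FF0: "FF 0 z = \<pi> (z 0)" and FFS: "FF (Suc n) z = FF n (part 0 z) \<oplus> FF n (part 1 z)
      \<oplus> FF n (part 2 z) \<otimes> FF n (part 3 z) \<oplus> adj U (FF n (part 4 z))" for n z
      by (simp_all add: FF_def)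
    have FF: "S n \<subseteq> range (FF n)" for n
    proof (induction n)
      case 0
      show ?case
      proof
        fix x assume "x \<in> S 0"
        then obtain a where "x = \<pi> a" by (auto simp: S0)
        then have "x = FF 0 (\<lambda>_. a)" by (simp add: FF0)
        then show "x \<in> range (FF 0)" by blast
      qed
    next
      case (Suc n)
      show ?case
      proof
        fix x assume "x \<in> S (Suc n)"
        then obtain x0 x1 x2 x3 x4 where *: "x0 \<in> S n" "x1 \<in> S n" "x2 \<in> S n" "x3 \<in> S n" "x4 \<in> S n"
            "x = x0 \<oplus> x1 \<oplus> x2 \<otimes> x3 \<oplus> adj U x4" by (auto simp: SS)
        then obtain z0 z1 z2 z3 z4 where **: "x0 = FF n z0" "x1 = FF n z1" "x2 = FF n z2" "x3 = FF n z3" "x4 = FF n z4"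
          using Suc by (meson rangeE subsetD)
        obtain z where z: "\<And>i. part i z = ([z0, z1, z2, z3, z4] ! i)" using part_surj by metis
        have "x = FF (Suc n) z" by (simp add: FFS z * **)
        then show "x \<in> range (FF (Suc n))" by blast
      qed
    qed
    \<comment> \<open>Part 0 codes the number of the stage, as the first place with a value other
      than \<open>a\<close>; part 1 codes the element within that stage.\<close>
    define F0 where "F0 z = FF (LEAST m. part 0 z m \<noteq> a) (part 1 z)" for z
    have "x \<in> range F0" if xS: "x \<in> S n" for x n
    proof -
      obtain y where y: "x = FF n y" using xS FF[of n] by blast
      obtain z where z: "\<And>i. part i z = (if i = 0 then (\<lambda>m. if m = n then b else a) else y)"
        using part_surj[of "\<lambda>i. if i = 0 then (\<lambda>m. if m = n then b else a) else y"] by blast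
      have "(LEAST m. part 0 z m \<noteq> a) = n"
        by (rule Least_equality) (use ab z in \<open>auto split: if_splits\<close>)
      then have "x = F0 z" by (simp add: F0_def y z)
      then show ?thesis by blast
    qed
    then show ?thesis by (intro exI[of _ F0]) blast
  qed
  then obtain F0 :: "(nat \<Rightarrow> 'c) \<Rightarrow> 'a" where F0: "?T \<subseteq> range F0" by blast
  define F where "F z = (THE x. cnv sequentially (\<lambda>n. F0 (part n z)) x)" for z
  have "?C \<subseteq> range F"
  proof
    fix x assume "x \<in> ?C"
    then obtain \<xi> where \<xi>: "\<forall>n. \<xi> n \<in> ?T" "cnv sequentially \<xi> x" by blast
    then have "\<forall>n. \<exists>z. \<xi> n = F0 z" using F0 by blast
    then obtain zs where zs: "\<And>n. \<xi> n = F0 (zs n)" by metis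
    obtain z where z: "\<And>i. part i z = zs i" using part_surj by metis
    have "F z = x"
      unfolding F_def z zs[symmetric]
      by (rule the_equality) (rule \<xi>(2), rule conv_unique[OF _ \<xi>(2) sequentially_bot])
    then show "x \<in> range F" by blast
  qed
  then show ?thesis using gen by blast
qed

end

text \<open>The target may be replaced by the C*-algebra generated by the range of
  \<open>\<pi>\<close>, which is small enough to be copied injectively into
  \<open>nat \<Rightarrow> 'c\<close>. The extension found there is carried back by the inverse of
  the copying map.\<close>

theorem max_cstar_cover_any_type:
  fixes V :: "('c, 'm) matrix_normed_alg_scheme" and H :: "('h, 'n) matrix_normed_alg_scheme"
  assumes max: "max_cstar_cover TYPE(nat \<Rightarrow> 'c) V E j" and V: "complex_algebra V"
    and H: "cstar_algebra H" and \<pi>: "\<pi> \<in> algebra_hom V H" and cc: "completely_contractive V H \<pi>"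
  obtains \<theta> where "star_map E H \<theta>" "\<And>x. x \<in> carrier V \<Longrightarrow> \<theta> (j x) = \<pi> x"
proof -
  interpret H: cstar_alg H using H by unfold_locales
  interpret V: complex_algebra V by fact
  have \<pi>': "\<And>x. x \<in> carrier V \<Longrightarrow> \<pi> x \<in> carrier H"
    "\<And>x y. x \<in> carrier V \<Longrightarrow> y \<in> carrier V \<Longrightarrow> \<pi> (x \<otimes>\<^bsub>V\<^esub> y) = \<pi> x \<otimes>\<^bsub>H\<^esub> \<pi> y"
    "\<And>x y. x \<in> carrier V \<Longrightarrow> y \<in> carrier V \<Longrightarrow> \<pi> (x \<oplus>\<^bsub>V\<^esub> y) = \<pi> x \<oplus>\<^bsub>H\<^esub> \<pi> y"
    "\<And>c x. x \<in> carrier V \<Longrightarrow> \<pi> (c \<odot>\<^bsub>V\<^esub> x) = c \<odot>\<^bsub>H\<^esub> \<pi> x"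
    using \<pi> by (auto simp: algebra_hom_def hom_def)
  let ?K = "generated_cstar_subalgebra H (\<pi> ` carrier V)"
  have sub: "\<pi> ` carrier V \<subseteq> carrier H" using \<pi>'(1) by blast
  note K = H.generated_cstar_subalgebra(1,2)[OF sub]
  have \<pi>K: "\<pi> x \<in> ?K" if "x \<in> carrier V" for x using K(2) that by blast
  obtain F :: "(nat \<Rightarrow> 'c) \<Rightarrow> 'h" where F: "?K \<subseteq> range F"
    using H.generated_small[OF V \<pi>'(1,4)] by blast
  define f where "f x = (SOME z. F z = x)" for x
  have Ff: "F (f x) = x" if "x \<in> ?K" for x
    unfolding f_def using F that by (intro someI_ex[of "\<lambda>z. F z = x"]) blast
  have inj: "inj_on f ?K" by (rule inj_on_inverseI[of _ F]) (rule Ff)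
  let ?G = "transported H ?K f"
  note G = transported_cstar[OF H K(1) inj]
  note f' = star_mapD[OF G(2), simplified]
  have h: "(\<lambda>x. f (\<pi> x)) \<in> algebra_hom V ?G"
    using \<pi>' \<pi>K f' by (auto simp: algebra_hom_def hom_def)
  have "completely_contractive V ?G (\<lambda>x. f (\<pi> x))"
    unfolding completely_contractive_def
  proof (intro allI impI ballI)
    fix n M assume n: "(1::nat) \<le> n" and M: "M \<in> matrices n V"
    have "compose (matrix_index n) (inv_into ?K f) (compose (matrix_index n) (\<lambda>x. f (\<pi> x)) M)
        = compose (matrix_index n) \<pi> M"
      using M \<pi>K inj by (intro ext) (auto simp: compose_def inv_into_f_f)
    then show "mnorm ?G n (compose (matrix_index n) (\<lambda>x. f (\<pi> x)) M) \<le> mnorm V n M"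
      using cc n M by (simp add: transported_sel completely_contractive_def del: matrices_iff)
  qed
  then obtain \<theta> where \<theta>: "\<theta> \<in> star_hom E ?G" "\<And>x. x \<in> carrier V \<Longrightarrow> \<theta> (j x) = f (\<pi> x)"
    using max G(1) h unfolding max_cstar_cover_def by blast
  note \<theta>' = star_mapD[OF \<theta>(1)[unfolded star_hom_iff]]
  note g' = star_mapD[OF G(3)]
  show thesis
  proof (rule that[of "\<lambda>x. inv_into ?K f (\<theta> x)"])
    show "star_map E H (\<lambda>x. inv_into ?K f (\<theta> x))"
      using \<theta>' g' by (auto simp: star_map_def)
    show "inv_into ?K f (\<theta> (j x)) = \<pi> x" if "x \<in> carrier V" for x
      using \<theta>(2)[OF that] \<pi>K[OF that] inj by (simp add: inv_into_f_f)
  qed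
qed

section \<open>Multiplier algebras\<close>

text \<open>Convergence is asked for only along a subsequence. This suits quotients, where one
  passes to a subsequence with summable differences in order to lift it.\<close>

lemma complete_cstar_normI:
  fixes W :: "('a, 'm) star_alg_scheme"
  assumes W: "star_algebra W"
    and nonneg: "\<And>x. x \<in> carrier W \<Longrightarrow> 0 \<le> \<mu> x"
    and eq0: "\<And>x. x \<in> carrier W \<Longrightarrow> \<mu> x = 0 \<longleftrightarrow> x = \<zero>\<^bsub>W\<^esub>"
    and tri: "\<And>x y. \<lbrakk>x \<in> carrier W; y \<in> carrier W\<rbrakk> \<Longrightarrow> \<mu> (x \<oplus>\<^bsub>W\<^esub> y) \<le> \<mu> x + \<mu> y"
    and sm: "\<And>c x. x \<in> carrier W \<Longrightarrow> \<mu> (c \<odot>\<^bsub>W\<^esub> x) = cmod c * \<mu> x"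
    and mult: "\<And>x y. \<lbrakk>x \<in> carrier W; y \<in> carrier W\<rbrakk> \<Longrightarrow> \<mu> (x \<otimes>\<^bsub>W\<^esub> y) \<le> \<mu> x * \<mu> y"
    and cs: "\<And>x. x \<in> carrier W \<Longrightarrow> \<mu> (adj W x \<otimes>\<^bsub>W\<^esub> x) = (\<mu> x)\<^sup>2"
    and complete: "\<And>\<xi> :: nat \<Rightarrow> 'a. (\<And>n. \<xi> n \<in> carrier W) \<Longrightarrow>
      (\<And>\<epsilon>. \<epsilon> > 0 \<Longrightarrow> \<exists>N. \<forall>m\<ge>N. \<forall>n\<ge>N. \<mu> (\<xi> m \<ominus>\<^bsub>W\<^esub> \<xi> n) < \<epsilon>) \<Longrightarrow>
      \<exists>x\<in>carrier W. \<exists>r. strict_mono r \<and> (\<lambda>n::nat. \<mu> (\<xi> (r n) \<ominus>\<^bsub>W\<^esub> x)) \<longlonglongrightarrow> 0"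
  shows "complete_cstar_norm W \<mu>"
proof -
  interpret star_algebra W by fact
  have neg: "\<mu> (\<ominus>\<^bsub>W\<^esub> x) = \<mu> x" if "x \<in> carrier W" for x using that by (simp add: minus_sm sm)
  have comm: "\<mu> (x \<ominus>\<^bsub>W\<^esub> y) = \<mu> (y \<ominus>\<^bsub>W\<^esub> x)" if "x \<in> carrier W" "y \<in> carrier W" for x y
    using that neg[of "y \<ominus>\<^bsub>W\<^esub> x"] by (simp add: M.minus_eq M.minus_add M.a_comm)
  have d0: "\<mu> (x \<ominus>\<^bsub>W\<^esub> y) = 0 \<longleftrightarrow> x = y" if "x \<in> carrier W" "y \<in> carrier W" for x y
  proof
    assume "\<mu> (x \<ominus>\<^bsub>W\<^esub> y) = 0"
    then have "x \<ominus>\<^bsub>W\<^esub> y = \<zero>\<^bsub>W\<^esub>" using that eq0 by simp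
    then show "x = y" using that by (metis M.add.inv_solve_right M.l_zero M.minus_eq M.zero_closed)
  qed (use that eq0 in \<open>simp add: M.minus_eq M.r_neg\<close>)
  have dt: "\<mu> (x \<ominus>\<^bsub>W\<^esub> z) \<le> \<mu> (x \<ominus>\<^bsub>W\<^esub> y) + \<mu> (y \<ominus>\<^bsub>W\<^esub> z)"
    if "x \<in> carrier W" "y \<in> carrier W" "z \<in> carrier W" for x y z
  proof -
    have "x \<ominus>\<^bsub>W\<^esub> z = (x \<ominus>\<^bsub>W\<^esub> y) \<oplus>\<^bsub>W\<^esub> (y \<ominus>\<^bsub>W\<^esub> z)"
      using that by (intro eq_by_functionals) (auto simp: functionalD)
    then show ?thesis using tri[of "x \<ominus>\<^bsub>W\<^esub> y" "y \<ominus>\<^bsub>W\<^esub> z"] that by simp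
  qed
  have met: "Metric_space (carrier W) (norm_dist W \<mu>)"
    by unfold_locales (auto simp: norm_dist_def nonneg comm d0 dt)
  then interpret m: Metric_space "carrier W" "norm_dist W \<mu>" .
  have "m.mcomplete"
    unfolding m.mcomplete_def
  proof (intro allI impI)
    fix \<xi> assume C: "m.MCauchy \<xi>"
    then have \<xi>: "\<And>n. \<xi> n \<in> carrier W" by (auto simp: m.MCauchy_def)
    have "\<exists>N. \<forall>k\<ge>N. \<forall>n\<ge>N. \<mu> (\<xi> k \<ominus>\<^bsub>W\<^esub> \<xi> n) < \<epsilon>" if "\<epsilon> > 0" for \<epsilon>
      using C that \<xi> unfolding m.MCauchy_def by (force simp: norm_dist_def)
    then obtain x r where x: "x \<in> carrier W" "strict_mono r" "(\<lambda>n::nat. \<mu> (\<xi> (r n) \<ominus>\<^bsub>W\<^esub> x)) \<longlonglongrightarrow> 0"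
      using complete[of \<xi>] \<xi> by blast
    have "limitin m.mtopology (\<xi> \<circ> r) x sequentially"
      unfolding m.limitin_metric
    proof (intro conjI allI impI)
      fix \<epsilon> :: real assume "\<epsilon> > 0"
      then have "\<forall>\<^sub>F n in sequentially. \<mu> (\<xi> (r n) \<ominus>\<^bsub>W\<^esub> x) < \<epsilon>"
        by (rule order_tendstoD(2)[OF x(3)])
      then show "\<forall>\<^sub>F n in sequentially. (\<xi> \<circ> r) n \<in> carrier W \<and> norm_dist W \<mu> ((\<xi> \<circ> r) n) x < \<epsilon>"
        by eventually_elim (use x \<xi> in \<open>simp add: norm_dist_def\<close>)
    qed (use x in auto)
    then show "\<exists>x. limitin m.mtopology \<xi> x sequentially"
      using m.MCauchy_convergent_subsequence[OF C x(2)] by blast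
  qed
  then show ?thesis
    using W by (simp add: complete_cstar_norm_def complete_cstar_norm_axioms_def nonneg eq0 tri sm mult cs)
qed

subsection \<open>Adjointable operators\<close>

text \<open>Adjointness for the algebra-valued inner product \<open>adj(x) y\<close>, which makes
  the algebra a Hilbert module over itself. Its adjointable operators are the multipliers of the
  algebra, acting from the left.\<close>

definition adjoint_pair :: "('a, 'm) star_alg_scheme \<Rightarrow> ('a \<Rightarrow> 'a) \<Rightarrow> ('a \<Rightarrow> 'a) \<Rightarrow> bool" where
  "adjoint_pair V T S \<longleftrightarrow> (\<forall>x\<in>carrier V. T x \<in> carrier V \<and> S x \<in> carrier V) \<and>
     (\<forall>x\<in>carrier V. \<forall>y\<in>carrier V. adj V x \<otimes>\<^bsub>V\<^esub> T y = adj V (S x) \<otimes>\<^bsub>V\<^esub> y)"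

definition bounded_op :: "('a, 'm) star_alg_scheme \<Rightarrow> ('a \<Rightarrow> real) \<Rightarrow> ('a \<Rightarrow> 'a) \<Rightarrow> bool" where
  "bounded_op V \<nu> T \<longleftrightarrow> (\<exists>K. \<forall>x\<in>carrier V. \<nu> (T x) \<le> K * \<nu> x)"

definition adjointable :: "('a, 'm) star_alg_scheme \<Rightarrow> ('a \<Rightarrow> real) \<Rightarrow> ('a \<Rightarrow> 'a) star_alg" where
  "adjointable V \<nu> =
    \<lparr>carrier = {T \<in> extensional (carrier V). (\<exists>S. adjoint_pair V T S) \<and> bounded_op V \<nu> T},
     mult = (\<lambda>T S. \<lambda>x\<in>carrier V. T (S x)),
     one = (\<lambda>x\<in>carrier V. x),
     zero = (\<lambda>x\<in>carrier V. \<zero>\<^bsub>V\<^esub>),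
     add = (\<lambda>T S. \<lambda>x\<in>carrier V. T x \<oplus>\<^bsub>V\<^esub> S x),
     smult = (\<lambda>c T. \<lambda>x\<in>carrier V. c \<odot>\<^bsub>V\<^esub> T x),
     adj = (\<lambda>T. \<lambda>x\<in>carrier V. THE z. z \<in> carrier V \<and> (\<forall>y\<in>carrier V. adj V z \<otimes>\<^bsub>V\<^esub> y = adj V x \<otimes>\<^bsub>V\<^esub> T y))\<rparr>"

definition op_norm :: "('a, 'm) star_alg_scheme \<Rightarrow> ('a \<Rightarrow> real) \<Rightarrow> ('a \<Rightarrow> 'a) \<Rightarrow> real" where
  "op_norm V \<nu> T = Inf {K. 0 \<le> K \<and> (\<forall>x\<in>carrier V. \<nu> (T x) \<le> K * \<nu> x)}"

lemma adjointable_sel: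
  "carrier (adjointable V \<nu>) = {T \<in> extensional (carrier V). (\<exists>S. adjoint_pair V T S) \<and> bounded_op V \<nu> T}"
  "mult (adjointable V \<nu>) T S = (\<lambda>x\<in>carrier V. T (S x))"
  "zero (adjointable V \<nu>) = (\<lambda>x\<in>carrier V. \<zero>\<^bsub>V\<^esub>)"
  "add (adjointable V \<nu>) T S = (\<lambda>x\<in>carrier V. T x \<oplus>\<^bsub>V\<^esub> S x)"
  "smult (adjointable V \<nu>) c T = (\<lambda>x\<in>carrier V. c \<odot>\<^bsub>V\<^esub> T x)"
  "adj (adjointable V \<nu>) T = (\<lambda>x\<in>carrier V. THE z. z \<in> carrier V \<and> (\<forall>y\<in>carrier V. adj V z \<otimes>\<^bsub>V\<^esub> y = adj V x \<otimes>\<^bsub>V\<^esub> T y))"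
  by (simp_all add: adjointable_def)

lemma adjoint_pairD:
  assumes "adjoint_pair V T S"
  shows "\<And>x. x \<in> carrier V \<Longrightarrow> T x \<in> carrier V" "\<And>x. x \<in> carrier V \<Longrightarrow> S x \<in> carrier V"
    "\<And>x y. x \<in> carrier V \<Longrightarrow> y \<in> carrier V \<Longrightarrow> adj V x \<otimes>\<^bsub>V\<^esub> T y = adj V (S x) \<otimes>\<^bsub>V\<^esub> y"
  using assms by (auto simp: adjoint_pair_def)

context complete_cstar_norm
begin

lemma eq_by_left_mult:
  assumes "a \<in> carrier U" "b \<in> carrier U" and eq: "\<And>z. z \<in> carrier U \<Longrightarrow> adj U z \<otimes> a = adj U z \<otimes> b"
  shows "a = b"
proof -
  have "a \<ominus> b = \<zero>"
  proof (rule mult_eq_zeroI)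
    fix z assume "z \<in> carrier U"
    then show "z \<otimes> (a \<ominus> b) = \<zero>" using eq[of "adj U z"] assms(1,2) by (simp add: distr_minus)
  qed (use assms in auto)
  then show ?thesis using norm_diff_eq_zero[of a b] assms by simp
qed

lemma eq_by_right_mult:
  assumes "a \<in> carrier U" "b \<in> carrier U" and eq: "\<And>z. z \<in> carrier U \<Longrightarrow> a \<otimes> z = b \<otimes> z"
  shows "a = b"
proof -
  have "adj U a = adj U b"
  proof (rule eq_by_left_mult)
    fix z assume "z \<in> carrier U"
    then show "adj U z \<otimes> adj U a = adj U z \<otimes> adj U b"
      using eq[of z] assms by (simp add: adj_mult[symmetric])
  qed (use assms in auto)
  then show ?thesis using assms adj_adj by metis
qed

lemma adjoint_pair_sym:
  assumes p: "adjoint_pair U T S"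
  shows "adjoint_pair U S T"
proof -
  note p' = adjoint_pairD[OF p]
  have "adj U x \<otimes> S y = adj U (T x) \<otimes> y" if "x \<in> carrier U" "y \<in> carrier U" for x y
  proof -
    have "adj U (adj U y \<otimes> T x) = adj U (adj U (S y) \<otimes> x)" using p'(3)[OF that(2,1)] by (rule arg_cong)
    then show ?thesis using that p'(1,2) by (simp add: adj_mult)
  qed
  then show ?thesis using p' by (simp add: adjoint_pair_def)
qed

text \<open>No linearity is built into \<open>adjoint_pair\<close>. It follows because
  multiplication by \<open>adj z\<close> moves the operator to the other factor, and elements are
  separated by such products.\<close>

lemma adjoint_pair_linear:
  assumes p: "adjoint_pair U T S"
  shows "\<And>x y. \<lbrakk>x \<in> carrier U; y \<in> carrier U\<rbrakk> \<Longrightarrow> T (x \<oplus> y) = T x \<oplus> T y"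
    and "\<And>c x. x \<in> carrier U \<Longrightarrow> T (c \<odot> x) = c \<odot> T x"
    and "\<lbrakk>finite I; g \<in> I \<rightarrow> carrier U\<rbrakk> \<Longrightarrow> T (\<Oplus>i\<in>I. g i) = (\<Oplus>i\<in>I. T (g i))"
proof -
  note p' = adjoint_pairD[OF p]
  show 1: "T (x \<oplus> y) = T x \<oplus> T y" if "x \<in> carrier U" "y \<in> carrier U" for x y
    by (rule eq_by_left_mult) (use that p' in \<open>auto simp: distr_right\<close>)
  show 2: "T (c \<odot> x) = c \<odot> T x" if "x \<in> carrier U" for c x
    by (rule eq_by_left_mult) (use that p' in \<open>auto simp: smult_mult_right\<close>)
  show "\<lbrakk>finite I; g \<in> I \<rightarrow> carrier U\<rbrakk> \<Longrightarrow> T (\<Oplus>i\<in>I. g i) = (\<Oplus>i\<in>I. T (g i))"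
    by (rule star_map_linear(4)[OF complex_algebra_axioms complex_algebra_axioms p'(1) 1 2])
qed

text \<open>The square of the norm of \<open>S x\<close> is the norm of
  \<open>adj(x) T (S x)\<close>; one factor of the norm of \<open>S x\<close> cancels.\<close>

lemma adjoint_bound:
  assumes p: "adjoint_pair U T S" and K: "\<And>x. x \<in> carrier U \<Longrightarrow> \<nu> (T x) \<le> K * \<nu> x" and x: "x \<in> carrier U"
  shows "\<nu> (S x) \<le> K * \<nu> x"
proof (cases "\<nu> (S x) = 0")
  case True
  have "0 \<le> K * \<nu> x" using K[OF x] norm_nonneg[OF adjoint_pairD(1)[OF p x]] by linarith
  then show ?thesis using True by simp
next
  case False
  note p' = adjoint_pairD[OF p]
  have pos: "\<nu> (S x) > 0" using False norm_nonneg[OF p'(2)[OF x]] by linarith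
  have "(\<nu> (S x))\<^sup>2 = \<nu> (adj U x \<otimes> T (S x))" using p' x by (simp add: cstar_identity)
  also have "\<dots> \<le> \<nu> x * \<nu> (T (S x))" using norm_mult[of "adj U x" "T (S x)"] p' x by simp
  also have "\<dots> \<le> \<nu> x * (K * \<nu> (S x))" using K p' x by (intro mult_left_mono) auto
  finally have "\<nu> (S x) * \<nu> (S x) \<le> (K * \<nu> x) * \<nu> (S x)" by (simp add: power2_eq_square mult_ac)
  then show ?thesis using pos by simp
qed

lemma adjointable_intro:
  assumes "T \<in> extensional (carrier U)" "adjoint_pair U T S" "\<And>x. x \<in> carrier U \<Longrightarrow> \<nu> (T x) \<le> K * \<nu> x"
  shows "T \<in> carrier (adjointable U \<nu>)"
  using assms by (auto simp: adjointable_sel bounded_op_def)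

lemma adjoint_unique:
  assumes p: "adjoint_pair U T S"
  shows "adj (adjointable U \<nu>) T = restrict S (carrier U)"
  unfolding adjointable_sel
proof (rule restrict_ext)
  fix x assume x: "x \<in> carrier U"
  note p' = adjoint_pairD[OF p]
  show "(THE z. z \<in> carrier U \<and> (\<forall>y\<in>carrier U. adj U z \<otimes> y = adj U x \<otimes> T y)) = S x"
  proof (rule the_equality)
    fix z assume z: "z \<in> carrier U \<and> (\<forall>y\<in>carrier U. adj U z \<otimes> y = adj U x \<otimes> T y)"
    have "adj U z = adj U (S x)" by (rule eq_by_right_mult) (use z p' x in auto)
    then show "z = S x" using z p'(2)[OF x] adj_adj by metis
  qed (use p' x in auto)
qed

lemma adjointableD:
  assumes T: "T \<in> carrier (adjointable U \<nu>)"
  shows "T \<in> extensional (carrier U)" "adjoint_pair U T (adj (adjointable U \<nu>) T)"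
    "\<And>x. x \<in> carrier U \<Longrightarrow> T x \<in> carrier U" "0 \<le> op_norm U \<nu> T"
    "\<And>x. x \<in> carrier U \<Longrightarrow> \<nu> (T x) \<le> op_norm U \<nu> T * \<nu> x"
    "adj (adjointable U \<nu>) T \<in> carrier (adjointable U \<nu>)"
proof -
  obtain S where S: "adjoint_pair U T S" and ext: "T \<in> extensional (carrier U)"
    and b: "bounded_op U \<nu> T" using T by (auto simp: adjointable_sel)
  show "T \<in> extensional (carrier U)" by fact
  show pair: "adjoint_pair U T (adj (adjointable U \<nu>) T)"
    unfolding adjoint_unique[OF S] using S by (simp add: adjoint_pair_def)
  show TU: "T x \<in> carrier U" if "x \<in> carrier U" for x using adjoint_pairD(1)[OF S that] .
  obtain K where K: "\<And>x. x \<in> carrier U \<Longrightarrow> \<nu> (T x) \<le> K * \<nu> x" using b by (auto simp: bounded_op_def)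
  let ?A = "{K. 0 \<le> K \<and> (\<forall>x\<in>carrier U. \<nu> (T x) \<le> K * \<nu> x)}"
  have "\<nu> (T x) \<le> \<bar>K\<bar> * \<nu> x" if "x \<in> carrier U" for x
    by (rule order_trans[OF K[OF that] mult_right_mono]) (use that in auto)
  then have ne: "\<bar>K\<bar> \<in> ?A" by auto
  then have ne: "?A \<noteq> {}" by blast
  show "0 \<le> op_norm U \<nu> T" unfolding op_norm_def by (rule cInf_greatest[OF ne]) simp
  show "\<nu> (T x) \<le> op_norm U \<nu> T * \<nu> x" if x: "x \<in> carrier U" for x
  proof (cases "\<nu> x = 0")
    case True
    then show ?thesis using K[OF x] by simp
  next
    case False
    then have pos: "\<nu> x > 0" using norm_nonneg[OF x] by linarith
    have "\<nu> (T x) / \<nu> x \<le> op_norm U \<nu> T"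
      unfolding op_norm_def
    proof (rule cInf_greatest[OF ne])
      fix L assume "L \<in> ?A"
      then show "\<nu> (T x) / \<nu> x \<le> L" using pos x by (simp add: pos_divide_le_eq)
    qed
    then show ?thesis using pos by (simp add: pos_divide_le_eq)
  qed
  show "adj (adjointable U \<nu>) T \<in> carrier (adjointable U \<nu>)"
    using adjoint_bound[OF pair K]
    by (intro adjointable_intro[OF _ adjoint_pair_sym[OF pair]]) (auto simp: adjointable_sel)
qed

lemma op_norm_le:
  assumes "0 \<le> K" "\<And>x. x \<in> carrier U \<Longrightarrow> \<nu> (T x) \<le> K * \<nu> x"
  shows "op_norm U \<nu> T \<le> K"
  unfolding op_norm_def by (rule cInf_lower) (use assms in \<open>auto intro: bdd_belowI[of _ 0]\<close>)

lemma adjointable_eqI: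
  assumes "T \<in> carrier (adjointable U \<nu>)" "S \<in> carrier (adjointable U \<nu>)" "\<And>x. x \<in> carrier U \<Longrightarrow> T x = S x"
  shows "T = S"
  using assms by (intro extensionalityI[of T "carrier U" S]) (auto simp: adjointable_sel)

lemma adjointable_star_algebra: "star_algebra (adjointable U \<nu>)"
proof -
  let ?A = "adjointable U \<nu>"
  note D = adjointableD
  note sel = adjointable_sel(2-5)
  have add: "T \<oplus>\<^bsub>?A\<^esub> S \<in> carrier ?A \<and> adjoint_pair U (T \<oplus>\<^bsub>?A\<^esub> S) (\<lambda>x. adj ?A T x \<oplus> adj ?A S x)"
    if T: "T \<in> carrier ?A" and S: "S \<in> carrier ?A" for T S
  proof -
    note t = adjoint_pairD[OF D(2)[OF T]] and s = adjoint_pairD[OF D(2)[OF S]]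
    have p: "adjoint_pair U (T \<oplus>\<^bsub>?A\<^esub> S) (\<lambda>x. adj ?A T x \<oplus> adj ?A S x)"
      using t s by (auto simp: adjoint_pair_def sel distr_left distr_right adj_add)
    moreover have "\<nu> ((T \<oplus>\<^bsub>?A\<^esub> S) x) \<le> (op_norm U \<nu> T + op_norm U \<nu> S) * \<nu> x" if "x \<in> carrier U" for x
      using norm_triangle[of "T x" "S x"] D(5)[OF T that] D(5)[OF S that] t s that
      by (simp add: sel distrib_right)
    ultimately show ?thesis by (intro conjI adjointable_intro[OF _ p]) (auto simp: sel)
  qed
  have smul: "c \<odot>\<^bsub>?A\<^esub> T \<in> carrier ?A \<and> adjoint_pair U (c \<odot>\<^bsub>?A\<^esub> T) (\<lambda>x. cnj c \<odot> adj ?A T x)"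
    if T: "T \<in> carrier ?A" for c T
  proof -
    note t = adjoint_pairD[OF D(2)[OF T]]
    have p: "adjoint_pair U (c \<odot>\<^bsub>?A\<^esub> T) (\<lambda>x. cnj c \<odot> adj ?A T x)"
      using t by (auto simp: adjoint_pair_def sel smult_mult_left smult_mult_right adj_smult)
    moreover have "\<nu> ((c \<odot>\<^bsub>?A\<^esub> T) x) \<le> (cmod c * op_norm U \<nu> T) * \<nu> x" if "x \<in> carrier U" for x
      using D(5)[OF T that] t that by (simp add: sel norm_smult mult.assoc mult_left_mono)
    ultimately show ?thesis by (intro conjI adjointable_intro[OF _ p]) (auto simp: sel)
  qed
  have mul: "T \<otimes>\<^bsub>?A\<^esub> S \<in> carrier ?A \<and> adjoint_pair U (T \<otimes>\<^bsub>?A\<^esub> S) (\<lambda>x. adj ?A S (adj ?A T x))"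
    if T: "T \<in> carrier ?A" and S: "S \<in> carrier ?A" for T S
  proof -
    note t = adjoint_pairD[OF D(2)[OF T]] and s = adjoint_pairD[OF D(2)[OF S]]
    have p: "adjoint_pair U (T \<otimes>\<^bsub>?A\<^esub> S) (\<lambda>x. adj ?A S (adj ?A T x))"
      using t s by (auto simp: adjoint_pair_def sel)
    moreover have "\<nu> ((T \<otimes>\<^bsub>?A\<^esub> S) x) \<le> (op_norm U \<nu> T * op_norm U \<nu> S) * \<nu> x" if x: "x \<in> carrier U" for x
      using D(5)[OF T s(1)[OF x]] mult_left_mono[OF D(5)[OF S x] D(4)[OF T]] x
      by (simp add: sel mult.assoc)
    ultimately show ?thesis by (intro conjI adjointable_intro[OF _ p]) (auto simp: sel)
  qed
  have pz: "adjoint_pair U \<zero>\<^bsub>?A\<^esub> (\<lambda>x. \<zero>)" by (auto simp: adjoint_pair_def sel)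
  have z: "\<zero>\<^bsub>?A\<^esub> \<in> carrier ?A"
    by (rule adjointable_intro[OF _ pz, of 0]) (auto simp: sel)
  have ab: "abelian_group ?A"
  proof (rule abelian_groupI)
    fix T assume T: "T \<in> carrier ?A"
    show "\<exists>S\<in>carrier ?A. S \<oplus>\<^bsub>?A\<^esub> T = \<zero>\<^bsub>?A\<^esub>"
      using smul[OF T, of "-1"] D(3)[OF T]
      by (intro bexI[of _ "(-1) \<odot>\<^bsub>?A\<^esub> T"]) (auto simp: sel sm_minus_one M.l_neg)
    show "\<zero>\<^bsub>?A\<^esub> \<oplus>\<^bsub>?A\<^esub> T = T"
      using add[OF z T] T D(3)[OF T] by (intro adjointable_eqI) (auto simp: sel)
    fix S assume S: "S \<in> carrier ?A"
    show "T \<oplus>\<^bsub>?A\<^esub> S \<in> carrier ?A" using add[OF T S] by blast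
    show "T \<oplus>\<^bsub>?A\<^esub> S = S \<oplus>\<^bsub>?A\<^esub> T"
      unfolding sel by (rule restrict_ext) (simp add: D(3)[OF T] D(3)[OF S] M.a_comm)
    fix R assume R: "R \<in> carrier ?A"
    show "T \<oplus>\<^bsub>?A\<^esub> S \<oplus>\<^bsub>?A\<^esub> R = T \<oplus>\<^bsub>?A\<^esub> (S \<oplus>\<^bsub>?A\<^esub> R)"
      unfolding sel by (rule restrict_ext) (simp add: D(3)[OF T] D(3)[OF S] D(3)[OF R] M.a_assoc)
  qed (rule z)
  have "complex_algebra ?A"
  proof (rule complex_algebraI[OF ab])
    fix a T assume T: "T \<in> carrier ?A"
    show "a \<odot>\<^bsub>?A\<^esub> T \<in> carrier ?A" using smul[OF T] by blast
    show "1 \<odot>\<^bsub>?A\<^esub> T = T" using smul[OF T] T D(3)[OF T] by (intro adjointable_eqI) (auto simp: sel)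
    show "(a + b) \<odot>\<^bsub>?A\<^esub> T = a \<odot>\<^bsub>?A\<^esub> T \<oplus>\<^bsub>?A\<^esub> b \<odot>\<^bsub>?A\<^esub> T" "(a * b) \<odot>\<^bsub>?A\<^esub> T = a \<odot>\<^bsub>?A\<^esub> (b \<odot>\<^bsub>?A\<^esub> T)" for b
      unfolding sel by (rule restrict_ext, simp add: D(3)[OF T] sm_add_left sm_assoc)+
    fix S assume S: "S \<in> carrier ?A"
    show "a \<odot>\<^bsub>?A\<^esub> (T \<oplus>\<^bsub>?A\<^esub> S) = a \<odot>\<^bsub>?A\<^esub> T \<oplus>\<^bsub>?A\<^esub> a \<odot>\<^bsub>?A\<^esub> S"
      unfolding sel by (rule restrict_ext) (simp add: D(3)[OF T] D(3)[OF S] sm_add_right)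
  next
    show "complex_algebra_axioms ?A"
    proof
      fix T S assume T: "T \<in> carrier ?A" and S: "S \<in> carrier ?A"
      note l = adjoint_pair_linear[OF D(2)[OF T]]
      show "T \<otimes>\<^bsub>?A\<^esub> S \<in> carrier ?A" using mul[OF T S] by blast
      show "c \<odot>\<^bsub>?A\<^esub> T \<otimes>\<^bsub>?A\<^esub> S = c \<odot>\<^bsub>?A\<^esub> (T \<otimes>\<^bsub>?A\<^esub> S)" "T \<otimes>\<^bsub>?A\<^esub> (c \<odot>\<^bsub>?A\<^esub> S) = c \<odot>\<^bsub>?A\<^esub> (T \<otimes>\<^bsub>?A\<^esub> S)" for c
        unfolding sel by (rule restrict_ext, simp add: D(3)[OF S] l)+
      fix R assume R: "R \<in> carrier ?A"
      show "T \<otimes>\<^bsub>?A\<^esub> S \<otimes>\<^bsub>?A\<^esub> R = T \<otimes>\<^bsub>?A\<^esub> (S \<otimes>\<^bsub>?A\<^esub> R)"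
        unfolding sel by (rule restrict_ext) (simp add: D(3)[OF R])
      show "(T \<oplus>\<^bsub>?A\<^esub> S) \<otimes>\<^bsub>?A\<^esub> R = T \<otimes>\<^bsub>?A\<^esub> R \<oplus>\<^bsub>?A\<^esub> S \<otimes>\<^bsub>?A\<^esub> R"
        unfolding sel by (rule restrict_ext) (simp add: D(3)[OF R])
      show "R \<otimes>\<^bsub>?A\<^esub> (T \<oplus>\<^bsub>?A\<^esub> S) = R \<otimes>\<^bsub>?A\<^esub> T \<oplus>\<^bsub>?A\<^esub> R \<otimes>\<^bsub>?A\<^esub> S"
        unfolding sel by (rule restrict_ext)
          (simp add: D(3)[OF T] D(3)[OF S] adjoint_pair_linear[OF D(2)[OF R]])
    qed
  qed
  then show ?thesis
  proof (rule star_algebra.intro)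
    show "star_algebra_axioms ?A"
    proof
      fix T assume T: "T \<in> carrier ?A"
      show "adj ?A T \<in> carrier ?A" by (rule D(6)[OF T])
      show "adj ?A (adj ?A T) = T"
        using adjoint_unique[OF adjoint_pair_sym[OF D(2)[OF T]]] D(1)[OF T] by (simp add: extensional_restrict)
      show "adj ?A (c \<odot>\<^bsub>?A\<^esub> T) = cnj c \<odot>\<^bsub>?A\<^esub> adj ?A T" for c
        using adjoint_unique[OF conjunct2[OF smul[OF T]]] by (simp add: sel)
      fix S assume S: "S \<in> carrier ?A"
      show "adj ?A (T \<oplus>\<^bsub>?A\<^esub> S) = adj ?A T \<oplus>\<^bsub>?A\<^esub> adj ?A S"
        using adjoint_unique[OF conjunct2[OF add[OF T S]]] by (simp add: sel)
      show "adj ?A (T \<otimes>\<^bsub>?A\<^esub> S) = adj ?A S \<otimes>\<^bsub>?A\<^esub> adj ?A T"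
        using adjoint_unique[OF conjunct2[OF mul[OF T S]]] by (simp add: sel)
    qed
  qed
qed

lemma adjointable_complete: "complete_cstar_norm (adjointable U \<nu>) (op_norm U \<nu>)"
proof (rule complete_cstar_normI[OF adjointable_star_algebra])
  let ?A = "adjointable U \<nu>" and ?n = "op_norm U \<nu>"
  interpret A: star_algebra ?A by (rule adjointable_star_algebra)
  note D = adjointableD
  note sel = adjointable_sel(2-5)
  fix T assume T: "T \<in> carrier ?A"
  note t = adjoint_pairD[OF D(2)[OF T]]
  show "0 \<le> ?n T" by (rule D(4)[OF T])
  show "?n T = 0 \<longleftrightarrow> T = \<zero>\<^bsub>?A\<^esub>"
  proof
    assume 0: "?n T = 0"
    have "T x = \<zero>" if x: "x \<in> carrier U" for x
      using D(5)[OF T x] norm_nonneg[OF D(3)[OF T x]] norm_eq_zero[OF D(3)[OF T x]] by (simp add: 0)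
    then show "T = \<zero>\<^bsub>?A\<^esub>" using T A.M.zero_closed by (intro adjointable_eqI) (auto simp: sel)
  next
    assume "T = \<zero>\<^bsub>?A\<^esub>"
    then have "?n T \<le> 0" by (intro op_norm_le) (auto simp: sel)
    then show "?n T = 0" using D(4)[OF T] by simp
  qed
  have le: "?n (c \<odot>\<^bsub>?A\<^esub> T) \<le> cmod c * ?n T" if T: "T \<in> carrier ?A" for c T
    using D(3,4,5)[OF T] by (intro op_norm_le) (auto simp: sel norm_smult mult.assoc intro!: mult_left_mono)
  show "?n (c \<odot>\<^bsub>?A\<^esub> T) = cmod c * ?n T" for c
  proof (rule antisym[OF le[OF T]])
    show "cmod c * ?n T \<le> ?n (c \<odot>\<^bsub>?A\<^esub> T)"
    proof (cases "c = 0")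
      case False
      have "inverse c \<odot>\<^bsub>?A\<^esub> (c \<odot>\<^bsub>?A\<^esub> T) = T" using False T by (simp add: A.sm_assoc)
      then have "?n T \<le> cmod (inverse c) * ?n (c \<odot>\<^bsub>?A\<^esub> T)"
        using le[of "c \<odot>\<^bsub>?A\<^esub> T" "inverse c"] T by simp
      then have "cmod c * ?n T \<le> cmod c * (cmod (inverse c) * ?n (c \<odot>\<^bsub>?A\<^esub> T))"
        by (intro mult_left_mono) auto
      also have "\<dots> = ?n (c \<odot>\<^bsub>?A\<^esub> T)" using False by (simp add: norm_inverse)
      finally show ?thesis .
    qed (use D(4)[of "c \<odot>\<^bsub>?A\<^esub> T"] T in simp)
  qed
  have mult: "?n (T \<otimes>\<^bsub>?A\<^esub> S) \<le> ?n T * ?n S" if T: "T \<in> carrier ?A" and S: "S \<in> carrier ?A" for T S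
  proof (rule op_norm_le)
    fix x assume x: "x \<in> carrier U"
    show "\<nu> ((T \<otimes>\<^bsub>?A\<^esub> S) x) \<le> ?n T * ?n S * \<nu> x"
      using D(5)[OF T D(3)[OF S x]] mult_left_mono[OF D(5)[OF S x] D(4)[OF T]] x
      by (simp add: sel mult.assoc)
  qed (use D(4) T S in auto)
  have adj_le: "?n (adj ?A T) \<le> ?n T" if T: "T \<in> carrier ?A" for T
    by (rule op_norm_le[OF D(4)[OF T]]) (rule adjoint_bound[OF D(2)[OF T] D(5)[OF T]])
  show "?n (adj ?A T \<otimes>\<^bsub>?A\<^esub> T) = (?n T)\<^sup>2"
  proof (rule antisym)
    have "?n (adj ?A T \<otimes>\<^bsub>?A\<^esub> T) \<le> ?n (adj ?A T) * ?n T" using T by (intro mult) auto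
    also have "\<dots> \<le> ?n T * ?n T" using adj_le[OF T] D(4)[OF T] by (intro mult_right_mono)
    finally show "?n (adj ?A T \<otimes>\<^bsub>?A\<^esub> T) \<le> (?n T)\<^sup>2" by (simp add: power2_eq_square)
    let ?P = "adj ?A T \<otimes>\<^bsub>?A\<^esub> T"
    have P: "?P \<in> carrier ?A" using T by simp
    \<comment> \<open>The identity \<open>adj(T x) (T x) = adj(P x) x\<close>, for \<open>P\<close>
      the operator \<open>?P\<close>, bounds the square of the norm of \<open>T x\<close> by the
      norm of \<open>P\<close>.\<close>
    have "?n T \<le> sqrt (?n ?P)"
    proof (rule op_norm_le)
      fix x assume x: "x \<in> carrier U"
      have "(\<nu> (T x))\<^sup>2 = \<nu> (adj U (T x) \<otimes> T x)" using t(1)[OF x] by (rule cstar_identity[symmetric])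
      also have "\<dots> = \<nu> (adj U (adj ?A T (T x)) \<otimes> x)"
        using t(3)[OF t(1)[OF x] x] by simp
      also have "\<dots> \<le> \<nu> (?P x) * \<nu> x"
        using norm_mult[of "adj U (?P x)" x] D(3)[OF P x] x by (simp add: sel)
      also have "\<dots> \<le> ?n ?P * \<nu> x * \<nu> x" using D(5)[OF P x] x by (intro mult_right_mono) auto
      also have "\<dots> = (sqrt (?n ?P) * \<nu> x)\<^sup>2" using D(4)[OF P] by (simp add: power2_eq_square)
      finally show "\<nu> (T x) \<le> sqrt (?n ?P) * \<nu> x" 
        by (rule power2_le_imp_le) (use D(4)[OF P] x in simp)
    qed (use D(4)[OF P] in simp)
    then have "(?n T)\<^sup>2 \<le> (sqrt (?n ?P))\<^sup>2" using D(4)[OF T] by (intro power_mono)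
    then show "(?n T)\<^sup>2 \<le> ?n ?P" using D(4)[OF P] by simp
  qed
  fix S assume S: "S \<in> carrier ?A"
  show "?n (T \<otimes>\<^bsub>?A\<^esub> S) \<le> ?n T * ?n S" by (rule mult[OF T S])
  show "?n (T \<oplus>\<^bsub>?A\<^esub> S) \<le> ?n T + ?n S"
  proof (rule op_norm_le)
    fix x assume x: "x \<in> carrier U"
    show "\<nu> ((T \<oplus>\<^bsub>?A\<^esub> S) x) \<le> (?n T + ?n S) * \<nu> x"
      using norm_triangle[OF D(3)[OF T x] D(3)[OF S x]] D(5)[OF T x] D(5)[OF S x] x
      by (simp add: sel distrib_right)
  qed (use D(4) T S in auto)
next
  let ?A = "adjointable U \<nu>" and ?n = "op_norm U \<nu>"
  interpret A: star_algebra ?A by (rule adjointable_star_algebra)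
  note D = adjointableD
  note sel = adjointable_sel(2-5)
  have diff: "(T \<ominus>\<^bsub>?A\<^esub> S) x = T x \<ominus> S x" if "T \<in> carrier ?A" "S \<in> carrier ?A" "x \<in> carrier U" for T S x
    by (rule star_map_linear(3)[OF A.complex_algebra_axioms complex_algebra_axioms, of "\<lambda>T. T x"])
      (use that D(3) in \<open>auto simp: sel\<close>)
  fix \<xi> :: "nat \<Rightarrow> 'a \<Rightarrow> 'a" assume \<xi>: "\<And>n. \<xi> n \<in> carrier ?A"
    and C: "\<And>\<epsilon>. \<epsilon> > 0 \<Longrightarrow> \<exists>N. \<forall>m\<ge>N. \<forall>n\<ge>N. ?n (\<xi> m \<ominus>\<^bsub>?A\<^esub> \<xi> n) < \<epsilon>"
  have Cx: "\<exists>y. conv U \<nu> sequentially (\<lambda>n. \<eta> n x) y"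
    if \<eta>: "\<And>n. \<eta> n \<in> carrier ?A" and x: "x \<in> carrier U"
      and C: "\<And>\<epsilon>. \<epsilon> > 0 \<Longrightarrow> \<exists>N. \<forall>m\<ge>N. \<forall>n\<ge>N. ?n (\<eta> m \<ominus>\<^bsub>?A\<^esub> \<eta> n) < \<epsilon>" for x \<eta>
  proof -
    have "\<exists>N. \<forall>m\<ge>N. \<forall>n\<ge>N. \<nu> (\<eta> m x \<ominus> \<eta> n x) < \<epsilon>" if "\<epsilon> > 0" for \<epsilon>
    proof -
      have pos: "\<nu> x + 1 > 0" using norm_nonneg[OF x] by linarith
      then obtain N where N: "\<forall>m\<ge>N. \<forall>n\<ge>N. ?n (\<eta> m \<ominus>\<^bsub>?A\<^esub> \<eta> n) < \<epsilon> / (\<nu> x + 1)"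
        using C[of "\<epsilon> / (\<nu> x + 1)"] \<open>\<epsilon> > 0\<close> by auto
      have "\<nu> (\<eta> m x \<ominus> \<eta> n x) < \<epsilon>" if "m \<ge> N" "n \<ge> N" for m n
      proof -
        have d: "\<eta> m \<ominus>\<^bsub>?A\<^esub> \<eta> n \<in> carrier ?A" using \<eta> by simp
        have "\<nu> (\<eta> m x \<ominus> \<eta> n x) \<le> ?n (\<eta> m \<ominus>\<^bsub>?A\<^esub> \<eta> n) * \<nu> x"
          using D(5)[OF d x] diff[OF \<eta> \<eta> x] by simp
        also have "\<dots> \<le> ?n (\<eta> m \<ominus>\<^bsub>?A\<^esub> \<eta> n) * (\<nu> x + 1)" using D(4)[OF d] by (intro mult_left_mono) auto
        also have "\<dots> < \<epsilon> / (\<nu> x + 1) * (\<nu> x + 1)" using N that pos by (intro mult_strict_right_mono) auto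
        finally show ?thesis using pos by simp
      qed
      then show ?thesis by blast
    qed
    then obtain y where "conv U \<nu> sequentially (\<lambda>n. \<eta> n x) y"
      using Cauchy_converges[of "\<lambda>n. \<eta> n x"] D(3)[OF \<eta> x] by metis
    then show ?thesis by blast
  qed
  have adj_n: "?n (adj ?A T) \<le> ?n T" if T: "T \<in> carrier ?A" for T
    by (rule op_norm_le[OF D(4)[OF T]]) (rule adjoint_bound[OF D(2)[OF T] D(5)[OF T]])
  \<comment> \<open>The adjoints form a Cauchy sequence as well, so that the pointwise limit comes
    with a candidate for its adjoint.\<close>
  have C': "\<exists>N. \<forall>m\<ge>N. \<forall>n\<ge>N. ?n (adj ?A (\<xi> m) \<ominus>\<^bsub>?A\<^esub> adj ?A (\<xi> n)) < \<epsilon>" if "\<epsilon> > 0" for \<epsilon>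
  proof -
    have "?n (adj ?A (\<xi> m) \<ominus>\<^bsub>?A\<^esub> adj ?A (\<xi> n)) \<le> ?n (\<xi> m \<ominus>\<^bsub>?A\<^esub> \<xi> n)" for m n
      using adj_n[of "\<xi> m \<ominus>\<^bsub>?A\<^esub> \<xi> n"] \<xi> by (simp add: A.adj_diff)
    then show ?thesis using C[OF that] by (meson le_less_trans)
  qed
  have "\<forall>x. \<exists>y. x \<in> carrier U \<longrightarrow> conv U \<nu> sequentially (\<lambda>n. \<xi> n x) y" using Cx[OF \<xi> _ C] by blast
  then obtain T0 where T0: "\<And>x. x \<in> carrier U \<Longrightarrow> conv U \<nu> sequentially (\<lambda>n. \<xi> n x) (T0 x)" by metis
  have "\<forall>x. \<exists>y. x \<in> carrier U \<longrightarrow> conv U \<nu> sequentially (\<lambda>n. adj ?A (\<xi> n) x) y"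
    using Cx[OF D(6)[OF \<xi>] _ C'] by blast
  then obtain S where S: "\<And>x. x \<in> carrier U \<Longrightarrow> conv U \<nu> sequentially (\<lambda>n. adj ?A (\<xi> n) x) (S x)" by metis
  define T where "T = restrict T0 (carrier U)"
  have T: "conv U \<nu> sequentially (\<lambda>n. \<xi> n x) (T x)" if "x \<in> carrier U" for x
    using T0[OF that] that by (simp add: T_def)
  have pair: "adjoint_pair U T S"
    unfolding adjoint_pair_def
  proof (intro conjI ballI)
    fix x assume x: "x \<in> carrier U"
    show "T x \<in> carrier U" "S x \<in> carrier U" using convD(1)[OF T[OF x]] convD(1)[OF S[OF x]] by auto
    fix y assume y: "y \<in> carrier U"
    have 1: "conv U \<nu> sequentially (\<lambda>n. adj U x \<otimes> \<xi> n y) (adj U x \<otimes> T y)"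
      using conv_mult_left[OF T[OF y], of "adj U x"] x by simp
    have "adj U x \<otimes> \<xi> n y = adj U (adj ?A (\<xi> n) x) \<otimes> y" for n
      using adjoint_pairD(3)[OF D(2)[OF \<xi>] x y] .
    moreover have "conv U \<nu> sequentially (\<lambda>n. adj U (adj ?A (\<xi> n) x) \<otimes> y) (adj U (S x) \<otimes> y)"
      by (rule conv_mult_right[OF conv_adj[OF S[OF x]] y])
    ultimately have 2: "conv U \<nu> sequentially (\<lambda>n. adj U x \<otimes> \<xi> n y) (adj U (S x) \<otimes> y)" by simp
    show "adj U x \<otimes> T y = adj U (S x) \<otimes> y"
      by (rule conv_unique[OF 1 2 sequentially_bot])
  qed
  note TU = adjoint_pairD(1)[OF pair]
  \<comment> \<open>Let \<open>m\<close> tend to infinity in the Cauchy estimate: pointwise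
    convergence becomes uniform on the unit ball, that is, convergence in the operator norm.\<close>
  have unif: "\<exists>N. \<forall>n\<ge>N. \<forall>x\<in>carrier U. \<nu> (\<xi> n x \<ominus> T x) \<le> \<epsilon> * \<nu> x" if e0: "\<epsilon> > 0" for \<epsilon>
  proof -
    obtain N where N: "\<forall>m\<ge>N. \<forall>n\<ge>N. ?n (\<xi> m \<ominus>\<^bsub>?A\<^esub> \<xi> n) < \<epsilon>" using C[OF e0] by blast
    have "\<nu> (\<xi> n x \<ominus> T x) \<le> \<epsilon> * \<nu> x" if n: "n \<ge> N" and x: "x \<in> carrier U" for n x
    proof (rule conv_norm_le)
      show "conv U \<nu> sequentially (\<lambda>m. \<xi> n x \<ominus> \<xi> m x) (\<xi> n x \<ominus> T x)"
        by (rule conv_diff[OF conv_const[OF D(3)[OF \<xi> x]] T[OF x]])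
      have "\<nu> (\<xi> n x \<ominus> \<xi> m x) \<le> \<epsilon> * \<nu> x" if m: "m \<ge> N" for m
      proof -
        have d: "\<xi> n \<ominus>\<^bsub>?A\<^esub> \<xi> m \<in> carrier ?A" using \<xi> by simp
        have "\<nu> (\<xi> n x \<ominus> \<xi> m x) \<le> ?n (\<xi> n \<ominus>\<^bsub>?A\<^esub> \<xi> m) * \<nu> x"
          using D(5)[OF d x] diff[OF \<xi> \<xi> x] by simp
        also have "\<dots> \<le> \<epsilon> * \<nu> x" using N n m x by (intro mult_right_mono) (auto simp: less_imp_le)
        finally show ?thesis .
      qed
      then show "\<forall>\<^sub>F m in sequentially. \<nu> (\<xi> n x \<ominus> \<xi> m x) \<le> \<epsilon> * \<nu> x"
        by (auto simp: eventually_sequentially)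
    qed simp
    then show ?thesis by blast
  qed
  obtain N where N: "\<forall>n\<ge>N. \<forall>x\<in>carrier U. \<nu> (\<xi> n x \<ominus> T x) \<le> 1 * \<nu> x" using unif[of 1] by auto
  have TA: "T \<in> carrier ?A"
  proof (rule adjointable_intro[OF _ pair])
    fix x assume x: "x \<in> carrier U"
    have "\<nu> (T x) \<le> \<nu> (\<xi> N x) + \<nu> (T x \<ominus> \<xi> N x)"
      using TU[OF x] D(3)[OF \<xi> x] by (intro norm_le_diff)
    also have "\<nu> (T x \<ominus> \<xi> N x) \<le> 1 * \<nu> x" using N x norm_diff_comm[OF TU[OF x] D(3)[OF \<xi> x]] by auto
    also have "\<nu> (\<xi> N x) \<le> ?n (\<xi> N) * \<nu> x" by (rule D(5)[OF \<xi> x])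
    finally show "\<nu> (T x) \<le> (?n (\<xi> N) + 1) * \<nu> x" by (simp add: distrib_right)
  qed (simp add: T_def)
  have "(\<lambda>n. ?n (\<xi> n \<ominus>\<^bsub>?A\<^esub> T)) \<longlonglongrightarrow> 0"
  proof (rule tendstoI)
    fix \<epsilon> :: real assume \<epsilon>: "\<epsilon> > 0"
    obtain N where N: "\<forall>n\<ge>N. \<forall>x\<in>carrier U. \<nu> (\<xi> n x \<ominus> T x) \<le> \<epsilon> / 2 * \<nu> x" using unif[of "\<epsilon> / 2"] \<epsilon> by auto
    have "dist (?n (\<xi> n \<ominus>\<^bsub>?A\<^esub> T)) 0 < \<epsilon>" if n: "n \<ge> N" for n
    proof -
      have d: "\<xi> n \<ominus>\<^bsub>?A\<^esub> T \<in> carrier ?A" using \<xi> TA by simp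
      have "?n (\<xi> n \<ominus>\<^bsub>?A\<^esub> T) \<le> \<epsilon> / 2"
        using N n \<epsilon> diff[OF \<xi> TA] by (intro op_norm_le) auto
      then show ?thesis using D(4)[OF d] \<epsilon> by simp
    qed
    then show "\<forall>\<^sub>F n in sequentially. dist (?n (\<xi> n \<ominus>\<^bsub>?A\<^esub> T)) 0 < \<epsilon>"
      by (auto simp: eventually_sequentially)
  qed
  then show "\<exists>T\<in>carrier ?A. \<exists>r. strict_mono r \<and> (\<lambda>n::nat. ?n (\<xi> (r n) \<ominus>\<^bsub>?A\<^esub> T)) \<longlonglongrightarrow> 0"
    using TA by (intro bexI[of _ T] exI[of _ "\<lambda>n. n"]) (auto simp: strict_mono_def)
qed

end

subsection \<open>Matrix norms on the multiplier algebra\<close>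

definition matrix_action :: "('a, 'm) matrix_normed_alg_scheme \<Rightarrow> nat \<Rightarrow> (nat \<times> nat \<Rightarrow> 'a \<Rightarrow> 'a) \<Rightarrow>
    (nat \<times> nat \<Rightarrow> 'a) \<Rightarrow> nat \<times> nat \<Rightarrow> 'a" where
  "matrix_action H n M = (\<lambda>Y\<in>matrices n H. \<lambda>(i, k)\<in>matrix_index n. \<Oplus>\<^bsub>H\<^esub>j\<in>{..<n}. M (i, j) (Y (j, k)))"

text \<open>Matrices over the multipliers are normed as operators on \<open>M_n(H)\<close>: the
  algebra \<open>M_n\<close> over the multipliers of \<open>H\<close> is placed inside the
  multipliers of \<open>M_n(H)\<close>.\<close>

definition multiplier_algebra :: "('a, 'm) matrix_normed_alg_scheme \<Rightarrow> ('a \<Rightarrow> 'a) matrix_normed_alg" where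
  "multiplier_algebra H = (let A = adjointable H (elt_norm H) in
    \<lparr>carrier = carrier A, mult = mult A, one = one A, zero = zero A, add = add A, smult = smult A,
     adj = adj A, mnorm = (\<lambda>n M. op_norm (matrix_algebra n H) (mnorm H n) (matrix_action H n M))\<rparr>)"

lemma multiplier_algebra_sel:
  "carrier (multiplier_algebra H) = carrier (adjointable H (elt_norm H))"
  "mult (multiplier_algebra H) = mult (adjointable H (elt_norm H))"
  "zero (multiplier_algebra H) = zero (adjointable H (elt_norm H))"
  "add (multiplier_algebra H) = add (adjointable H (elt_norm H))"
  "smult (multiplier_algebra H) = smult (adjointable H (elt_norm H))"
  "adj (multiplier_algebra H) = adj (adjointable H (elt_norm H))"
  "mnorm (multiplier_algebra H) n M = op_norm (matrix_algebra n H) (mnorm H n) (matrix_action H n M)"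
  by (simp_all add: multiplier_algebra_def Let_def)

context cstar_alg
begin

abbreviation (input) mult_alg :: "('a \<Rightarrow> 'a) matrix_normed_alg" where
  "mult_alg \<equiv> multiplier_algebra U"

lemma star_map_adjointable_multiplier:
  "star_map (adjointable U (elt_norm U)) mult_alg (\<lambda>T. T)"
  "star_map mult_alg (adjointable U (elt_norm U)) (\<lambda>T. T)"
  by (auto simp: star_map_def multiplier_algebra_sel
      star_algebra.adj_closed[OF adjointable_star_algebra])

lemma multiplier_star_algebra: "star_algebra mult_alg"
  by (rule star_algebra_image[OF adjointable_star_algebra _ _ star_map_adjointable_multiplier(1)])
    (simp_all add: multiplier_algebra_sel)

lemma multiplierD:
  assumes T: "T \<in> carrier mult_alg"
  shows "adjoint_pair U T (adj mult_alg T)" "\<And>x. x \<in> carrier U \<Longrightarrow> T x \<in> carrier U"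
    "\<And>x. x \<in> carrier U \<Longrightarrow> elt_norm U (T x) \<le> op_norm U (elt_norm U) T * elt_norm U x"
    "0 \<le> op_norm U (elt_norm U) T" "T \<in> extensional (carrier U)"
    "\<And>I g. finite I \<Longrightarrow> g \<in> I \<rightarrow> carrier U \<Longrightarrow> T (\<Oplus>i\<in>I. g i) = (\<Oplus>i\<in>I. T (g i))" "T \<zero> = \<zero>"
proof -
  have T': "T \<in> carrier (adjointable U (elt_norm U))" using T by (simp add: multiplier_algebra_sel)
  note D = adjointableD[OF T']
  show p: "adjoint_pair U T (adj mult_alg T)" using D(2) by (simp add: multiplier_algebra_sel)
  show "\<And>x. x \<in> carrier U \<Longrightarrow> T x \<in> carrier U"
    "\<And>x. x \<in> carrier U \<Longrightarrow> elt_norm U (T x) \<le> op_norm U (elt_norm U) T * elt_norm U x"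
    "0 \<le> op_norm U (elt_norm U) T" "T \<in> extensional (carrier U)"
    by (rule D; assumption)+
  show "\<And>I g. finite I \<Longrightarrow> g \<in> I \<rightarrow> carrier U \<Longrightarrow> T (\<Oplus>i\<in>I. g i) = (\<Oplus>i\<in>I. T (g i))"
    by (rule adjoint_pair_linear(3)[OF p])
  show "T \<zero> = \<zero>" using adjoint_pair_linear(2)[OF p, of \<zero> 0] D(3)[of \<zero>] by simp
qed

lemma matrix_action_apply:
  "Y \<in> matrices n U \<Longrightarrow> i < n \<Longrightarrow> k < n \<Longrightarrow>
    matrix_action U n M Y (i, k) = (\<Oplus>j\<in>{..<n}. M (i, j) (Y (j, k)))"
  by (simp add: matrix_action_def del: matrices_iff)

definition multiplier_entries :: "nat \<Rightarrow> (nat \<times> nat \<Rightarrow> 'a \<Rightarrow> 'a) \<Rightarrow> bool" where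
  "multiplier_entries n M \<longleftrightarrow> (\<forall>i<n. \<forall>j<n. M (i, j) \<in> carrier mult_alg)"

lemma multiplier_entriesD:
  "multiplier_entries n M \<Longrightarrow> i < n \<Longrightarrow> j < n \<Longrightarrow> M (i, j) \<in> carrier mult_alg"
  by (simp add: multiplier_entries_def)

lemma matrix_action_closed:
  assumes M: "multiplier_entries n M" and Y: "Y \<in> matrices n U"
  shows "matrix_action U n M Y \<in> matrices n U"
proof -
  have "matrix_action U n M Y (i, k) \<in> carrier U" if "i < n" "k < n" for i k
    unfolding matrix_action_apply[OF Y that]
    using Y that by (auto simp: multiplierD(2)[OF multiplier_entriesD[OF M]] intro!: M.finsum_closed)
  moreover have "matrix_action U n M Y \<in> extensional (matrix_index n)"
    using Y by (simp add: matrix_action_def del: matrices_iff)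
  ultimately show ?thesis by simp
qed

lemma matrix_mult_apply:
  assumes "i < n" "k < n"
  shows "(M \<otimes>\<^bsub>matrix_algebra n U\<^esub> N) (i, k) = (\<Oplus>j\<in>{..<n}. M (i, j) \<otimes> N (j, k))"
  using assms by simp

lemma matrix_adj_apply:
  assumes "i < n" "k < n"
  shows "adj (matrix_algebra n U) M (i, k) = adj U (M (k, i))"
  using assms by simp

lemma matrix_action_pair:
  assumes M: "multiplier_entries n M"
  shows "adjoint_pair (matrix_algebra n U) (matrix_action U n M)
    (matrix_action U n (\<lambda>(i, j). adj mult_alg (M (j, i))))"
    (is "adjoint_pair ?V ?T ?S")
proof -
  interpret m: star_algebra mult_alg by (rule multiplier_star_algebra)
  interpret v: star_algebra ?V by (rule matrix_star_algebra)
  let ?N = "\<lambda>(i, j). adj mult_alg (M (j, i))"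
  have N: "multiplier_entries n ?N" using M by (simp add: multiplier_entries_def)
  note Me = multiplier_entriesD[OF M] and Ne = multiplier_entriesD[OF N]
  note Tc = matrix_action_closed[OF M] and Sc = matrix_action_closed[OF N]
  have "adj ?V x \<otimes>\<^bsub>?V\<^esub> ?T y = adj ?V (?S x) \<otimes>\<^bsub>?V\<^esub> y" if x: "x \<in> matrices n U" and y: "y \<in> matrices n U" for x y
  proof (rule matrix_eqI[of _ n U])
    have c: "x \<in> carrier ?V" "y \<in> carrier ?V" "?T y \<in> carrier ?V" "?S x \<in> carrier ?V"
      using x y Tc[OF y] Sc[OF x] by (simp_all only: matrix_sel(1))
    show "adj ?V x \<otimes>\<^bsub>?V\<^esub> ?T y \<in> matrices n U" "adj ?V (?S x) \<otimes>\<^bsub>?V\<^esub> y \<in> matrices n U"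
      using v.mult_closed[OF v.adj_closed[OF c(1)] c(3)] v.mult_closed[OF v.adj_closed[OF c(4)] c(2)]
      by (simp_all only: matrix_sel(1))
    fix i k assume ik: "i < n" "k < n"
    have xe: "x (j, l) \<in> carrier U" "y (j, l) \<in> carrier U" if "j < n" "l < n" for j l using x y that by auto
    have Mc: "M (j, l) z \<in> carrier U" "adj mult_alg (M (j, l)) z \<in> carrier U" if "j < n" "l < n" "z \<in> carrier U" for j l z
      using multiplierD(2)[OF Me[OF that(1,2)] that(3)] multiplierD(2)[OF Ne[OF that(2,1)] that(3)] by auto
    have "(adj ?V x \<otimes>\<^bsub>?V\<^esub> ?T y) (i, k) = (\<Oplus>j\<in>{..<n}. adj U (x (j, i)) \<otimes> (\<Oplus>l\<in>{..<n}. M (j, l) (y (l, k))))"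
      unfolding matrix_mult_apply[OF ik]
      using ik x y xe Mc by (intro M.finsum_cong') (auto simp: matrix_adj_apply matrix_action_apply
          simp del: matrix_sel matrices_iff intro!: M.finsum_closed)
    also have "\<dots> = (\<Oplus>l\<in>{..<n}. adj U (\<Oplus>j\<in>{..<n}. adj mult_alg (M (j, l)) (x (j, i))) \<otimes> y (l, k))"
    proof (rule eq_by_functionals)
      fix f assume f: "functional U f"
      have "f (\<Oplus>j\<in>{..<n}. adj U (x (j, i)) \<otimes> (\<Oplus>l\<in>{..<n}. M (j, l) (y (l, k))))
          = (\<Sum>j<n. f (adj U (x (j, i)) \<otimes> (\<Oplus>l\<in>{..<n}. M (j, l) (y (l, k)))))"
        using ik xe Mc by (intro functional_finsum[OF f]) (auto intro!: M.finsum_closed)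
      also have "\<dots> = (\<Sum>j<n. \<Sum>l<n. f (adj U (x (j, i)) \<otimes> M (j, l) (y (l, k))))"
        using ik xe Mc by (intro sum.cong refl functional_finsum[OF functional_mult_left[OF f]]) auto
      also have "\<dots> = (\<Sum>l<n. \<Sum>j<n. f (adj U (adj mult_alg (M (j, l)) (x (j, i))) \<otimes> y (l, k)))"
        using ik xe by (subst sum.swap) (auto intro!: sum.cong simp: adjoint_pairD(3)[OF multiplierD(1)[OF Me]])
      also have "\<dots> = (\<Sum>l<n. f ((\<Oplus>j\<in>{..<n}. adj U (adj mult_alg (M (j, l)) (x (j, i)))) \<otimes> y (l, k)))"
        using ik xe Mc
        by (intro sum.cong refl functional_finsum[OF functional_mult_right[OF f], symmetric]) auto
      also have "\<dots> = (\<Sum>l<n. f (adj U (\<Oplus>j\<in>{..<n}. adj mult_alg (M (j, l)) (x (j, i))) \<otimes> y (l, k)))"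
        using ik xe Mc by (intro sum.cong refl) (simp add: adj_finsum Pi_iff)
      also have "\<dots> = f (\<Oplus>l\<in>{..<n}. adj U (\<Oplus>j\<in>{..<n}. adj mult_alg (M (j, l)) (x (j, i))) \<otimes> y (l, k))"
        using ik xe Mc by (intro functional_finsum[OF f, symmetric]) (auto intro!: M.finsum_closed)
      finally show "f (\<Oplus>j\<in>{..<n}. adj U (x (j, i)) \<otimes> (\<Oplus>l\<in>{..<n}. M (j, l) (y (l, k))))
        = f (\<Oplus>l\<in>{..<n}. adj U (\<Oplus>j\<in>{..<n}. adj mult_alg (M (j, l)) (x (j, i))) \<otimes> y (l, k))" .
    qed (use ik xe Mc in \<open>auto intro!: M.finsum_closed\<close>)
    also have "\<dots> = (adj ?V (?S x) \<otimes>\<^bsub>?V\<^esub> y) (i, k)"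
      unfolding matrix_mult_apply[OF ik]
      using ik x y xe Mc by (intro M.finsum_cong') (auto simp: matrix_adj_apply matrix_action_apply
          simp del: matrix_sel matrices_iff intro!: M.finsum_closed)
    finally show "(adj ?V x \<otimes>\<^bsub>?V\<^esub> ?T y) (i, k) = (adj ?V (?S x) \<otimes>\<^bsub>?V\<^esub> y) (i, k)" .
  qed
  note main = this
  show ?thesis
    unfolding adjoint_pair_def matrix_sel(1)
    by (intro conjI ballI) (rule Tc Sc main; assumption)+
qed

lemma matrix_action_adjointable:
  assumes n: "n \<ge> 1" and M: "multiplier_entries n M"
  shows "matrix_action U n M \<in> carrier (adjointable (matrix_algebra n U) (mnorm U n))"
proof -
  interpret v: complete_cstar_norm "matrix_algebra n U" "mnorm U n" using n by (rule matrix_complete)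
  note Me = multiplier_entriesD[OF M]
  define K where "K = (\<Sum>p\<in>matrix_index n. \<Sum>j<n. op_norm U (elt_norm U) (M (fst p, j)))"
  have "mnorm U n (matrix_action U n M Y) \<le> K * mnorm U n Y" if Y: "Y \<in> matrices n U" for Y
  proof -
    have "mnorm U n (matrix_action U n M Y) \<le> (\<Sum>p\<in>matrix_index n. elt_norm U (matrix_action U n M Y p))"
      by (rule norm_le_entries[OF matrix_action_closed[OF M Y] n])
    also have "\<dots> \<le> (\<Sum>p\<in>matrix_index n. \<Sum>j<n. op_norm U (elt_norm U) (M (fst p, j)) * mnorm U n Y)"
    proof (rule sum_mono)
      fix p assume "p \<in> matrix_index n"
      then obtain i k where p: "p = (i, k)" and ik: "i \<in> {..<n}" "k \<in> {..<n}" by auto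
      have "elt_norm U (matrix_action U n M Y (i, k)) \<le> (\<Sum>j<n. elt_norm U (M (i, j) (Y (j, k))))"
        using ik Y by (subst matrix_action_apply[OF Y]) (auto simp: multiplierD(2)[OF Me] intro!: norm_finsum)
      also have "\<dots> \<le> (\<Sum>j<n. op_norm U (elt_norm U) (M (i, j)) * mnorm U n Y)"
      proof (rule sum_mono)
        fix j assume j: "j \<in> {..<n}"
        have "elt_norm U (M (i, j) (Y (j, k))) \<le> op_norm U (elt_norm U) (M (i, j)) * elt_norm U (Y (j, k))"
          using ik j Y by (intro multiplierD(3)[OF Me]) auto
        also have "\<dots> \<le> op_norm U (elt_norm U) (M (i, j)) * mnorm U n Y"
          using ik j by (intro mult_left_mono norm_entry_le[OF Y] multiplierD(4)[OF Me]) auto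
        finally show "elt_norm U (M (i, j) (Y (j, k))) \<le> op_norm U (elt_norm U) (M (i, j)) * mnorm U n Y" .
      qed
      finally show "elt_norm U (matrix_action U n M Y p)
          \<le> (\<Sum>j<n. op_norm U (elt_norm U) (M (fst p, j)) * mnorm U n Y)" by (simp add: p)
    qed
    finally show ?thesis by (simp add: K_def sum_distrib_right)
  qed
  then show ?thesis
    by (intro v.adjointable_intro[OF _ matrix_action_pair[OF M], of K])
      (simp_all add: matrix_action_def del: matrices_iff)
qed

text \<open>Operators on \<open>M_n(U)\<close> are compared by their values, and these entry by
  entry. For products this comes down to additivity of the multipliers and an interchange of two
  finite sums.\<close>

lemma matrix_action_star_map:
  assumes n: "n \<ge> 1"
  shows "star_map (matrix_algebra n mult_alg) (adjointable (matrix_algebra n U) (mnorm U n)) (matrix_action U n)"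
proof -
  let ?V = "matrix_algebra n U" and ?W = "matrix_algebra n mult_alg"
  let ?A = "adjointable ?V (mnorm U n)"
  interpret m: star_algebra mult_alg by (rule multiplier_star_algebra)
  interpret v: complete_cstar_norm ?V "mnorm U n" using n by (rule matrix_complete)
  interpret A: star_algebra ?A by (rule v.adjointable_star_algebra)
  interpret W: star_algebra ?W by (rule m.matrix_star_algebra)
  have W: "multiplier_entries n M" if "M \<in> carrier ?W" for M using that by (simp add: multiplier_entries_def)
  have cl: "matrix_action U n M \<in> carrier ?A" if "M \<in> carrier ?W" for M
    by (rule matrix_action_adjointable[OF n W[OF that]])
  have Wz: "M (i, j) z \<in> carrier U" if "M \<in> carrier ?W" "i < n" "j < n" "z \<in> carrier U" for M i j z
    by (rule multiplierD(2)[OF multiplier_entriesD[OF W[OF that(1)] that(2,3)] that(4)])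
  have eval_sum: "(\<Oplus>\<^bsub>mult_alg\<^esub>l\<in>{..<n}. g l) x = (\<Oplus>l\<in>{..<n}. g l x)"
    if g: "\<And>l. l < n \<Longrightarrow> g l \<in> carrier mult_alg" and x: "x \<in> carrier U" for g x
  proof (rule star_map_linear(4)[OF m.complex_algebra_axioms complex_algebra_axioms, of "\<lambda>T. T x"])
    show "T x \<in> carrier U" if "T \<in> carrier mult_alg" for T by (rule multiplierD(2)[OF that x])
  qed (use g x in \<open>auto simp: multiplier_algebra_sel adjointable_sel(2-5)\<close>)
  show ?thesis
    unfolding star_map_def
  proof (intro conjI ballI allI)
    fix M assume M: "M \<in> carrier ?W"
    note Mm = W[OF M] and Me = multiplier_entriesD[OF W[OF M]] and Mz = Wz[OF M]
    show "matrix_action U n M \<in> carrier ?A" by (rule cl[OF M])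
    show "matrix_action U n (adj ?W M) = adj ?A (matrix_action U n M)"
    proof -
      have "matrix_action U n (adj ?W M) = restrict (matrix_action U n (\<lambda>(i, j). adj mult_alg (M (j, i)))) (carrier ?V)"
      proof (rule v.adjointable_eqI)
        show "matrix_action U n (adj ?W M) \<in> carrier ?A" using cl[OF W.adj_closed[OF M]] .
        show "restrict (matrix_action U n (\<lambda>(i, j). adj mult_alg (M (j, i)))) (carrier ?V) \<in> carrier ?A"
          using cl[OF M] A.adj_closed v.adjoint_unique[OF matrix_action_pair[OF Mm]] by metis
        fix Y assume "Y \<in> carrier ?V"
        then have Y: "Y \<in> matrices n U" by (simp only: matrix_sel(1))
        have N: "multiplier_entries n (\<lambda>(i, j). adj mult_alg (M (j, i)))"
          using Me by (simp add: multiplier_entries_def)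
        have "matrix_action U n (adj ?W M) Y = matrix_action U n (\<lambda>(i, j). adj mult_alg (M (j, i))) Y"
        proof (rule matrix_eqI[of _ n U])
          show "matrix_action U n (adj ?W M) Y \<in> matrices n U"
            by (rule matrix_action_closed[OF W[OF W.adj_closed[OF M]] Y])
          show "matrix_action U n (\<lambda>(i, j). adj mult_alg (M (j, i))) Y \<in> matrices n U"
            by (rule matrix_action_closed[OF N Y])
          fix i k assume ik: "i < n" "k < n"
          show "matrix_action U n (adj ?W M) Y (i, k) = matrix_action U n (\<lambda>(i, j). adj mult_alg (M (j, i))) Y (i, k)"
            unfolding matrix_action_apply[OF Y ik] using ik Y multiplierD(2)[OF multiplier_entriesD[OF N]]
            by (intro M.finsum_cong') auto
        qed
        then show "matrix_action U n (adj ?W M) Y = restrict (matrix_action U n (\<lambda>(i, j). adj mult_alg (M (j, i)))) (carrier ?V) Y"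
          using Y by (simp del: matrices_iff)
      qed
      then show ?thesis using v.adjoint_unique[OF matrix_action_pair[OF Mm]] by simp
    qed
    show "matrix_action U n (c \<odot>\<^bsub>?W\<^esub> M) = c \<odot>\<^bsub>?A\<^esub> matrix_action U n M" for c
    proof (rule v.adjointable_eqI)
      show "matrix_action U n (c \<odot>\<^bsub>?W\<^esub> M) \<in> carrier ?A" by (rule cl[OF W.sm_closed[OF M]])
      show "c \<odot>\<^bsub>?A\<^esub> matrix_action U n M \<in> carrier ?A" by (rule A.sm_closed[OF cl[OF M]])
      fix Y assume YV: "Y \<in> carrier ?V"
      then have Y: "Y \<in> matrices n U" by (simp only: matrix_sel(1))
      have R: "(c \<odot>\<^bsub>?A\<^esub> matrix_action U n M) Y = c \<odot>\<^bsub>?V\<^esub> matrix_action U n M Y"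
        using YV by (simp only: adjointable_sel(5) restrict_apply if_True)
      show "matrix_action U n (c \<odot>\<^bsub>?W\<^esub> M) Y = (c \<odot>\<^bsub>?A\<^esub> matrix_action U n M) Y"
        unfolding R
      proof (rule matrix_eqI[of _ n U])
        show "matrix_action U n (c \<odot>\<^bsub>?W\<^esub> M) Y \<in> matrices n U"
          by (rule matrix_action_closed[OF W[OF W.sm_closed[OF M]] Y])
        show "c \<odot>\<^bsub>?V\<^esub> matrix_action U n M Y \<in> matrices n U"
          using v.sm_closed[of "matrix_action U n M Y" c] matrix_action_closed[OF Mm Y] by (simp only: matrix_sel(1))
        fix i k assume ik: "i < n" "k < n"
        have "(\<Oplus>j\<in>{..<n}. (c \<odot>\<^bsub>?W\<^esub> M) (i, j) (Y (j, k))) = (\<Oplus>j\<in>{..<n}. c \<odot> M (i, j) (Y (j, k)))"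
          using ik Mz Y by (intro M.finsum_cong') (auto simp: multiplier_algebra_sel adjointable_sel(2-5))
        also have "\<dots> = c \<odot> (\<Oplus>j\<in>{..<n}. M (i, j) (Y (j, k)))"
          using ik Mz Y by (intro finsum_sm[symmetric]) auto
        finally show "matrix_action U n (c \<odot>\<^bsub>?W\<^esub> M) Y (i, k) = (c \<odot>\<^bsub>?V\<^esub> matrix_action U n M Y) (i, k)"
          using ik by (simp add: matrix_action_apply[OF Y ik])
      qed
    qed
    fix N assume N: "N \<in> carrier ?W"
    note Nm = W[OF N] and Ne = multiplier_entriesD[OF W[OF N]] and Nz = Wz[OF N]
    show "matrix_action U n (M \<oplus>\<^bsub>?W\<^esub> N) = matrix_action U n M \<oplus>\<^bsub>?A\<^esub> matrix_action U n N"
    proof (rule v.adjointable_eqI)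
      show "matrix_action U n (M \<oplus>\<^bsub>?W\<^esub> N) \<in> carrier ?A" by (rule cl[OF W.M.a_closed[OF M N]])
      show "matrix_action U n M \<oplus>\<^bsub>?A\<^esub> matrix_action U n N \<in> carrier ?A"
        by (rule A.M.a_closed[OF cl[OF M] cl[OF N]])
      fix Y assume YV: "Y \<in> carrier ?V"
      then have Y: "Y \<in> matrices n U" by (simp only: matrix_sel(1))
      have R: "(matrix_action U n M \<oplus>\<^bsub>?A\<^esub> matrix_action U n N) Y = matrix_action U n M Y \<oplus>\<^bsub>?V\<^esub> matrix_action U n N Y"
        using YV by (simp only: adjointable_sel(4) restrict_apply if_True)
      show "matrix_action U n (M \<oplus>\<^bsub>?W\<^esub> N) Y = (matrix_action U n M \<oplus>\<^bsub>?A\<^esub> matrix_action U n N) Y"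
        unfolding R
      proof (rule matrix_eqI[of _ n U])
        show "matrix_action U n (M \<oplus>\<^bsub>?W\<^esub> N) Y \<in> matrices n U"
          by (rule matrix_action_closed[OF W[OF W.M.a_closed[OF M N]] Y])
        show "matrix_action U n M Y \<oplus>\<^bsub>?V\<^esub> matrix_action U n N Y \<in> matrices n U"
          using v.M.a_closed[of "matrix_action U n M Y" "matrix_action U n N Y"]
            matrix_action_closed[OF Mm Y] matrix_action_closed[OF Nm Y] by (simp only: matrix_sel(1))
        fix i k assume ik: "i < n" "k < n"
        have "(\<Oplus>j\<in>{..<n}. (M \<oplus>\<^bsub>?W\<^esub> N) (i, j) (Y (j, k))) = (\<Oplus>j\<in>{..<n}. M (i, j) (Y (j, k)) \<oplus> N (i, j) (Y (j, k)))"
          using ik Mz Nz Y by (intro M.finsum_cong') (auto simp: multiplier_algebra_sel adjointable_sel(2-5))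
        also have "\<dots> = (\<Oplus>j\<in>{..<n}. M (i, j) (Y (j, k))) \<oplus> (\<Oplus>j\<in>{..<n}. N (i, j) (Y (j, k)))"
          using ik Mz Nz Y by (intro M.finsum_addf) auto
        finally show "matrix_action U n (M \<oplus>\<^bsub>?W\<^esub> N) Y (i, k) = (matrix_action U n M Y \<oplus>\<^bsub>?V\<^esub> matrix_action U n N Y) (i, k)"
          using ik by (simp add: matrix_action_apply[OF Y ik])
      qed
    qed
    show "matrix_action U n (M \<otimes>\<^bsub>?W\<^esub> N) = matrix_action U n M \<otimes>\<^bsub>?A\<^esub> matrix_action U n N"
    proof (rule v.adjointable_eqI)
      show "matrix_action U n (M \<otimes>\<^bsub>?W\<^esub> N) \<in> carrier ?A" by (rule cl[OF W.mult_closed[OF M N]])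
      show "matrix_action U n M \<otimes>\<^bsub>?A\<^esub> matrix_action U n N \<in> carrier ?A"
        by (rule A.mult_closed[OF cl[OF M] cl[OF N]])
      fix Y assume YV: "Y \<in> carrier ?V"
      then have Y: "Y \<in> matrices n U" by (simp only: matrix_sel(1))
      have R: "(matrix_action U n M \<otimes>\<^bsub>?A\<^esub> matrix_action U n N) Y = matrix_action U n M (matrix_action U n N Y)"
        using YV by (simp only: adjointable_sel(2) restrict_apply if_True)
      note NY = matrix_action_closed[OF Nm Y]
      show "matrix_action U n (M \<otimes>\<^bsub>?W\<^esub> N) Y = (matrix_action U n M \<otimes>\<^bsub>?A\<^esub> matrix_action U n N) Y"
        unfolding R
      proof (rule matrix_eqI[of _ n U])
        show "matrix_action U n (M \<otimes>\<^bsub>?W\<^esub> N) Y \<in> matrices n U"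
          by (rule matrix_action_closed[OF W[OF W.mult_closed[OF M N]] Y])
        show "matrix_action U n M (matrix_action U n N Y) \<in> matrices n U"
          by (rule matrix_action_closed[OF Mm NY])
        fix i k assume ik: "i < n" "k < n"
        have Yc: "Y (j, l) \<in> carrier U" if "j < n" "l < n" for j l using Y that by auto
        have MNc: "M (i, l) (N (l, j) (Y (j, k))) \<in> carrier U" "N (l, j) (Y (j, k)) \<in> carrier U" if "l < n" "j < n" for l j
          using that ik Mz Nz Yc by auto
        have "(M \<otimes>\<^bsub>?W\<^esub> N) (i, j) (Y (j, k)) = (\<Oplus>l\<in>{..<n}. M (i, l) (N (l, j) (Y (j, k))))" if j: "j < n" for j
        proof -
          have "(M \<otimes>\<^bsub>?W\<^esub> N) (i, j) (Y (j, k)) = (\<Oplus>\<^bsub>mult_alg\<^esub>l\<in>{..<n}. M (i, l) \<otimes>\<^bsub>mult_alg\<^esub> N (l, j)) (Y (j, k))"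
            using ik j by simp
          also have "\<dots> = (\<Oplus>l\<in>{..<n}. (M (i, l) \<otimes>\<^bsub>mult_alg\<^esub> N (l, j)) (Y (j, k)))"
            using ik j Me Ne Yc by (intro eval_sum) auto
          also have "\<dots> = (\<Oplus>l\<in>{..<n}. M (i, l) (N (l, j) (Y (j, k))))"
            using ik j Yc MNc by (intro M.finsum_cong') (auto simp: multiplier_algebra_sel adjointable_sel(2))
          finally show ?thesis .
        qed
        then have "(\<Oplus>j\<in>{..<n}. (M \<otimes>\<^bsub>?W\<^esub> N) (i, j) (Y (j, k))) = (\<Oplus>j\<in>{..<n}. \<Oplus>l\<in>{..<n}. M (i, l) (N (l, j) (Y (j, k))))"
          using MNc by (intro M.finsum_cong') (auto intro!: M.finsum_closed)
        also have "\<dots> = (\<Oplus>l\<in>{..<n}. \<Oplus>j\<in>{..<n}. M (i, l) (N (l, j) (Y (j, k))))"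
        proof (rule eq_by_functionals)
          fix f assume f: "functional U f"
          show "f (\<Oplus>j\<in>{..<n}. \<Oplus>l\<in>{..<n}. M (i, l) (N (l, j) (Y (j, k)))) = f (\<Oplus>l\<in>{..<n}. \<Oplus>j\<in>{..<n}. M (i, l) (N (l, j) (Y (j, k))))"
            using MNc by (simp add: functional_finsum[OF f] M.finsum_closed) (rule sum.swap)
        qed (use MNc in \<open>auto intro!: M.finsum_closed\<close>)
        also have "\<dots> = (\<Oplus>l\<in>{..<n}. M (i, l) (\<Oplus>j\<in>{..<n}. N (l, j) (Y (j, k))))"
          using ik MNc Mz by (intro M.finsum_cong') (auto simp: multiplierD(6)[OF Me] intro!: M.finsum_closed)
        also have "\<dots> = (\<Oplus>l\<in>{..<n}. M (i, l) (matrix_action U n N Y (l, k)))"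
          using ik MNc by (intro M.finsum_cong')
            (auto simp: matrix_action_apply[OF Y] Mz intro!: M.finsum_closed)
        finally show "matrix_action U n (M \<otimes>\<^bsub>?W\<^esub> N) Y (i, k) = matrix_action U n M (matrix_action U n N Y) (i, k)"
          by (simp only: matrix_action_apply[OF Y ik] matrix_action_apply[OF NY ik])
      qed
    qed
  qed
qed

end

lemma (in complete_cstar_norm) adjointable_conv_apply:
  assumes l: "conv (adjointable U \<nu>) (op_norm U \<nu>) F f T" and x: "x \<in> carrier U"
  shows "conv U \<nu> F (\<lambda>t. f t x) (T x)"
proof -
  interpret A: complete_cstar_norm "adjointable U \<nu>" "op_norm U \<nu>" by (rule adjointable_complete)
  note l' = A.convD[OF l]
  note D = adjointableD
  show ?thesis
  proof (rule convI_bound)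
    show "T x \<in> carrier U" by (rule D(3)[OF l'(1) x])
    show "((\<lambda>t. op_norm U \<nu> (f t \<ominus>\<^bsub>adjointable U \<nu>\<^esub> T) * \<nu> x) \<longlongrightarrow> 0) F"
      using tendsto_mult_right[OF l'(3), of "\<nu> x"] by simp
    show "\<forall>\<^sub>F t in F. f t x \<in> carrier U \<and> \<nu> (f t x \<ominus> T x) \<le> op_norm U \<nu> (f t \<ominus>\<^bsub>adjointable U \<nu>\<^esub> T) * \<nu> x"
      using l'(2)
    proof eventually_elim
      case (elim t)
      have "(f t \<ominus>\<^bsub>adjointable U \<nu>\<^esub> T) x = f t x \<ominus> T x"
        by (rule star_map_linear(3)[OF A.complex_algebra_axioms complex_algebra_axioms, of "\<lambda>T. T x"])
          (use elim l' x D(3) in \<open>auto simp: adjointable_sel(2-5)\<close>)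
      then show ?case
        using D(3)[OF elim x] D(5)[OF A.M.minus_closed[OF elim l'(1)] x] by simp
    qed
  qed
qed

context cstar_alg
begin

text \<open>Column 0 is a fixed but arbitrary place: applied to a matrix with the single entry
  \<open>x\<close> in row \<open>j\<close> of that column, the action exposes column
  \<open>j\<close> of \<open>M\<close>.\<close>

lemma matrix_action_unit:
  assumes M: "multiplier_entries n M" and x: "x \<in> carrier U" and ij: "i < n" "j < n"
  shows "matrix_action U n M (matrix_unit n j 0 x) (i, 0) = M (i, j) x"
proof -
  have Y: "matrix_unit n j 0 x \<in> matrices n U" by (rule matrix_unit_closed[OF x])
  have n0: "0 < n" using ij by simp
  note Me = multiplier_entriesD[OF M]
  show ?thesis
    unfolding matrix_action_apply[OF Y ij(1) n0]
    using ij x n0 multiplierD(2)[OF Me] multiplierD(7)[OF Me]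
    by (subst finsum_delta[where i = j]) (auto simp: matrix_unit_def)
qed

lemma matrix_unit_apply: "k < n \<Longrightarrow> l < n \<Longrightarrow> matrix_unit n i j x (k, l) = (if k = i \<and> l = j then x else \<zero>)"
  by (simp add: matrix_unit_def)

text \<open>The map is the \<open>(i, j)\<close> block of \<open>T\<close>, and its adjoint is the
  \<open>(j, i)\<close> block of the adjoint of \<open>T\<close>. For operators that come from a
  matrix of multipliers this recovers the entries.\<close>

lemma multiplier_entry:
  assumes n: "n \<ge> 1" and T: "T \<in> carrier (adjointable (matrix_algebra n U) (mnorm U n))" and ij: "i < n" "j < n"
  shows "(\<lambda>x\<in>carrier U. T (matrix_unit n j 0 x) (i, 0)) \<in> carrier mult_alg" (is "?N \<in> _")
proof -
  let ?V = "matrix_algebra n U"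
  interpret v: complete_cstar_norm ?V "mnorm U n" using n by (rule matrix_complete)
  let ?S = "adj (adjointable ?V (mnorm U n)) T"
  have n0: "0 < n" using n by simp
  note p = adjoint_pairD[OF v.adjointableD(2)[OF T]]
  have uV: "matrix_unit n i j x \<in> carrier ?V" if "x \<in> carrier U" for i j x
    using that by (simp del: matrices_iff)
  have Te: "T (matrix_unit n k l x) (i, j) \<in> carrier U" "?S (matrix_unit n k l x) (i, j) \<in> carrier U"
    if "x \<in> carrier U" "i < n" "j < n" for x i j k l
    using p(1,2)[OF uV[OF that(1), of k l]] that by simp_all
  have "adjoint_pair U ?N (\<lambda>x. ?S (matrix_unit n i 0 x) (j, 0))"
    unfolding adjoint_pair_def
  proof (intro conjI ballI)
    fix x assume x: "x \<in> carrier U"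
    show "?N x \<in> carrier U" "?S (matrix_unit n i 0 x) (j, 0) \<in> carrier U" using x Te ij n0 by simp_all
    fix y assume y: "y \<in> carrier U"
    have eq: "adj ?V (matrix_unit n i 0 x) \<otimes>\<^bsub>?V\<^esub> T (matrix_unit n j 0 y) = adj ?V (?S (matrix_unit n i 0 x)) \<otimes>\<^bsub>?V\<^esub> matrix_unit n j 0 y"
      by (rule p(3)[OF uV[OF x] uV[OF y]])
    have 1: "(adj ?V (matrix_unit n i 0 x) \<otimes>\<^bsub>?V\<^esub> T (matrix_unit n j 0 y)) (0, 0) = adj U x \<otimes> T (matrix_unit n j 0 y) (i, 0)"
      unfolding matrix_mult_apply[OF n0 n0] using ij n0 x y Te
      by (subst finsum_delta[where i = i]) (auto simp: matrix_adj_apply matrix_unit_apply simp del: matrix_sel)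
    have 2: "(adj ?V (?S (matrix_unit n i 0 x)) \<otimes>\<^bsub>?V\<^esub> matrix_unit n j 0 y) (0, 0) = adj U (?S (matrix_unit n i 0 x) (j, 0)) \<otimes> y"
      unfolding matrix_mult_apply[OF n0 n0] using ij n0 x y Te
      by (subst finsum_delta[where i = j]) (auto simp: matrix_adj_apply matrix_unit_apply simp del: matrix_sel)
    have "adj U x \<otimes> T (matrix_unit n j 0 y) (i, 0) = adj U (?S (matrix_unit n i 0 x) (j, 0)) \<otimes> y"
      by (simp only: 1[symmetric] 2[symmetric] eq)
    then show "adj U x \<otimes> ?N y = adj U (?S (matrix_unit n i 0 x) (j, 0)) \<otimes> y"
      using y by simp
  qed
  moreover have "elt_norm U (?N x) \<le> op_norm ?V (mnorm U n) T * elt_norm U x" if x: "x \<in> carrier U" for x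
  proof -
    have "T (matrix_unit n j 0 x) \<in> matrices n U" using p(1)[OF uV[OF x]] by (simp only: matrix_sel(1))
    from norm_entry_le[OF this ij(1) n0] have "elt_norm U (?N x) \<le> mnorm U n (T (matrix_unit n j 0 x))"
      using x by simp
    also have "\<dots> \<le> op_norm ?V (mnorm U n) T * mnorm U n (matrix_unit n j 0 x)"
      by (rule v.adjointableD(5)[OF T uV[OF x]])
    finally show ?thesis using x ij n0 by (simp add: matrix_unit_isometric)
  qed
  ultimately show ?thesis
    unfolding multiplier_algebra_sel by (intro adjointable_intro) auto
qed

text \<open>The norms are pulled back from operators on \<open>M_n(U)\<close>, so the point is that
  the range is closed. Entry \<open>(i, l)\<close> of the value at \<open>Y\<close> is a sum of
  blocks applied to column \<open>l\<close> of \<open>Y\<close>. This identity holds along the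
  sequence, passes to the limit \<open>T\<close>, and shows that \<open>T\<close> comes from the
  matrix of its blocks.\<close>

lemma multiplier_cstar: "cstar_algebra mult_alg"
  unfolding cstar_algebra_def
proof (intro conjI allI impI multiplier_star_algebra)
  fix n :: nat assume n: "n \<ge> 1"
  let ?V = "matrix_algebra n U" and ?W = "matrix_algebra n mult_alg"
  let ?A = "adjointable ?V (mnorm U n)"
  interpret m: star_algebra mult_alg by (rule multiplier_star_algebra)
  interpret v: complete_cstar_norm ?V "mnorm U n" using n by (rule matrix_complete)
  interpret A: complete_cstar_norm ?A "op_norm ?V (mnorm U n)" by (rule v.adjointable_complete)
  have n0: "0 < n" using n by simp
  have ent: "multiplier_entries n M" if "M \<in> carrier ?W" for M using that by (simp add: multiplier_entries_def)
  have "complete_cstar_norm ?W (\<lambda>M. op_norm ?V (mnorm U n) (matrix_action U n M))"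
  proof (rule complete_cstar_norm_pullback[OF m.matrix_star_algebra v.adjointable_complete matrix_action_star_map[OF n]])
    show "inj_on (matrix_action U n) (carrier ?W)"
    proof (rule inj_onI)
      fix M N assume M: "M \<in> carrier ?W" and N: "N \<in> carrier ?W" and eq: "matrix_action U n M = matrix_action U n N"
      show "M = N"
      proof (rule matrix_eqI[of _ n mult_alg])
        fix i j assume ij: "i < n" "j < n"
        show "M (i, j) = N (i, j)"
        proof (rule adjointable_eqI)
          show "M (i, j) \<in> carrier (adjointable U (elt_norm U))" "N (i, j) \<in> carrier (adjointable U (elt_norm U))"
            using M N ij by (simp_all add: multiplier_algebra_sel)
          show "M (i, j) x = N (i, j) x" if "x \<in> carrier U" for x
            using matrix_action_unit[OF ent[OF M] that ij] matrix_action_unit[OF ent[OF N] that ij] eq by simp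
        qed
      qed (use M N in simp_all)
    qed
    show "seq_closed ?A (op_norm ?V (mnorm U n)) (matrix_action U n ` carrier ?W)"
      unfolding seq_closed_def
    proof (intro allI impI, elim conjE)
      fix \<xi> T assume \<xi>: "\<forall>k. \<xi> k \<in> matrix_action U n ` carrier ?W"
        and l: "conv ?A (op_norm ?V (mnorm U n)) sequentially \<xi> T"
      note T = A.convD(1)[OF l]
      from \<xi> have "\<forall>k. \<exists>M. M \<in> carrier ?W \<and> \<xi> k = matrix_action U n M" by blast
      then obtain M where M: "\<And>k. M k \<in> carrier ?W" "\<And>k. \<xi> k = matrix_action U n (M k)" by metis
      define N where "N = (\<lambda>(i, j)\<in>matrix_index n. \<lambda>x\<in>carrier U. T (matrix_unit n j 0 x) (i, 0))"
      have N: "N \<in> carrier ?W" using multiplier_entry[OF n T] by (simp add: N_def)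
      have entry_lim: "conv U (elt_norm U) sequentially (\<lambda>k. \<xi> k Y (i, l)) (T Y (i, l))"
        if Y: "Y \<in> matrices n U" and il: "i < n" "l < n" for Y i l
      proof -
        have "conv ?V (mnorm U n) sequentially (\<lambda>k. \<xi> k Y) (T Y)"
          using v.adjointable_conv_apply[OF l, of Y] Y by (simp only: matrix_sel(1))
        then show ?thesis using il unfolding conv_matrix_iff[OF n] by blast
      qed
      have "matrix_action U n N = T"
      proof (rule v.adjointable_eqI[OF matrix_action_adjointable[OF n ent[OF N]] T])
        fix Y assume YV: "Y \<in> carrier ?V"
        then have Y: "Y \<in> matrices n U" by (simp only: matrix_sel(1))
        show "matrix_action U n N Y = T Y"
        proof (rule matrix_eqI[of _ n U])
          show "matrix_action U n N Y \<in> matrices n U" by (rule matrix_action_closed[OF ent[OF N] Y])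
          show "T Y \<in> matrices n U" using v.adjointableD(3)[OF T YV] by (simp only: matrix_sel(1))
          fix i l assume il: "i < n" "l < n"
          have Yc: "Y (k, l) \<in> carrier U" if "k < n" for k using Y that il by simp
          note Me = multiplier_entriesD[OF ent[OF M(1)]]
          have "conv U (elt_norm U) sequentially (\<lambda>k. \<Oplus>j\<in>{..<n}. \<xi> k (matrix_unit n j 0 (Y (j, l))) (i, 0))
            (\<Oplus>j\<in>{..<n}. T (matrix_unit n j 0 (Y (j, l))) (i, 0))"
          proof (rule conv_finsum)
            fix j assume j: "j \<in> {..<n}"
            show "conv U (elt_norm U) sequentially (\<lambda>k. \<xi> k (matrix_unit n j 0 (Y (j, l))) (i, 0))
              (T (matrix_unit n j 0 (Y (j, l))) (i, 0))"
              using Yc j il n0 by (intro entry_lim matrix_unit_closed) auto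
            show "\<xi> k (matrix_unit n j 0 (Y (j, l))) (i, 0) \<in> carrier U" for k
              using j il Yc multiplierD(2)[OF Me] unfolding M(2)
              by (subst matrix_action_unit[OF ent[OF M(1)]]) auto
          qed simp
          moreover have "(\<Oplus>j\<in>{..<n}. \<xi> k (matrix_unit n j 0 (Y (j, l))) (i, 0)) = \<xi> k Y (i, l)" for k
            unfolding M(2) matrix_action_apply[OF Y il] using il Yc multiplierD(2)[OF Me]
            by (intro M.finsum_cong') (auto simp: matrix_action_unit[OF ent[OF M(1)]])
          ultimately have "(\<Oplus>j\<in>{..<n}. T (matrix_unit n j 0 (Y (j, l))) (i, 0)) = T Y (i, l)"
            using conv_unique[OF _ entry_lim[OF Y il] sequentially_bot] by simp
          moreover have "(\<Oplus>j\<in>{..<n}. N (i, j) (Y (j, l))) = (\<Oplus>j\<in>{..<n}. T (matrix_unit n j 0 (Y (j, l))) (i, 0))"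
          proof (rule M.finsum_cong'[OF refl])
            show "(\<lambda>j. T (matrix_unit n j 0 (Y (j, l))) (i, 0)) \<in> {..<n} \<rightarrow> carrier U"
            proof
              fix j assume "j \<in> {..<n}"
              then have "T (matrix_unit n j 0 (Y (j, l))) \<in> matrices n U"
                using v.adjointableD(3)[OF T] matrix_unit_closed[OF Yc] by (simp only: matrix_sel(1) lessThan_iff)
              then show "T (matrix_unit n j 0 (Y (j, l))) (i, 0) \<in> carrier U" using il n0 by simp
            qed
          qed (use il Yc in \<open>simp add: N_def\<close>)
          ultimately show "matrix_action U n N Y (i, l) = T Y (i, l)"
            by (simp only: matrix_action_apply[OF Y il])
        qed
      qed
      then show "T \<in> matrix_action U n ` carrier ?W" using N by blast
    qed
  qed
  then show "complete_cstar_norm ?W (mnorm mult_alg n)"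
    by (rule complete_cstar_norm_cong) (simp add: multiplier_algebra_sel)
qed

text \<open>Both sides are complete C*-norms on the same *-algebra, hence equal by contractivity of
  the identity in either direction.\<close>

lemma elt_norm_multiplier:
  assumes T: "T \<in> carrier mult_alg"
  shows "elt_norm mult_alg T = op_norm U (elt_norm U) T"
  using star_map_contractive[OF elt_norm_complete[OF multiplier_cstar] adjointable_complete star_map_adjointable_multiplier(2) T]
    star_map_contractive[OF adjointable_complete elt_norm_complete[OF multiplier_cstar] star_map_adjointable_multiplier(1)] T
  by (force simp: multiplier_algebra_sel)

section \<open>The embedding of a C*-algebra into its multipliers\<close>

definition left_mult :: "'a \<Rightarrow> 'a \<Rightarrow> 'a" where
  "left_mult g = (\<lambda>x\<in>carrier U. g \<otimes> x)"

lemma left_mult_star_map: "star_map U mult_alg left_mult"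
proof -
  have p: "adjoint_pair U (left_mult g) (left_mult (adj U g))" if "g \<in> carrier U" for g
    using that by (auto simp: adjoint_pair_def left_mult_def adj_mult mult_assoc)
  have c: "left_mult g \<in> carrier mult_alg" if g: "g \<in> carrier U" for g
    unfolding multiplier_algebra_sel
    by (rule adjointable_intro[OF _ p[OF g], of "elt_norm U g"]) (use g norm_mult in \<open>auto simp: left_mult_def\<close>)
  show ?thesis
    unfolding star_map_def
  proof (intro conjI ballI allI)
    fix x assume x: "x \<in> carrier U"
    show "left_mult (adj U x) = adj mult_alg (left_mult x)"
      unfolding multiplier_algebra_sel adjoint_unique[OF p[OF x]] by (simp add: left_mult_def)
  qed (use c in \<open>auto simp: left_mult_def multiplier_algebra_sel adjointable_sel(2-5) distr_left
      smult_mult_left mult_assoc intro!: restrict_ext\<close>)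
qed

lemma left_mult_inj: "inj_on left_mult (carrier U)"
proof (rule inj_onI)
  fix x y assume xy: "x \<in> carrier U" "y \<in> carrier U" and eq: "left_mult x = left_mult y"
  show "x = y"
  proof (rule eq_by_right_mult[OF xy])
    show "x \<otimes> z = y \<otimes> z" if "z \<in> carrier U" for z
      using fun_cong[OF eq, of z] that by (simp add: left_mult_def)
  qed
qed

text \<open>For the lower bound the operator is evaluated at \<open>adj U g\<close>.\<close>

lemma left_mult_isometric:
  assumes g: "g \<in> carrier U"
  shows "elt_norm mult_alg (left_mult g) = elt_norm U g"
proof (rule antisym)
  show "elt_norm mult_alg (left_mult g) \<le> elt_norm U g"
    by (rule star_map_contractive[OF complete_cstar_norm_axioms elt_norm_complete[OF multiplier_cstar] left_mult_star_map g])
  note c = star_mapD(1)[OF left_mult_star_map g]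
  have "(elt_norm U g)\<^sup>2 = elt_norm U (left_mult g (adj U g))"
    using cstar_identity[of "adj U g"] g by (simp add: left_mult_def)
  also have "\<dots> \<le> elt_norm mult_alg (left_mult g) * elt_norm U g"
    using multiplierD(3)[OF c, of "adj U g"] g elt_norm_multiplier[OF c] by simp
  finally have "elt_norm U g * elt_norm U g \<le> elt_norm mult_alg (left_mult g) * elt_norm U g"
    by (simp add: power2_eq_square)
  moreover have "0 \<le> elt_norm mult_alg (left_mult g)" using elt_norm_multiplier[OF c] multiplierD(4)[OF c] by simp
  ultimately show "elt_norm U g \<le> elt_norm mult_alg (left_mult g)"
    using norm_nonneg[OF g] by (cases "elt_norm U g = 0") auto
qed

text \<open>The embedding is isometric, so a convergent sequence in the range is the image of a
  Cauchy sequence in \<open>U\<close>.\<close>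

lemma left_mult_range: "cstar_subalgebra (left_mult ` carrier U) mult_alg"
proof -
  interpret m: cstar_alg mult_alg by unfold_locales (rule multiplier_cstar)
  note L = star_mapD[OF left_mult_star_map]
  note lin = star_map_linear[OF complex_algebra_axioms m.complex_algebra_axioms L(1,3,4), simplified]
  have "seq_closed mult_alg (elt_norm mult_alg) (left_mult ` carrier U)"
    unfolding seq_closed_def
  proof (intro allI impI, elim conjE)
    fix \<xi> T assume \<xi>: "\<forall>k. \<xi> k \<in> left_mult ` carrier U" and l: "conv mult_alg (elt_norm mult_alg) sequentially \<xi> T"
    then have "\<forall>k. \<exists>g. g \<in> carrier U \<and> \<xi> k = left_mult g" by blast
    then obtain g where g: "\<And>k. g k \<in> carrier U" "\<And>k. \<xi> k = left_mult (g k)" by metis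
    note T = m.convD(1)[OF l]
    have \<xi>c: "\<xi> k \<in> carrier mult_alg" for k using L(1) g by simp
    have "\<exists>N. \<forall>p\<ge>N. \<forall>q\<ge>N. elt_norm U (g p \<ominus> g q) < \<epsilon>" if e: "\<epsilon> > 0" for \<epsilon>
    proof -
      have "\<forall>\<^sub>F k in sequentially. elt_norm mult_alg (\<xi> k \<ominus>\<^bsub>mult_alg\<^esub> T) < \<epsilon> / 2"
        using e by (intro order_tendstoD(2)[OF m.convD(3)[OF l]]) simp
      then obtain N where N: "\<And>k. k \<ge> N \<Longrightarrow> elt_norm mult_alg (\<xi> k \<ominus>\<^bsub>mult_alg\<^esub> T) < \<epsilon> / 2"
        by (auto simp: eventually_sequentially)
      have "elt_norm U (g p \<ominus> g q) < \<epsilon>" if "p \<ge> N" "q \<ge> N" for p q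
      proof -
        have "elt_norm U (g p \<ominus> g q) = elt_norm mult_alg (\<xi> p \<ominus>\<^bsub>mult_alg\<^esub> \<xi> q)"
          using left_mult_isometric[of "g p \<ominus> g q"] lin(3)[OF g(1) g(1)] g by simp
        also have "\<dots> \<le> elt_norm mult_alg (\<xi> p \<ominus>\<^bsub>mult_alg\<^esub> T) + elt_norm mult_alg (\<xi> q \<ominus>\<^bsub>mult_alg\<^esub> T)"
          using m.norm_diff_triangle[OF \<xi>c T \<xi>c] m.norm_diff_comm[OF \<xi>c T] by metis
        finally show ?thesis using N[OF that(1)] N[OF that(2)] by simp
      qed
      then show ?thesis by blast
    qed
    then obtain h where h: "conv U (elt_norm U) sequentially g h"
      using Cauchy_converges[of g] g(1) by metis
    have "conv mult_alg (elt_norm mult_alg) sequentially \<xi> (left_mult h)"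
      using star_map_conv[OF complete_cstar_norm_axioms m.complete_cstar_norm_axioms left_mult_star_map h]
      by (simp add: g(2)[symmetric])
    then have "T = left_mult h" using m.conv_unique[OF l _ sequentially_bot] by blast
    then show "T \<in> left_mult ` carrier U" using convD(1)[OF h] by blast
  qed
  then show ?thesis
    unfolding m.cstar_subalgebra_iff linear_subspace_def
    using L(1) by (auto simp: L(2-5)[symmetric] lin(1)[symmetric])
qed

text \<open>The column inequality is known in \<open>M_1(U)\<close>, of which \<open>U\<close> is an
  isometric copy.\<close>

lemma column_norm: "column_cstar_norm U (elt_norm U)"
proof -
  have 1: "(1::nat) \<le> 1" by simp
  interpret c: column_cstar_norm "matrix_algebra 1 U" "mnorm U 1" by (rule matrix_column_norm[OF 1])
  let ?L = "diag 1"
  note L = star_mapD[OF star_map_diag[of 1]]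
  have nL: "mnorm U 1 (?L x) = elt_norm U x" if "x \<in> carrier U" for x
  proof -
    have "?L x = (\<lambda>p\<in>matrix_index 1. x)" by (auto simp: diag_def)
    then show ?thesis by (simp add: elt_norm_def)
  qed
  show ?thesis
  proof
    fix r :: nat and s assume r: "1 \<le> r" and s: "\<And>i. i < r \<Longrightarrow> s i \<in> carrier U"
    have "?L (\<Oplus>i\<in>{..<r}. adj U (s i) \<otimes> s i) = (\<Oplus>\<^bsub>matrix_algebra 1 U\<^esub>i\<in>{..<r}. ?L (adj U (s i) \<otimes> s i))"
      using s by (intro star_map_linear(4)[OF complex_algebra_axioms c.complex_algebra_axioms L(1,3,4)]) auto
    also have "\<dots> = (\<Oplus>\<^bsub>matrix_algebra 1 U\<^esub>i\<in>{..<r}. adj (matrix_algebra 1 U) (?L (s i)) \<otimes>\<^bsub>matrix_algebra 1 U\<^esub> ?L (s i))"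
      using s L(1) by (intro c.M.finsum_cong' refl) (auto simp: L(2,5) simp del: matrix_sel One_nat_def)
    finally have eq: "?L (\<Oplus>i\<in>{..<r}. adj U (s i) \<otimes> s i) =
      (\<Oplus>\<^bsub>matrix_algebra 1 U\<^esub>i\<in>{..<r}. adj (matrix_algebra 1 U) (?L (s i)) \<otimes>\<^bsub>matrix_algebra 1 U\<^esub> ?L (s i))" .
    have "(elt_norm U (s 0))\<^sup>2 = (mnorm U 1 (?L (s 0)))\<^sup>2" using r s[of 0] nL[of "s 0"] by (simp del: One_nat_def)
    also have "\<dots> \<le> mnorm U 1 (?L (\<Oplus>i\<in>{..<r}. adj U (s i) \<otimes> s i))"
      unfolding eq using s L(1) by (intro c.column[OF r]) blast
    also have "\<dots> = elt_norm U (\<Oplus>i\<in>{..<r}. adj U (s i) \<otimes> s i)"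
      using s by (intro nL M.finsum_closed) auto
    finally show "(elt_norm U (s 0))\<^sup>2 \<le> elt_norm U (\<Oplus>i\<in>{..<r}. adj U (s i) \<otimes> s i)" .
  qed
qed

end

section \<open>Construction of single values of a multiplier along a net\<close>

context complete_cstar_norm
begin

lemma net_left_cancel:
  assumes F: "F \<noteq> bot" and e: "\<And>t. e t \<in> I" and P: "\<And>a. a \<in> I \<Longrightarrow> P a \<in> carrier U"
    and lim: "\<And>y. y \<in> carrier U \<Longrightarrow> conv U \<nu> F (\<lambda>t. P (e t) \<otimes> y) y"
    and z: "z \<in> carrier U" "z' \<in> carrier U" and eq: "\<And>a. a \<in> I \<Longrightarrow> P a \<otimes> z = P a \<otimes> z'"
  shows "z = z'"
proof (rule conv_unique[OF lim[OF z(1)] _ F])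
  show "conv U \<nu> F (\<lambda>t. P (e t) \<otimes> z) z'" using lim[OF z(2)] eq[OF e] by simp
qed

text \<open>\<open>T\<close> is determined by \<open>P a \<cdot> T y = Q a \<cdot> y\<close>. On the dense set of all \<open>P a \<cdot> y\<close> it is given by
  \<open>P a \<cdot> y \<mapsto> R a \<cdot> y\<close>, and the defining equation bounds it there.\<close>

lemma multiplier_exists:
  assumes F: "F \<noteq> bot" and e: "\<And>t. e t \<in> I"
    and PQR: "\<And>a. a \<in> I \<Longrightarrow> P a \<in> carrier U" "\<And>a. a \<in> I \<Longrightarrow> Q a \<in> carrier U" "\<And>a. a \<in> I \<Longrightarrow> R a \<in> carrier U"
    and eq: "\<And>a b. a \<in> I \<Longrightarrow> b \<in> I \<Longrightarrow> P a \<otimes> R b = Q a \<otimes> P b"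
    and lim: "\<And>y. y \<in> carrier U \<Longrightarrow> conv U \<nu> F (\<lambda>t. P (e t) \<otimes> y) y"
    and K: "\<And>t. \<nu> (Q (e t)) \<le> K" and y: "y \<in> carrier U"
  shows "\<exists>z\<in>carrier U. (\<forall>a\<in>I. P a \<otimes> z = Q a \<otimes> y) \<and> \<nu> z \<le> K * \<nu> y"
proof -
  \<comment> \<open>Multiplying \<open>z\<close> by \<open>P (e t)\<close> recovers \<open>z\<close>
    in the limit, while \<open>P (e t) z = Q (e t) y\<close> is bounded through \<open>K\<close>.
    Applied to differences, the same bound makes the approximants below a Cauchy sequence.\<close>
  have bound: "\<nu> z \<le> K * \<nu> y" if z: "z \<in> carrier U" and y: "y \<in> carrier U" and zy: "\<And>a. a \<in> I \<Longrightarrow> P a \<otimes> z = Q a \<otimes> y" for z y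
  proof (rule conv_norm_le[OF lim[OF z] _ F])
    have "\<nu> (P (e t) \<otimes> z) \<le> K * \<nu> y" for t
      using norm_mult[OF PQR(2)[OF e] y, of t] mult_right_mono[OF K[of t] norm_nonneg[OF y]] zy[OF e] by simp
    then show "\<forall>\<^sub>F t in F. \<nu> (P (e t) \<otimes> z) \<le> K * \<nu> y" by simp
  qed
  \<comment> \<open>For a single \<open>y\<close> a sequence suffices: the elements
    \<open>P (a n) y\<close> tend to \<open>y\<close>, and for them the solution is known to be
    \<open>R (a n) y\<close>.\<close>
  have "\<exists>a\<in>I. \<nu> (P a \<otimes> y \<ominus> y) < 1 / Suc n" for n
  proof -
    have "\<forall>\<^sub>F t in F. \<nu> (P (e t) \<otimes> y \<ominus> y) < 1 / Suc n"
      by (rule order_tendstoD(2)[OF convD(3)[OF lim[OF y]]]) simp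
    then show ?thesis using eventually_happens F e by blast
  qed
  then obtain a where a: "\<And>n. a n \<in> I" "\<And>n. \<nu> (P (a n) \<otimes> y \<ominus> y) < 1 / Suc n" by metis
  define yn where "yn n = P (a n) \<otimes> y" for n
  define zn where "zn n = R (a n) \<otimes> y" for n
  have c: "yn n \<in> carrier U" "zn n \<in> carrier U" for n using a(1) PQR y by (auto simp: yn_def zn_def)
  have rel: "P b \<otimes> zn n = Q b \<otimes> yn n" if "b \<in> I" for b n
    using that a(1) PQR y eq[OF that a(1)] by (simp add: yn_def zn_def mult_assoc[symmetric])
  have yn: "conv U \<nu> sequentially yn y"
  proof (rule convI_bound[OF y])
    show "(\<lambda>n. 1 / Suc n) \<longlonglongrightarrow> 0" using LIMSEQ_inverse_real_of_nat by (simp add: inverse_eq_divide)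
    have "\<nu> (yn n \<ominus> y) \<le> 1 / Suc n" for n using a(2)[of n] by (simp add: yn_def less_imp_le)
    then show "\<forall>\<^sub>F n in sequentially. yn n \<in> carrier U \<and> \<nu> (yn n \<ominus> y) \<le> 1 / Suc n" using c by simp
  qed
  have K0: "0 \<le> K" using order_trans[OF norm_nonneg[OF PQR(2)[OF e]] K] .
  have "\<exists>N. \<forall>m\<ge>N. \<forall>n\<ge>N. \<nu> (zn m \<ominus> zn n) < \<epsilon>" if \<epsilon>: "\<epsilon> > 0" for \<epsilon>
  proof -
    have "\<forall>\<^sub>F n in sequentially. \<nu> (yn n \<ominus> y) < \<epsilon> / (2 * (K + 1))"
      using \<epsilon> K0 by (intro order_tendstoD(2)[OF convD(3)[OF yn]]) simp
    then obtain N where N: "\<And>n. n \<ge> N \<Longrightarrow> \<nu> (yn n \<ominus> y) < \<epsilon> / (2 * (K + 1))" by (auto simp: eventually_sequentially)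
    have "\<nu> (zn m \<ominus> zn n) < \<epsilon>" if mn: "m \<ge> N" "n \<ge> N" for m n
    proof -
      have "\<nu> (zn m \<ominus> zn n) \<le> K * \<nu> (yn m \<ominus> yn n)"
        using c rel PQR by (intro bound) (simp_all add: distr_minus)
      also have "\<dots> \<le> (K + 1) * \<nu> (yn m \<ominus> yn n)" using c by (intro mult_right_mono) auto
      also have "\<nu> (yn m \<ominus> yn n) \<le> \<nu> (yn m \<ominus> y) + \<nu> (yn n \<ominus> y)"
        using norm_diff_triangle[OF c(1) y c(1), of m n] norm_diff_comm[OF c(1) y, of n] by simp
      also have "\<dots> < \<epsilon> / (2 * (K + 1)) + \<epsilon> / (2 * (K + 1))" using N[OF mn(1)] N[OF mn(2)] by simp
      also have "\<dots> = \<epsilon> / (K + 1)"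
      proof -
        have "\<epsilon> / (2 * k) + \<epsilon> / (2 * k) = \<epsilon> / k" for k by (cases "k = 0") (simp_all add: field_simps)
        then show ?thesis .
      qed
      finally show ?thesis using K0 by (simp add: mult_strict_left_mono)
    qed
    then show ?thesis by blast
  qed
  then obtain z where z: "conv U \<nu> sequentially zn z" using Cauchy_converges[of zn] c by metis
  have zU: "z \<in> carrier U" by (rule convD(1)[OF z])
  have zz: "P b \<otimes> z = Q b \<otimes> y" if b: "b \<in> I" for b
  proof (rule conv_unique[OF conv_mult_left[OF z PQR(1)[OF b]] _ sequentially_bot])
    show "conv U \<nu> sequentially (\<lambda>n. P b \<otimes> zn n) (Q b \<otimes> y)"
      unfolding rel[OF b] by (rule conv_mult_left[OF yn PQR(2)[OF b]])
  qed
  then show ?thesis using zU bound[OF zU y] by blast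
qed

end

section \<open>Extension of homomorphisms from an ideal\<close>

lemma algebra_homD:
  assumes "\<pi> \<in> algebra_hom V H"
  shows "\<And>x. x \<in> carrier V \<Longrightarrow> \<pi> x \<in> carrier H"
    "\<And>x y. x \<in> carrier V \<Longrightarrow> y \<in> carrier V \<Longrightarrow> \<pi> (x \<otimes>\<^bsub>V\<^esub> y) = \<pi> x \<otimes>\<^bsub>H\<^esub> \<pi> y"
    "\<And>x y. x \<in> carrier V \<Longrightarrow> y \<in> carrier V \<Longrightarrow> \<pi> (x \<oplus>\<^bsub>V\<^esub> y) = \<pi> x \<oplus>\<^bsub>H\<^esub> \<pi> y"
    "\<And>c x. x \<in> carrier V \<Longrightarrow> \<pi> (c \<odot>\<^bsub>V\<^esub> x) = c \<odot>\<^bsub>H\<^esub> \<pi> x"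
  using assms by (auto simp: algebra_hom_def hom_def)

lemma completely_contractive_elt_norm:
  assumes "completely_contractive V H \<pi>" "a \<in> carrier V"
  shows "elt_norm H (\<pi> a) \<le> elt_norm V a"
proof -
  have "compose (matrix_index 1) \<pi> (\<lambda>p\<in>matrix_index 1. a) = (\<lambda>p\<in>matrix_index 1. \<pi> a)"
    by (auto simp: compose_def)
  moreover have "(\<lambda>p\<in>matrix_index 1. a) \<in> matrices 1 V" using assms(2) by auto
  ultimately show ?thesis
    using assms(1) unfolding completely_contractive_def elt_norm_def by (metis order_refl)
qed

text \<open>The net is normalised: membership in \<open>A\<close> and the norm bound hold at every
  index and not just eventually, which spares a side condition throughout. Closure of
  \<open>A\<close> and \<open>B\<close> under adjoints is not assumed.\<close>

locale approx_unital_ideal = C: cstar_alg C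
  for C :: "('c, 'm) matrix_normed_alg_scheme" and A B :: "'c set" and F :: "'t filter" and e :: "'t \<Rightarrow> 'c" +
  assumes B: "linear_subspace C B" "seq_closed C (elt_norm C) B"
    and B_mult: "\<And>x y. x \<in> B \<Longrightarrow> y \<in> B \<Longrightarrow> x \<otimes>\<^bsub>C\<^esub> y \<in> B"
    and A: "linear_subspace C A" "A \<subseteq> B" "seq_closed C (elt_norm C) A"
    and ideal: "\<And>a b. a \<in> A \<Longrightarrow> b \<in> B \<Longrightarrow> a \<otimes>\<^bsub>C\<^esub> b \<in> A" "\<And>a b. a \<in> A \<Longrightarrow> b \<in> B \<Longrightarrow> b \<otimes>\<^bsub>C\<^esub> a \<in> A"
    and F: "F \<noteq> bot"
    and e: "\<And>t. e t \<in> A" "\<And>t. elt_norm C (e t) \<le> 1"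
    and unit: "\<And>a. a \<in> A \<Longrightarrow> conv C (elt_norm C) F (\<lambda>t. e t \<otimes>\<^bsub>C\<^esub> a) a"
      "\<And>a. a \<in> A \<Longrightarrow> conv C (elt_norm C) F (\<lambda>t. a \<otimes>\<^bsub>C\<^esub> e t) a"
begin

lemma A_mult: "x \<in> A \<Longrightarrow> y \<in> A \<Longrightarrow> x \<otimes>\<^bsub>C\<^esub> y \<in> A"
  using ideal(1) A(2) by blast

lemma AB: "x \<in> A \<Longrightarrow> x \<in> B" "x \<in> B \<Longrightarrow> x \<in> carrier C" "x \<in> A \<Longrightarrow> x \<in> carrier C"
  using A(2) linear_subspaceD(1)[OF B(1)] by auto

lemma B_algebra: "complex_algebra (C\<lparr>carrier := B\<rparr>)"
  by (rule C.subalgebra_complex_algebra[OF B(1) B_mult])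

lemma hom_conv:
  assumes H: "cstar_algebra H" and S: "linear_subspace C S" "\<And>x y. x \<in> S \<Longrightarrow> y \<in> S \<Longrightarrow> x \<otimes>\<^bsub>C\<^esub> y \<in> S"
    and \<pi>: "\<pi> \<in> algebra_hom (C\<lparr>carrier := S\<rparr>) H"
    and bd: "\<And>x. x \<in> S \<Longrightarrow> elt_norm H (\<pi> x) \<le> elt_norm C x"
    and l: "conv C (elt_norm C) G f a" and f: "\<And>t. f t \<in> S" and a: "a \<in> S"
  shows "conv H (elt_norm H) G (\<lambda>t. \<pi> (f t)) (\<pi> a)"
proof -
  interpret H: cstar_alg H using H by unfold_locales
  note \<pi>' = algebra_homD[OF \<pi>, simplified]
  have "elt_norm H (\<pi> (f t) \<ominus>\<^bsub>H\<^esub> \<pi> a) \<le> elt_norm C (f t \<ominus>\<^bsub>C\<^esub> a)" for t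
  proof -
    have "\<pi> (f t \<ominus>\<^bsub>C\<^esub> a) = \<pi> (f t) \<ominus>\<^bsub>H\<^esub> \<pi> a"
      using star_map_linear(3)[OF C.subalgebra_complex_algebra[OF S] H.complex_algebra_axioms, of \<pi> "f t" a]
        \<pi>' f[of t] a C.subspace_diff[OF S(1) f[of t] a] by simp
    then show ?thesis using bd[OF C.linear_subspace_minus(2)[OF S(1) f[of t] a]] by simp
  qed
  then show ?thesis
    using \<pi>'(1) f a by (intro H.convI_bound[OF _ _ C.convD(3)[OF l]]) auto
qed

text \<open>The elements on which the images of the net act as an approximate unit form a
  C*-subalgebra, and it contains the image of \<open>A\<close>. The domain \<open>S\<close> will be
  \<open>A\<close> for the extension to multipliers, and \<open>B\<close> for the cover
  itself.\<close>

lemma hom_approx_unit: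
  assumes H: "cstar_algebra H" and S: "linear_subspace C S" "A \<subseteq> S" "\<And>x y. x \<in> S \<Longrightarrow> y \<in> S \<Longrightarrow> x \<otimes>\<^bsub>C\<^esub> y \<in> S"
    and \<pi>: "\<pi> \<in> algebra_hom (C\<lparr>carrier := S\<rparr>) H"
    and bd: "\<And>x. x \<in> S \<Longrightarrow> elt_norm H (\<pi> x) \<le> elt_norm C x"
    and x: "x \<in> generated_cstar_subalgebra H (\<pi> ` A)"
  shows "column_cstar_norm.approx_unit H (elt_norm H) F (\<lambda>t. \<pi> (e t)) x"
proof -
  interpret H: cstar_alg H using H by unfold_locales
  interpret Hc: column_cstar_norm H "elt_norm H" by (rule H.column_norm)
  note \<pi>' = algebra_homD[OF \<pi>, simplified]
  have AS: "a \<in> S" if "a \<in> A" for a using S(2) that by blast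
  have pe: "\<pi> (e t) \<in> carrier H" "elt_norm H (\<pi> (e t)) \<le> 1" for t
    using \<pi>'(1)[OF AS[OF e(1)]] order_trans[OF bd[OF AS[OF e(1)]] e(2)] by auto
  let ?T = "{x. Hc.approx_unit F (\<lambda>t. \<pi> (e t)) x}"
  note cl = Hc.approx_unit_closure[of "\<lambda>t. \<pi> (e t)" F, OF pe]
  have T: "cstar_subalgebra ?T H"
    unfolding H.cstar_subalgebra_iff
  proof (intro conjI)
    show "seq_closed H (elt_norm H) ?T"
      unfolding seq_closed_def
    proof (intro allI impI, elim conjE)
      fix \<xi> x assume \<xi>: "\<forall>n. \<xi> n \<in> ?T" and l: "conv H (elt_norm H) sequentially \<xi> x"
      have "Hc.approx_unit F (\<lambda>t. \<pi> (e t)) x" by (rule cl(7)[OF _ l]) (use \<xi> in simp)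
      then show "x \<in> ?T" by simp
    qed
  qed (use cl in \<open>auto simp: linear_subspace_def\<close>)
  have "\<pi> a \<in> ?T" if a: "a \<in> A" for a
  proof -
    have "conv H (elt_norm H) F (\<lambda>t. \<pi> (e t \<otimes>\<^bsub>C\<^esub> a)) (\<pi> a)" "conv H (elt_norm H) F (\<lambda>t. \<pi> (a \<otimes>\<^bsub>C\<^esub> e t)) (\<pi> a)"
      using a e(1) AS S(3) unit[OF a] by (auto intro!: hom_conv[OF H S(1,3) \<pi> bd])
    then have "Hc.approx_unit F (\<lambda>t. \<pi> (e t)) (\<pi> a)"
      using a e(1) AS \<pi>' pe by (intro Hc.approx_unitI) auto
    then show ?thesis by simp
  qed
  moreover have "\<pi> ` A \<subseteq> carrier H" using \<pi>'(1) AS by blast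
  ultimately have "generated_cstar_subalgebra H (\<pi> ` A) \<subseteq> ?T"
    using H.generated_cstar_subalgebra(3)[OF _ T] by blast
  then show ?thesis using x by blast
qed

text \<open>The value \<open>T b y\<close> is characterised by
  \<open>\<pi> a (T b y) = \<pi> (a b) y\<close>, which makes it well defined, as an element is
  determined by its left products with all \<open>\<pi> a\<close>. The existence of
  \<open>T b\<close> and of its adjoint are two uses of one lemma, for the values of
  \<open>\<pi>\<close> and for their adjoints, with the two sides of \<open>b\<close> interchanged.
  For complete contractivity, left multiplication by \<open>diag n (\<pi> (e t))\<close> replaces
  the entries \<open>b\<close> by elements \<open>e t b\<close> of \<open>A\<close>, to which the
  hypothesis on \<open>\<pi>\<close> applies.\<close>

theorem extend_to_multipliers:
  assumes H: "cstar_algebra H" and \<pi>: "\<pi> \<in> algebra_hom (C\<lparr>carrier := A\<rparr>) H"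
    and cc: "completely_contractive (C\<lparr>carrier := A\<rparr>) H \<pi>"
    and gen: "generated_cstar_subalgebra H (\<pi> ` A) = carrier H"
  obtains \<tau> where "\<tau> \<in> algebra_hom (C\<lparr>carrier := B\<rparr>) (multiplier_algebra H)"
    "completely_contractive (C\<lparr>carrier := B\<rparr>) (multiplier_algebra H) \<tau>"
    "\<And>a. a \<in> A \<Longrightarrow> \<tau> a = cstar_alg.left_mult H (\<pi> a)"
proof -
  interpret H: cstar_alg H using H by unfold_locales
  interpret Hc: column_cstar_norm H "elt_norm H" by (rule H.column_norm)
  let ?\<nu> = "elt_norm H"
  note \<pi>' = algebra_homD[OF \<pi>, simplified]
  note Bm = ideal B_mult AB A_mult
  have bd: "?\<nu> (\<pi> x) \<le> elt_norm C x" if "x \<in> A" for x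
    using completely_contractive_elt_norm[OF cc] that by simp
  have pe: "\<pi> (e t) \<in> carrier H" "?\<nu> (\<pi> (e t)) \<le> 1" for t
    using \<pi>'(1)[OF e(1)] order_trans[OF bd[OF e(1)] e(2)] by auto
  have app: "Hc.approx_unit F (\<lambda>t. \<pi> (e t)) y" if "y \<in> carrier H" for y
    using hom_approx_unit[OF H A(1) subset_refl A_mult \<pi> bd, of y] that gen by simp
  have lim: "conv H ?\<nu> F (\<lambda>t. \<pi> (e t) \<otimes>\<^bsub>H\<^esub> y) y" "conv H ?\<nu> F (\<lambda>t. adj H (\<pi> (e t)) \<otimes>\<^bsub>H\<^esub> y) y" if "y \<in> carrier H" for y
    using app[OF that] unfolding Hc.approx_unit_def Hc.left_unit_def by blast+
  have nb: "?\<nu> (\<pi> (e t \<otimes>\<^bsub>C\<^esub> b)) \<le> elt_norm C b" "?\<nu> (\<pi> (b \<otimes>\<^bsub>C\<^esub> e t)) \<le> elt_norm C b" if b: "b \<in> B" for b t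
  proof -
    have "elt_norm C (e t \<otimes>\<^bsub>C\<^esub> b) \<le> 1 * elt_norm C b" "elt_norm C (b \<otimes>\<^bsub>C\<^esub> e t) \<le> elt_norm C b * 1"
      using C.norm_mult[of "e t" b] C.norm_mult[of b "e t"] mult_right_mono[OF e(2)[of t], of "elt_norm C b"]
        mult_left_mono[OF e(2)[of t], of "elt_norm C b"] b e(1)[of t] Bm by fastforce+
    moreover have "?\<nu> (\<pi> (e t \<otimes>\<^bsub>C\<^esub> b)) \<le> elt_norm C (e t \<otimes>\<^bsub>C\<^esub> b)" "?\<nu> (\<pi> (b \<otimes>\<^bsub>C\<^esub> e t)) \<le> elt_norm C (b \<otimes>\<^bsub>C\<^esub> e t)"
      using b e(1)[of t] ideal by (auto intro!: bd)
    ultimately show "?\<nu> (\<pi> (e t \<otimes>\<^bsub>C\<^esub> b)) \<le> elt_norm C b" "?\<nu> (\<pi> (b \<otimes>\<^bsub>C\<^esub> e t)) \<le> elt_norm C b" by simp_all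
  qed
  have exT: "\<exists>z\<in>carrier H. (\<forall>a\<in>A. \<pi> a \<otimes>\<^bsub>H\<^esub> z = \<pi> (a \<otimes>\<^bsub>C\<^esub> b) \<otimes>\<^bsub>H\<^esub> y) \<and> ?\<nu> z \<le> elt_norm C b * ?\<nu> y"
    if b: "b \<in> B" and y: "y \<in> carrier H" for b y
  proof (rule H.multiplier_exists[where F = F and e = e and R = "\<lambda>a. \<pi> (b \<otimes>\<^bsub>C\<^esub> a)"])
    show "\<pi> a \<otimes>\<^bsub>H\<^esub> \<pi> (b \<otimes>\<^bsub>C\<^esub> c) = \<pi> (a \<otimes>\<^bsub>C\<^esub> b) \<otimes>\<^bsub>H\<^esub> \<pi> c" if "a \<in> A" "c \<in> A" for a c
      using that b Bm by (simp add: \<pi>'(2)[symmetric] C.mult_assoc)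
  qed (use b y F e lim \<pi>'(1) Bm nb in auto)
  have exS: "\<exists>z\<in>carrier H. (\<forall>a\<in>A. adj H (\<pi> a) \<otimes>\<^bsub>H\<^esub> z = adj H (\<pi> (b \<otimes>\<^bsub>C\<^esub> a)) \<otimes>\<^bsub>H\<^esub> y) \<and> ?\<nu> z \<le> elt_norm C b * ?\<nu> y"
    if b: "b \<in> B" and y: "y \<in> carrier H" for b y
  proof (rule H.multiplier_exists[where F = F and e = e and R = "\<lambda>a. adj H (\<pi> (a \<otimes>\<^bsub>C\<^esub> b))"])
    show "adj H (\<pi> a) \<otimes>\<^bsub>H\<^esub> adj H (\<pi> (c \<otimes>\<^bsub>C\<^esub> b)) = adj H (\<pi> (b \<otimes>\<^bsub>C\<^esub> a)) \<otimes>\<^bsub>H\<^esub> adj H (\<pi> c)" if "a \<in> A" "c \<in> A" for a c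
    proof -
      have "\<pi> (c \<otimes>\<^bsub>C\<^esub> b) \<otimes>\<^bsub>H\<^esub> \<pi> a = \<pi> c \<otimes>\<^bsub>H\<^esub> \<pi> (b \<otimes>\<^bsub>C\<^esub> a)"
        using that b Bm by (simp add: \<pi>'(2)[symmetric] C.mult_assoc)
      then show ?thesis using that b Bm \<pi>'(1) by (simp add: H.adj_mult[symmetric])
    qed
  qed (use b y F e lim \<pi>'(1) Bm nb in auto)
  define T where "T b = (\<lambda>y\<in>carrier H. SOME z. z \<in> carrier H \<and> (\<forall>a\<in>A. \<pi> a \<otimes>\<^bsub>H\<^esub> z = \<pi> (a \<otimes>\<^bsub>C\<^esub> b) \<otimes>\<^bsub>H\<^esub> y) \<and> ?\<nu> z \<le> elt_norm C b * ?\<nu> y)" for b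
  have T: "T b y \<in> carrier H" "\<And>a. a \<in> A \<Longrightarrow> \<pi> a \<otimes>\<^bsub>H\<^esub> T b y = \<pi> (a \<otimes>\<^bsub>C\<^esub> b) \<otimes>\<^bsub>H\<^esub> y" "?\<nu> (T b y) \<le> elt_norm C b * ?\<nu> y"
    if "b \<in> B" "y \<in> carrier H" for b y
  proof -
    have "T b y \<in> carrier H \<and> (\<forall>a\<in>A. \<pi> a \<otimes>\<^bsub>H\<^esub> T b y = \<pi> (a \<otimes>\<^bsub>C\<^esub> b) \<otimes>\<^bsub>H\<^esub> y) \<and> ?\<nu> (T b y) \<le> elt_norm C b * ?\<nu> y"
      using someI_ex[of "\<lambda>z. z \<in> carrier H \<and> (\<forall>a\<in>A. \<pi> a \<otimes>\<^bsub>H\<^esub> z = \<pi> (a \<otimes>\<^bsub>C\<^esub> b) \<otimes>\<^bsub>H\<^esub> y) \<and> ?\<nu> z \<le> elt_norm C b * ?\<nu> y"]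
        exT[OF that] that(2) by (auto simp: T_def)
    then show "T b y \<in> carrier H" "\<And>a. a \<in> A \<Longrightarrow> \<pi> a \<otimes>\<^bsub>H\<^esub> T b y = \<pi> (a \<otimes>\<^bsub>C\<^esub> b) \<otimes>\<^bsub>H\<^esub> y" "?\<nu> (T b y) \<le> elt_norm C b * ?\<nu> y"
      by blast+
  qed
  have Text: "T b \<in> extensional (carrier H)" for b by (simp add: T_def)
  have uniq: "z = z'" if "z \<in> carrier H" "z' \<in> carrier H" "\<And>a. a \<in> A \<Longrightarrow> \<pi> a \<otimes>\<^bsub>H\<^esub> z = \<pi> a \<otimes>\<^bsub>H\<^esub> z'" for z z'
    by (rule H.net_left_cancel[OF F e(1) \<pi>'(1) lim(1) that])
  have T_diff: "T b (y \<ominus>\<^bsub>H\<^esub> y') = T b y \<ominus>\<^bsub>H\<^esub> T b y'" if "b \<in> B" "y \<in> carrier H" "y' \<in> carrier H" for b y y'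
    by (rule uniq) (use that T Bm \<pi>'(1) in \<open>simp_all add: H.distr_minus\<close>)
  have pair: "\<exists>S. adjoint_pair H (T b) S" if b: "b \<in> B" for b
  proof -
    have "\<forall>x. \<exists>z. x \<in> carrier H \<longrightarrow> z \<in> carrier H \<and> (\<forall>a\<in>A. adj H (\<pi> a) \<otimes>\<^bsub>H\<^esub> z = adj H (\<pi> (b \<otimes>\<^bsub>C\<^esub> a)) \<otimes>\<^bsub>H\<^esub> x)"
      using exS[OF b] by blast
    then obtain S where S: "\<And>x. x \<in> carrier H \<Longrightarrow> S x \<in> carrier H"
      "\<And>x a. x \<in> carrier H \<Longrightarrow> a \<in> A \<Longrightarrow> adj H (\<pi> a) \<otimes>\<^bsub>H\<^esub> S x = adj H (\<pi> (b \<otimes>\<^bsub>C\<^esub> a)) \<otimes>\<^bsub>H\<^esub> x" by metis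
    have "adj H x \<otimes>\<^bsub>H\<^esub> T b y = adj H (S x) \<otimes>\<^bsub>H\<^esub> y" if x: "x \<in> carrier H" and y: "y \<in> carrier H" for x y
    proof (rule H.conv_unique[OF _ _ F])
      \<comment> \<open>Adjointness is checked on the vectors \<open>\<pi> (e t) y\<close>, where
        \<open>T b\<close> acts by the explicit formula with \<open>\<pi> (b e t)\<close>;
        continuity of \<open>T b\<close> extends it to \<open>y\<close>.\<close>
      let ?f = "\<lambda>t. adj H (S x) \<otimes>\<^bsub>H\<^esub> (\<pi> (e t) \<otimes>\<^bsub>H\<^esub> y)"
      show "conv H ?\<nu> F ?f (adj H (S x) \<otimes>\<^bsub>H\<^esub> y)"
        using S(1)[OF x] by (intro H.conv_mult_left lim(1) y) auto
      have "?f t = adj H x \<otimes>\<^bsub>H\<^esub> T b (\<pi> (e t) \<otimes>\<^bsub>H\<^esub> y)" for t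
      proof -
        have "adj H (adj H (\<pi> (e t)) \<otimes>\<^bsub>H\<^esub> S x) = adj H (adj H (\<pi> (b \<otimes>\<^bsub>C\<^esub> e t)) \<otimes>\<^bsub>H\<^esub> x)"
          using S(2)[OF x e(1)] by simp
        then have 1: "adj H (S x) \<otimes>\<^bsub>H\<^esub> \<pi> (e t) = adj H x \<otimes>\<^bsub>H\<^esub> \<pi> (b \<otimes>\<^bsub>C\<^esub> e t)"
          using S(1)[OF x] x b e(1) pe \<pi>'(1) ideal by (simp add: H.adj_mult)
        have 2: "T b (\<pi> (e t) \<otimes>\<^bsub>H\<^esub> y) = \<pi> (b \<otimes>\<^bsub>C\<^esub> e t) \<otimes>\<^bsub>H\<^esub> y"
        proof (rule uniq)
          fix a assume a: "a \<in> A"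
          have "\<pi> (a \<otimes>\<^bsub>C\<^esub> b) \<otimes>\<^bsub>H\<^esub> (\<pi> (e t) \<otimes>\<^bsub>H\<^esub> y) = \<pi> (a \<otimes>\<^bsub>C\<^esub> b \<otimes>\<^bsub>C\<^esub> e t) \<otimes>\<^bsub>H\<^esub> y"
            using a b e(1) pe y \<pi>' Bm by (simp add: H.mult_assoc)
          also have "a \<otimes>\<^bsub>C\<^esub> b \<otimes>\<^bsub>C\<^esub> e t = a \<otimes>\<^bsub>C\<^esub> (b \<otimes>\<^bsub>C\<^esub> e t)" using a b e(1) Bm by (simp add: C.mult_assoc)
          finally show "\<pi> a \<otimes>\<^bsub>H\<^esub> T b (\<pi> (e t) \<otimes>\<^bsub>H\<^esub> y) = \<pi> a \<otimes>\<^bsub>H\<^esub> (\<pi> (b \<otimes>\<^bsub>C\<^esub> e t) \<otimes>\<^bsub>H\<^esub> y)"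
            using T(2)[OF b _ a, of "\<pi> (e t) \<otimes>\<^bsub>H\<^esub> y"] a b e(1) pe y \<pi>' Bm by (simp add: H.mult_assoc)
        qed (use b y pe e(1) T(1) \<pi>'(1) ideal in auto)
        have "?f t = (adj H (S x) \<otimes>\<^bsub>H\<^esub> \<pi> (e t)) \<otimes>\<^bsub>H\<^esub> y"
          using S(1)[OF x] pe y by (simp add: H.mult_assoc)
        also have "\<dots> = adj H x \<otimes>\<^bsub>H\<^esub> (\<pi> (b \<otimes>\<^bsub>C\<^esub> e t) \<otimes>\<^bsub>H\<^esub> y)"
          unfolding 1 using x y b e(1) \<pi>'(1) ideal by (simp add: H.mult_assoc)
        finally show ?thesis by (simp only: 2)
      qed
      moreover have "conv H ?\<nu> F (\<lambda>t. T b (\<pi> (e t) \<otimes>\<^bsub>H\<^esub> y)) (T b y)"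
      proof (rule H.convI_bound[OF T(1)[OF b y]])
        show "((\<lambda>t. elt_norm C b * ?\<nu> (\<pi> (e t) \<otimes>\<^bsub>H\<^esub> y \<ominus>\<^bsub>H\<^esub> y)) \<longlongrightarrow> 0) F"
          using tendsto_mult_left[OF H.convD(3)[OF lim(1)[OF y]], of "elt_norm C b"] by simp
        have "T b (\<pi> (e t) \<otimes>\<^bsub>H\<^esub> y) \<in> carrier H \<and> ?\<nu> (T b (\<pi> (e t) \<otimes>\<^bsub>H\<^esub> y) \<ominus>\<^bsub>H\<^esub> T b y)
            \<le> elt_norm C b * ?\<nu> (\<pi> (e t) \<otimes>\<^bsub>H\<^esub> y \<ominus>\<^bsub>H\<^esub> y)" for t
          using T(1)[OF b, of "\<pi> (e t) \<otimes>\<^bsub>H\<^esub> y"] T(3)[OF b, of "\<pi> (e t) \<otimes>\<^bsub>H\<^esub> y \<ominus>\<^bsub>H\<^esub> y"] pe y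
            T_diff[OF b _ y, of "\<pi> (e t) \<otimes>\<^bsub>H\<^esub> y"] by simp
        then show "\<forall>\<^sub>F t in F. T b (\<pi> (e t) \<otimes>\<^bsub>H\<^esub> y) \<in> carrier H \<and> ?\<nu> (T b (\<pi> (e t) \<otimes>\<^bsub>H\<^esub> y) \<ominus>\<^bsub>H\<^esub> T b y)
            \<le> elt_norm C b * ?\<nu> (\<pi> (e t) \<otimes>\<^bsub>H\<^esub> y \<ominus>\<^bsub>H\<^esub> y)" by simp
      qed
      ultimately show "conv H ?\<nu> F ?f (adj H x \<otimes>\<^bsub>H\<^esub> T b y)"
        using H.conv_mult_left[of F _ "T b y" "adj H x"] x by simp
    qed
    then have "adjoint_pair H (T b) S" using T(1)[OF b] S(1) by (simp add: adjoint_pair_def)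
    then show ?thesis by blast
  qed
  have TM: "T b \<in> carrier (multiplier_algebra H)" if b: "b \<in> B" for b
    using pair[OF b] H.adjointable_intro[OF Text _ T(3)[OF b]] by (auto simp: multiplier_algebra_sel)
  note sel = multiplier_algebra_sel adjointable_sel(2-5)
  have hom: "T \<in> algebra_hom (C\<lparr>carrier := B\<rparr>) (multiplier_algebra H)"
  proof -
    interpret m: cstar_alg "multiplier_algebra H" by unfold_locales (rule H.multiplier_cstar)
    have eqI: "R = R'" if "R \<in> carrier (multiplier_algebra H)" "R' \<in> carrier (multiplier_algebra H)"
      "\<And>y. y \<in> carrier H \<Longrightarrow> R y = R' y" for R R'
      using that H.adjointable_eqI by (simp add: multiplier_algebra_sel)
    have 1: "T (b \<otimes>\<^bsub>C\<^esub> b') = T b \<otimes>\<^bsub>multiplier_algebra H\<^esub> T b'" if b: "b \<in> B" "b' \<in> B" for b b'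
    proof (rule eqI[OF TM[OF B_mult[OF b]] m.mult_closed[OF TM[OF b(1)] TM[OF b(2)]]])
      fix y assume y: "y \<in> carrier H"
      have "T (b \<otimes>\<^bsub>C\<^esub> b') y = T b (T b' y)"
        by (rule uniq) (use b y T Bm \<pi>'(1) in \<open>simp_all add: C.mult_assoc\<close>)
      then show "T (b \<otimes>\<^bsub>C\<^esub> b') y = (T b \<otimes>\<^bsub>multiplier_algebra H\<^esub> T b') y" using y by (simp add: sel)
    qed
    have Badd: "b \<oplus>\<^bsub>C\<^esub> b' \<in> B" "c \<odot>\<^bsub>C\<^esub> b \<in> B" if "b \<in> B" "b' \<in> B" for b b' c
      using linear_subspaceD(4,5)[OF B(1)] that by auto
    have 2: "T (b \<oplus>\<^bsub>C\<^esub> b') = T b \<oplus>\<^bsub>multiplier_algebra H\<^esub> T b'" if b: "b \<in> B" "b' \<in> B" for b b'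
    proof (rule eqI[OF TM[OF Badd(1)[OF b]] m.M.a_closed[OF TM[OF b(1)] TM[OF b(2)]]])
      fix y assume y: "y \<in> carrier H"
      have "T (b \<oplus>\<^bsub>C\<^esub> b') y = T b y \<oplus>\<^bsub>H\<^esub> T b' y"
        by (rule uniq) (use b y T Badd Bm \<pi>'(1,3) in \<open>simp_all add: C.distr_right H.distr_right H.distr_left\<close>)
      then show "T (b \<oplus>\<^bsub>C\<^esub> b') y = (T b \<oplus>\<^bsub>multiplier_algebra H\<^esub> T b') y" using y by (simp add: sel)
    qed
    have 3: "T (c \<odot>\<^bsub>C\<^esub> b) = c \<odot>\<^bsub>multiplier_algebra H\<^esub> T b" if b: "b \<in> B" for c b
    proof (rule eqI[OF TM[OF Badd(2)[OF b b]] m.sm_closed[OF TM[OF b]]])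
      fix y assume y: "y \<in> carrier H"
      have "T (c \<odot>\<^bsub>C\<^esub> b) y = c \<odot>\<^bsub>H\<^esub> T b y"
        by (rule uniq) (use b y T Badd(2)[OF b b] Bm \<pi>'(1,4) in \<open>simp_all add: C.smult_mult_right H.smult_mult_right H.smult_mult_left\<close>)
      then show "T (c \<odot>\<^bsub>C\<^esub> b) y = (c \<odot>\<^bsub>multiplier_algebra H\<^esub> T b) y" using y by (simp add: sel)
    qed
    show ?thesis using TM 1 2 3 by (auto simp: algebra_hom_def hom_def)
  qed
  have TA: "T a = H.left_mult (\<pi> a)" if a: "a \<in> A" for a
  proof (rule extensionalityI[OF Text, of "H.left_mult (\<pi> a)"])
    fix y assume y: "y \<in> carrier H"
    show "T a y = H.left_mult (\<pi> a) y"
      by (rule uniq) (use a y T Bm \<pi>'(1,2) in \<open>simp_all add: H.left_mult_def H.mult_assoc\<close>)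
  qed (simp add: H.left_mult_def)
  have "completely_contractive (C\<lparr>carrier := B\<rparr>) (multiplier_algebra H) T"
    unfolding completely_contractive_def
  proof (intro allI impI ballI)
    fix n :: nat and M assume n: "1 \<le> n" and "M \<in> matrices n (C\<lparr>carrier := B\<rparr>)"
    then have MB: "\<And>i j. i < n \<Longrightarrow> j < n \<Longrightarrow> M (i, j) \<in> B" and Mext: "M \<in> extensional (matrix_index n)"
      by (auto simp: PiE_iff)
    then have M: "M \<in> matrices n C" using AB by auto
    let ?V = "matrix_algebra n H" and ?VC = "matrix_algebra n C"
    interpret v: complete_cstar_norm ?V "mnorm H n" using n by (rule H.matrix_complete)
    interpret vC: complete_cstar_norm ?VC "mnorm C n" using n by (rule C.matrix_complete)
    let ?M = "compose (matrix_index n) T M"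
    have ent: "H.multiplier_entries n ?M" using MB TM by (simp add: H.multiplier_entries_def compose_def)
    have "mnorm H n (matrix_action H n ?M Y) \<le> mnorm C n M * mnorm H n Y" if Y: "Y \<in> matrices n H" for Y
    proof (rule v.conv_norm_le[OF _ _ F])
      let ?Z = "matrix_action H n ?M Y"
      have Z: "?Z \<in> matrices n H" by (rule H.matrix_action_closed[OF ent Y])
      let ?D = "\<lambda>t. H.diag n (\<pi> (e t))"
      show "conv ?V (mnorm H n) F (\<lambda>t. ?D t \<otimes>\<^bsub>?V\<^esub> ?Z) ?Z"
        unfolding H.conv_matrix_iff[OF n]
      proof (intro conjI allI impI Z)
        show "\<forall>\<^sub>F t in F. ?D t \<otimes>\<^bsub>?V\<^esub> ?Z \<in> matrices n H"
          using v.mult_closed[of "?D _" ?Z] Z H.diag_closed[OF pe(1)] by (simp only: matrix_sel(1)) simp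
        fix i k assume ik: "i < n" "k < n"
        then show "conv H ?\<nu> F (\<lambda>t. (?D t \<otimes>\<^bsub>?V\<^esub> ?Z) (i, k)) (?Z (i, k))"
          using lim(1)[of "?Z (i, k)"] Z by (simp add: H.diag_mult(1)[OF pe(1) Z] del: matrix_sel(2))
      qed
      have "mnorm H n (?D t \<otimes>\<^bsub>?V\<^esub> ?Z) \<le> mnorm C n M * mnorm H n Y" for t
      proof -
        \<comment> \<open>The entries of this matrix belong to \<open>A\<close>, and multiplication
          by the contraction \<open>diag n (e t)\<close> does not increase the norm of
          \<open>M\<close>.\<close>
        let ?EM = "C.diag n (e t) \<otimes>\<^bsub>?VC\<^esub> M"
        let ?P = "compose (matrix_index n) \<pi> ?EM"
        have eC: "e t \<in> carrier C" using e(1) AB by blast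
        have EM: "?EM = (\<lambda>p\<in>matrix_index n. e t \<otimes>\<^bsub>C\<^esub> M p)" by (rule C.diag_mult(1)[OF eC M])
        have EMA: "?EM \<in> matrices n (C\<lparr>carrier := A\<rparr>)" unfolding EM using MB e(1) ideal by auto
        have P: "?P \<in> matrices n H" unfolding EM using MB e(1) ideal \<pi>'(1) by (auto simp: compose_def)
        have "?D t \<otimes>\<^bsub>?V\<^esub> ?Z = ?P \<otimes>\<^bsub>?V\<^esub> Y"
        proof (rule matrix_eqI[of _ n H])
          show "?D t \<otimes>\<^bsub>?V\<^esub> ?Z \<in> matrices n H" "?P \<otimes>\<^bsub>?V\<^esub> Y \<in> matrices n H"
            using v.mult_closed[of "?D t" ?Z] v.mult_closed[of ?P Y] Z P Y H.diag_closed[OF pe(1)] by (simp_all only: matrix_sel(1))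
          fix i k assume ik: "i < n" "k < n"
          have Ye: "Y (j, l) \<in> carrier H" if "j < n" "l < n" for j l using Y that by simp
          have "(?D t \<otimes>\<^bsub>?V\<^esub> ?Z) (i, k) = \<pi> (e t) \<otimes>\<^bsub>H\<^esub> (\<Oplus>\<^bsub>H\<^esub>j\<in>{..<n}. T (M (i, j)) (Y (j, k)))"
          proof -
            have "?Z (i, k) = (\<Oplus>\<^bsub>H\<^esub>j\<in>{..<n}. T (M (i, j)) (Y (j, k)))"
              unfolding H.matrix_action_apply[OF Y ik] using ik MB T(1) Ye
              by (intro H.M.finsum_cong') (auto simp: compose_def)
            then show ?thesis using ik by (simp only: H.diag_mult(1)[OF pe(1) Z]) simp
          qed
          also have "\<dots> = (\<Oplus>\<^bsub>H\<^esub>j\<in>{..<n}. \<pi> (e t) \<otimes>\<^bsub>H\<^esub> T (M (i, j)) (Y (j, k)))"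
            using ik MB T(1) Ye pe by (intro H.finsum_mult_left) auto
          also have "\<dots> = (\<Oplus>\<^bsub>H\<^esub>j\<in>{..<n}. ?P (i, j) \<otimes>\<^bsub>H\<^esub> Y (j, k))"
            using ik MB Ye T(2)[OF _ _ e(1)] \<pi>'(1) e(1) ideal
            unfolding EM by (intro H.M.finsum_cong') (auto simp: compose_def)
          finally show "(?D t \<otimes>\<^bsub>?V\<^esub> ?Z) (i, k) = (?P \<otimes>\<^bsub>?V\<^esub> Y) (i, k)"
            by (simp only: H.matrix_mult_apply[OF ik])
        qed
        then have "mnorm H n (?D t \<otimes>\<^bsub>?V\<^esub> ?Z) \<le> mnorm H n ?P * mnorm H n Y"
          using v.norm_mult[of ?P Y] P Y by (simp only: matrix_sel(1))
        also have "\<dots> \<le> mnorm C n M * mnorm H n Y"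
        proof (rule mult_right_mono)
          have "mnorm H n ?P \<le> mnorm (C\<lparr>carrier := A\<rparr>) n ?EM"
            using cc n EMA unfolding completely_contractive_def by blast
          also have "\<dots> = mnorm C n ?EM" by simp
          also have "\<dots> \<le> mnorm C n (C.diag n (e t)) * mnorm C n M"
            using vC.norm_mult[of "C.diag n (e t)" M] C.diag_closed[OF eC] M by (simp only: matrix_sel(1))
          also have "\<dots> \<le> 1 * mnorm C n M"
            using order_trans[OF C.norm_diag_le[OF n eC] e(2)] vC.norm_nonneg[of M] M
            by (intro mult_right_mono) (simp_all only: matrix_sel(1))
          finally show "mnorm H n ?P \<le> mnorm C n M" by simp
          show "0 \<le> mnorm H n Y" using v.norm_nonneg[of Y] Y by (simp only: matrix_sel(1))
        qed
        finally show ?thesis .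
      qed
      then show "\<forall>\<^sub>F t in F. mnorm H n (?D t \<otimes>\<^bsub>?V\<^esub> ?Z) \<le> mnorm C n M * mnorm H n Y" by simp
    qed
    moreover have "0 \<le> mnorm C n M" using vC.norm_nonneg[of M] M by (simp only: matrix_sel(1))
    ultimately have "op_norm ?V (mnorm H n) (matrix_action H n ?M) \<le> mnorm C n M"
      by (intro v.op_norm_le) (simp_all only: matrix_sel(1))
    then show "mnorm (multiplier_algebra H) n ?M \<le> mnorm (C\<lparr>carrier := B\<rparr>) n M"
      by (simp add: multiplier_algebra_sel)
  qed
  then show thesis by (rule that[OF hom _ TA])
qed

end

section \<open>The maximal cover of the ideal\<close>

text \<open>From a net converging in norm one extracts a sequence with the same limit, choosing
  indices at distance below \<open>1 / Suc n\<close>.\<close>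

lemma (in complete_cstar_norm) seq_closed_filter:
  assumes S: "seq_closed U \<nu> S" and l: "conv U \<nu> G f x" and f: "\<And>t. f t \<in> S" "\<And>t. f t \<in> carrier U" and G: "G \<noteq> bot"
  shows "x \<in> S"
proof -
  have "\<exists>t. \<nu> (f t \<ominus> x) < 1 / Suc n" for n
  proof -
    have "\<forall>\<^sub>F t in G. \<nu> (f t \<ominus> x) < 1 / Suc n"
      by (rule order_tendstoD(2)[OF convD(3)[OF l]]) simp
    then show ?thesis using eventually_happens G by blast
  qed
  then obtain t where t: "\<And>n. \<nu> (f (t n) \<ominus> x) < 1 / Suc n" by metis
  have "conv U \<nu> sequentially (\<lambda>n. f (t n)) x"
  proof (rule convI_bound[OF convD(1)[OF l]])
    show "(\<lambda>n. 1 / Suc n) \<longlonglongrightarrow> 0" using LIMSEQ_inverse_real_of_nat by (simp add: inverse_eq_divide)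
    show "\<forall>\<^sub>F n in sequentially. f (t n) \<in> carrier U \<and> \<nu> (f (t n) \<ominus> x) \<le> 1 / Suc n"
      using f(2) t by (simp add: less_imp_le)
  qed
  then show ?thesis by (rule seq_closedD[OF S f(1)])
qed

text \<open>The universal property is assumed at the type \<open>nat \<Rightarrow> 'c\<close> only;
  targets on other types are reached through \<open>max_cstar_cover_any_type\<close>.\<close>

locale maximal_cover = approx_unital_ideal C A B F e
  for C :: "('c, 'm) matrix_normed_alg_scheme" and A B F and e :: "'t \<Rightarrow> 'c" +
  fixes E :: "('e, 'n) matrix_normed_alg_scheme" and j :: "'c \<Rightarrow> 'e"
  assumes max: "max_cstar_cover TYPE(nat \<Rightarrow> 'c) (C\<lparr>carrier := B\<rparr>) E j"

sublocale maximal_cover \<subseteq> E: cstar_alg E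
  using max by unfold_locales (simp add: max_cstar_cover_def cstar_cover_def)

context maximal_cover
begin

abbreviation "D \<equiv> generated_cstar_subalgebra E (j ` A)"

lemma j_hom: "j \<in> algebra_hom (C\<lparr>carrier := B\<rparr>) E"
  using max by (simp add: max_cstar_cover_def cstar_cover_def)

lemmas j = algebra_homD[OF j_hom, simplified]

lemma j_isometric:
  assumes "n \<ge> 1" "\<And>i k. i < n \<Longrightarrow> k < n \<Longrightarrow> M (i, k) \<in> B" "M \<in> extensional (matrix_index n)"
  shows "mnorm E n (compose (matrix_index n) j M) = mnorm C n M"
proof -
  have "M \<in> matrices n (C\<lparr>carrier := B\<rparr>)" using assms by (auto simp: PiE_iff)
  then show ?thesis
    using max assms(1) by (auto simp: max_cstar_cover_def cstar_cover_def completely_isometric_def)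
qed

lemma j_norm:
  assumes "b \<in> B"
  shows "elt_norm E (j b) = elt_norm C b"
proof -
  have "compose (matrix_index 1) j (\<lambda>p\<in>matrix_index 1. b) = (\<lambda>p\<in>matrix_index 1. j b)"
    by (auto simp: compose_def)
  then show ?thesis
    using j_isometric[of 1 "\<lambda>p\<in>matrix_index 1. b"] assms by (simp add: elt_norm_def)
qed

lemma generated_E: "generated_cstar_subalgebra E (j ` B) = carrier E"
  using max by (simp add: max_cstar_cover_def cstar_cover_def)

lemma jA: "j ` A \<subseteq> carrier E"
  using j(1) AB by blast

lemmas D_gen = E.generated_cstar_subalgebra[OF jA]
lemmas D = E.cstar_subalgebraD[OF D_gen(1)]

lemma j_diff: "x \<in> B \<Longrightarrow> y \<in> B \<Longrightarrow> j (x \<ominus>\<^bsub>C\<^esub> y) = j x \<ominus>\<^bsub>E\<^esub> j y"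
  using star_map_linear(3)[OF B_algebra E.complex_algebra_axioms, of j x y] j C.subspace_diff[OF B(1), of x y] by simp

lemma je: "j (e t) \<in> carrier E" "elt_norm E (j (e t)) \<le> 1" "j (e t) \<in> D"
  using j(1) e AB j_norm D_gen(2) by auto

sublocale Ec: column_cstar_norm E "elt_norm E"
  by (rule E.column_norm)

lemma D_approx_unit: "d \<in> D \<Longrightarrow> Ec.approx_unit F (\<lambda>t. j (e t)) d"
  using hom_approx_unit[OF E.cstar B(1) A(2) B_mult j_hom] j_norm by simp

text \<open>Insert the net between the two factors, using that \<open>j b j(e t) = j (b e t)\<close>
  lies in \<open>D\<close>. For the adjoint of \<open>j b\<close> the adjoint net has to be
  inserted, with \<open>adj(j b) adj(j (e t)) = adj(j (e t b))\<close>, so the two halves use the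
  ideal property on different sides.\<close>

lemma jb_D:
  assumes b: "b \<in> B" and d: "d \<in> D"
  shows "j b \<otimes>\<^bsub>E\<^esub> d \<in> D" "adj E (j b) \<otimes>\<^bsub>E\<^esub> d \<in> D"
proof -
  have jAD: "j a \<in> D" if "a \<in> A" for a using D_gen(2) that by blast
  have lim: "conv E (elt_norm E) F (\<lambda>t. j (e t) \<otimes>\<^bsub>E\<^esub> d) d" "conv E (elt_norm E) F (\<lambda>t. adj E (j (e t)) \<otimes>\<^bsub>E\<^esub> d) d"
    using D_approx_unit[OF d] unfolding Ec.approx_unit_def Ec.left_unit_def by blast+
  have jb: "j b \<in> carrier E" using j(1) b by simp
  show "j b \<otimes>\<^bsub>E\<^esub> d \<in> D"
  proof (rule E.seq_closed_filter[OF D(2) E.conv_mult_left[OF lim(1) jb] _ _ F])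
    fix t
    have "j b \<otimes>\<^bsub>E\<^esub> (j (e t) \<otimes>\<^bsub>E\<^esub> d) = j (b \<otimes>\<^bsub>C\<^esub> e t) \<otimes>\<^bsub>E\<^esub> d"
      using b d D(4) e(1) AB j je by (simp add: E.mult_assoc)
    then show "j b \<otimes>\<^bsub>E\<^esub> (j (e t) \<otimes>\<^bsub>E\<^esub> d) \<in> D" using D(5) jAD ideal(2)[OF e(1) b] d by simp
    then show "j b \<otimes>\<^bsub>E\<^esub> (j (e t) \<otimes>\<^bsub>E\<^esub> d) \<in> carrier E" by (rule D(4))
  qed
  show "adj E (j b) \<otimes>\<^bsub>E\<^esub> d \<in> D"
  proof (rule E.seq_closed_filter[OF D(2) E.conv_mult_left[OF lim(2) E.adj_closed[OF jb]] _ _ F])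
    fix t
    have "adj E (j b) \<otimes>\<^bsub>E\<^esub> (adj E (j (e t)) \<otimes>\<^bsub>E\<^esub> d) = adj E (j (e t \<otimes>\<^bsub>C\<^esub> b)) \<otimes>\<^bsub>E\<^esub> d"
      using b d D(4) e(1) AB j je jb by (simp add: E.mult_assoc E.adj_mult)
    then show "adj E (j b) \<otimes>\<^bsub>E\<^esub> (adj E (j (e t)) \<otimes>\<^bsub>E\<^esub> d) \<in> D"
      using D(5,6) jAD ideal(1)[OF e(1) b] d by simp
    then show "adj E (j b) \<otimes>\<^bsub>E\<^esub> (adj E (j (e t)) \<otimes>\<^bsub>E\<^esub> d) \<in> carrier E" by (rule D(4))
  qed
qed

text \<open>The elements that multiply \<open>D\<close> into itself from the left, along with their
  adjoints, form a C*-subalgebra that contains the generators. Products from the other side follow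
  by taking adjoints, as \<open>D\<close> is selfadjoint.\<close>

lemma D_ideal:
  assumes x: "x \<in> carrier E" and d: "d \<in> D"
  shows "x \<otimes>\<^bsub>E\<^esub> d \<in> D" "d \<otimes>\<^bsub>E\<^esub> x \<in> D"
proof -
  let ?T = "{x \<in> carrier E. \<forall>d\<in>D. x \<otimes>\<^bsub>E\<^esub> d \<in> D \<and> adj E x \<otimes>\<^bsub>E\<^esub> d \<in> D}"
  note Dl = linear_subspaceD[OF D(1)]
  have z: "\<zero>\<^bsub>E\<^esub> \<otimes>\<^bsub>E\<^esub> d = \<zero>\<^bsub>E\<^esub>" if "d \<in> D" for d using D(4) that by simp
  have "cstar_subalgebra ?T E"
    unfolding E.cstar_subalgebra_iff
  proof (intro conjI ballI)
    show "linear_subspace E ?T"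
      unfolding linear_subspace_def using Dl z
      by (auto simp: E.distr_left E.smult_mult_left E.adj_add E.adj_smult)
    show "seq_closed E (elt_norm E) ?T"
      unfolding seq_closed_def
    proof (intro allI impI, elim conjE)
      fix \<xi> x assume \<xi>: "\<forall>n. \<xi> n \<in> ?T" and l: "conv E (elt_norm E) sequentially \<xi> x"
      have "x \<otimes>\<^bsub>E\<^esub> d \<in> D \<and> adj E x \<otimes>\<^bsub>E\<^esub> d \<in> D" if d: "d \<in> D" for d
      proof
        show "x \<otimes>\<^bsub>E\<^esub> d \<in> D"
          by (rule seq_closedD[OF D(2) _ E.conv_mult_right[OF l D(4)[OF d]]]) (use \<xi> d in blast)
        show "adj E x \<otimes>\<^bsub>E\<^esub> d \<in> D"
          by (rule seq_closedD[OF D(2) _ E.conv_mult_right[OF E.conv_adj[OF l] D(4)[OF d]]]) (use \<xi> d in blast)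
      qed
      then show "x \<in> ?T" using E.convD(1)[OF l] by blast
    qed
    show "x \<otimes>\<^bsub>E\<^esub> y \<in> ?T" if "x \<in> ?T" "y \<in> ?T" for x y
      using that D(4) by (auto simp: E.adj_mult E.mult_assoc)
    show "adj E x \<in> ?T" if "x \<in> ?T" for x using that by auto
  qed
  moreover have "j ` B \<subseteq> ?T" using jb_D j(1) by blast
  moreover have "j ` B \<subseteq> carrier E" using j(1) by blast
  ultimately have T: "carrier E \<subseteq> ?T" using E.generated_cstar_subalgebra(3) generated_E by blast
  then show "x \<otimes>\<^bsub>E\<^esub> d \<in> D" using x d by blast
  have "adj E x \<otimes>\<^bsub>E\<^esub> adj E d \<in> D" using T x D(6)[OF d] by blast
  then have "adj E (adj E x \<otimes>\<^bsub>E\<^esub> adj E d) \<in> D" by (rule D(6))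
  then show "d \<otimes>\<^bsub>E\<^esub> x \<in> D" using x D(4)[OF d] by (simp add: E.adj_mult)
qed

theorem D_closed_ideal: "closed_ideal D E"
  using D_ideal D(1,2) by (simp add: closed_ideal_def E.closed_subspace_iff)

theorem ideal_max_cstar_cover: "max_cstar_cover TYPE('g) (C\<lparr>carrier := A\<rparr>) (E\<lparr>carrier := D\<rparr>) j"
  unfolding max_cstar_cover_def cstar_cover_def
proof (intro conjI allI impI)
  have jAD: "j a \<in> D" if "a \<in> A" for a using D_gen(2) that by blast
  show "cstar_algebra (E\<lparr>carrier := D\<rparr>)" by (rule cstar_subalgebra_cstar[OF E.cstar D_gen(1)])
  show "j \<in> algebra_hom (C\<lparr>carrier := A\<rparr>) (E\<lparr>carrier := D\<rparr>)"
    using jAD j AB by (auto simp: algebra_hom_def hom_def)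
  show "completely_isometric (C\<lparr>carrier := A\<rparr>) (E\<lparr>carrier := D\<rparr>) j"
    unfolding completely_isometric_def
  proof (intro allI impI ballI)
    fix n :: nat and M assume n: "1 \<le> n" and M: "M \<in> matrices n (C\<lparr>carrier := A\<rparr>)"
    then show "mnorm (E\<lparr>carrier := D\<rparr>) n (compose (matrix_index n) j M) = mnorm (C\<lparr>carrier := A\<rparr>) n M"
      using j_isometric[OF n, of M] AB(1) by (simp add: PiE_iff)
  qed
  show "generated_cstar_subalgebra (E\<lparr>carrier := D\<rparr>) (j ` carrier (C\<lparr>carrier := A\<rparr>)) = carrier (E\<lparr>carrier := D\<rparr>)"
    using generated_cstar_subalgebra_self[OF E.cstar jA] by simp
  fix G :: "'g matrix_normed_alg" and \<pi>
  assume "cstar_algebra G \<and> \<pi> \<in> algebra_hom (C\<lparr>carrier := A\<rparr>) G \<and> completely_contractive (C\<lparr>carrier := A\<rparr>) G \<pi>"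
  then have G: "cstar_algebra G" and \<pi>: "\<pi> \<in> algebra_hom (C\<lparr>carrier := A\<rparr>) G"
    and cc: "completely_contractive (C\<lparr>carrier := A\<rparr>) G \<pi>" by auto
  interpret G: cstar_alg G using G by unfold_locales
  note \<pi>' = algebra_homD[OF \<pi>, simplified]
  let ?K = "generated_cstar_subalgebra G (\<pi> ` A)"
  \<comment> \<open>Inside the algebra generated by its range, \<open>\<pi>\<close> is
    nondegenerate: the images of the net are an approximate unit there, as the extension to
    multipliers requires.\<close>
  let ?H = "G\<lparr>carrier := ?K\<rparr>"
  have sub: "\<pi> ` A \<subseteq> carrier G" using \<pi>'(1) by blast
  note K = G.generated_cstar_subalgebra[OF sub]
  note K' = G.cstar_subalgebraD[OF K(1)]
  have H: "cstar_algebra ?H" by (rule cstar_subalgebra_cstar[OF G K(1)])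
  interpret H: cstar_alg ?H using H by unfold_locales
  have \<pi>H: "\<pi> \<in> algebra_hom (C\<lparr>carrier := A\<rparr>) ?H"
    using \<pi>' K(2) by (auto simp: algebra_hom_def hom_def)
  have ccH: "completely_contractive (C\<lparr>carrier := A\<rparr>) ?H \<pi>"
    using cc by (simp add: completely_contractive_def)
  have gen: "generated_cstar_subalgebra ?H (\<pi> ` A) = carrier ?H"
    using generated_cstar_subalgebra_self[OF G sub] by simp
  obtain \<tau> where \<tau>: "\<tau> \<in> algebra_hom (C\<lparr>carrier := B\<rparr>) (multiplier_algebra ?H)"
    "completely_contractive (C\<lparr>carrier := B\<rparr>) (multiplier_algebra ?H) \<tau>"
    "\<And>a. a \<in> A \<Longrightarrow> \<tau> a = H.left_mult (\<pi> a)"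
    using extend_to_multipliers[OF H \<pi>H ccH gen] by blast
  obtain \<theta> where \<theta>: "star_map E (multiplier_algebra ?H) \<theta>" "\<And>b. b \<in> carrier (C\<lparr>carrier := B\<rparr>) \<Longrightarrow> \<theta> (j b) = \<tau> b"
    using max_cstar_cover_any_type[OF max B_algebra H.multiplier_cstar \<tau>(1,2)] by blast
  let ?L = "H.left_mult"
  note L = star_mapD[OF H.left_mult_star_map]
  note \<theta>' = star_mapD[OF \<theta>(1)]
  have "cstar_subalgebra {x \<in> carrier E. \<theta> x \<in> ?L ` carrier ?H} E"
    by (rule cstar_subalgebra_vimage[OF E.cstar H.multiplier_cstar \<theta>(1) H.left_mult_range])
  moreover have \<theta>j: "\<theta> (j a) = ?L (\<pi> a)" if "a \<in> A" for a using \<theta>(2) \<tau>(3) that AB by simp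
  moreover have "j ` A \<subseteq> {x \<in> carrier E. \<theta> x \<in> ?L ` carrier ?H}"
    using \<theta>j jA \<pi>'(1) K(2) by auto
  ultimately have DT: "D \<subseteq> {x \<in> carrier E. \<theta> x \<in> ?L ` carrier ?H}"
    using D_gen(3) by blast
  \<comment> \<open>On \<open>D\<close> the extension takes values in the left multiplications by
    elements of \<open>?K\<close>; undoing this embedding gives a map into \<open>G\<close>.\<close>
  define g where "g d = inv_into ?K ?L (\<theta> d)" for d
  have injL: "inj_on ?L ?K" using H.left_mult_inj by simp
  have g: "g d \<in> ?K" "?L (g d) = \<theta> d" if "d \<in> D" for d
  proof -
    have "\<theta> d \<in> ?L ` ?K" using DT that by auto
    then show "g d \<in> ?K" "?L (g d) = \<theta> d" by (simp_all add: g_def inv_into_into f_inv_into_f)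
  qed
  have eqI: "g d = k" if "d \<in> D" "k \<in> ?K" "\<theta> d = ?L k" for d k
    using that injL by (simp add: g_def inv_into_f_f)
  note Dl = linear_subspaceD[OF D(1)] and Kl = linear_subspaceD[OF K'(1)]
  show "\<exists>\<theta>\<in>star_hom (E\<lparr>carrier := D\<rparr>) G. \<forall>x\<in>carrier (C\<lparr>carrier := A\<rparr>). \<theta> (j x) = \<pi> x"
  proof (intro bexI ballI)
    have "g x \<in> carrier G" if "x \<in> D" for x using g(1)[OF that] K'(4) by blast
    moreover have "g (x \<otimes>\<^bsub>E\<^esub> y) = g x \<otimes>\<^bsub>G\<^esub> g y" if "x \<in> D" "y \<in> D" for x y
      by (rule eqI) (use that D Dl K' g \<theta>' L(2)[of "g x" "g y"] in simp_all)
    moreover have "g (x \<oplus>\<^bsub>E\<^esub> y) = g x \<oplus>\<^bsub>G\<^esub> g y" if "x \<in> D" "y \<in> D" for x y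
      by (rule eqI) (use that D Dl Kl g \<theta>' L(3)[of "g x" "g y"] in simp_all)
    moreover have "g (c \<odot>\<^bsub>E\<^esub> x) = c \<odot>\<^bsub>G\<^esub> g x" if "x \<in> D" for c x
      by (rule eqI) (use that D Dl Kl g \<theta>' L(4)[of "g x" c] in simp_all)
    moreover have "g (adj E x) = adj G (g x)" if "x \<in> D" for x
      by (rule eqI) (use that D Dl K' g \<theta>' L(5)[of "g x"] in simp_all)
    ultimately show "g \<in> star_hom (E\<lparr>carrier := D\<rparr>) G"
      unfolding star_hom_iff star_map_def by simp
    fix a assume "a \<in> carrier (C\<lparr>carrier := A\<rparr>)"
    then show "g (j a) = \<pi> a"
      using \<theta>j jAD K(2) by (intro eqI) auto
  qed
qed

end

section \<open>Quotients\<close>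

text \<open>The map \<open>q\<close> is abstract because the lemma is applied to
  \<open>M_n(U)\<close> and \<open>M_n(U/I)\<close>, where the elements of the target are matrices
  of cosets. Submultiplicativity and invariance under the adjoint come directly from nearly optimal
  lifts; the hypothesis \<open>unit\<close> is spent on the C*-identity.\<close>

lemma quotient_cstar_norm:
  fixes V :: "('a, 'm) star_alg_scheme" and W :: "('b, 'n) star_alg_scheme"
  assumes V: "complete_cstar_norm V \<nu>" and W: "star_algebra W" and q: "star_map V W q"
    and surj: "carrier W = q ` carrier V"
    and closed: "seq_closed V \<nu> {x \<in> carrier V. q x = \<zero>\<^bsub>W\<^esub>}"
    and unit: "\<And>d \<delta>. d \<in> carrier V \<Longrightarrow> q d = \<zero>\<^bsub>W\<^esub> \<Longrightarrow> \<delta> > 0 \<Longrightarrow> \<exists>a\<in>carrier V. q a = \<zero>\<^bsub>W\<^esub> \<and>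
      (\<forall>x\<in>carrier V. \<nu> (x \<ominus>\<^bsub>V\<^esub> a \<otimes>\<^bsub>V\<^esub> x) \<le> (1 + \<delta>) * \<nu> x) \<and> \<nu> (d \<ominus>\<^bsub>V\<^esub> a \<otimes>\<^bsub>V\<^esub> d) \<le> \<delta>"
    and \<mu>: "\<And>x. x \<in> carrier V \<Longrightarrow> \<mu> (q x) = Inf (\<nu> ` {y \<in> carrier V. q y = q x})"
  shows "complete_cstar_norm W \<mu>"
proof (rule complete_cstar_normI[OF W])
  interpret V: complete_cstar_norm V \<nu> by fact
  interpret W: star_algebra W by fact
  note q' = star_mapD[OF q]
  note lin = star_map_linear[OF V.complex_algebra_axioms W.complex_algebra_axioms q'(1,3,4)]
  have le: "\<mu> (q x) \<le> \<nu> x" if "x \<in> carrier V" for x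
    unfolding \<mu>[OF that] by (rule cInf_lower) (use that in \<open>auto intro!: bdd_belowI[of _ 0]\<close>)
  have ge: "b \<le> \<mu> (q x)" if "x \<in> carrier V" "\<And>y. y \<in> carrier V \<Longrightarrow> q y = q x \<Longrightarrow> b \<le> \<nu> y" for x b
    unfolding \<mu>[OF that(1)] by (rule cInf_greatest) (use that in auto)
  have lift: "\<exists>y\<in>carrier V. q y = w \<and> \<nu> y < \<mu> w + \<epsilon>" if w: "w \<in> carrier W" and \<epsilon>: "\<epsilon> > 0" for w \<epsilon>
  proof (rule ccontr)
    assume n: "\<not> ?thesis"
    obtain x where x: "x \<in> carrier V" "w = q x" using w surj by auto
    have "\<mu> w + \<epsilon> \<le> \<mu> (q x)" using n x by (intro ge[OF x(1)]) force
    then show False using x \<epsilon> by simp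
  qed
  have nonneg: "0 \<le> \<mu> w" if "w \<in> carrier W" for w
    using that ge[of _ 0] surj by auto
  show "0 \<le> \<mu> w" if "w \<in> carrier W" for w by (rule nonneg[OF that])
  show eq0: "\<mu> w = 0 \<longleftrightarrow> w = \<zero>\<^bsub>W\<^esub>" if w: "w \<in> carrier W" for w
  proof
    assume 0: "\<mu> w = 0"
    obtain x where x: "x \<in> carrier V" "w = q x" using w surj by auto
    have "\<exists>y\<in>carrier V. q y = w \<and> \<nu> y < 1 / Suc n" for n using lift[OF w, of "1 / Suc n"] 0 by simp
    then obtain y where y: "\<And>n. y n \<in> carrier V" "\<And>n. q (y n) = w" "\<And>n. \<nu> (y n) < 1 / Suc n" by metis
    have l: "conv V \<nu> sequentially (\<lambda>n. x \<ominus>\<^bsub>V\<^esub> y n) x"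
    proof (rule V.convI_bound[OF x(1)])
      show "(\<lambda>n. 1 / Suc n) \<longlonglongrightarrow> 0" using LIMSEQ_inverse_real_of_nat by (simp add: inverse_eq_divide)
      have "x \<ominus>\<^bsub>V\<^esub> y n \<ominus>\<^bsub>V\<^esub> x = \<ominus>\<^bsub>V\<^esub> y n" for n
        using x y(1) by (intro V.eq_by_functionals) (auto simp: V.functionalD)
      then show "\<forall>\<^sub>F n in sequentially. x \<ominus>\<^bsub>V\<^esub> y n \<in> carrier V \<and> \<nu> (x \<ominus>\<^bsub>V\<^esub> y n \<ominus>\<^bsub>V\<^esub> x) \<le> 1 / Suc n"
        using x y by (simp add: less_imp_le)
    qed
    have "q (x \<ominus>\<^bsub>V\<^esub> y n) = \<zero>\<^bsub>W\<^esub>" for n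
      using x(1) x(2)[symmetric] y(1,2) w lin(3) by (simp add: W.M.minus_eq W.M.r_neg)
    then have "x \<in> {x \<in> carrier V. q x = \<zero>\<^bsub>W\<^esub>}"
      by (intro seq_closedD[OF closed _ l]) (use x y(1) in auto)
    then show "w = \<zero>\<^bsub>W\<^esub>" using x by simp
  next
    assume "w = \<zero>\<^bsub>W\<^esub>"
    then show "\<mu> w = 0" using le[of "\<zero>\<^bsub>V\<^esub>"] nonneg[OF w] lin(1) by simp
  qed
  show tri: "\<mu> (v \<oplus>\<^bsub>W\<^esub> w) \<le> \<mu> v + \<mu> w" if v: "v \<in> carrier W" and w: "w \<in> carrier W" for v w
  proof (rule field_le_epsilon)
    fix \<epsilon> :: real assume "\<epsilon> > 0"
    then obtain x y where xy: "x \<in> carrier V" "q x = v" "\<nu> x < \<mu> v + \<epsilon> / 2" "y \<in> carrier V" "q y = w" "\<nu> y < \<mu> w + \<epsilon> / 2"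
      using lift[OF v, of "\<epsilon> / 2"] lift[OF w, of "\<epsilon> / 2"] by auto
    then have "\<mu> (v \<oplus>\<^bsub>W\<^esub> w) \<le> \<nu> (x \<oplus>\<^bsub>V\<^esub> y)" using le[of "x \<oplus>\<^bsub>V\<^esub> y"] q' by simp
    then show "\<mu> (v \<oplus>\<^bsub>W\<^esub> w) \<le> \<mu> v + \<mu> w + \<epsilon>" using V.norm_triangle[of x y] xy by simp
  qed
  have sm_le: "\<mu> (c \<odot>\<^bsub>W\<^esub> w) \<le> cmod c * \<mu> w" if w: "w \<in> carrier W" for c w
  proof (rule le_of_le_add_small)
    fix u :: real assume "0 < u" "u < 1"
    then obtain x where x: "x \<in> carrier V" "q x = w" "\<nu> x < \<mu> w + u" using lift[OF w] by auto
    then have "\<mu> (c \<odot>\<^bsub>W\<^esub> w) \<le> cmod c * \<nu> x" using le[of "c \<odot>\<^bsub>V\<^esub> x"] q' by (simp add: V.norm_smult)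
    also have "\<dots> \<le> cmod c * (\<mu> w + u)" using x by (intro mult_left_mono) auto
    finally show "\<mu> (c \<odot>\<^bsub>W\<^esub> w) \<le> cmod c * \<mu> w + u * cmod c" by (simp add: algebra_simps)
  qed
  show "\<mu> (c \<odot>\<^bsub>W\<^esub> w) = cmod c * \<mu> w" if w: "w \<in> carrier W" for c w
  proof (rule antisym[OF sm_le[OF w]])
    show "cmod c * \<mu> w \<le> \<mu> (c \<odot>\<^bsub>W\<^esub> w)"
    proof (cases "c = 0")
      case False
      have "\<mu> w \<le> cmod (inverse c) * \<mu> (c \<odot>\<^bsub>W\<^esub> w)"
        using sm_le[of "c \<odot>\<^bsub>W\<^esub> w" "inverse c"] w False by (simp add: W.sm_assoc)
      then have "cmod c * \<mu> w \<le> cmod c * (cmod (inverse c) * \<mu> (c \<odot>\<^bsub>W\<^esub> w))"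
        by (intro mult_left_mono) auto
      also have "\<dots> = \<mu> (c \<odot>\<^bsub>W\<^esub> w)" using False by (simp add: norm_inverse)
      finally show ?thesis .
    qed (use nonneg[of "c \<odot>\<^bsub>W\<^esub> w"] w in simp)
  qed
  show mult: "\<mu> (v \<otimes>\<^bsub>W\<^esub> w) \<le> \<mu> v * \<mu> w" if v: "v \<in> carrier W" and w: "w \<in> carrier W" for v w
  proof (rule le_of_le_add_small)
    fix u :: real assume u: "0 < u" "u < 1"
    then obtain x y where xy: "x \<in> carrier V" "q x = v" "\<nu> x < \<mu> v + u" "y \<in> carrier V" "q y = w" "\<nu> y < \<mu> w + u"
      using lift[OF v u(1)] lift[OF w u(1)] by auto
    then have "\<mu> (v \<otimes>\<^bsub>W\<^esub> w) \<le> \<nu> x * \<nu> y"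
      using le[of "x \<otimes>\<^bsub>V\<^esub> y"] q' V.norm_mult[of x y] by simp
    also have "\<dots> \<le> (\<mu> v + u) * (\<mu> w + u)"
      using xy nonneg[OF v] u by (intro mult_mono) auto
    also have "\<dots> = \<mu> v * \<mu> w + u * (\<mu> v + \<mu> w + u)" by (simp add: algebra_simps)
    also have "\<dots> \<le> \<mu> v * \<mu> w + u * (\<mu> v + \<mu> w + 1)" using u by (intro add_left_mono mult_left_mono) auto
    finally show "\<mu> (v \<otimes>\<^bsub>W\<^esub> w) \<le> \<mu> v * \<mu> w + u * (\<mu> v + \<mu> w + 1)" .
  qed
  have adj_le: "\<mu> (adj W w) \<le> \<mu> w" if w: "w \<in> carrier W" for w
  proof (rule le_of_le_add_small)
    fix u :: real assume "0 < u" "u < 1"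
    then obtain x where x: "x \<in> carrier V" "q x = w" "\<nu> x < \<mu> w + u" using lift[OF w] by auto
    then show "\<mu> (adj W w) \<le> \<mu> w + u * 1" using le[of "adj V x"] q' by simp
  qed
  txt \<open>If \<open>y\<close> is close to optimal among the lifts of \<open>ww\<^sup>*\<close>, the lift \<open>z = x - ax\<close> of \<open>w\<close> has
    \<open>zz\<^sup>* = (1 - a)xx\<^sup>*(1 - a)\<^sup>*\<close>, and \<open>(1 - a)xx\<^sup>*\<close> is close to \<open>(1 - a)y\<close>.\<close>
  have sq: "(\<mu> w)\<^sup>2 \<le> \<mu> (w \<otimes>\<^bsub>W\<^esub> adj W w)" if w: "w \<in> carrier W" for w
  proof (rule le_of_le_add_small)
    fix u :: real assume u: "0 < u" "u < 1"
    obtain x where x: "x \<in> carrier V" "q x = w" using w surj by auto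
    let ?y = "x \<otimes>\<^bsub>V\<^esub> adj V x" and ?m = "\<mu> (w \<otimes>\<^bsub>W\<^esub> adj W w)"
    obtain y where y: "y \<in> carrier V" "q y = w \<otimes>\<^bsub>W\<^esub> adj W w" "\<nu> y < ?m + u"
      using lift[of "w \<otimes>\<^bsub>W\<^esub> adj W w" u] w u by auto
    let ?d = "?y \<ominus>\<^bsub>V\<^esub> y"
    have d: "?d \<in> carrier V" "q ?d = \<zero>\<^bsub>W\<^esub>"
      using x y w q' lin(3) by (simp_all add: W.M.minus_eq W.M.r_neg)
    obtain a where a: "a \<in> carrier V" "q a = \<zero>\<^bsub>W\<^esub>"
      "\<And>z. z \<in> carrier V \<Longrightarrow> \<nu> (z \<ominus>\<^bsub>V\<^esub> a \<otimes>\<^bsub>V\<^esub> z) \<le> (1 + u) * \<nu> z" "\<nu> (?d \<ominus>\<^bsub>V\<^esub> a \<otimes>\<^bsub>V\<^esub> ?d) \<le> u"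
      using unit[OF d u(1)] by blast
    define z where "z = x \<ominus>\<^bsub>V\<^esub> a \<otimes>\<^bsub>V\<^esub> x"
    define p where "p = ?y \<ominus>\<^bsub>V\<^esub> a \<otimes>\<^bsub>V\<^esub> ?y"
    have z: "z \<in> carrier V" and p: "p \<in> carrier V" using x a by (simp_all add: z_def p_def)
    have "q z = w"
      unfolding z_def using x a q' lin(3) w by (simp add: W.M.minus_eq)
    then have "\<mu> w \<le> \<nu> z" using le[OF z] by simp
    then have "(\<mu> w)\<^sup>2 \<le> (\<nu> z)\<^sup>2" using nonneg[OF w] by (rule power_mono)
    also have "\<dots> = \<nu> (z \<otimes>\<^bsub>V\<^esub> adj V z)" using V.cstar_identity[of "adj V z"] z by simp
    also have "z \<otimes>\<^bsub>V\<^esub> adj V z = adj V (adj V p \<ominus>\<^bsub>V\<^esub> a \<otimes>\<^bsub>V\<^esub> adj V p)"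
    proof (rule V.eq_by_functionals)
      fix f assume f: "functional V f"
      show "f (z \<otimes>\<^bsub>V\<^esub> adj V z) = f (adj V (adj V p \<ominus>\<^bsub>V\<^esub> a \<otimes>\<^bsub>V\<^esub> adj V p))"
        using x a by (simp add: z_def p_def V.functionalD[OF f] V.distr_simps V.adj_simps)
    qed (use a z p in auto)
    also have "\<nu> \<dots> \<le> (1 + u) * \<nu> p"
      using a(3)[of "adj V p"] p a(1) by simp
    finally have 1: "(\<mu> w)\<^sup>2 \<le> (1 + u) * \<nu> p" .
    have "p = (y \<ominus>\<^bsub>V\<^esub> a \<otimes>\<^bsub>V\<^esub> y) \<oplus>\<^bsub>V\<^esub> (?d \<ominus>\<^bsub>V\<^esub> a \<otimes>\<^bsub>V\<^esub> ?d)"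
    proof (rule V.eq_by_functionals)
      fix f assume f: "functional V f"
      show "f p = f ((y \<ominus>\<^bsub>V\<^esub> a \<otimes>\<^bsub>V\<^esub> y) \<oplus>\<^bsub>V\<^esub> (?d \<ominus>\<^bsub>V\<^esub> a \<otimes>\<^bsub>V\<^esub> ?d))"
        using x y a by (simp add: p_def V.functionalD[OF f] V.distr_simps)
    qed (use x y a p in auto)
    then have "\<nu> p \<le> \<nu> (y \<ominus>\<^bsub>V\<^esub> a \<otimes>\<^bsub>V\<^esub> y) + \<nu> (?d \<ominus>\<^bsub>V\<^esub> a \<otimes>\<^bsub>V\<^esub> ?d)"
      using V.norm_triangle[of "y \<ominus>\<^bsub>V\<^esub> a \<otimes>\<^bsub>V\<^esub> y" "?d \<ominus>\<^bsub>V\<^esub> a \<otimes>\<^bsub>V\<^esub> ?d"] x y a by simp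
    also have "\<dots> \<le> (1 + u) * (?m + u) + u"
      using a(3)[OF y(1)] a(4) y(3) u mult_left_mono[of "\<nu> y" "?m + u" "1 + u"] by linarith
    finally have 2: "\<nu> p \<le> (1 + u) * (?m + u) + u" .
    have m: "0 \<le> ?m" using nonneg w by simp
    have "(\<mu> w)\<^sup>2 \<le> (1 + u) * ((1 + u) * (?m + u) + u)"
      using order_trans[OF 1 mult_left_mono[OF 2]] u by simp
    also have "\<dots> = ?m + u * ((2 + u) * ?m + (1 + u) * (1 + u) + (1 + u))"
      by (simp add: algebra_simps)
    \<comment> \<open>The crude constants come from \<open>u < 1\<close> and leave a remainder that
      is linear in \<open>u\<close>.\<close>
    also have "\<dots> \<le> ?m + u * (3 * ?m + 2 * 2 + 2)"
      using u m by (intro add_left_mono mult_left_mono add_mono mult_right_mono mult_mono) auto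
    finally show "(\<mu> w)\<^sup>2 \<le> ?m + u * (3 * ?m + 2 * 2 + 2)" .
  qed
  show "\<mu> (adj W w \<otimes>\<^bsub>W\<^esub> w) = (\<mu> w)\<^sup>2" if w: "w \<in> carrier W" for w
  proof (rule antisym)
    have "\<mu> (adj W w \<otimes>\<^bsub>W\<^esub> w) \<le> \<mu> (adj W w) * \<mu> w" using w by (intro mult) auto
    also have "\<dots> \<le> \<mu> w * \<mu> w" using adj_le[OF w] nonneg[OF w] by (rule mult_right_mono)
    finally show "\<mu> (adj W w \<otimes>\<^bsub>W\<^esub> w) \<le> (\<mu> w)\<^sup>2" by (simp add: power2_eq_square)
    have "(\<mu> w)\<^sup>2 \<le> (\<mu> (adj W w))\<^sup>2"
      using adj_le[of "adj W w"] w nonneg[OF w] by (intro power_mono) auto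
    also have "\<dots> \<le> \<mu> (adj W w \<otimes>\<^bsub>W\<^esub> w)" using sq[of "adj W w"] w by simp
    finally show "(\<mu> w)\<^sup>2 \<le> \<mu> (adj W w \<otimes>\<^bsub>W\<^esub> w)" .
  qed
  fix \<xi> :: "nat \<Rightarrow> 'b"
  assume \<xi>: "\<And>n. \<xi> n \<in> carrier W"
    and C: "\<And>\<epsilon>. \<epsilon> > 0 \<Longrightarrow> \<exists>N. \<forall>m\<ge>N. \<forall>n\<ge>N. \<mu> (\<xi> m \<ominus>\<^bsub>W\<^esub> \<xi> n) < \<epsilon>"
  \<comment> \<open>Completeness: pass to a subsequence whose successive differences are below
    \<open>(1/2) ^ i\<close>, lift each difference with the same bound, and sum the lifts in
    \<open>V\<close>.\<close>
  have "\<exists>N. \<forall>m\<ge>N. \<forall>n\<ge>N. \<mu> (\<xi> m \<ominus>\<^bsub>W\<^esub> \<xi> n) < (1/2) ^ i" for i using C by simp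
  then obtain N where N: "\<And>i m n. m \<ge> N i \<Longrightarrow> n \<ge> N i \<Longrightarrow> \<mu> (\<xi> m \<ominus>\<^bsub>W\<^esub> \<xi> n) < (1/2) ^ i" by metis
  define r where "r = rec_nat (N 0) (\<lambda>i ri. max (Suc ri) (N (Suc i)))"
  have r0: "r 0 = N 0" and rS: "\<And>i. r (Suc i) = max (Suc (r i)) (N (Suc i))" by (simp_all add: r_def)
  have rm: "strict_mono r" by (rule strict_mono_Suc_iff[THEN iffD2]) (simp add: rS less_max_iff_disj)
  have rN: "r i \<ge> N i" for i by (cases i) (simp_all add: r0 rS)
  have step: "\<mu> (\<xi> (r (Suc i)) \<ominus>\<^bsub>W\<^esub> \<xi> (r i)) < (1/2) ^ i" for i
    using N[of i "r (Suc i)" "r i"] rN[of i] by (simp add: rS)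
  have "\<exists>y. y \<in> carrier V \<and> q y = \<xi> (r (Suc i)) \<ominus>\<^bsub>W\<^esub> \<xi> (r i) \<and> \<nu> y \<le> (1/2) ^ i" for i
  proof -
    obtain y where "y \<in> carrier V" "q y = \<xi> (r (Suc i)) \<ominus>\<^bsub>W\<^esub> \<xi> (r i)"
      "\<nu> y < \<mu> (\<xi> (r (Suc i)) \<ominus>\<^bsub>W\<^esub> \<xi> (r i)) + ((1/2) ^ i - \<mu> (\<xi> (r (Suc i)) \<ominus>\<^bsub>W\<^esub> \<xi> (r i)))"
      using lift[of "\<xi> (r (Suc i)) \<ominus>\<^bsub>W\<^esub> \<xi> (r i)" "(1/2) ^ i - \<mu> (\<xi> (r (Suc i)) \<ominus>\<^bsub>W\<^esub> \<xi> (r i))"] \<xi> step[of i] by auto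
    then show ?thesis by (intro exI[of _ y]) simp
  qed
  then obtain y where y: "\<And>i. y i \<in> carrier V" "\<And>i. q (y i) = \<xi> (r (Suc i)) \<ominus>\<^bsub>W\<^esub> \<xi> (r i)" "\<And>i. \<nu> (y i) \<le> (1/2) ^ i"
    by metis
  obtain x0 where x0: "x0 \<in> carrier V" "q x0 = \<xi> (r 0)" using \<xi>[of "r 0"] surj by auto
  define s where "s = rec_nat x0 (\<lambda>i si. si \<oplus>\<^bsub>V\<^esub> y i)"
  have s0: "s 0 = x0" and sS: "\<And>i. s (Suc i) = s i \<oplus>\<^bsub>V\<^esub> y i" by (simp_all add: s_def)
  have sV: "s i \<in> carrier V" for i by (induction i) (simp_all add: s0 sS x0 y)
  have qs: "q (s i) = \<xi> (r i)" for i
  proof (induction i)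
    case (Suc i)
    have "\<xi> (r i) \<oplus>\<^bsub>W\<^esub> (\<xi> (r (Suc i)) \<ominus>\<^bsub>W\<^esub> \<xi> (r i)) = \<xi> (r (Suc i))"
      using \<xi> by (intro W.eq_by_functionals) (auto simp: W.functionalD)
    then show ?case using Suc q'(3)[OF sV y(1)] y(2) by (simp add: sS)
  qed (simp add: s0 x0)
  have "\<nu> (s (Suc n) \<ominus>\<^bsub>V\<^esub> s n) \<le> 1 * (1/2) ^ n" for n
  proof -
    have "s (Suc n) \<ominus>\<^bsub>V\<^esub> s n = y n"
      unfolding sS using sV y(1) by (intro V.eq_by_functionals) (auto simp: V.functionalD)
    then show ?thesis using y(3) by simp
  qed
  then obtain x where x: "conv V \<nu> sequentially s x"
    using V.geometric_converges[of s "1/2" 1] sV by auto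
  have xV: "x \<in> carrier V" by (rule V.convD(1)[OF x])
  have "(\<lambda>n. \<mu> (\<xi> (r n) \<ominus>\<^bsub>W\<^esub> q x)) \<longlonglongrightarrow> 0"
  proof (rule tendsto_sandwich[OF _ _ tendsto_const V.convD(3)[OF x]])
    show "\<forall>\<^sub>F n in sequentially. 0 \<le> \<mu> (\<xi> (r n) \<ominus>\<^bsub>W\<^esub> q x)" using nonneg \<xi> q'(1)[OF xV] by simp
    have "\<mu> (\<xi> (r n) \<ominus>\<^bsub>W\<^esub> q x) \<le> \<nu> (s n \<ominus>\<^bsub>V\<^esub> x)" for n
      using le[of "s n \<ominus>\<^bsub>V\<^esub> x"] lin(3)[of "s n" x] qs[of n] sV[of n] xV by simp
    then show "\<forall>\<^sub>F n in sequentially. \<mu> (\<xi> (r n) \<ominus>\<^bsub>W\<^esub> q x) \<le> \<nu> (s n \<ominus>\<^bsub>V\<^esub> x)" by simp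
  qed
  then show "\<exists>x\<in>carrier W. \<exists>r. strict_mono r \<and> (\<lambda>n::nat. \<mu> (\<xi> (r n) \<ominus>\<^bsub>W\<^esub> x)) \<longlonglongrightarrow> 0"
    using rm q'(1)[OF xV] by blast
qed

section \<open>Cosets and the operations of the quotient algebra\<close>

context complex_algebra
begin

lemma coset_iff:
  assumes "linear_subspace U I" "x \<in> carrier U"
  shows "y \<in> I +> x \<longleftrightarrow> y \<in> carrier U \<and> y \<ominus> x \<in> I"
proof
  note I = linear_subspaceD[OF assms(1)]
  assume "y \<in> I +> x"
  then obtain i where i: "i \<in> I" "y = i \<oplus> x" by (auto simp: a_r_coset_def')
  then have "y \<ominus> x = i" using assms I(2) by (simp add: M.minus_eq M.a_assoc M.r_neg)
  then show "y \<in> carrier U \<and> y \<ominus> x \<in> I" using i I(2) assms by simp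
next
  assume y: "y \<in> carrier U \<and> y \<ominus> x \<in> I"
  then have "y = (y \<ominus> x) \<oplus> x" using assms by (simp add: M.minus_eq M.a_assoc M.l_neg)
  then show "y \<in> I +> x" using y by (auto simp: a_r_coset_def')
qed

lemma coset_self: "linear_subspace U I \<Longrightarrow> x \<in> carrier U \<Longrightarrow> x \<in> I +> x"
  using linear_subspaceD(3) by (simp add: coset_iff M.minus_eq M.r_neg)

lemma coset_eq_iff:
  assumes I: "linear_subspace U I" and xy: "x \<in> carrier U" "y \<in> carrier U"
  shows "I +> x = I +> y \<longleftrightarrow> x \<ominus> y \<in> I"
proof
  assume "I +> x = I +> y"
  then show "x \<ominus> y \<in> I" using coset_self[OF I xy(1)] coset_iff[OF I xy(2)] by blast
next
  assume d: "x \<ominus> y \<in> I"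
  have "z \<ominus> x \<in> I \<longleftrightarrow> z \<ominus> y \<in> I" if z: "z \<in> carrier U" for z
  proof -
    have 1: "z \<ominus> y = (z \<ominus> x) \<oplus> (x \<ominus> y)" "z \<ominus> x = (z \<ominus> y) \<ominus> (x \<ominus> y)"
      using xy z by (auto intro!: eq_by_functionals simp: functionalD)
    show ?thesis
      using 1 linear_subspaceD(4)[OF I _ d] linear_subspace_minus(2)[OF I _ d] by metis
  qed
  then show "I +> x = I +> y" using coset_iff[OF I] xy by blast
qed

lemma coset_eq_subspace_iff:
  assumes I: "linear_subspace U I" and x: "x \<in> carrier U"
  shows "I +> x = I \<longleftrightarrow> x \<in> I"
proof -
  have m0: "y \<ominus> \<zero> = y" if "y \<in> carrier U" for y
    using that by (intro eq_by_functionals) (auto simp: functionalD)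
  have "y \<in> I +> \<zero> \<longleftrightarrow> y \<in> I" for y
    using coset_iff[OF I, of \<zero> y] linear_subspaceD(2)[OF I, of y] m0 by auto
  then have "I +> \<zero> = I" by blast
  then show ?thesis using coset_eq_iff[OF I x, of \<zero>] x m0 by simp
qed

end

locale algebra_ideal = complex_algebra U for U :: "('a, 'm) matrix_normed_alg_scheme" (structure) +
  fixes I :: "'a set"
  assumes subspace: "linear_subspace U I"
    and ideal: "\<And>a z. a \<in> I \<Longrightarrow> z \<in> carrier U \<Longrightarrow> a \<otimes> z \<in> I" "\<And>a z. a \<in> I \<Longrightarrow> z \<in> carrier U \<Longrightarrow> z \<otimes> a \<in> I"
begin

lemma quotient_carrier: "carrier (quotient_algebra U I) = (+>) I ` carrier U"
  by (auto simp: quotient_algebra_def A_RCOSETS_def')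

lemma quotient_zero: "\<zero>\<^bsub>quotient_algebra U I\<^esub> = I"
  by (simp add: quotient_algebra_def)

text \<open>\<open>quotient_algebra\<close> forms several operations as unions over all
  representatives; such a union collapses to one representative when its members agree.\<close>

lemma coset_union:
  assumes x: "x \<in> carrier U"
    and f: "\<And>y. y \<in> carrier U \<Longrightarrow> y \<ominus> x \<in> I \<Longrightarrow> f y = f x"
  shows "(\<Union>y\<in>I +> x. f y) = f x"
proof (rule UN_constant_eq[OF coset_self[OF subspace x]])
qed (use f coset_iff[OF subspace x] in blast)

lemma quotient_add:
  assumes xy: "x \<in> carrier U" "y \<in> carrier U"
  shows "(I +> x) \<oplus>\<^bsub>quotient_algebra U I\<^esub> (I +> y) = I +> (x \<oplus> y)"
proof -
  note Il = linear_subspaceD[OF subspace]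
  have "z \<in> set_add U (I +> x) (I +> y) \<longleftrightarrow> z \<in> I +> (x \<oplus> y)" for z
  proof
    assume "z \<in> set_add U (I +> x) (I +> y)"
    then obtain a b where ab: "a \<in> I" "b \<in> I" "z = (a \<oplus> x) \<oplus> (b \<oplus> y)"
      by (auto simp: set_add_def' a_r_coset_def')
    then have "z = (a \<oplus> b) \<oplus> (x \<oplus> y)" using xy Il(2) by (simp add: M.a_ac)
    then show "z \<in> I +> (x \<oplus> y)" using ab Il by (auto simp: a_r_coset_def')
  next
    assume "z \<in> I +> (x \<oplus> y)"
    then obtain a where a: "a \<in> I" "z = a \<oplus> (x \<oplus> y)" by (auto simp: a_r_coset_def')
    then have "z = (a \<oplus> x) \<oplus> (\<zero> \<oplus> y)" using xy Il(2) by (simp add: M.a_ac)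
    then show "z \<in> set_add U (I +> x) (I +> y)"
      using a Il(3) by (auto simp: set_add_def' a_r_coset_def')
  qed
  then show ?thesis by (auto simp: quotient_algebra_def)
qed

lemma quotient_smult:
  assumes x: "x \<in> carrier U"
  shows "c \<odot>\<^bsub>quotient_algebra U I\<^esub> (I +> x) = I +> (c \<odot> x)"
proof -
  have "I +> (c \<odot> y) = I +> (c \<odot> x)" if "y \<in> carrier U" "y \<ominus> x \<in> I" for y
  proof -
    have "c \<odot> y \<ominus> c \<odot> x = c \<odot> (y \<ominus> x)"
      using x that by (intro eq_by_functionals) (auto simp: functionalD algebra_simps)
    then show ?thesis using that x linear_subspaceD(5)[OF subspace] by (simp add: coset_eq_iff[OF subspace])
  qed
  then show ?thesis using coset_union[OF x, of "\<lambda>y. I +> (c \<odot> y)"] by (simp add: quotient_algebra_def)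
qed

lemma quotient_mult:
  assumes xy: "x \<in> carrier U" "y \<in> carrier U"
  shows "(I +> x) \<otimes>\<^bsub>quotient_algebra U I\<^esub> (I +> y) = I +> (x \<otimes> y)"
proof -
  have 1: "(\<Union>b\<in>I +> y. I +> (a \<otimes> b)) = I +> (a \<otimes> y)" if a: "a \<in> carrier U" for a
  proof (rule coset_union[OF xy(2)])
    fix b assume b: "b \<in> carrier U" "b \<ominus> y \<in> I"
    have "a \<otimes> b \<ominus> a \<otimes> y = a \<otimes> (b \<ominus> y)"
      using a b xy by (intro eq_by_functionals) (auto simp: functionalD distr_simps)
    then show "I +> (a \<otimes> b) = I +> (a \<otimes> y)" using a b xy ideal by (simp add: coset_eq_iff[OF subspace])
  qed
  have "(\<Union>a\<in>I +> x. \<Union>b\<in>I +> y. I +> (a \<otimes> b)) = (\<Union>a\<in>I +> x. I +> (a \<otimes> y))"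
    using coset_iff[OF subspace xy(1)] 1 by (intro SUP_cong) auto
  also have "\<dots> = I +> (x \<otimes> y)"
  proof (rule coset_union[OF xy(1)])
    fix a assume a: "a \<in> carrier U" "a \<ominus> x \<in> I"
    have "a \<otimes> y \<ominus> x \<otimes> y = (a \<ominus> x) \<otimes> y"
      using a xy by (intro eq_by_functionals) (auto simp: functionalD distr_simps)
    then show "I +> (a \<otimes> y) = I +> (x \<otimes> y)" using a xy ideal by (simp add: coset_eq_iff[OF subspace])
  qed
  finally show ?thesis by (simp add: quotient_algebra_def rcoset_mult_def)
qed

lemma quotient_adj:
  assumes U: "star_algebra U" and adj: "\<And>a. a \<in> I \<Longrightarrow> adj U a \<in> I" and x: "x \<in> carrier U"
  shows "adj (quotient_algebra U I) (I +> x) = I +> adj U x"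
proof -
  interpret star_algebra U by fact
  have "I +> adj U y = I +> adj U x" if "y \<in> carrier U" "y \<ominus> x \<in> I" for y
  proof -
    have "adj U y \<ominus> adj U x = adj U (y \<ominus> x)" using x that by (simp add: adj_simps)
    then show ?thesis using that x adj by (simp add: coset_eq_iff[OF subspace])
  qed
  then show ?thesis using coset_union[OF x, of "\<lambda>y. I +> adj U y"] by (simp add: quotient_algebra_def)
qed

text \<open>Choosing each entry from the coset \<open>q Z p\<close> amounts to lifting the matrix
  \<open>q Z\<close>, which puts the norm into the form of an infimum over the lifts.\<close>

lemma quotient_mnorm:
  assumes Z: "Z \<in> matrices n U"
  defines "q \<equiv> compose (matrix_index n) ((+>) I)"
  shows "mnorm (quotient_algebra U I) n (q Z) = Inf (mnorm U n ` {M \<in> matrices n U. q M = q Z})"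
proof -
  have "(\<forall>p\<in>matrix_index n. M p \<in> q Z p) \<longleftrightarrow> q M = q Z" if M: "M \<in> matrices n U" for M
  proof
    assume *: "\<forall>p\<in>matrix_index n. M p \<in> q Z p"
    show "q M = q Z"
      unfolding q_def compose_def
    proof (rule restrict_ext)
      fix p assume p: "p \<in> matrix_index n"
      then have c: "Z p \<in> carrier U" "M p \<in> carrier U" using Z M by auto
      have "M p \<in> I +> Z p" using * p by (auto simp: q_def compose_def)
      then show "I +> M p = I +> Z p" using coset_iff[OF subspace c(1)] coset_eq_iff[OF subspace c(2,1)] by blast
    qed
  next
    assume *: "q M = q Z"
    show "\<forall>p\<in>matrix_index n. M p \<in> q Z p"
    proof
      fix p assume p: "p \<in> matrix_index n"
      then have "M p \<in> carrier U" using M by auto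
      then have "M p \<in> q M p" using coset_self[OF subspace] p by (auto simp: q_def compose_def)
      then show "M p \<in> q Z p" by (simp only: *)
    qed
  qed
  then have "{M \<in> matrices n U. \<forall>p\<in>matrix_index n. M p \<in> q Z p} = {M \<in> matrices n U. q M = q Z}" by blast
  then show ?thesis by (simp add: quotient_algebra_def del: matrices_iff)
qed

end

lemma compose_image_matrices:
  assumes "carrier W = q ` carrier V"
  shows "matrices n W = compose (matrix_index n) q ` matrices n V"
proof
  show "compose (matrix_index n) q ` matrices n V \<subseteq> matrices n W"
    using assms by (auto simp: compose_def)
  show "matrices n W \<subseteq> compose (matrix_index n) q ` matrices n V"
  proof
    fix M assume M: "M \<in> matrices n W"
    have Mq: "M (i, k) \<in> q ` carrier V" if "i < n" "k < n" for i k
      using M that unfolding matrices_iff assms by blast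
    define N where "N = (\<lambda>p\<in>matrix_index n. inv_into (carrier V) q (M p))"
    have N: "N \<in> matrices n V" using inv_into_into[OF Mq] by (simp add: N_def)
    have "M = compose (matrix_index n) q N"
      using M Mq by (intro matrix_eqI[of _ n W]) (simp_all add: N_def compose_def f_inv_into_f)
    then show "M \<in> compose (matrix_index n) q ` matrices n V" using N by blast
  qed
qed

text \<open>At level \<open>n\<close> the kernel of the quotient map is \<open>M_n(I)\<close>, which
  contains \<open>diag n a\<close> for \<open>a\<close> in \<open>I\<close>. The hypothesis
  \<open>unit\<close> supplies such diagonal elements at every level, since the norms of all levels
  have to be C*-norms.\<close>

theorem (in cstar_alg) quotient_cstar_algebra:
  assumes I: "linear_subspace U I" "seq_closed U (elt_norm U) I"
    and id: "\<And>a z. a \<in> I \<Longrightarrow> z \<in> carrier U \<Longrightarrow> a \<otimes> z \<in> I" "\<And>a z. a \<in> I \<Longrightarrow> z \<in> carrier U \<Longrightarrow> z \<otimes> a \<in> I"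
    and adj: "\<And>a. a \<in> I \<Longrightarrow> adj U a \<in> I"
    and unit: "\<And>n d \<delta>. n \<ge> 1 \<Longrightarrow> d \<in> matrices n U \<Longrightarrow> (\<And>i k. i < n \<Longrightarrow> k < n \<Longrightarrow> d (i, k) \<in> I) \<Longrightarrow> \<delta> > 0 \<Longrightarrow>
      \<exists>a\<in>I. (\<forall>x\<in>matrices n U. mnorm U n (x \<ominus>\<^bsub>matrix_algebra n U\<^esub> diag n a \<otimes>\<^bsub>matrix_algebra n U\<^esub> x) \<le> (1 + \<delta>) * mnorm U n x) \<and>
        mnorm U n (d \<ominus>\<^bsub>matrix_algebra n U\<^esub> diag n a \<otimes>\<^bsub>matrix_algebra n U\<^esub> d) \<le> \<delta>"
  shows "cstar_algebra (quotient_algebra U I)" and "star_map U (quotient_algebra U I) ((+>) I)"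
proof -
  interpret algebra_ideal U I using I(1) id by unfold_locales
  let ?Q = "quotient_algebra U I" and ?q = "(+>) I"
  have car: "carrier ?Q = ?q ` carrier U" by (rule quotient_carrier)
  note ops = quotient_add quotient_smult quotient_mult quotient_adj[OF star_algebra_axioms adj]
  show sm: "star_map U ?Q ?q" using car by (auto simp: star_map_def ops)
  have ker: "?q x = I \<longleftrightarrow> x \<in> I" if "x \<in> carrier U" for x by (rule coset_eq_subspace_iff[OF I(1) that])
  have "\<zero>\<^bsub>?Q\<^esub> = ?q \<zero>" using ker[of \<zero>] linear_subspaceD(3)[OF I(1)] by (simp add: quotient_zero)
  then have Q: "star_algebra ?Q" by (rule star_algebra_image[OF star_algebra_axioms car _ sm])
  interpret Q: star_algebra ?Q by (rule Q)
  have "complete_cstar_norm (matrix_algebra n ?Q) (mnorm ?Q n)" if n: "n \<ge> 1" for n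
  proof (rule quotient_cstar_norm[OF matrix_complete[OF n] Q.matrix_star_algebra star_map_matrix[OF star_algebra_axioms Q sm]])
    let ?V = "matrix_algebra n U" and ?W = "matrix_algebra n ?Q" and ?qn = "compose (matrix_index n) ?q"
    have ker': "?qn Z = \<zero>\<^bsub>?W\<^esub> \<longleftrightarrow> (\<forall>i<n. \<forall>k<n. Z (i, k) \<in> I)" if Z: "Z \<in> matrices n U" for Z
    proof -
      have "?qn Z = \<zero>\<^bsub>?W\<^esub> \<longleftrightarrow> (\<forall>p\<in>matrix_index n. ?q (Z p) = I)"
        unfolding matrix_sel quotient_zero compose_def
        using restrict_apply'[of _ "matrix_index n"] restrict_ext[of "matrix_index n" "\<lambda>p. ?q (Z p)" "\<lambda>p. I"]
        by metis
      also have "\<dots> \<longleftrightarrow> (\<forall>i<n. \<forall>k<n. Z (i, k) \<in> I)" using Z ker by auto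
      finally show ?thesis .
    qed
    show "carrier ?W = ?qn ` carrier ?V"
      unfolding matrix_sel(1) by (rule compose_image_matrices[OF car])
    show "mnorm ?Q n (?qn Z) = Inf (mnorm U n ` {M \<in> carrier ?V. ?qn M = ?qn Z})" if "Z \<in> carrier ?V" for Z
      using quotient_mnorm that by (simp only: matrix_sel(1))
    show "seq_closed ?V (mnorm U n) {Z \<in> carrier ?V. ?qn Z = \<zero>\<^bsub>?W\<^esub>}"
      unfolding seq_closed_def
    proof (intro allI impI, elim conjE)
      fix \<xi> Y assume \<xi>: "\<forall>k. \<xi> k \<in> {Z \<in> carrier ?V. ?qn Z = \<zero>\<^bsub>?W\<^esub>}" and l: "conv ?V (mnorm U n) sequentially \<xi> Y"
      have Y: "Y \<in> matrices n U" using l unfolding conv_matrix_iff[OF n] by blast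
      have "Y (i, k) \<in> I" if ik: "i < n" "k < n" for i k
      proof (rule seq_closedD[OF I(2)])
        show "conv U (elt_norm U) sequentially (\<lambda>m. \<xi> m (i, k)) (Y (i, k))"
          using l ik unfolding conv_matrix_iff[OF n] by blast
        show "\<xi> m (i, k) \<in> I" for m using \<xi> ker' ik unfolding matrix_sel(1) by blast
      qed
      then show "Y \<in> {Z \<in> carrier ?V. ?qn Z = \<zero>\<^bsub>?W\<^esub>}"
        using Y ker'[OF Y] unfolding matrix_sel(1) by blast
    qed
    fix d and \<delta> :: real assume d: "d \<in> carrier ?V" "?qn d = \<zero>\<^bsub>?W\<^esub>" and \<delta>: "\<delta> > 0"
    have dm: "d \<in> matrices n U" using d(1) by (simp only: matrix_sel(1))
    obtain a where a: "a \<in> I" "\<And>x. x \<in> matrices n U \<Longrightarrow> mnorm U n (x \<ominus>\<^bsub>?V\<^esub> diag n a \<otimes>\<^bsub>?V\<^esub> x) \<le> (1 + \<delta>) * mnorm U n x"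
        "mnorm U n (d \<ominus>\<^bsub>?V\<^esub> diag n a \<otimes>\<^bsub>?V\<^esub> d) \<le> \<delta>"
      using unit[OF n dm _ \<delta>] d(2) ker'[OF dm] by blast
    have aU: "a \<in> carrier U" using a(1) linear_subspaceD(2)[OF I(1)] by blast
    have "?qn (diag n a) = \<zero>\<^bsub>?W\<^esub>"
      unfolding ker'[OF diag_closed[OF aU]] using a(1) linear_subspaceD(3)[OF I(1)] by (auto simp: diag_def)
    then show "\<exists>a\<in>carrier ?V. ?qn a = \<zero>\<^bsub>?W\<^esub> \<and> (\<forall>x\<in>carrier ?V. mnorm U n (x \<ominus>\<^bsub>?V\<^esub> a \<otimes>\<^bsub>?V\<^esub> x) \<le> (1 + \<delta>) * mnorm U n x) \<and>
        mnorm U n (d \<ominus>\<^bsub>?V\<^esub> a \<otimes>\<^bsub>?V\<^esub> d) \<le> \<delta>"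
      unfolding matrix_sel(1) using a(2,3) diag_closed[OF aU] by blast
  qed
  then show "cstar_algebra ?Q" using Q by (simp add: cstar_algebra_def)
qed

section \<open>The maximal cover of the quotient\<close>

context maximal_cover
begin

sublocale BB: complex_algebra "C\<lparr>carrier := B\<rparr>" by (rule B_algebra)

sublocale BA: algebra_ideal "C\<lparr>carrier := B\<rparr>" A
  using A ideal by unfold_locales (auto simp: linear_subspace_def)

sublocale ED: algebra_ideal E D
  using D(1) D_ideal by unfold_locales auto

lemma jA_D: "a \<in> A \<Longrightarrow> j a \<in> D"
  using D_gen(2) by blast

text \<open>The averages are taken in \<open>M_n(E)\<close>, of the net
  \<open>diag n (j (e t))\<close>. As \<open>j\<close> and \<open>diag n\<close> are linear, the
  result is \<open>diag n (j a)\<close> for an average \<open>a\<close> formed in \<open>A\<close>.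
  Having \<open>a\<close> in \<open>A\<close>, and not just an element of \<open>D\<close>, is what
  the comparison with lifts in \<open>B\<close> needs.\<close>

lemma average_unit:
  assumes n: "n \<ge> 1" and d: "d \<in> matrices n E" "\<And>i k. i < n \<Longrightarrow> k < n \<Longrightarrow> d (i, k) \<in> D" and \<delta>: "\<delta> > 0"
  defines "V \<equiv> matrix_algebra n E"
  obtains a where "a \<in> A"
    "\<And>Y. Y \<in> matrices n E \<Longrightarrow> mnorm E n (Y \<ominus>\<^bsub>V\<^esub> E.diag n (j a) \<otimes>\<^bsub>V\<^esub> Y) \<le> (1 + \<delta>) * mnorm E n Y"
    "mnorm E n (d \<ominus>\<^bsub>V\<^esub> E.diag n (j a) \<otimes>\<^bsub>V\<^esub> d) \<le> \<delta>"
proof -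
  interpret v: column_cstar_norm V "mnorm E n" unfolding V_def by (rule E.matrix_column_norm[OF n])
  have cV: "carrier V = matrices n E" by (simp only: V_def matrix_sel(1))
  let ?f = "\<lambda>t. E.diag n (j (e t))"
  have f: "?f t \<in> carrier V" "mnorm E n (?f t) \<le> 1" for t
    using E.diag_closed[OF je(1)] order_trans[OF E.norm_diag_le[OF n je(1)] je(2)] by (simp_all only: cV)
  have unit: "v.approx_unit F ?f M" if M: "M \<in> matrices n E" "\<And>i k. i < n \<Longrightarrow> k < n \<Longrightarrow> M (i, k) \<in> D" for M
  proof (rule v.approx_unitI[OF _ f])
    show "M \<in> carrier V" using M(1) by (simp only: cV)
    have lim: "conv E (elt_norm E) F (\<lambda>t. j (e t) \<otimes>\<^bsub>E\<^esub> M (i, k)) (M (i, k))"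
      "conv E (elt_norm E) F (\<lambda>t. M (i, k) \<otimes>\<^bsub>E\<^esub> j (e t)) (M (i, k))" if "i < n" "k < n" for i k
      using Ec.approx_unitD(1,2)[OF je(1) D_approx_unit[OF M(2)[OF that]]] by blast+
    note dm = E.diag_mult[OF je(1) M(1)]
    show "conv V (mnorm E n) F (\<lambda>t. ?f t \<otimes>\<^bsub>V\<^esub> M) M"
      unfolding V_def dm(1) E.conv_matrix_iff[OF n] using M lim je(1) by auto
    show "conv V (mnorm E n) F (\<lambda>t. M \<otimes>\<^bsub>V\<^esub> ?f t) M"
      unfolding V_def dm(2) E.conv_matrix_iff[OF n] using M lim je(1) by auto
  qed
  have "v.approx_unit F ?f (?f t)" for t
    using unit[of "?f t"] E.diag_closed[OF je(1)] je(3) linear_subspaceD(3)[OF D(1)]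
    by (simp add: E.diag_def del: matrices_iff)
  then obtain m t where avg: "\<And>Y. Y \<in> carrier V \<Longrightarrow>
      mnorm E n (Y \<ominus>\<^bsub>V\<^esub> (\<Oplus>\<^bsub>V\<^esub>i\<in>{..<m::nat}. complex_of_real (1 / m) \<odot>\<^bsub>V\<^esub> ?f (t i)) \<otimes>\<^bsub>V\<^esub> Y) \<le> (1 + \<delta>) * mnorm E n Y"
    "mnorm E n (d \<ominus>\<^bsub>V\<^esub> (\<Oplus>\<^bsub>V\<^esub>i\<in>{..<m}. complex_of_real (1 / m) \<odot>\<^bsub>V\<^esub> ?f (t i)) \<otimes>\<^bsub>V\<^esub> d) \<le> \<delta>"
    using v.exists_average_unit[OF F f _ unit[OF d] \<delta>] by blast
  let ?g = "\<lambda>i. complex_of_real (1 / m) \<odot>\<^bsub>C\<^esub> e (t i)"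
  define a where "a = (\<Oplus>\<^bsub>C\<lparr>carrier := B\<rparr>\<^esub>i\<in>{..<m}. ?g i)"
  have gA: "?g i \<in> A" for i using linear_subspaceD(5)[OF A(1) e(1)] by simp
  have a: "a \<in> A"
    unfolding a_def using gA by (intro BB.linear_subspace_finsum[OF BA.subspace]) auto
  have "j a = (\<Oplus>\<^bsub>E\<^esub>i\<in>{..<m}. j (?g i))"
    unfolding a_def
    by (rule star_map_linear(4)[OF BB.complex_algebra_axioms E.complex_algebra_axioms]) (use j gA AB in auto)
  moreover have "j (?g i) = complex_of_real (1 / m) \<odot>\<^bsub>E\<^esub> j (e (t i))" for i using j(4) e(1) AB by simp
  ultimately have ja: "j a = (\<Oplus>\<^bsub>E\<^esub>i\<in>{..<m}. complex_of_real (1 / m) \<odot>\<^bsub>E\<^esub> j (e (t i)))" by simp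
  note dg = star_mapD[OF E.star_map_diag[of n], folded V_def]
  have "E.diag n (j a) = (\<Oplus>\<^bsub>V\<^esub>i\<in>{..<m}. E.diag n (complex_of_real (1 / m) \<odot>\<^bsub>E\<^esub> j (e (t i))))"
    unfolding ja
    by (rule star_map_linear(4)[OF E.complex_algebra_axioms v.complex_algebra_axioms dg(1,3,4)]) (use je in auto)
  also have "\<dots> = (\<Oplus>\<^bsub>V\<^esub>i\<in>{..<m}. complex_of_real (1 / m) \<odot>\<^bsub>V\<^esub> ?f (t i))"
    by (simp only: dg(4)[OF je(1)])
  finally have "E.diag n (j a) = (\<Oplus>\<^bsub>V\<^esub>i\<in>{..<m}. complex_of_real (1 / m) \<odot>\<^bsub>V\<^esub> ?f (t i))" .
  then show thesis using that[OF a] avg by (simp only: cV)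
qed

lemma quotient_cstar: "cstar_algebra (quotient_algebra E D)" "star_map E (quotient_algebra E D) ((+>\<^bsub>E\<^esub>) D)"
proof -
  have "\<exists>a\<in>D. (\<forall>Y\<in>matrices n E. mnorm E n (Y \<ominus>\<^bsub>matrix_algebra n E\<^esub> E.diag n a \<otimes>\<^bsub>matrix_algebra n E\<^esub> Y) \<le> (1 + \<delta>) * mnorm E n Y) \<and>
        mnorm E n (d \<ominus>\<^bsub>matrix_algebra n E\<^esub> E.diag n a \<otimes>\<^bsub>matrix_algebra n E\<^esub> d) \<le> \<delta>"
    if "n \<ge> 1" "d \<in> matrices n E" "\<And>i k. i < n \<Longrightarrow> k < n \<Longrightarrow> d (i, k) \<in> D" "\<delta> > 0" for n d \<delta>
    using average_unit[OF that] jA_D by metis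
  from E.quotient_cstar_algebra[OF D(1,2) D_ideal(2,1) D(6) this]
  show "cstar_algebra (quotient_algebra E D)" "star_map E (quotient_algebra E D) ((+>\<^bsub>E\<^esub>) D)" by blast+
qed

abbreviation "qA \<equiv> (+>\<^bsub>C\<lparr>carrier := B\<rparr>\<^esub>) A"
abbreviation "qD \<equiv> (+>\<^bsub>E\<^esub>) D"
abbreviation "BqA \<equiv> quotient_algebra (C\<lparr>carrier := B\<rparr>) A"
abbreviation "EqD \<equiv> quotient_algebra E D"

lemma induced_apply:
  assumes b: "b \<in> B"
  shows "induced_map E D j (qA b) = qD (j b)"
  unfolding induced_map_def
proof (rule BA.coset_union)
  fix y assume y: "y \<in> carrier (C\<lparr>carrier := B\<rparr>)" "y \<ominus>\<^bsub>C\<lparr>carrier := B\<rparr>\<^esub> b \<in> A"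
  then have "y \<ominus>\<^bsub>C\<^esub> b \<in> A" using C.subspace_diff[OF B(1), of y b] b by simp
  then show "qD (j y) = qD (j b)" using y b j(1) jA_D by (simp add: E.coset_eq_iff[OF D(1)] j_diff[symmetric])
qed (use b in simp)

lemma induced_hom: "induced_map E D j \<in> algebra_hom BqA EqD"
proof -
  have "induced_map E D j P \<in> carrier EqD" if "P \<in> carrier BqA" for P
    using that j(1) by (auto simp: BA.quotient_carrier ED.quotient_carrier induced_apply)
  moreover have "induced_map E D j (P \<otimes>\<^bsub>BqA\<^esub> R) = induced_map E D j P \<otimes>\<^bsub>EqD\<^esub> induced_map E D j R"
    "induced_map E D j (P \<oplus>\<^bsub>BqA\<^esub> R) = induced_map E D j P \<oplus>\<^bsub>EqD\<^esub> induced_map E D j R"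
    "induced_map E D j (c \<odot>\<^bsub>BqA\<^esub> P) = c \<odot>\<^bsub>EqD\<^esub> induced_map E D j P"
    if PR: "P \<in> carrier BqA" "R \<in> carrier BqA" for P R c
  proof -
    obtain x y where xy: "x \<in> B" "P = qA x" "y \<in> B" "R = qA y" using PR by (auto simp: BA.quotient_carrier)
    have op: "x \<otimes>\<^bsub>C\<^esub> y \<in> B" "x \<oplus>\<^bsub>C\<^esub> y \<in> B" "c \<odot>\<^bsub>C\<^esub> x \<in> B"
      using xy B_mult linear_subspaceD(4,5)[OF B(1)] by auto
    show "induced_map E D j (P \<otimes>\<^bsub>BqA\<^esub> R) = induced_map E D j P \<otimes>\<^bsub>EqD\<^esub> induced_map E D j R"
      using xy op j BA.quotient_mult[of x y] ED.quotient_mult[of "j x" "j y"] by (simp add: induced_apply)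
    show "induced_map E D j (P \<oplus>\<^bsub>BqA\<^esub> R) = induced_map E D j P \<oplus>\<^bsub>EqD\<^esub> induced_map E D j R"
      using xy op j BA.quotient_add[of x y] ED.quotient_add[of "j x" "j y"] by (simp add: induced_apply)
    show "induced_map E D j (c \<odot>\<^bsub>BqA\<^esub> P) = c \<odot>\<^bsub>EqD\<^esub> induced_map E D j P"
      using xy op j BA.quotient_smult[of x c] ED.quotient_smult[of "j x" c] by (simp add: induced_apply)
  qed
  ultimately show ?thesis by (auto simp: algebra_hom_def hom_def)
qed

lemma quotient_matrices:
  assumes "M \<in> matrices n BqA"
  obtains N where "N \<in> matrices n (C\<lparr>carrier := B\<rparr>)" "M = compose (matrix_index n) qA N"
proof -
  have "M \<in> compose (matrix_index n) qA ` matrices n (C\<lparr>carrier := B\<rparr>)"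
    using assms by (simp only: compose_image_matrices[OF BA.quotient_carrier])
  then show thesis by (rule imageE) (rule that)
qed

lemma B_mnorm:
  assumes n: "n \<ge> 1"
  shows "M \<in> matrices n (C\<lparr>carrier := B\<rparr>) \<Longrightarrow> 0 \<le> mnorm C n M"
    and "N \<in> matrices n (C\<lparr>carrier := B\<rparr>) \<Longrightarrow> mnorm BqA n (compose (matrix_index n) qA N) \<le> mnorm C n N"
proof -
  interpret m: complete_cstar_norm "matrix_algebra n C" "mnorm C n" using n by (rule C.matrix_complete)
  show nn: "0 \<le> mnorm C n M" if "M \<in> matrices n (C\<lparr>carrier := B\<rparr>)" for M
    using m.norm_nonneg[of M] that AB by (simp add: PiE_iff)
  show "mnorm BqA n (compose (matrix_index n) qA N) \<le> mnorm C n N" if N: "N \<in> matrices n (C\<lparr>carrier := B\<rparr>)" for N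
    unfolding BA.quotient_mnorm[OF N]
    by (rule cInf_lower) (use N nn in \<open>auto intro!: bdd_belowI[of _ 0] simp del: matrices_iff\<close>)
qed

text \<open>Both norms are infima over lifts of the same coset matrix. A lift in \<open>B\<close>
  gives one in \<open>E\<close> of equal norm. Conversely, for a lift \<open>Y\<close> in
  \<open>E\<close> let \<open>J\<close> be the image of \<open>N\<close> and
  \<open>d = J - Y\<close>, which has entries in \<open>D\<close>. Then \<open>N - a N\<close> is a
  lift in \<open>B\<close>, and its image \<open>(1 - a) J = (1 - a) Y + (1 - a) d\<close> has norm
  at most \<open>(1 + u)\<close> times that of \<open>Y\<close>, plus \<open>u\<close>.\<close>

lemma induced_isometric: "completely_isometric BqA EqD (induced_map E D j)"
  unfolding completely_isometric_def
proof (intro allI impI ballI)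
  fix n :: nat and M assume n: "1 \<le> n" and M: "M \<in> matrices n BqA"
  let ?V = "matrix_algebra n E" and ?CB = "C\<lparr>carrier := B\<rparr>"
  let ?c = "compose (matrix_index n)"
  interpret v: complete_cstar_norm ?V "mnorm E n" using n by (rule E.matrix_complete)
  obtain N where N: "N \<in> matrices n ?CB" and MN: "M = ?c qA N" using quotient_matrices[OF M] .
  have ent: "Z (i, k) \<in> B" "Z (i, k) \<in> carrier C" if "Z \<in> matrices n ?CB" "i < n" "k < n" for Z i k
    using that AB by (auto simp: PiE_iff)
  have ext: "Z \<in> extensional (matrix_index n)" if "Z \<in> matrices n ?CB" for Z
    using that by (simp add: PiE_iff)
  have jE: "?c j Z \<in> matrices n E" if "Z \<in> matrices n ?CB" for Z
    using ent(1)[OF that] j(1) by (simp add: compose_def)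
  have jnorm: "mnorm E n (?c j Z) = mnorm C n Z" if "Z \<in> matrices n ?CB" for Z
    by (rule j_isometric[OF n ent(1)[OF that] ext[OF that]])
  have ind: "?c (induced_map E D j) (?c qA Z) = ?c qD (?c j Z)" if "Z \<in> matrices n ?CB" for Z
    unfolding compose_def by (rule restrict_ext) (use ent(1)[OF that] induced_apply in auto)
  let ?S = "{Z \<in> matrices n ?CB. ?c qA Z = ?c qA N}" and ?T = "{Y \<in> matrices n E. ?c qD Y = ?c qD (?c j N)}"
  have bdd: "bdd_below (mnorm C n ` ?S)" "bdd_below (mnorm E n ` ?T)"
    using B_mnorm(1)[OF n] v.norm_nonneg by (auto intro!: bdd_belowI[of _ 0] simp del: matrices_iff)
  have "Inf (mnorm E n ` ?T) = Inf (mnorm C n ` ?S)"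
  proof (rule antisym)
    show "Inf (mnorm E n ` ?T) \<le> Inf (mnorm C n ` ?S)"
    proof (rule cInf_greatest)
      fix r assume "r \<in> mnorm C n ` ?S"
      then obtain Z where Z: "Z \<in> matrices n ?CB" "?c qA Z = ?c qA N" "r = mnorm C n Z" by blast
      have "?c j Z \<in> ?T" using ind[OF Z(1)] ind[OF N] jE[OF Z(1)] Z(2) by (simp del: matrices_iff)
      then show "Inf (mnorm E n ` ?T) \<le> r"
        unfolding Z(3) jnorm[OF Z(1), symmetric] by (intro cInf_lower[OF _ bdd(2)] imageI)
    qed (use N in blast)
    show "Inf (mnorm C n ` ?S) \<le> Inf (mnorm E n ` ?T)"
    proof (rule cInf_greatest)
      fix r assume "r \<in> mnorm E n ` ?T"
      then obtain Y where Y: "Y \<in> matrices n E" "?c qD Y = ?c qD (?c j N)" "r = mnorm E n Y" by blast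
      let ?J = "?c j N"
      define d where "d = ?J \<ominus>\<^bsub>?V\<^esub> Y"
      note J = jE[OF N]
      have d: "d \<in> matrices n E"
        unfolding d_def using v.M.minus_closed[of ?J Y] J Y(1) by (simp only: matrix_sel(1))
      have dD: "d (i, k) \<in> D" if ik: "i < n" "k < n" for i k
      proof -
        have "qD (?J (i, k)) = qD (Y (i, k))" using fun_cong[OF Y(2), of "(i, k)"] ik by (simp add: compose_def)
        then have "?J (i, k) \<ominus>\<^bsub>E\<^esub> Y (i, k) \<in> D"
          using E.coset_eq_iff[OF D(1), of "?J (i, k)" "Y (i, k)"] J Y(1) ik by simp
        then show ?thesis unfolding d_def using E.matrix_linear(1)[OF _ J Y(1), of "(i, k)"] ik by simp
      qed
      have "Inf (mnorm C n ` ?S) \<le> mnorm E n Y"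
      proof (rule le_of_le_add_small)
        fix u :: real assume u: "0 < u" "u < 1"
        obtain a where a: "a \<in> A"
          "\<And>Y. Y \<in> matrices n E \<Longrightarrow> mnorm E n (Y \<ominus>\<^bsub>?V\<^esub> E.diag n (j a) \<otimes>\<^bsub>?V\<^esub> Y) \<le> (1 + u) * mnorm E n Y"
          "mnorm E n (d \<ominus>\<^bsub>?V\<^esub> E.diag n (j a) \<otimes>\<^bsub>?V\<^esub> d) \<le> u"
          using average_unit[OF n d dD u(1)] by blast
        let ?a = "E.diag n (j a)"
        have ja: "j a \<in> carrier E" using j(1) a(1) AB by simp
        note dg = E.diag_closed[OF ja, of n]
        define Z where "Z = (\<lambda>p\<in>matrix_index n. N p \<ominus>\<^bsub>C\<^esub> a \<otimes>\<^bsub>C\<^esub> N p)"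
        have aN: "a \<otimes>\<^bsub>C\<^esub> N (i, k) \<in> A" if "i < n" "k < n" for i k using ideal(1)[OF a(1) ent(1)[OF N that]] .
        have Zent: "Z (i, k) \<in> B" if "i < n" "k < n" for i k
          unfolding Z_def using that C.linear_subspace_minus(2)[OF B(1) ent(1)[OF N that] AB(1)[OF aN[OF that]]] by simp
        moreover have "Z \<in> extensional (matrix_index n)" by (simp add: Z_def)
        ultimately have Z: "Z \<in> matrices n ?CB" by (auto simp: PiE_iff)
        have "?c qA Z = ?c qA N"
          unfolding compose_def
        proof (rule restrict_ext, clarify)
          fix i k assume ik: "i < n" "k < n"
          have "Z (i, k) \<ominus>\<^bsub>C\<^esub> N (i, k) = \<ominus>\<^bsub>C\<^esub> (a \<otimes>\<^bsub>C\<^esub> N (i, k))"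
            using ik ent(2)[OF N ik] a(1) AB
            by (intro C.eq_by_functionals) (auto simp: Z_def C.functionalD)
          then have "Z (i, k) \<ominus>\<^bsub>C\<^esub> N (i, k) \<in> A" using C.linear_subspace_minus(1)[OF A(1) aN[OF ik] aN[OF ik]] by simp
          then have "Z (i, k) \<ominus>\<^bsub>?CB\<^esub> N (i, k) \<in> A"
            using C.subspace_diff[OF B(1) Zent[OF ik] ent(1)[OF N ik]] by simp
          then show "qA (Z (i, k)) = qA (N (i, k))"
            using BB.coset_eq_iff[OF BA.subspace, of "Z (i, k)" "N (i, k)"] Zent[OF ik] ent(1)[OF N ik] by simp
        qed
        then have "Inf (mnorm C n ` ?S) \<le> mnorm C n Z" using Z by (intro cInf_lower[OF _ bdd(1)]) blast
        also have "\<dots> = mnorm E n (?c j Z)" using jnorm[OF Z] by simp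
        also have "?c j Z = ?J \<ominus>\<^bsub>?V\<^esub> ?a \<otimes>\<^bsub>?V\<^esub> ?J"
        proof (rule matrix_eqI[of _ n E])
          have aJ: "?a \<otimes>\<^bsub>?V\<^esub> ?J \<in> matrices n E" using v.mult_closed[of ?a ?J] dg J by (simp only: matrix_sel(1))
          show "?J \<ominus>\<^bsub>?V\<^esub> ?a \<otimes>\<^bsub>?V\<^esub> ?J \<in> matrices n E"
            using v.M.minus_closed[of ?J "?a \<otimes>\<^bsub>?V\<^esub> ?J"] J aJ by (simp only: matrix_sel(1))
          show "?c j Z \<in> matrices n E" by (rule jE[OF Z])
          fix i k assume ik: "i < n" "k < n"
          have "(?J \<ominus>\<^bsub>?V\<^esub> ?a \<otimes>\<^bsub>?V\<^esub> ?J) (i, k) = ?J (i, k) \<ominus>\<^bsub>E\<^esub> (?a \<otimes>\<^bsub>?V\<^esub> ?J) (i, k)"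
            by (rule E.matrix_linear(1)[OF _ J aJ]) (use ik in simp)
          also have "\<dots> = j (N (i, k)) \<ominus>\<^bsub>E\<^esub> j a \<otimes>\<^bsub>E\<^esub> j (N (i, k))"
            unfolding E.diag_mult(1)[OF ja J] using ik by (simp add: compose_def)
          also have "\<dots> = j (Z (i, k))"
            using ik ent(1)[OF N ik] AB(1)[OF aN[OF ik]] AB(1)[OF a(1)] by (simp add: Z_def j_diff j(2))
          finally show "?c j Z (i, k) = (?J \<ominus>\<^bsub>?V\<^esub> ?a \<otimes>\<^bsub>?V\<^esub> ?J) (i, k)" using ik by (simp add: compose_def)
        qed
        also have "\<dots> = (Y \<ominus>\<^bsub>?V\<^esub> ?a \<otimes>\<^bsub>?V\<^esub> Y) \<oplus>\<^bsub>?V\<^esub> (d \<ominus>\<^bsub>?V\<^esub> ?a \<otimes>\<^bsub>?V\<^esub> d)"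
        proof -
          have cs: "?J \<in> carrier ?V" "Y \<in> carrier ?V" "?a \<in> carrier ?V" using J Y(1) dg by (simp_all only: matrix_sel(1))
          show ?thesis
          proof (rule v.eq_by_functionals)
            fix f assume f: "functional ?V f"
            show "f (?J \<ominus>\<^bsub>?V\<^esub> ?a \<otimes>\<^bsub>?V\<^esub> ?J) = f ((Y \<ominus>\<^bsub>?V\<^esub> ?a \<otimes>\<^bsub>?V\<^esub> Y) \<oplus>\<^bsub>?V\<^esub> (d \<ominus>\<^bsub>?V\<^esub> ?a \<otimes>\<^bsub>?V\<^esub> d))"
              using cs by (simp add: d_def v.functionalD[OF f] v.distr_simps del: matrix_sel matrices_iff)
          qed (use cs in \<open>simp_all add: d_def del: matrix_sel matrices_iff\<close>)
        qed
        also have "mnorm E n \<dots> \<le> mnorm E n (Y \<ominus>\<^bsub>?V\<^esub> ?a \<otimes>\<^bsub>?V\<^esub> Y) + mnorm E n (d \<ominus>\<^bsub>?V\<^esub> ?a \<otimes>\<^bsub>?V\<^esub> d)"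
        proof (rule v.norm_triangle)
          have "Y \<in> carrier ?V" "?a \<in> carrier ?V" "d \<in> carrier ?V" using d Y(1) dg by (simp_all only: matrix_sel(1))
          then show "Y \<ominus>\<^bsub>?V\<^esub> ?a \<otimes>\<^bsub>?V\<^esub> Y \<in> carrier ?V" "d \<ominus>\<^bsub>?V\<^esub> ?a \<otimes>\<^bsub>?V\<^esub> d \<in> carrier ?V"
            by (simp_all del: matrix_sel matrices_iff)
        qed
        also have "\<dots> \<le> (1 + u) * mnorm E n Y + u" using a(2)[OF Y(1)] a(3) by simp
        finally show "Inf (mnorm C n ` ?S) \<le> mnorm E n Y + u * (mnorm E n Y + 1)" by (simp add: algebra_simps)
      qed
      then show "Inf (mnorm C n ` ?S) \<le> r" by (simp only: Y(3))
    qed (use jE[OF N] in blast)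
  qed
  then show "mnorm EqD n (?c (induced_map E D j) M) = mnorm BqA n M"
    unfolding MN ind[OF N] ED.quotient_mnorm[OF jE[OF N]] BA.quotient_mnorm[OF N] by simp
qed

text \<open>The preimage in \<open>E\<close> of the generated algebra is a C*-subalgebra that
  contains the image of \<open>B\<close>, hence it is everything.\<close>

lemma induced_generates: "generated_cstar_subalgebra EqD (induced_map E D j ` carrier BqA) = carrier EqD"
proof -
  interpret Q: cstar_alg EqD using quotient_cstar(1) by unfold_locales
  let ?R = "induced_map E D j ` carrier BqA"
  have im: "?R = (\<lambda>b. qD (j b)) ` B" by (auto simp: BA.quotient_carrier image_image induced_apply)
  have sub: "?R \<subseteq> carrier EqD" using j(1) by (auto simp: im ED.quotient_carrier)
  note g = Q.generated_cstar_subalgebra[OF sub]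
  let ?T = "{x \<in> carrier E. qD x \<in> generated_cstar_subalgebra EqD ?R}"
  have "cstar_subalgebra ?T E" by (rule cstar_subalgebra_vimage[OF E.cstar quotient_cstar g(1)])
  moreover have "j ` B \<subseteq> ?T" using j(1) g(2) unfolding im by auto
  moreover have "j ` B \<subseteq> carrier E" using j(1) by blast
  ultimately have "carrier E \<subseteq> ?T" using E.generated_cstar_subalgebra(3) generated_E by blast
  then show ?thesis using Q.cstar_subalgebraD(3)[OF g(1)] by (auto simp: ED.quotient_carrier)
qed

theorem quotient_max_cstar_cover: "max_cstar_cover TYPE('g) BqA EqD (induced_map E D j)"
  unfolding max_cstar_cover_def cstar_cover_def
proof (intro conjI allI impI quotient_cstar(1) induced_hom induced_isometric induced_generates)
  fix G :: "'g matrix_normed_alg" and \<rho>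
  assume "cstar_algebra G \<and> \<rho> \<in> algebra_hom BqA G \<and> completely_contractive BqA G \<rho>"
  then have G: "cstar_algebra G" and \<rho>: "\<rho> \<in> algebra_hom BqA G" and cc: "completely_contractive BqA G \<rho>" by auto
  interpret G: cstar_alg G using G by unfold_locales
  note \<rho>' = algebra_homD[OF \<rho>]
  let ?\<pi> = "\<lambda>b. \<rho> (qA b)"
  have q: "qA b \<in> carrier BqA" if "b \<in> B" for b using that by (simp add: BA.quotient_carrier)
  have \<pi>: "?\<pi> \<in> algebra_hom (C\<lparr>carrier := B\<rparr>) G"
  proof -
    have "?\<pi> (x \<otimes>\<^bsub>C\<^esub> y) = ?\<pi> x \<otimes>\<^bsub>G\<^esub> ?\<pi> y" "?\<pi> (x \<oplus>\<^bsub>C\<^esub> y) = ?\<pi> x \<oplus>\<^bsub>G\<^esub> ?\<pi> y" "?\<pi> (c \<odot>\<^bsub>C\<^esub> x) = c \<odot>\<^bsub>G\<^esub> ?\<pi> x"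
      if "x \<in> B" "y \<in> B" for x y c
      using that \<rho>'(2-4)[OF q] q BA.quotient_mult[of x y, symmetric] BA.quotient_add[of x y, symmetric]
        BA.quotient_smult[of x c, symmetric] by simp_all
    then show ?thesis using \<rho>'(1)[OF q] by (auto simp: algebra_hom_def hom_def)
  qed
  have ccp: "completely_contractive (C\<lparr>carrier := B\<rparr>) G ?\<pi>"
    unfolding completely_contractive_def
  proof (intro allI impI ballI)
    fix n :: nat and N assume n: "1 \<le> n" and N: "N \<in> matrices n (C\<lparr>carrier := B\<rparr>)"
    let ?c = "compose (matrix_index n)"
    have "?c ?\<pi> N = ?c \<rho> (?c qA N)" by (auto simp: compose_def)
    moreover have "?c qA N \<in> matrices n BqA"
      unfolding compose_image_matrices[OF BA.quotient_carrier] using N by (rule imageI)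
    ultimately have "mnorm G n (?c ?\<pi> N) \<le> mnorm BqA n (?c qA N)"
      using cc n unfolding completely_contractive_def by simp
    also have "\<dots> \<le> mnorm C n N" by (rule B_mnorm(2)[OF n N])
    finally show "mnorm G n (?c ?\<pi> N) \<le> mnorm (C\<lparr>carrier := B\<rparr>) n N" by simp
  qed
  obtain \<theta> where \<theta>: "star_map E G \<theta>" "\<And>b. b \<in> carrier (C\<lparr>carrier := B\<rparr>) \<Longrightarrow> \<theta> (j b) = ?\<pi> b"
    using max_cstar_cover_any_type[OF max B_algebra G \<pi> ccp] by blast
  note \<theta>' = star_mapD[OF \<theta>(1)]
  have \<pi>A: "?\<pi> a = \<zero>\<^bsub>G\<^esub>" if a: "a \<in> A" for a
  proof -
    have 0: "0 \<odot>\<^bsub>C\<^esub> a \<in> A" by (rule linear_subspaceD(5)[OF A(1) a])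
    have "?\<pi> a = ?\<pi> (0 \<odot>\<^bsub>C\<^esub> a)"
      using BB.coset_eq_subspace_iff[OF BA.subspace, of a] BB.coset_eq_subspace_iff[OF BA.subspace, of "0 \<odot>\<^bsub>C\<^esub> a"] a 0 AB by simp
    also have "\<dots> = 0 \<odot>\<^bsub>G\<^esub> ?\<pi> a" using algebra_homD(4)[OF \<pi>, of a 0] a AB by simp
    also have "\<dots> = \<zero>\<^bsub>G\<^esub>" using \<rho>'(1)[OF q] a AB by simp
    finally show ?thesis .
  qed
  \<comment> \<open>The kernel of \<open>\<theta>\<close> is a C*-subalgebra, being the preimage of
    the zero algebra. It contains the image of \<open>A\<close>, and therefore
    \<open>D\<close>.\<close>
  have "cstar_subalgebra {\<zero>\<^bsub>G\<^esub>} G"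
    unfolding G.cstar_subalgebra_iff
  proof (intro conjI)
    show "linear_subspace G {\<zero>\<^bsub>G\<^esub>}" by (simp add: linear_subspace_def)
    show "seq_closed G (elt_norm G) {\<zero>\<^bsub>G\<^esub>}"
      unfolding seq_closed_def
    proof (intro allI impI, elim conjE)
      fix \<xi> x assume \<xi>: "\<forall>n. \<xi> n \<in> {\<zero>\<^bsub>G\<^esub>}" and l: "conv G (elt_norm G) sequentially \<xi> x"
      have "\<xi> = (\<lambda>n. \<zero>\<^bsub>G\<^esub>)" using \<xi> by auto
      then have "conv G (elt_norm G) sequentially \<xi> \<zero>\<^bsub>G\<^esub>" using G.conv_const[OF G.M.zero_closed] by simp
      then show "x \<in> {\<zero>\<^bsub>G\<^esub>}" using G.conv_unique[OF l _ sequentially_bot] by simp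
    qed
  qed auto
  then have "cstar_subalgebra {x \<in> carrier E. \<theta> x \<in> {\<zero>\<^bsub>G\<^esub>}} E"
    by (rule cstar_subalgebra_vimage[OF E.cstar G \<theta>(1)])
  moreover have "j ` A \<subseteq> {x \<in> carrier E. \<theta> x \<in> {\<zero>\<^bsub>G\<^esub>}}" using jA \<theta>(2) \<pi>A AB by auto
  ultimately have "D \<subseteq> {x \<in> carrier E. \<theta> x \<in> {\<zero>\<^bsub>G\<^esub>}}" using D_gen(3) by blast
  then have kill: "\<theta> d = \<zero>\<^bsub>G\<^esub>" if "d \<in> D" for d using that by blast
  \<comment> \<open>The choice of the representative is immaterial, because \<open>\<theta>\<close>
    vanishes on \<open>D\<close>.\<close>
  define \<eta> where "\<eta> P = \<theta> (SOME x. x \<in> P)" for P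
  have \<eta>: "\<eta> (qD x) = \<theta> x" if x: "x \<in> carrier E" for x
  proof -
    let ?y = "SOME y. y \<in> qD x"
    have "?y \<in> qD x" using E.coset_self[OF D(1) x] by (rule someI)
    then have y: "?y \<in> carrier E" "?y \<ominus>\<^bsub>E\<^esub> x \<in> D" using E.coset_iff[OF D(1) x] by auto
    have "\<theta> ?y \<ominus>\<^bsub>G\<^esub> \<theta> x = \<theta> (?y \<ominus>\<^bsub>E\<^esub> x)"
      using star_map_linear(3)[OF E.complex_algebra_axioms G.complex_algebra_axioms \<theta>'(1,3,4)] x y by simp
    then have "\<theta> ?y = \<theta> x" using kill[OF y(2)] \<theta>'(1) x y(1) G.norm_diff_eq_zero[of "\<theta> ?y" "\<theta> x"] G.norm_eq_zero[of "\<zero>\<^bsub>G\<^esub>"] by simp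
    then show ?thesis by (simp add: \<eta>_def)
  qed
  show "\<exists>\<theta>\<in>star_hom EqD G. \<forall>P\<in>carrier BqA. \<theta> (induced_map E D j P) = \<rho> P"
  proof (intro bexI ballI)
    note qE = star_mapD[OF quotient_cstar(2)]
    show "\<eta> \<in> star_hom EqD G"
      unfolding star_hom_iff star_map_def ED.quotient_carrier
      using \<eta> \<theta>' by (auto simp: qE(2-5)[symmetric])
    fix P assume "P \<in> carrier BqA"
    then show "\<eta> (induced_map E D j P) = \<rho> P" using \<eta> \<theta>(2) j(1) by (auto simp: BA.quotient_carrier induced_apply)
  qed
qed

end

section \<open>From the filter in the hypothesis to a normalised net, and the conclusion\<close>

theorem lemma2p7:
  fixes C :: "'c matrix_normed_alg" and E :: "'e matrix_normed_alg"
    and A B :: "'c set" and j :: "'c \<Rightarrow> 'e" and D :: "'e set"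
  assumes "cstar_algebra C"
    and "closed_subalgebra B C"
    and "closed_ideal A (C\<lparr>carrier := B\<rparr>)"
    and "approximately_unital (C\<lparr>carrier := A\<rparr>)"
    and "max_cstar_cover TYPE(nat \<Rightarrow> 'c) (C\<lparr>carrier := B\<rparr>) E j"
    and "D = generated_cstar_subalgebra E (j ` A)"
  shows "max_cstar_cover TYPE('g) (C\<lparr>carrier := A\<rparr>) (E\<lparr>carrier := D\<rparr>) j \<and>
    closed_ideal D E \<and>
    max_cstar_cover TYPE('g) (quotient_algebra (C\<lparr>carrier := B\<rparr>) A) (quotient_algebra E D)
      (induced_map E D j)"
proof -
  interpret C: cstar_alg C using assms(1) by unfold_locales
  have B: "linear_subspace C B" "seq_closed C (elt_norm C) B" "\<And>x y. x \<in> B \<Longrightarrow> y \<in> B \<Longrightarrow> x \<otimes>\<^bsub>C\<^esub> y \<in> B"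
    using assms(2) by (auto simp: closed_subalgebra_def C.closed_subspace_iff)
  have A: "A \<subseteq> B" "linear_subspace C A" "seq_closed C (elt_norm C) A"
    using assms(3) C.closed_subspace_sub_iff[OF B] by (auto simp: closed_ideal_def)
  have id: "a \<otimes>\<^bsub>C\<^esub> b \<in> A" "b \<otimes>\<^bsub>C\<^esub> a \<in> A" if "a \<in> A" "b \<in> B" for a b
    using assms(3) that by (auto simp: closed_ideal_def)
  obtain F where F: "F \<noteq> bot" and eF: "\<forall>\<^sub>F e in F. e \<in> A \<and> elt_norm C e \<le> 1"
    and lim: "\<And>x. x \<in> A \<Longrightarrow> limitin (norm_topology (C\<lparr>carrier := A\<rparr>)) (\<lambda>e. e \<otimes>\<^bsub>C\<^esub> x) x F"
      "\<And>x. x \<in> A \<Longrightarrow> limitin (norm_topology (C\<lparr>carrier := A\<rparr>)) (\<lambda>e. x \<otimes>\<^bsub>C\<^esub> e) x F"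
    using assms(4) by (auto simp: approximately_unital_def)
  \<comment> \<open>The net is the identity map, indexed by the elements themselves. Exceptional
    points, which \<open>F\<close> neglects, are sent to zero, so that membership in
    \<open>A\<close> and the norm bound hold everywhere.\<close>
  define e where "e t = (if t \<in> A \<and> elt_norm C t \<le> 1 then t else \<zero>\<^bsub>C\<^esub>)" for t
  have ev: "\<forall>\<^sub>F t in F. e t = t" using eF by eventually_elim (simp add: e_def)
  have cong: "conv C (elt_norm C) F f x" if "conv C (elt_norm C) F g x" "\<forall>\<^sub>F t in F. f t = g t" for f g x
  proof (rule C.convI_bound[OF C.convD(1)[OF that(1)] _ C.convD(3)[OF that(1)]])
    show "\<forall>\<^sub>F t in F. f t \<in> carrier C \<and> elt_norm C (f t \<ominus>\<^bsub>C\<^esub> x) \<le> elt_norm C (g t \<ominus>\<^bsub>C\<^esub> x)"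
      using that(2) C.convD(2)[OF that(1)] by eventually_elim simp
  qed
  have unit: "conv C (elt_norm C) F (\<lambda>t. e t \<otimes>\<^bsub>C\<^esub> a) a" "conv C (elt_norm C) F (\<lambda>t. a \<otimes>\<^bsub>C\<^esub> e t) a" if a: "a \<in> A" for a
  proof -
    have l: "conv C (elt_norm C) F (\<lambda>t. t \<otimes>\<^bsub>C\<^esub> a) a" "conv C (elt_norm C) F (\<lambda>t. a \<otimes>\<^bsub>C\<^esub> t) a"
      using lim[OF a] unfolding C.limitin_subspace[OF A(2)] by blast+
    show "conv C (elt_norm C) F (\<lambda>t. e t \<otimes>\<^bsub>C\<^esub> a) a"
      by (rule cong[OF l(1)]) (use ev in \<open>eventually_elim, simp\<close>)
    show "conv C (elt_norm C) F (\<lambda>t. a \<otimes>\<^bsub>C\<^esub> e t) a"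
      by (rule cong[OF l(2)]) (use ev in \<open>eventually_elim, simp\<close>)
  qed
  have "elt_norm C \<zero>\<^bsub>C\<^esub> = 0" using C.norm_eq_zero[of "\<zero>\<^bsub>C\<^esub>"] by simp
  then have "e t \<in> A" "elt_norm C (e t) \<le> 1" for t using linear_subspaceD(3)[OF A(2)] by (auto simp: e_def)
  then interpret maximal_cover C A B F e E j
    using B A id F unit assms(5) by unfold_locales auto
  show ?thesis
    unfolding assms(6) using ideal_max_cstar_cover D_closed_ideal quotient_max_cstar_cover by blast
qed

end
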